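(* The following are equivalent: (1) There exists a proper class of strong cardinals. (2) $\mathbf{\Sigma}_2$-$\mathrm{PRP}$. (3) $\mathbf{\Pi}_1$-$\mathrm{PRP}$. (4) $\mathbf{\Sigma}_2$-$\mathrm{SWVP}$. (5) $\mathbf{\Pi}_1$-$\mathrm{SWVP}$. (6) $\mathbf{\Sigma}_2$-$\mathrm{WVP}$. (7) $\mathbf{\Pi}_1$-$\mathrm{WVP}$.
   Context: We work in ZFC; $\Sigma_n,\Pi_n$ refer to the Levy hierarchy, and "class" means definable class. Graphs. A graph is a structure $\langle G,E_G\rangle$ with $G$ a non-empty set and $E_G$ a binary relation on $G$. A homomorphism $h:G\to H$ is a map such that $xE_Gy$ implies $h(x)E_Hh(y)$. For a set $S$ of graphs, $\prod S$ is the structure whose universe is the set of all functions $f$ with domain $S$ such that $f(\mathcal{A})$ belongs to the universe of $\mathcal{A}$ for every $\mathcal{A}\in S$, with the relation defined pointwise. Boldface principles. Let $\Gamma$ be one of $\Sigma_m,\Pi_m$, $m>0$, and let $\mathbf{\Gamma}$ denote the corresponding boldface class: $\mathbf{\Gamma}$-definable means definable by a $\Gamma$ formula with arbitrary sets as parameters. - $\mathbf{\Gamma}$-$\mathrm{PRP}$ (Product Reflection Principle): for every $\mathbf{\Gamma}$-definable proper class $\mathcal{C}$ of graphs there is a subset $S$ of $\mathcal{C}$ such that for every $G$ in $\mathcal{C}$ there is a homomorphism $\prod S\to G$. - $\mathbf{\Gamma}$-$\mathrm{WVP}$ (Weak Vopěnka Principle): there is no $\mathbf{\Gamma}$-definable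 sequence $\langle G_\alpha:\alpha\in\mathrm{OR}\rangle$ of graphs such that for every $\alpha\leq\beta$ there exists exactly one homomorphism $G_\beta\to G_\alpha$, and there is no homomorphism $G_\alpha\to G_\beta$ whenever $\alpha<\beta$. - $\mathbf{\Gamma}$-$\mathrm{SWVP}$ (Semi-Weak Vopěnka Principle): the same as $\mathbf{\Gamma}$-$\mathrm{WVP}$, with "exactly one homomorphism $G_\beta\to G_\alpha$" replaced by "at least one homomorphism $G_\beta\to G_\alpha$". A cardinal $\kappa$ is $\lambda$-strong, where $\lambda>\kappa$ is a cardinal, if there is an elementary embedding $j:V\to M$ with $M$ transitive, critical point $\kappa$, and $V_\lambda\subseteq M$; $\kappa$ is strong if it is $\lambda$-strong for every cardinal $\lambda>\kappa$. *)

theory Defs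
  imports Main
begin

section \<open>Formulas of set theory, satisfaction and the Levy hierarchy\<close>

datatype fm =
    Mem nat nat
  | Eq nat nat
  | Neg fm
  | Conj fm fm
  | Disj fm fm
  | Imp fm fm
  | Exists nat fm
  | Forall nat fm

text \<open>Satisfaction in the structure with domain \<open>D\<close> and membership relation \<open>mem\<close>; variables are
  natural numbers, valued by \<open>s\<close>. The assignment is meant to take its values in \<open>D\<close>.\<close>

primrec sat :: "'v set \<Rightarrow> ('v \<Rightarrow> 'v \<Rightarrow> bool) \<Rightarrow> fm \<Rightarrow> (nat \<Rightarrow> 'v) \<Rightarrow> bool" where
  "sat D mem (Mem x y) s \<longleftrightarrow> mem (s x) (s y)"
| "sat D mem (Eq x y) s \<longleftrightarrow> s x = s y"
| "sat D mem (Neg \<phi>) s \<longleftrightarrow> \<not> sat D mem \<phi> s"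
| "sat D mem (Conj \<phi> \<psi>) s \<longleftrightarrow> sat D mem \<phi> s \<and> sat D mem \<psi> s"
| "sat D mem (Disj \<phi> \<psi>) s \<longleftrightarrow> sat D mem \<phi> s \<or> sat D mem \<psi> s"
| "sat D mem (Imp \<phi> \<psi>) s \<longleftrightarrow> (sat D mem \<phi> s \<longrightarrow> sat D mem \<psi> s)"
| "sat D mem (Exists x \<phi>) s \<longleftrightarrow> (\<exists>a\<in>D. sat D mem \<phi> (s(x := a)))"
| "sat D mem (Forall x \<phi>) s \<longleftrightarrow> (\<forall>a\<in>D. sat D mem \<phi> (s(x := a)))"

inductive delta0_fm :: "fm \<Rightarrow> bool" where
  "delta0_fm (Mem x y)"
| "delta0_fm (Eq x y)"
| "delta0_fm \<phi> \<Longrightarrow> delta0_fm (Neg \<phi>)"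
| "delta0_fm \<phi> \<Longrightarrow> delta0_fm \<psi> \<Longrightarrow> delta0_fm (Conj \<phi> \<psi>)"
| "delta0_fm \<phi> \<Longrightarrow> delta0_fm \<psi> \<Longrightarrow> delta0_fm (Disj \<phi> \<psi>)"
| "delta0_fm \<phi> \<Longrightarrow> delta0_fm \<psi> \<Longrightarrow> delta0_fm (Imp \<phi> \<psi>)"
| "delta0_fm \<phi> \<Longrightarrow> x \<noteq> y \<Longrightarrow> delta0_fm (Exists x (Conj (Mem x y) \<phi>))"
| "delta0_fm \<phi> \<Longrightarrow> x \<noteq> y \<Longrightarrow> delta0_fm (Forall x (Imp (Mem x y) \<phi>))"

text \<open>Each quantifier of the prefix stands for a finite, possibly empty, block of like quantifiers.\<close>

inductive sigma_fm :: "nat \<Rightarrow> fm \<Rightarrow> bool" and pi_fm :: "nat \<Rightarrow> fm \<Rightarrow> bool" where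
  "delta0_fm \<phi> \<Longrightarrow> sigma_fm 0 \<phi>"
| "delta0_fm \<phi> \<Longrightarrow> pi_fm 0 \<phi>"
| "pi_fm n \<phi> \<Longrightarrow> sigma_fm (Suc n) \<phi>"
| "sigma_fm (Suc n) \<phi> \<Longrightarrow> sigma_fm (Suc n) (Exists x \<phi>)"
| "sigma_fm n \<phi> \<Longrightarrow> pi_fm (Suc n) \<phi>"
| "pi_fm (Suc n) \<phi> \<Longrightarrow> pi_fm (Suc n) (Forall x \<phi>)"


section \<open>Set theory inside a structure\<close>

text \<open>The universe of sets is a type \<open>'v\<close> with a relation \<open>\<epsilon>\<close>, which will be assumed to satisfy the
  first-order theory ZFC. Elements of \<open>'v\<close> are the sets of the universe; a class is an (external) set
  \<open>C :: 'v set\<close> that is definable from parameters. Set-theoretic operations are rendered as relations,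
  with the value as first argument, so that no description operator is needed.\<close>

context
  fixes mem :: "'v \<Rightarrow> 'v \<Rightarrow> bool"  (infix "\<epsilon>" 50)
begin

subsection \<open>Basic notions\<close>

definition is_empty :: "'v \<Rightarrow> bool" where
  "is_empty z \<longleftrightarrow> (\<forall>x. \<not> x \<epsilon> z)"

definition subset_of :: "'v \<Rightarrow> 'v \<Rightarrow> bool" where
  "subset_of x y \<longleftrightarrow> (\<forall>w. w \<epsilon> x \<longrightarrow> w \<epsilon> y)"

definition is_upair :: "'v \<Rightarrow> 'v \<Rightarrow> 'v \<Rightarrow> bool" where
  "is_upair z x y \<longleftrightarrow> (\<forall>w. w \<epsilon> z \<longleftrightarrow> w = x \<or> w = y)"

text \<open>Kuratowski pairs: \<open>p = {{x}, {x, y}}\<close>.\<close>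

definition is_opair :: "'v \<Rightarrow> 'v \<Rightarrow> 'v \<Rightarrow> bool" where
  "is_opair p x y \<longleftrightarrow> (\<exists>u v. is_upair u x x \<and> is_upair v x y \<and> is_upair p u v)"

definition is_succ :: "'v \<Rightarrow> 'v \<Rightarrow> bool" where
  "is_succ y x \<longleftrightarrow> (\<forall>w. w \<epsilon> y \<longleftrightarrow> w \<epsilon> x \<or> w = x)"

text \<open>\<open>\<langle>x, y\<rangle> \<in> r\<close>; for a function \<open>r\<close> this says \<open>r(x) = y\<close>.\<close>

definition rel :: "'v \<Rightarrow> 'v \<Rightarrow> 'v \<Rightarrow> bool" where
  "rel r x y \<longleftrightarrow> (\<exists>p. p \<epsilon> r \<and> is_opair p x y)"

definition function_on :: "'v \<Rightarrow> 'v \<Rightarrow> bool" where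
  "function_on f a \<longleftrightarrow>
     (\<forall>p. p \<epsilon> f \<longrightarrow> (\<exists>x y. x \<epsilon> a \<and> is_opair p x y)) \<and> (\<forall>x. x \<epsilon> a \<longrightarrow> (\<exists>!y. rel f x y))"

definition function_to :: "'v \<Rightarrow> 'v \<Rightarrow> 'v \<Rightarrow> bool" where
  "function_to f a b \<longleftrightarrow> function_on f a \<and> (\<forall>x y. rel f x y \<longrightarrow> y \<epsilon> b)"

definition bijection :: "'v \<Rightarrow> 'v \<Rightarrow> 'v \<Rightarrow> bool" where
  "bijection f a b \<longleftrightarrow> function_to f a b \<and> (\<forall>y. y \<epsilon> b \<longrightarrow> (\<exists>!x. rel f x y))"

text \<open>Transitive and strictly well-ordered by \<open>\<epsilon>\<close>.\<close>

definition ordinal :: "'v \<Rightarrow> bool" where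
  "ordinal \<alpha> \<longleftrightarrow>
     (\<forall>x. x \<epsilon> \<alpha> \<longrightarrow> subset_of x \<alpha>) \<and>
     (\<forall>x. x \<epsilon> \<alpha> \<longrightarrow> \<not> x \<epsilon> x) \<and>
     (\<forall>x y z. x \<epsilon> \<alpha> \<and> y \<epsilon> \<alpha> \<and> z \<epsilon> \<alpha> \<and> x \<epsilon> y \<and> y \<epsilon> z \<longrightarrow> x \<epsilon> z) \<and>
     (\<forall>x y. x \<epsilon> \<alpha> \<and> y \<epsilon> \<alpha> \<longrightarrow> x \<epsilon> y \<or> x = y \<or> y \<epsilon> x) \<and>
     (\<forall>a. subset_of a \<alpha> \<and> \<not> is_empty a \<longrightarrow> (\<exists>m. m \<epsilon> a \<and> (\<forall>x. x \<epsilon> a \<longrightarrow> m = x \<or> m \<epsilon> x)))"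

definition cardinal :: "'v \<Rightarrow> bool" where
  "cardinal \<kappa> \<longleftrightarrow> ordinal \<kappa> \<and> \<not> (\<exists>\<alpha> f. \<alpha> \<epsilon> \<kappa> \<and> bijection f \<alpha> \<kappa>)"

text \<open>\<open>v = V\<^sub>\<alpha>\<close>: the function \<open>f\<close> on \<open>\<alpha> + 1\<close> satisfies the recursion
  \<open>V\<^sub>\<beta> = (\<Union>\<gamma><\<beta>. Pow V\<^sub>\<gamma>)\<close>.\<close>

definition is_V :: "'v \<Rightarrow> 'v \<Rightarrow> bool" where
  "is_V v \<alpha> \<longleftrightarrow> ordinal \<alpha> \<and>
     (\<exists>f d. is_succ d \<alpha> \<and> function_on f d \<and>
        (\<forall>\<beta> u. rel f \<beta> u \<longrightarrow>
           (\<forall>x. x \<epsilon> u \<longleftrightarrow> (\<exists>\<gamma> w. \<gamma> \<epsilon> \<beta> \<and> rel f \<gamma> w \<and> subset_of x w))) \<and>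
        rel f \<alpha> v)"

subsection \<open>The axioms of ZFC\<close>

text \<open>Separation and Replacement are schemes over all formulas; parameters are the values of \<open>s\<close> at
  the remaining variables.\<close>

definition ZFC :: bool where
  "ZFC \<longleftrightarrow>
     \<comment> \<open>Extensionality\<close>
     (\<forall>x y. (\<forall>w. w \<epsilon> x \<longleftrightarrow> w \<epsilon> y) \<longrightarrow> x = y) \<and>
     \<comment> \<open>Foundation\<close>
     (\<forall>x. \<not> is_empty x \<longrightarrow> (\<exists>m. m \<epsilon> x \<and> \<not> (\<exists>w. w \<epsilon> m \<and> w \<epsilon> x))) \<and>
     \<comment> \<open>Pairing\<close>
     (\<forall>x y. \<exists>z. is_upair z x y) \<and>
     \<comment> \<open>Union\<close>
     (\<forall>x. \<exists>u. \<forall>w. w \<epsilon> u \<longleftrightarrow> (\<exists>y. y \<epsilon> x \<and> w \<epsilon> y)) \<and>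
     \<comment> \<open>Power set\<close>
     (\<forall>x. \<exists>p. \<forall>y. y \<epsilon> p \<longleftrightarrow> subset_of y x) \<and>
     \<comment> \<open>Infinity\<close>
     (\<exists>i. (\<exists>e. e \<epsilon> i \<and> is_empty e) \<and> (\<forall>x. x \<epsilon> i \<longrightarrow> (\<exists>y. y \<epsilon> i \<and> is_succ y x))) \<and>
     \<comment> \<open>Separation\<close>
     (\<forall>\<phi> s a. \<exists>b. \<forall>x. x \<epsilon> b \<longleftrightarrow> x \<epsilon> a \<and> sat UNIV mem \<phi> (s(0 := x))) \<and>
     \<comment> \<open>Replacement\<close>
     (\<forall>\<phi> s a. (\<forall>x. x \<epsilon> a \<longrightarrow> (\<exists>!y. sat UNIV mem \<phi> (s(0 := x, 1 := y)))) \<longrightarrow>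
        (\<exists>b. \<forall>y. y \<epsilon> b \<longleftrightarrow> (\<exists>x. x \<epsilon> a \<and> sat UNIV mem \<phi> (s(0 := x, 1 := y))))) \<and>
     \<comment> \<open>Choice\<close>
     (\<forall>a. (\<forall>x. x \<epsilon> a \<longrightarrow> \<not> is_empty x) \<and>
          (\<forall>x y. x \<epsilon> a \<and> y \<epsilon> a \<and> x \<noteq> y \<longrightarrow> \<not> (\<exists>w. w \<epsilon> x \<and> w \<epsilon> y)) \<longrightarrow>
        (\<exists>c. \<forall>x. x \<epsilon> a \<longrightarrow> (\<exists>!w. w \<epsilon> x \<and> w \<epsilon> c)))"

subsection \<open>Classes\<close>

text \<open>Boldface definability: the formula lies in \<open>\<Gamma>\<close>, variable \<open>0\<close> is the argument, and the values of
  \<open>s\<close> at the other variables are arbitrary parameters. Only finitely many of them matter.\<close>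

definition definable :: "(fm \<Rightarrow> bool) \<Rightarrow> 'v set \<Rightarrow> bool" where
  "definable \<Gamma> C \<longleftrightarrow> (\<exists>\<phi> s. \<Gamma> \<phi> \<and> C = {x. sat UNIV mem \<phi> (s(0 := x))})"

definition proper_class :: "'v set \<Rightarrow> bool" where
  "proper_class C \<longleftrightarrow> \<not> (\<exists>c. \<forall>x. x \<epsilon> c \<longleftrightarrow> x \<in> C)"

text \<open>The sequence \<open>\<langle>F \<alpha> : \<alpha> \<in> OR\<rangle>\<close> as a class of ordered pairs; values of \<open>F\<close> off the ordinals are
  irrelevant.\<close>

definition OR_sequence :: "('v \<Rightarrow> 'v) \<Rightarrow> 'v set" where
  "OR_sequence F = {p. \<exists>\<alpha>. ordinal \<alpha> \<and> is_opair p \<alpha> (F \<alpha>)}"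

subsection \<open>Graphs\<close>

definition graph :: "'v \<Rightarrow> bool" where
  "graph \<A> \<longleftrightarrow> (\<exists>G R. is_opair \<A> G R \<and> \<not> is_empty G \<and>
     (\<forall>p. p \<epsilon> R \<longrightarrow> (\<exists>x y. x \<epsilon> G \<and> y \<epsilon> G \<and> is_opair p x y)))"

definition vertex :: "'v \<Rightarrow> 'v \<Rightarrow> bool" where
  "vertex \<A> x \<longleftrightarrow> (\<exists>G R. is_opair \<A> G R \<and> x \<epsilon> G)"

definition edge :: "'v \<Rightarrow> 'v \<Rightarrow> 'v \<Rightarrow> bool" where
  "edge \<A> x y \<longleftrightarrow> (\<exists>G R. is_opair \<A> G R \<and> rel R x y)"

definition hom :: "'v \<Rightarrow> 'v \<Rightarrow> 'v \<Rightarrow> bool" where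
  "hom h \<A> \<B> \<longleftrightarrow> (\<exists>G R H Q. is_opair \<A> G R \<and> is_opair \<B> H Q \<and> function_to h G H) \<and>
     (\<forall>x y x' y'. edge \<A> x y \<and> rel h x x' \<and> rel h y y' \<longrightarrow> edge \<B> x' y')"

definition is_product :: "'v \<Rightarrow> 'v \<Rightarrow> bool" where
  "is_product P S \<longleftrightarrow> (\<exists>U R. is_opair P U R \<and>
     (\<forall>f. f \<epsilon> U \<longleftrightarrow> function_on f S \<and> (\<forall>\<A> a. \<A> \<epsilon> S \<and> rel f \<A> a \<longrightarrow> vertex \<A> a)) \<and>
     (\<forall>p. p \<epsilon> R \<longleftrightarrow> (\<exists>f g. f \<epsilon> U \<and> g \<epsilon> U \<and> is_opair p f g \<and>
        (\<forall>\<A> a b. \<A> \<epsilon> S \<and> rel f \<A> a \<and> rel g \<A> b \<longrightarrow> edge \<A> a b))))"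

subsection \<open>The reflection and Vopenka principles\<close>

definition PRP :: "(fm \<Rightarrow> bool) \<Rightarrow> bool" where
  "PRP \<Gamma> \<longleftrightarrow> (\<forall>C. definable \<Gamma> C \<and> proper_class C \<and> (\<forall>\<A>\<in>C. graph \<A>) \<longrightarrow>
     (\<exists>S. (\<forall>\<A>. \<A> \<epsilon> S \<longrightarrow> \<A> \<in> C) \<and>
        (\<exists>P. is_product P S \<and> (\<forall>\<B>\<in>C. \<exists>h. hom h P \<B>))))"

definition WVP :: "(fm \<Rightarrow> bool) \<Rightarrow> bool" where
  "WVP \<Gamma> \<longleftrightarrow> \<not> (\<exists>F. definable \<Gamma> (OR_sequence F) \<and>
     (\<forall>\<alpha>. ordinal \<alpha> \<longrightarrow> graph (F \<alpha>)) \<and>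
     (\<forall>\<alpha> \<beta>. ordinal \<alpha> \<and> ordinal \<beta> \<and> (\<alpha> \<epsilon> \<beta> \<or> \<alpha> = \<beta>) \<longrightarrow> (\<exists>!h. hom h (F \<beta>) (F \<alpha>))) \<and>
     (\<forall>\<alpha> \<beta>. ordinal \<alpha> \<and> ordinal \<beta> \<and> \<alpha> \<epsilon> \<beta> \<longrightarrow> \<not> (\<exists>h. hom h (F \<alpha>) (F \<beta>))))"

definition SWVP :: "(fm \<Rightarrow> bool) \<Rightarrow> bool" where
  "SWVP \<Gamma> \<longleftrightarrow> \<not> (\<exists>F. definable \<Gamma> (OR_sequence F) \<and>
     (\<forall>\<alpha>. ordinal \<alpha> \<longrightarrow> graph (F \<alpha>)) \<and>
     (\<forall>\<alpha> \<beta>. ordinal \<alpha> \<and> ordinal \<beta> \<and> (\<alpha> \<epsilon> \<beta> \<or> \<alpha> = \<beta>) \<longrightarrow> (\<exists>h. hom h (F \<beta>) (F \<alpha>))) \<and>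
     (\<forall>\<alpha> \<beta>. ordinal \<alpha> \<and> ordinal \<beta> \<and> \<alpha> \<epsilon> \<beta> \<longrightarrow> \<not> (\<exists>h. hom h (F \<alpha>) (F \<beta>))))"

subsection \<open>Strong cardinals\<close>

definition transitive_class :: "'v set \<Rightarrow> bool" where
  "transitive_class M \<longleftrightarrow> (\<forall>x\<in>M. \<forall>y. y \<epsilon> x \<longrightarrow> y \<in> M)"

definition elementary_embedding :: "('v \<Rightarrow> 'v) \<Rightarrow> 'v set \<Rightarrow> bool" where
  "elementary_embedding j M \<longleftrightarrow> range j \<subseteq> M \<and>
     (\<forall>\<phi> s. sat UNIV mem \<phi> s \<longleftrightarrow> sat M mem \<phi> (j \<circ> s))"

definition critical_point :: "('v \<Rightarrow> 'v) \<Rightarrow> 'v \<Rightarrow> bool" where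
  "critical_point j \<kappa> \<longleftrightarrow> ordinal \<kappa> \<and> j \<kappa> \<noteq> \<kappa> \<and> (\<forall>\<alpha>. \<alpha> \<epsilon> \<kappa> \<longrightarrow> j \<alpha> = \<alpha>)"

text \<open>As usual in ZFC, the embedding \<open>j\<close> and its target \<open>M\<close> range over classes, that is, over what is
  definable from parameters by some formula, of arbitrary complexity. \<open>strong_for \<mu> \<kappa>\<close> says that \<open>\<kappa>\<close>
  is \<open>\<mu>\<close>-strong.\<close>

definition strong_for :: "'v \<Rightarrow> 'v \<Rightarrow> bool" where
  "strong_for \<mu> \<kappa> \<longleftrightarrow> cardinal \<kappa> \<and> cardinal \<mu> \<and> \<kappa> \<epsilon> \<mu> \<and>
     (\<exists>j M. definable (\<lambda>_. True) {p. \<exists>x. is_opair p x (j x)} \<and> definable (\<lambda>_. True) M \<and>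
        transitive_class M \<and> elementary_embedding j M \<and> critical_point j \<kappa> \<and>
        (\<forall>v x. is_V v \<mu> \<and> x \<epsilon> v \<longrightarrow> x \<in> M))"

definition strong :: "'v \<Rightarrow> bool" where
  "strong \<kappa> \<longleftrightarrow> cardinal \<kappa> \<and> (\<forall>\<mu>. cardinal \<mu> \<and> \<kappa> \<epsilon> \<mu> \<longrightarrow> strong_for \<mu> \<kappa>)"

end

end

theory Submission
  imports Defs
begin

text \<open>A strong cardinal \<open>\<kappa>\<close> above the rank of the parameters of a \<open>\<Sigma>\<^sub>2\<close> class \<open>C\<close> of graphs gives the
  product reflection principle for \<open>S = C \<inter> V\<^sub>\<kappa>\<close>: if \<open>G \<in> C\<close> has minimal rank \<open>\<rho>\<close> among the graphs without a
  homomorphism from \<open>\<Prod>S\<close>, then \<open>\<Prod>S\<close> maps to \<open>\<Prod>(C \<inter> V\<^sub>\<rho>)\<close>, and for \<open>j : V \<rightarrow> M\<close> with \<open>G\<close> and a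
  witness of \<open>G \<in> C\<close> in \<open>M\<close> either \<open>\<rho> < j(\<rho>)\<close> and \<open>f \<mapsto> j(f)(G)\<close> is a homomorphism to \<open>G\<close>, or \<open>j(\<rho>) = \<rho>\<close>,
  which contradicts Kunen's theorem. Product reflection for the class of labelled copies of a sequence
  refutes that the sequence is a counterexample to the semi-weak Vopenka principle.

  For the remaining implication, let \<open>\<gamma>\<close> bound all strong cardinals. An elementary \<open>j\<close> with \<open>j(\<gamma>) = \<gamma>\<close> is
  coded locally by the map \<open>X \<mapsto> j(X) \<inter> V\<^sub>\<beta>\<close>, and conversely every map between power sets that respects
  a few operations and well-foundedness yields such a \<open>j\<close> as an extended ultrapower. Therefore
  the ordinals \<open>\<beta>\<close> of cofinality \<open>\<omega>\<close> that are closed under a failure of strongness admit only the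
  trivial maps \<open>X \<mapsto> X \<inter> V\<^sub>\<beta>\<close>, and encoding the power sets of \<open>V\<^sub>\<beta>\<close> with these operations as graphs gives a \<open>\<Pi>\<^sub>1\<close>
  sequence that contradicts the weak Vopenka principle.\<close>

section \<open>Definability calculus\<close>

text \<open>ZFC is a first-order theory of \<open>mem\<close>: Separation, Replacement, induction
  and recursion apply only to predicates with a defining formula. Each notion therefore comes with a
  proof of definability (\<open>DP\<close>, \<open>TM\<close>), and with a bounded one
  (\<open>D0\<close>, \<open>T0\<close>) where elementarity or complexity is at stake. Strongness
  quantifies over classes; good maps, which are sets, make it first order. The bound of the strong
  cardinals is fixed by all embeddings in question, so Kunen's theorem keeps critical points above
  it. An embedding that moves an ordinal k thus has a critical point that is at most k and not
  strong, and such embeddings exist only up to some level. Cofinality omega serves the case b < b':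
  a cofinal omega-sequence in b whose values are fixed stays cofinal under j, so j(b) cannot exceed
  b. For the complexity, the obstacle is that being a power set is not a bounded condition. Each
  graph carries a record of the levels of the hierarchy and of the earlier ordinals of the sequence.
  Relative to the record everything else is bounded, and a single universal quantifier certifies the
  record.\<close>

primrec ren :: "(nat \<Rightarrow> nat) \<Rightarrow> fm \<Rightarrow> fm" where
  "ren f (Mem x y) = Mem (f x) (f y)"
| "ren f (Eq x y) = Eq (f x) (f y)"
| "ren f (Neg p) = Neg (ren f p)"
| "ren f (Conj p q) = Conj (ren f p) (ren f q)"
| "ren f (Disj p q) = Disj (ren f p) (ren f q)"
| "ren f (Imp p q) = Imp (ren f p) (ren f q)"
| "ren f (Exists x p) = Exists (f x) (ren f p)"
| "ren f (Forall x p) = Forall (f x) (ren f p)"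

primrec bv :: "fm \<Rightarrow> nat set" where
  "bv (Mem x y) = {}"
| "bv (Eq x y) = {}"
| "bv (Neg p) = bv p"
| "bv (Conj p q) = bv p \<union> bv q"
| "bv (Disj p q) = bv p \<union> bv q"
| "bv (Imp p q) = bv p \<union> bv q"
| "bv (Exists x p) = insert x (bv p)"
| "bv (Forall x p) = insert x (bv p)"

lemma bv_ren [simp]: "bv (ren f p) = f ` bv p"
  by (induction p) auto

lemma upd_ren: "\<forall>y. f y = f x \<longrightarrow> y = x \<Longrightarrow> (\<lambda>n. (s(f x := a)) (f n)) = (\<lambda>n. s (f n))(x := a)"
  by (auto simp: fun_eq_iff)

text \<open>Injectivity matters at bound variables only: free variables may be identified with each
  other, but another variable sent onto a bound one would be captured.\<close>

lemma sat_ren: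
  "\<forall>x\<in>bv p. \<forall>y. f y = f x \<longrightarrow> y = x \<Longrightarrow> sat D m (ren f p) s \<longleftrightarrow> sat D m p (\<lambda>n. s (f n))"
proof (induction p arbitrary: s)
  case (Exists x p)
  then show ?case using upd_ren[of f x s] by simp
next
  case (Forall x p)
  then show ?case using upd_ren[of f x s] by simp
qed auto

definition okf :: "fm \<Rightarrow> bool" where
  "okf p \<longleftrightarrow> (\<forall>x\<in>bv p. x mod 3 = 2)"

definition mix :: "(nat \<Rightarrow> 'v) \<Rightarrow> (nat \<Rightarrow> 'v) \<Rightarrow> (nat \<Rightarrow> 'v) \<Rightarrow> nat \<Rightarrow> 'v" where
  "mix e K u n = (if n mod 3 = 0 then e (n div 3) else if n mod 3 = 1 then K (n div 3) else u (n div 3))"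

lemma mod3_cases: obtains k where "n = 3 * k" | k where "n = Suc (3 * k)" | k where "n = Suc (Suc (3 * k))"
proof -
  have "n mod 3 = 0 \<or> n mod 3 = 1 \<or> n mod 3 = 2" by presburger
  moreover have "n = 3 * (n div 3) + n mod 3" by presburger
  ultimately show thesis using that
    by (metis One_nat_def Suc_eq_plus1 add.right_neutral add_Suc_right numeral_2_eq_2)
qed

lemma mod3_arith [simp]: "(3 * k) mod 3 = (0::nat)" "Suc (3 * k) mod 3 = 1" "Suc (Suc (3 * k)) mod 3 = 2"
  "(3 * k) div 3 = k" "Suc (3 * k) div 3 = k" "Suc (Suc (3 * k)) div 3 = k"
  by presburger+

lemma mix_simps [simp]: "mix e K u (3 * k) = e k" "mix e K u (Suc (3 * k)) = K k"
  "mix e K u (Suc (Suc (3 * k))) = u k"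
  by (simp_all only: mix_def mod3_arith) auto

lemma mix0 [simp]: "mix e K u 0 = e 0"
  by (simp add: mix_def)

lemma mix_upd0: "(mix e K u)(3 * i := y) = mix (e(i := y)) K u"
  apply (rule ext) subgoal for n by (rule mod3_cases[of n]) (auto, (presburger)+) done

lemma mix_upd2: "(mix e K u)(Suc (Suc (3 * i)) := y) = mix e K (u(i := y))"
  apply (rule ext) subgoal for n by (rule mod3_cases[of n]) (auto, (presburger)+) done

text \<open>Renamings that keep bound variables apart. Slots \<open>3i\<close> carry the arguments, slots
  \<open>3i + 1\<close> the parameters, slots \<open>3i + 2\<close> the bound variables.\<close>

definition slot :: "(nat \<Rightarrow> nat) \<Rightarrow> (nat \<Rightarrow> nat) \<Rightarrow> (nat \<Rightarrow> nat) \<Rightarrow> nat \<Rightarrow> nat" where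
  "slot a b c n = (if n mod 3 = 0 then a (n div 3) else if n mod 3 = 1 then b (n div 3) else c (n div 3))"

lemma slot_simps [simp]: "slot a b c (3 * k) = a k" "slot a b c (Suc (3 * k)) = b k"
  "slot a b c (Suc (Suc (3 * k))) = c k"
  by (simp_all only: slot_def mod3_arith) auto

lemma mix_slot: "(\<lambda>n. s (slot a b c n)) = mix (\<lambda>i. s (a i)) (\<lambda>i. s (b i)) (\<lambda>i. s (c i))"
  apply (rule ext) subgoal for n by (rule mod3_cases[of n]) auto done

definition good_slot :: "(nat \<Rightarrow> nat) \<Rightarrow> bool" where
  "good_slot f \<longleftrightarrow> (\<forall>x y. x mod 3 = 2 \<longrightarrow> f y = f x \<longrightarrow> y = x)"

text \<open>Closure under capture-free renaming is what \<open>df_sub\<close> and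
  \<open>df_bind\<close> ask of a class of formulas, so one calculus serves
  \<open>delta0_fm\<close>, \<open>sigma_fm n\<close>, \<open>pi_fm n\<close> and all
  formulas.\<close>

definition rcl :: "(fm \<Rightarrow> bool) \<Rightarrow> bool" where
  "rcl \<Gamma> \<longleftrightarrow> (\<forall>p f. \<Gamma> p \<longrightarrow> (\<forall>x\<in>bv p. \<forall>y. f y = f x \<longrightarrow> y = x) \<longrightarrow> \<Gamma> (ren f p))"

lemma delta0_ren: "delta0_fm p \<Longrightarrow> \<forall>x\<in>bv p. \<forall>y. f y = f x \<longrightarrow> y = x \<Longrightarrow> delta0_fm (ren f p)"
proof (induction rule: delta0_fm.induct)
  case (7 \<phi> x y)
  then have "f x \<noteq> f y" by auto
  with 7 show ?case by (auto intro!: delta0_fm.intros)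
next
  case (8 \<phi> x y)
  then have "f x \<noteq> f y" by auto
  with 8 show ?case by (auto intro!: delta0_fm.intros)
qed (auto intro: delta0_fm.intros)

lemma sigma_pi_ren:
  "(sigma_fm n p \<longrightarrow> (\<forall>x\<in>bv p. \<forall>y. f y = f x \<longrightarrow> y = x) \<longrightarrow> sigma_fm n (ren f p))"
  "(pi_fm n p \<longrightarrow> (\<forall>x\<in>bv p. \<forall>y. f y = f x \<longrightarrow> y = x) \<longrightarrow> pi_fm n (ren f p))"
proof -
  have "(sigma_fm n p \<longrightarrow> (\<forall>x\<in>bv p. \<forall>y. f y = f x \<longrightarrow> y = x) \<longrightarrow> sigma_fm n (ren f p)) \<and>
    (pi_fm n p \<longrightarrow> (\<forall>x\<in>bv p. \<forall>y. f y = f x \<longrightarrow> y = x) \<longrightarrow> pi_fm n (ren f p))"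
    by (rule sigma_fm_pi_fm.induct) (auto intro: sigma_fm_pi_fm.intros delta0_ren)
  then show "(sigma_fm n p \<longrightarrow> (\<forall>x\<in>bv p. \<forall>y. f y = f x \<longrightarrow> y = x) \<longrightarrow> sigma_fm n (ren f p))"
    "(pi_fm n p \<longrightarrow> (\<forall>x\<in>bv p. \<forall>y. f y = f x \<longrightarrow> y = x) \<longrightarrow> pi_fm n (ren f p))" by blast+
qed

lemma rcl [simp]: "rcl delta0_fm" "rcl (\<lambda>_. True)" "rcl (sigma_fm n)" "rcl (pi_fm n)"
  using delta0_ren sigma_pi_ren unfolding rcl_def by blast+

lemma okf_ren: "okf p \<Longrightarrow> good_slot f \<Longrightarrow> \<forall>x\<in>bv p. \<forall>y. f y = f x \<longrightarrow> y = x"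
  unfolding okf_def good_slot_def by blast

lemma good_slotI:
  assumes "inj c" "\<And>i. c i mod 3 = 2" "\<And>i j. a i \<noteq> c j" "\<And>i j. b i \<noteq> c j"
  shows "good_slot (slot a b c)"
  unfolding good_slot_def
proof (intro allI impI)
  fix x y :: nat
  assume x: "x mod 3 = 2" and e: "slot a b c y = slot a b c x"
  from x obtain k where k: "x = Suc (Suc (3 * k))" by (rule_tac mod3_cases[of x]) auto
  show "y = x"
    by (rule mod3_cases[of y]) (use e k assms in \<open>auto dest: injD\<close>)
qed

locale zfc =
  fixes mem :: "'v \<Rightarrow> 'v \<Rightarrow> bool"  (infix "\<epsilon>" 50)
  assumes ZFC: "ZFC mem"
begin

text \<open>Predicates take an environment in de Bruijn style, index 0 being the innermost variable.
  Quantifying over all \<open>u\<close> says that the values at the slots of bound variables do not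
  influence the truth value.\<close>

definition df :: "(fm \<Rightarrow> bool) \<Rightarrow> (nat \<Rightarrow> 'v) \<Rightarrow> ((nat \<Rightarrow> 'v) \<Rightarrow> bool) \<Rightarrow> bool" where
  "df \<Gamma> K P \<longleftrightarrow> (\<exists>p. \<Gamma> p \<and> okf p \<and> (\<forall>e u. P e \<longleftrightarrow> sat UNIV mem p (mix e K u)))"

text \<open>\<open>t n\<close> tells what replaces argument \<open>n\<close>: another argument
  (\<open>Inl\<close>) or a parameter (\<open>Inr\<close>). Both are renamings of slots, so the
  formula stays in its class.\<close>

lemma df_sub:
  assumes "rcl \<Gamma>" "df \<Gamma> K P" "range K \<subseteq> range K'"
  shows "df \<Gamma> K' (\<lambda>e. P (\<lambda>n. case t n of Inl i \<Rightarrow> e i | Inr i \<Rightarrow> K' i))"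
proof -
  obtain p where p: "\<Gamma> p" "okf p" "\<And>e u. P e \<longleftrightarrow> sat UNIV mem p (mix e K u)"
    using assms unfolding df_def by blast
  have "\<forall>i. \<exists>j. K i = K' j" using assms(3) by blast
  then obtain g where g: "\<And>i. K i = K' (g i)" by metis
  let ?f = "slot (\<lambda>n. case t n of Inl i \<Rightarrow> 3 * i | Inr i \<Rightarrow> Suc (3 * i)) (\<lambda>n. Suc (3 * g n)) (\<lambda>n. Suc (Suc (3 * n)))"
  have gs: "good_slot ?f"
    apply (rule good_slotI)
       apply (auto simp: inj_def split: sum.splits)
     apply presburger+
    done
  have "sat UNIV mem (ren ?f p) (mix e K' u) \<longleftrightarrow> P (\<lambda>n. case t n of Inl i \<Rightarrow> e i | Inr i \<Rightarrow> K' i)" for e u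
  proof -
    have "(\<lambda>i. mix e K' u (case t i of Inl i \<Rightarrow> 3 * i | Inr i \<Rightarrow> Suc (3 * i)))
      = (\<lambda>n. case t n of Inl i \<Rightarrow> e i | Inr i \<Rightarrow> K' i)"
      by (auto split: sum.splits)
    then show ?thesis
      unfolding p(3)[of "\<lambda>n. case t n of Inl i \<Rightarrow> e i | Inr i \<Rightarrow> K' i" u]
      by (subst sat_ren[OF okf_ren[OF p(2) gs]]) (simp only: mix_slot g[symmetric] mix_simps)
  qed
  moreover have "\<Gamma> (ren ?f p)" using assms(1) p(1) okf_ren[OF p(2) gs] unfolding rcl_def by blast
  moreover have "okf (ren ?f p)"
    using p(2) unfolding okf_def by (auto simp: slot_def)
  ultimately show ?thesis unfolding df_def by blast
qed

lemma df_ren: "rcl \<Gamma> \<Longrightarrow> df \<Gamma> K P \<Longrightarrow> df \<Gamma> K (\<lambda>e. P (\<lambda>n. e (r n)))"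
  using df_sub[of \<Gamma> K P K "\<lambda>n. Inl (r n)"] by simp

lemma df_mono: "rcl \<Gamma> \<Longrightarrow> df \<Gamma> K P \<Longrightarrow> range K \<subseteq> range K' \<Longrightarrow> df \<Gamma> K' P"
  using df_sub[of \<Gamma> K P K' "\<lambda>n. Inl n"] by simp

lemma df_const: assumes "rcl \<Gamma>" "df \<Gamma> K P" shows "df \<Gamma> K (\<lambda>e. P (case_nat (K i) e))"
proof -
  have "(\<lambda>n. case (case n of 0 \<Rightarrow> Inr i | Suc k \<Rightarrow> Inl k) of Inl i \<Rightarrow> e i | Inr i \<Rightarrow> K i) = case_nat (K i) e" for e
    by (auto split: nat.splits)
  then show ?thesis
    using df_sub[OF assms subset_refl, of "\<lambda>n. case n of 0 \<Rightarrow> Inr i | Suc k \<Rightarrow> Inl k"] by simp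
qed

lemma df_not: "(\<And>p. \<Gamma> p \<Longrightarrow> \<Gamma> (Neg p)) \<Longrightarrow> df \<Gamma> K P \<Longrightarrow> df \<Gamma> K (\<lambda>e. \<not> P e)"
  unfolding df_def okf_def by (metis bv.simps(3) sat.simps(3))

lemma df_conj: assumes "\<And>p q. \<Gamma> p \<Longrightarrow> \<Gamma> q \<Longrightarrow> \<Gamma> (Conj p q)" "df \<Gamma> K P" "df \<Gamma> K Q"
  shows "df \<Gamma> K (\<lambda>e. P e \<and> Q e)"
proof -
  obtain p q where "\<Gamma> p" "okf p" "\<forall>e u. P e \<longleftrightarrow> sat UNIV mem p (mix e K u)"
    "\<Gamma> q" "okf q" "\<forall>e u. Q e \<longleftrightarrow> sat UNIV mem q (mix e K u)" using assms unfolding df_def by blast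
  then show ?thesis unfolding df_def using assms(1)
    by (intro exI[of _ "Conj p q"]) (auto simp: okf_def)
qed

text \<open>A quantifier must bind a variable that is 2 modulo 3. Argument 0 moves to slot 2, the
  other arguments move down by one, and the old bound slots move up by one to leave slot 2
  free.\<close>

lemma df_bind:
  assumes "rcl \<Gamma>" "df \<Gamma> K P"
  obtains p where "\<Gamma> p" "okf p"
    "\<And>e u y. P (case_nat y e) \<longleftrightarrow> sat UNIV mem p ((mix e K u)(2 := y))"
proof -
  obtain p where p: "\<Gamma> p" "okf p" "\<And>e u. P e \<longleftrightarrow> sat UNIV mem p (mix e K u)"
    using assms unfolding df_def by blast
  let ?f = "slot (\<lambda>n. case n of 0 \<Rightarrow> Suc (Suc (3 * 0)) | Suc k \<Rightarrow> 3 * k) (\<lambda>n. Suc (3 * n)) (\<lambda>n. Suc (Suc (3 * Suc n)))"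
  have gs: "good_slot ?f"
    apply (rule good_slotI)
       apply (auto simp: inj_def split: nat.splits)
     apply presburger+
    done
  have two: "2 = Suc (Suc (3 * 0))" by simp
  have "sat UNIV mem (ren ?f p) ((mix e K u)(2 := y)) \<longleftrightarrow> P (case_nat y e)" for e u y
  proof -
    have A: "(\<lambda>i. mix e K (u(0 := y)) (case i of 0 \<Rightarrow> Suc (Suc (3 * 0)) | Suc k \<Rightarrow> 3 * k)) = case_nat y e"
      using mix_simps(3)[of e K "u(0 := y)" 0] by (auto split: nat.splits)
    have B: "mix e K (u(0 := y)) (Suc (Suc (3 * Suc i))) = u (Suc i)" for i
      by (simp only: mix_simps) simp
    show ?thesis
      unfolding p(3)[of "case_nat y e" "\<lambda>i. u (Suc i)"] two mix_upd2
      by (subst sat_ren[OF okf_ren[OF p(2) gs[unfolded two]]]) (simp only: mix_slot A mix_simps fun_upd_apply nat.distinct if_False)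
  qed
  moreover have "\<Gamma> (ren ?f p)" using assms(1) p(1) okf_ren[OF p(2) gs] unfolding rcl_def by blast
  moreover have "okf (ren ?f p)"
    unfolding okf_def
  proof
    fix x assume "x \<in> bv (ren ?f p)"
    then obtain y where "y mod 3 = 2" "x = ?f y" using p(2) unfolding okf_def bv_ren by blast
    then show "x mod 3 = 2" unfolding slot_def by simp
  qed
  ultimately show thesis using that by blast
qed

lemma df_ex': assumes "rcl \<Gamma>" "\<And>p. \<Gamma> p \<Longrightarrow> \<Gamma> (Exists 2 p)" "df \<Gamma> K P"
  shows "df \<Gamma> K (\<lambda>e. \<exists>y. P (case_nat y e))"
proof -
  obtain p where "\<Gamma> p" "okf p" "\<And>e u y. P (case_nat y e) \<longleftrightarrow> sat UNIV mem p ((mix e K u)(2 := y))"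
    using df_bind[OF assms(1,3)] by blast
  then show ?thesis unfolding df_def using assms(2)
    by (intro exI[of _ "Exists 2 p"]) (auto simp: okf_def)
qed

lemma df_all': assumes "rcl \<Gamma>" "\<And>p. \<Gamma> p \<Longrightarrow> \<Gamma> (Forall 2 p)" "df \<Gamma> K P"
  shows "df \<Gamma> K (\<lambda>e. \<forall>y. P (case_nat y e))"
proof -
  obtain p where "\<Gamma> p" "okf p" "\<And>e u y. P (case_nat y e) \<longleftrightarrow> sat UNIV mem p ((mix e K u)(2 := y))"
    using df_bind[OF assms(1,3)] by blast
  then show ?thesis unfolding df_def using assms(2)
    by (intro exI[of _ "Forall 2 p"]) (auto simp: okf_def)
qed

lemma case_nat_eta [simp]: "(case_nat (e 0) (\<lambda>n. e (Suc n)) :: nat \<Rightarrow> 'v) = e"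
  by (auto split: nat.splits)

lemma df_ex: assumes "rcl \<Gamma>" "\<And>p. \<Gamma> p \<Longrightarrow> \<Gamma> (Exists 2 p)" "df \<Gamma> K (\<lambda>e. P (\<lambda>n. e (Suc n)) (e 0))"
  shows "df \<Gamma> K (\<lambda>e. \<exists>y. P e y)"
  using df_ex'[OF assms] by simp

lemma df_all: assumes "rcl \<Gamma>" "\<And>p. \<Gamma> p \<Longrightarrow> \<Gamma> (Forall 2 p)" "df \<Gamma> K (\<lambda>e. P (\<lambda>n. e (Suc n)) (e 0))"
  shows "df \<Gamma> K (\<lambda>e. \<forall>y. P e y)"
  using df_all'[OF assms] by simp

lemma df_mem_var: "df delta0_fm K (\<lambda>e. e i \<epsilon> e j)"
  unfolding df_def by (rule exI[of _ "Mem (3 * i) (3 * j)"]) (auto simp: okf_def intro: delta0_fm.intros)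

lemma df_eq_var: "df delta0_fm K (\<lambda>e. e i = e j)"
  unfolding df_def by (rule exI[of _ "Eq (3 * i) (3 * j)"]) (auto simp: okf_def intro: delta0_fm.intros)

subsection \<open>Definability with arbitrary parameters\<close>

definition DP :: "((nat \<Rightarrow> 'v) \<Rightarrow> bool) \<Rightarrow> bool" where
  "DP P \<longleftrightarrow> (\<exists>K. df (\<lambda>_. True) K P)"

text \<open>Formulas have no terms, so an operation is represented by its graph and eliminated by
  quantifying over its value (\<open>DP_subst\<close>). This costs an unbounded quantifier; at the
  bounded level \<open>T0\<close> takes its place.\<close>

definition TM :: "((nat \<Rightarrow> 'v) \<Rightarrow> 'v) \<Rightarrow> bool" where
  "TM t \<longleftrightarrow> DP (\<lambda>e. t (\<lambda>n. e (Suc n)) = e 0)"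

lemma DP_eqI: "DP P \<Longrightarrow> (\<And>e. P e \<longleftrightarrow> Q e) \<Longrightarrow> DP Q"
  by (subgoal_tac "P = Q") auto

lemma df_imp_DP: "df \<Gamma> K P \<Longrightarrow> DP P"
  unfolding DP_def df_def by blast

definition merge :: "(nat \<Rightarrow> 'v) \<Rightarrow> (nat \<Rightarrow> 'v) \<Rightarrow> nat \<Rightarrow> 'v" where
  "merge K1 K2 n = (if even n then K1 (n div 2) else K2 (n div 2))"

lemma range_merge: "range K1 \<subseteq> range (merge K1 K2)" "range K2 \<subseteq> range (merge K1 K2)"
proof -
  have "merge K1 K2 (2 * i) = K1 i" "merge K1 K2 (Suc (2 * i)) = K2 i" for i by (auto simp: merge_def)
  then show "range K1 \<subseteq> range (merge K1 K2)" "range K2 \<subseteq> range (merge K1 K2)"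
    by (metis image_subsetI rangeI)+
qed

lemma DP_fix: assumes "DP P"
  shows "DP (\<lambda>e. P (\<lambda>n. case t n of Inl i \<Rightarrow> e i | Inr i \<Rightarrow> (L::nat \<Rightarrow> 'v) i))"
proof -
  obtain K where K: "df (\<lambda>_. True) K P" using assms DP_def by blast
  let ?K = "merge K L"
  have "\<forall>i. \<exists>j. L i = ?K j" using range_merge(2)[of L K] by blast
  then obtain g where g: "\<And>i. L i = ?K (g i)" by metis
  have "(\<lambda>n. case (case t n of Inl i \<Rightarrow> Inl i | Inr i \<Rightarrow> Inr (g i)) of Inl i \<Rightarrow> e i | Inr i \<Rightarrow> ?K i) =
    (\<lambda>n. case t n of Inl i \<Rightarrow> e i | Inr i \<Rightarrow> L i)" for e
    by (auto simp: g split: sum.splits)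
  then show ?thesis
    using df_sub[OF _ K range_merge(1)[of K L], of "\<lambda>n. case t n of Inl i \<Rightarrow> Inl i | Inr i \<Rightarrow> Inr (g i)"]
    by (auto intro: df_imp_DP)
qed

lemma DP_ren: "DP P \<Longrightarrow> DP (\<lambda>e. P (\<lambda>n. e (r n)))"
  using DP_fix[of P _ "\<lambda>n. Inl (r n)"] by simp

text \<open>This rule and most closure rules below carry the \<open>simp\<close> attribute, so that
  simplification derives definability from the shape of a predicate.\<close>

lemma DP_not [simp]: "DP P \<Longrightarrow> DP (\<lambda>e. \<not> P e)"
  unfolding DP_def by (metis df_not)

lemma DP_conj [simp]: assumes "DP P" "DP Q" shows "DP (\<lambda>e. P e \<and> Q e)"
proof -
  obtain K L where "df (\<lambda>_. True) K P" "df (\<lambda>_. True) L Q" using assms DP_def by blast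
  then have "df (\<lambda>_. True) (merge K L) P" "df (\<lambda>_. True) (merge K L) Q"
    by - (rule df_mono[OF rcl(2)], assumption, rule range_merge)+
  then show ?thesis by (auto intro!: df_imp_DP df_conj)
qed

lemma DP_disj [simp]: assumes "DP P" "DP Q" shows "DP (\<lambda>e. P e \<or> Q e)"
proof -
  have "DP (\<lambda>e. \<not> (\<not> P e \<and> \<not> Q e))" by (intro DP_not DP_conj assms)
  then show ?thesis by (rule DP_eqI) simp
qed

lemma DP_imp [simp]: assumes "DP P" "DP Q" shows "DP (\<lambda>e. P e \<longrightarrow> Q e)"
proof -
  have "DP (\<lambda>e. \<not> P e \<or> Q e)" by (intro DP_not DP_disj assms)
  then show ?thesis by (rule DP_eqI) simp
qed

lemma DP_iff [simp]: assumes "DP P" "DP Q" shows "DP (\<lambda>e. P e \<longleftrightarrow> Q e)"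
proof -
  have "DP (\<lambda>e. (P e \<longrightarrow> Q e) \<and> (Q e \<longrightarrow> P e))" by (intro DP_imp DP_conj assms)
  then show ?thesis by (rule DP_eqI) blast
qed

lemma DP_ex [simp]: "DP (\<lambda>e. P (\<lambda>n. e (Suc n)) (e 0)) \<Longrightarrow> DP (\<lambda>e. \<exists>y. P e y)"
  unfolding DP_def using df_ex[OF rcl(2), of _ P] by blast

lemma DP_all [simp]: "DP (\<lambda>e. P (\<lambda>n. e (Suc n)) (e 0)) \<Longrightarrow> DP (\<lambda>e. \<forall>y. P e y)"
  unfolding DP_def using df_all[OF rcl(2), of _ P] by blast

lemma DP_var_eq: "DP (\<lambda>e. e i = e j)" and DP_var_mem: "DP (\<lambda>e. e i \<epsilon> e j)"
  using df_eq_var df_mem_var df_imp_DP by blast+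

lemma DP_bconst [simp]: "DP (\<lambda>e. b)"
proof -
  have T: "DP (\<lambda>e. e 0 = e 0)" and F: "DP (\<lambda>e. \<not> e 0 = e 0)" by (intro DP_not DP_var_eq)+
  show ?thesis by (cases b) (rule DP_eqI[OF T], simp, rule DP_eqI[OF F], simp)
qed

lemma DP_if [simp]: "DP P \<Longrightarrow> DP Q \<Longrightarrow> DP (\<lambda>e. if b then P e else Q e)"
  by (cases b) auto

lemma DP_if_pred [simp]: assumes "DP B" "DP P" "DP Q" shows "DP (\<lambda>e. if B e then P e else Q e)"
proof -
  have "DP (\<lambda>e. (B e \<longrightarrow> P e) \<and> (\<not> B e \<longrightarrow> Q e))" by (intro DP_imp DP_conj DP_not assms)
  then show ?thesis by (rule DP_eqI) simp
qed

lemma TM_ren: "TM t \<Longrightarrow> TM (\<lambda>e. t (\<lambda>n. e (r n)))"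
  unfolding TM_def by (drule DP_ren[of _ "\<lambda>n. case n of 0 \<Rightarrow> 0 | Suc k \<Rightarrow> Suc (r k)"]) simp

lemma TM_var [simp]: "TM (\<lambda>e. e i)"
  unfolding TM_def by (rule DP_var_eq)

lemma TM_const [simp]: "TM (\<lambda>e. c)"
  using DP_fix[OF DP_var_eq[of 0 1], of "\<lambda>_. c" "\<lambda>n. case n of 0 \<Rightarrow> Inr 0 | Suc k \<Rightarrow> Inl k"]
  unfolding TM_def by (rule DP_eqI) auto

lemma DP_subst: assumes "DP P" "TM t" shows "DP (\<lambda>e. P (case_nat (t e) e))"
proof -
  have "DP (\<lambda>e. \<exists>y. t e = y \<and> P (case_nat y e))"
    by (intro DP_ex DP_conj) (use assms in \<open>auto simp: TM_def\<close>)
  then show ?thesis by (rule DP_eqI) simp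
qed

lemma TM_subst: assumes "TM f" "TM t" shows "TM (\<lambda>e. f (case_nat (t e) e))"
proof -
  have "DP (\<lambda>e. \<exists>y. t (\<lambda>n. e (Suc n)) = y \<and> f (case_nat y (\<lambda>n. e (Suc n))) = e 0)"
  proof (intro DP_ex DP_conj)
    show "DP (\<lambda>e. t (\<lambda>n. e (Suc (Suc n))) = e 0)"
      using TM_ren[OF assms(2), of Suc] unfolding TM_def .
    show "DP (\<lambda>e. f (case_nat (e 0) (\<lambda>n. e (Suc (Suc n)))) = e (Suc 0))"
      using DP_ren[of _ "\<lambda>n. case n of 0 \<Rightarrow> 1 | Suc 0 \<Rightarrow> 0 | Suc (Suc k) \<Rightarrow> Suc (Suc k)", OF assms(1)[unfolded TM_def]]
      by (rule back_subst[where P=DP]) (intro ext arg_cong2[where f="(=)"] arg_cong[where f=f]; auto split: nat.splits)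
  qed
  then show ?thesis unfolding TM_def by (rule DP_eqI) simp
qed

lemma DP_eq [simp]: assumes "TM t" "TM r" shows "DP (\<lambda>e. t e = r e)"
proof -
  have "DP (\<lambda>e. \<exists>y. t e = y \<and> r e = y)"
    by (rule DP_ex, rule DP_conj) (use assms in \<open>simp_all add: TM_def\<close>)
  then show ?thesis by (rule DP_eqI) auto
qed

lemma TM_sh: "TM t \<Longrightarrow> TM (\<lambda>e. t (\<lambda>n. e (Suc n)))" "TM t \<Longrightarrow> TM (\<lambda>e. t (\<lambda>n. e (Suc (Suc n))))"
  "TM t \<Longrightarrow> TM (\<lambda>e. t (\<lambda>n. e (Suc (Suc (Suc n)))))"
  by (rule TM_ren, assumption)+

lemma DP_mem [simp]: assumes "TM t" "TM r" shows "DP (\<lambda>e. t e \<epsilon> r e)"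
proof -
  have "DP (\<lambda>e. \<exists>x y. t e = x \<and> r e = y \<and> x \<epsilon> y)"
    by (rule DP_ex, rule DP_ex, rule DP_conj, rule DP_eq[OF TM_sh(2)[OF assms(1)] TM_var], rule DP_conj,
      rule DP_eq[OF TM_sh(2)[OF assms(2)] TM_var], rule DP_var_mem)
  then show ?thesis by (rule DP_eqI) simp
qed

lemma DP_app1: assumes "DP (\<lambda>e. P (e 0))" "TM t" shows "DP (\<lambda>e. P (t e))"
  using DP_subst[OF assms] by simp

lemma DP_app2: assumes "DP (\<lambda>e. P (e 0) (e 1))" "TM t" "TM r" shows "DP (\<lambda>e. P (t e) (r e))"
proof -
  have "DP (\<lambda>e. \<exists>x y. t e = x \<and> r e = y \<and> P x y)"
  proof (rule DP_ex, rule DP_ex, rule DP_conj, rule DP_eq[OF TM_sh(2)[OF assms(2)] TM_var], rule DP_conj,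
      rule DP_eq[OF TM_sh(2)[OF assms(3)] TM_var])
    show "DP (\<lambda>e. P (e (Suc 0)) (e 0))"
      using DP_ren[OF assms(1), of "\<lambda>n. if n = 0 then 1 else 0"] by simp
  qed
  then show ?thesis by (rule DP_eqI) simp
qed

lemma TM_app1: assumes "TM (\<lambda>e. F (e 0))" "TM t" shows "TM (\<lambda>e. F (t e))"
  using TM_subst[OF assms] by simp

lemma TM_app2: assumes "TM (\<lambda>e. F (e 0) (e 1))" "TM t" "TM r" shows "TM (\<lambda>e. F (t e) (r e))"
proof -
  have "DP (\<lambda>e. \<exists>x y. t (\<lambda>n. e (Suc n)) = x \<and> r (\<lambda>n. e (Suc n)) = y \<and> F x y = e 0)"
  proof (rule DP_ex, rule DP_ex, rule DP_conj, rule DP_eq[OF TM_sh(3)[OF assms(2)] TM_var], rule DP_conj,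
      rule DP_eq[OF TM_sh(3)[OF assms(3)] TM_var], rule DP_eq[OF _ TM_var])
    show "TM (\<lambda>e. F (e (Suc 0)) (e 0))"
      using TM_ren[OF assms(1), of "\<lambda>n. if n = 0 then 1 else 0"] by simp
  qed
  then show ?thesis unfolding TM_def by (rule DP_eqI) simp
qed

lemma DP_app3: assumes "DP (\<lambda>e. P (e 0) (e 1) (e 2))" "TM t" "TM r" "TM q" shows "DP (\<lambda>e. P (t e) (r e) (q e))"
proof -
  have "DP (\<lambda>e. \<exists>x y z. t e = x \<and> r e = y \<and> q e = z \<and> P x y z)"
  proof (rule DP_ex, rule DP_ex, rule DP_ex, rule DP_conj, rule DP_eq[OF TM_sh(3)[OF assms(2)] TM_var], rule DP_conj,
      rule DP_eq[OF TM_sh(3)[OF assms(3)] TM_var], rule DP_conj, rule DP_eq[OF TM_sh(3)[OF assms(4)] TM_var])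
    show "DP (\<lambda>e. P (e (Suc (Suc 0))) (e (Suc 0)) (e 0))"
      using DP_ren[OF assms(1), of "\<lambda>n. 2 - n"] by (simp add: numeral_2_eq_2)
  qed
  then show ?thesis by (rule DP_eqI) simp
qed

lemma DP_allfin [simp]: "(\<And>i. i < (n::nat) \<Longrightarrow> DP (\<lambda>e. P i e)) \<Longrightarrow> DP (\<lambda>e. \<forall>i<n. P i e)"
proof (induction n)
  case (Suc n)
  have "DP (\<lambda>e. (\<forall>i<n. P i e) \<and> P n e)" using Suc by auto
  moreover have "(\<lambda>e. (\<forall>i<n. P i e) \<and> P n e) = (\<lambda>e. \<forall>i<Suc n. P i e)"
    by (auto simp: less_Suc_eq fun_eq_iff)
  ultimately show ?case by metis
qed auto

lemma DP_ex1 [simp]: assumes "DP (\<lambda>e. P (\<lambda>n. e (Suc n)) (e 0))" shows "DP (\<lambda>e. \<exists>!y. P e y)"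
proof -
  have "DP (\<lambda>e. \<exists>y. P e y \<and> (\<forall>z. P e z \<longrightarrow> z = y))"
  proof (rule DP_ex, rule DP_conj)
    show "DP (\<lambda>e. P (\<lambda>n. e (Suc n)) (e 0))" by fact
    show "DP (\<lambda>e. \<forall>z. P (\<lambda>n. e (Suc n)) z \<longrightarrow> z = e 0)"
    proof (rule DP_all, rule DP_imp)
      show "DP (\<lambda>e. P (\<lambda>n. e (Suc (Suc n))) (e 0))"
        using DP_ren[OF assms, of "\<lambda>n. case n of 0 \<Rightarrow> 0 | Suc k \<Rightarrow> Suc (Suc k)"] by simp
    qed simp
  qed
  then show ?thesis by (rule DP_eqI) (auto simp: Ex1_def)
qed

lemma DP_sat: "(\<And>i. TM (t i)) \<Longrightarrow> DP (\<lambda>e. sat UNIV mem p (\<lambda>i. t i e))"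
proof (induction p arbitrary: t)
  case (Exists x p)
  have "DP (\<lambda>e. \<exists>a. sat UNIV mem p (\<lambda>i. if i = x then a else t i e))"
  proof (rule DP_ex)
    have "TM (\<lambda>e. if i = x then e 0 else t i (\<lambda>n. e (Suc n)))" for i
      by (cases "i = x") (simp_all add: TM_sh(1)[OF Exists(2)])
    then show "DP (\<lambda>e. sat UNIV mem p (\<lambda>i. if i = x then e 0 else t i (\<lambda>n. e (Suc n))))"
      by (rule Exists.IH)
  qed
  then show ?case by (simp add: fun_upd_def)
next
  case (Forall x p)
  have "DP (\<lambda>e. \<forall>a. sat UNIV mem p (\<lambda>i. if i = x then a else t i e))"
  proof (rule DP_all)
    have "TM (\<lambda>e. if i = x then e 0 else t i (\<lambda>n. e (Suc n)))" for i
      by (cases "i = x") (simp_all add: TM_sh(1)[OF Forall(2)])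
    then show "DP (\<lambda>e. sat UNIV mem p (\<lambda>i. if i = x then e 0 else t i (\<lambda>n. e (Suc n))))"
      by (rule Forall.IH)
  qed
  then show ?case by (simp add: fun_upd_def)
qed auto

lemma DP_definable: assumes "definable mem \<Gamma> C" shows "DP (\<lambda>e. e 0 \<in> C)"
proof -
  obtain p s where "C = {x. sat UNIV mem p (s(0 := x))}" using assms unfolding definable_def by blast
  moreover have "DP (\<lambda>e. sat UNIV mem p (\<lambda>i. (if i = 0 then e 0 else s i)))"
    apply (rule DP_sat) subgoal for i by (cases "i = 0") auto done
  ultimately show ?thesis by (simp add: fun_upd_def)
qed

lemma definable_df: assumes "df \<Gamma> K (\<lambda>e. P (e 0))" shows "definable mem \<Gamma> {x. P x}"
proof -
  obtain p where p: "\<Gamma> p" "\<And>e u. P (e 0) \<longleftrightarrow> sat UNIV mem p (mix e K u)"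
    using assms unfolding df_def by blast
  have "P x \<longleftrightarrow> sat UNIV mem p ((mix K K K)(0 := x))" for x
    using p(2)[of "K(0 := x)" K] mix_upd0[of K K K 0 x] by simp
  then show ?thesis unfolding definable_def using p(1) by blast
qed

lemma definable_DP: "DP (\<lambda>e. P (e 0)) \<Longrightarrow> definable mem (\<lambda>_. True) {x. P x}"
  unfolding DP_def using definable_df by blast

lemma separation: assumes "DP (\<lambda>e. P (e 0))" shows "\<exists>b. \<forall>x. x \<epsilon> b \<longleftrightarrow> x \<epsilon> a \<and> P x"
proof -
  obtain p s where "\<And>x. P x \<longleftrightarrow> sat UNIV mem p (s(0 := x))"
    using definable_DP[OF assms] unfolding definable_def by auto
  moreover have "\<forall>\<phi> s a. \<exists>b. \<forall>x. x \<epsilon> b \<longleftrightarrow> x \<epsilon> a \<and> sat UNIV mem \<phi> (s(0 := x))"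
    using ZFC unfolding ZFC_def by blast
  ultimately show ?thesis by metis
qed

lemma replacement:
  assumes "DP (\<lambda>e. P (e 0) (e 1))" "\<And>x. x \<epsilon> a \<Longrightarrow> \<exists>!y. P x y"
  shows "\<exists>b. \<forall>y. y \<epsilon> b \<longleftrightarrow> (\<exists>x. x \<epsilon> a \<and> P x y)"
proof -
  obtain K p where p: "okf p" "\<And>e u. P (e 0) (e 1) \<longleftrightarrow> sat UNIV mem p (mix e K u)"
    using assms(1) unfolding DP_def df_def by blast
  \<comment> \<open>The axiom reserves variables 0 and 1 for argument and value, whereas
    \<open>df\<close> has them in slots 0 and 3. The renaming is injective: 0 stays, 3 goes to 1,
    everything else moves up by 3 out of the way.\<close>
  let ?f = "\<lambda>n. if n = 0 then 0 else if n = 3 then 1 else n + 3 :: nat"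
  have i: "?f y = ?f x \<Longrightarrow> y = x" for x y by (auto split: if_splits)
  define s :: "nat \<Rightarrow> 'v" where "s n = mix K K K (n - 3)" for n
  have S: "sat UNIV mem (ren ?f p) (s(0 := x, 1 := y)) \<longleftrightarrow> P x y" for x y
  proof -
    have "(\<lambda>n. (s(0 := x, 1 := y)) (?f n)) = mix (K(0 := x, 1 := y)) K K"
    proof -
      have "mix (K(0 := x, 1 := y)) K K = (mix K K K)(3 * 0 := x, 3 * 1 := y)" by (simp only: mix_upd0)
      then show ?thesis by (auto simp: s_def fun_eq_iff)
    qed
    moreover have "sat UNIV mem (ren ?f p) (s(0 := x, 1 := y)) \<longleftrightarrow>
        sat UNIV mem p (\<lambda>n. (s(0 := x, 1 := y)) (?f n))"
      by (rule sat_ren) (intro ballI allI impI, erule i)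
    moreover have "P x y \<longleftrightarrow> sat UNIV mem p (mix (K(0 := x, 1 := y)) K K)"
      using p(2)[of "K(0 := x, 1 := y)" K] by simp
    ultimately show ?thesis by simp
  qed
  have "\<forall>\<phi> s a. (\<forall>x. x \<epsilon> a \<longrightarrow> (\<exists>!y. sat UNIV mem \<phi> (s(0 := x, 1 := y)))) \<longrightarrow>
        (\<exists>b. \<forall>y. y \<epsilon> b \<longleftrightarrow> (\<exists>x. x \<epsilon> a \<and> sat UNIV mem \<phi> (s(0 := x, 1 := y))))"
    using ZFC unfolding ZFC_def by blast
  note R = this[rule_format, of a "ren ?f p" s, unfolded S]
  show ?thesis by (rule R) (rule assms(2))
qed

end

context zfc
begin

section \<open>Basic set theory in the universe\<close>

abbreviation sub (infix "\<sqsubseteq>" 50) where "x \<sqsubseteq> y \<equiv> subset_of mem x y"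

lemmas axioms = ZFC[unfolded ZFC_def]
lemmas ax_ext = axioms[THEN conjunct1, rule_format]
  and ax_found = axioms[THEN conjunct2, THEN conjunct1, rule_format]
  and ax_pair = axioms[THEN conjunct2, THEN conjunct2, THEN conjunct1, rule_format]
  and ax_union = axioms[THEN conjunct2, THEN conjunct2, THEN conjunct2, THEN conjunct1, rule_format]
  and ax_pow = axioms[THEN conjunct2, THEN conjunct2, THEN conjunct2, THEN conjunct2, THEN conjunct1, rule_format]
  and ax_inf = axioms[THEN conjunct2, THEN conjunct2, THEN conjunct2, THEN conjunct2, THEN conjunct2, THEN conjunct1]
  and ax_choice = axioms[THEN conjunct2, THEN conjunct2, THEN conjunct2, THEN conjunct2, THEN conjunct2, THEN conjunct2,
    THEN conjunct2, THEN conjunct2, rule_format]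

lemma ext: "(\<And>w. w \<epsilon> x \<longleftrightarrow> w \<epsilon> y) \<Longrightarrow> x = y"
  by (rule ax_ext) blast

lemma subI: "(\<And>w. w \<epsilon> x \<Longrightarrow> w \<epsilon> y) \<Longrightarrow> x \<sqsubseteq> y"
  by (simp add: subset_of_def)

lemma subD: "x \<sqsubseteq> y \<Longrightarrow> w \<epsilon> x \<Longrightarrow> w \<epsilon> y"
  by (simp add: subset_of_def)

lemma sub_refl [simp]: "x \<sqsubseteq> x" by (simp add: subset_of_def)
lemma sub_trans: "x \<sqsubseteq> y \<Longrightarrow> y \<sqsubseteq> z \<Longrightarrow> x \<sqsubseteq> z" by (simp add: subset_of_def)
lemma sub_antisym: "x \<sqsubseteq> y \<Longrightarrow> y \<sqsubseteq> x \<Longrightarrow> x = y" by (rule ext) (auto simp: subset_of_def)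

section \<open>Class operations: empty set, descriptions, comprehension, pairs, functions\<close>

definition emp :: 'v where "emp = (THE x. \<forall>y. \<not> y \<epsilon> x)"

lemma emp [simp]: "\<not> y \<epsilon> emp"
proof -
  obtain b where "\<forall>x. \<not> x \<epsilon> b" using separation[of "\<lambda>_. False"] by auto
  then have "\<exists>!x. \<forall>y. \<not> y \<epsilon> x" by (metis ext)
  from theI'[OF this] show ?thesis unfolding emp_def by blast
qed

lemma is_empty_iff [simp]: "is_empty mem x \<longleftrightarrow> x = emp"
  unfolding is_empty_def by (metis emp ext)

lemma nonempty: "x \<noteq> emp \<Longrightarrow> \<exists>y. y \<epsilon> x"
  by (metis emp ext)

lemma emp_sub [simp]: "emp \<sqsubseteq> x" by (simp add: subset_of_def)

text \<open>An explicit default makes the value definable in every case (\<open>theD_iff\<close>),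
  in contrast to \<open>THE\<close>, about which nothing is known without unique existence.\<close>

definition theD :: "'v \<Rightarrow> ('v \<Rightarrow> bool) \<Rightarrow> 'v" where
  "theD d P = (if \<exists>!y. P y then THE y. P y else d)"

lemma theD_eq: "P y \<Longrightarrow> (\<And>z. P z \<Longrightarrow> z = y) \<Longrightarrow> theD d P = y"
  unfolding theD_def by (metis the_equality)

lemma theD_iff: "(theD d P = z) \<longleftrightarrow> ((\<exists>!y. P y) \<and> P z \<or> \<not> (\<exists>!y. P y) \<and> z = d)"
proof (cases "\<exists>!y. P y")
  case True
  then obtain y where y: "P y" "\<And>z. P z \<Longrightarrow> z = y" by blast
  then have "theD d P = y" by (rule theD_eq)
  moreover have "P z \<longleftrightarrow> y = z" using y by blast
  ultimately show ?thesis using True by argo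
qed (auto simp: theD_def)

lemma DP_bind: "DP (\<lambda>e. P (\<lambda>n. e (Suc n)) (e 0)) \<Longrightarrow> DP (\<lambda>e. P (\<lambda>n. e (Suc (Suc n))) (e 0))"
  "DP (\<lambda>e. P (\<lambda>n. e (Suc n)) (e 0)) \<Longrightarrow> DP (\<lambda>e. P (\<lambda>n. e (Suc (Suc (Suc n)))) (e 0))"
  using DP_ren[of "\<lambda>e. P (\<lambda>n. e (Suc n)) (e 0)" "\<lambda>n. case n of 0 \<Rightarrow> 0 | Suc k \<Rightarrow> Suc (Suc k)"]
    DP_ren[of "\<lambda>e. P (\<lambda>n. e (Suc n)) (e 0)" "\<lambda>n. case n of 0 \<Rightarrow> 0 | Suc k \<Rightarrow> Suc (Suc (Suc k))"]
  by (simp_all)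

lemma TM_theD [simp]: assumes "TM d" "DP (\<lambda>e. P (\<lambda>n. e (Suc n)) (e 0))"
  shows "TM (\<lambda>e. theD (d e) (\<lambda>y. P e y))"
proof -
  note a = DP_bind(1)[OF assms(2)]
  have b: "DP (\<lambda>e. P (\<lambda>n. e (Suc n)) (e 0))" by fact
  show ?thesis unfolding TM_def theD_iff
    by (intro DP_disj DP_conj DP_not DP_ex1 a b DP_eq TM_var TM_sh(1)[OF assms(1)])
qed

lemma DP_sub [simp]: "TM t \<Longrightarrow> TM r \<Longrightarrow> DP (\<lambda>e. t e \<sqsubseteq> r e)"
  by (rule DP_app2[where P="\<lambda>x y. x \<sqsubseteq> y"]) (unfold subset_of_def, simp_all)

lemma TM_if [simp]: assumes "DP B" "TM t" "TM r" shows "TM (\<lambda>e. if B e then t e else r e)"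
proof -
  have B: "DP (\<lambda>e. B (\<lambda>n. e (Suc n)))" using DP_ren[OF assms(1), of Suc] .
  have "DP (\<lambda>e. if B (\<lambda>n. e (Suc n)) then t (\<lambda>n. e (Suc n)) = e 0 else r (\<lambda>n. e (Suc n)) = e 0)"
    by (intro DP_if_pred B DP_eq TM_sh(1) assms TM_var)
  then show ?thesis unfolding TM_def by (rule DP_eqI) simp
qed

definition Sep :: "'v \<Rightarrow> ('v \<Rightarrow> bool) \<Rightarrow> 'v" where
  "Sep A P = theD emp (\<lambda>b. \<forall>x. x \<epsilon> b \<longleftrightarrow> x \<epsilon> A \<and> P x)"

definition Im :: "'v \<Rightarrow> ('v \<Rightarrow> 'v) \<Rightarrow> 'v" where
  "Im A F = theD emp (\<lambda>b. \<forall>y. y \<epsilon> b \<longleftrightarrow> (\<exists>x. x \<epsilon> A \<and> y = F x))"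

lemma theD_set: assumes "\<exists>b. \<forall>x. x \<epsilon> b \<longleftrightarrow> P x" shows "x \<epsilon> theD d (\<lambda>b. \<forall>x. x \<epsilon> b \<longleftrightarrow> P x) \<longleftrightarrow> P x"
proof -
  have "\<exists>!b. \<forall>x. x \<epsilon> b \<longleftrightarrow> P x" using assms ext by metis
  then show ?thesis unfolding theD_def using theI'[of "\<lambda>b. \<forall>x. x \<epsilon> b \<longleftrightarrow> P x"] by auto
qed

lemma mem_Sep [simp]: assumes "DP (\<lambda>e. P (e 0))" shows "x \<epsilon> Sep A P \<longleftrightarrow> x \<epsilon> A \<and> P x"
  unfolding Sep_def by (rule theD_set) (rule separation[OF assms])

lemma mem_Im [simp]: assumes "TM (\<lambda>e. F (e 0))" shows "y \<epsilon> Im A F \<longleftrightarrow> (\<exists>x. x \<epsilon> A \<and> y = F x)"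
  unfolding Im_def
proof (rule theD_set, rule replacement)
  show "DP (\<lambda>e. e 1 = F (e 0))" by (rule DP_eq[OF TM_var assms])
qed auto

lemma TM_Sep [simp]: assumes "TM A" "DP (\<lambda>e. P (\<lambda>n. e (Suc n)) (e 0))"
  shows "TM (\<lambda>e. Sep (A e) (\<lambda>x. P e x))"
  unfolding Sep_def
  by (intro TM_theD TM_const DP_all DP_iff DP_mem TM_var DP_conj TM_sh(2)[OF assms(1)] DP_bind(1)[OF assms(2)])

lemma TM_bind: "TM (\<lambda>e. F (\<lambda>n. e (Suc n)) (e 0)) \<Longrightarrow> TM (\<lambda>e. F (\<lambda>n. e (Suc (Suc n))) (e 0))"
  "TM (\<lambda>e. F (\<lambda>n. e (Suc n)) (e 0)) \<Longrightarrow> TM (\<lambda>e. F (\<lambda>n. e (Suc (Suc (Suc n)))) (e 0))"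
  using TM_ren[of "\<lambda>e. F (\<lambda>n. e (Suc n)) (e 0)" "\<lambda>n. case n of 0 \<Rightarrow> 0 | Suc k \<Rightarrow> Suc (Suc k)"]
    TM_ren[of "\<lambda>e. F (\<lambda>n. e (Suc n)) (e 0)" "\<lambda>n. case n of 0 \<Rightarrow> 0 | Suc k \<Rightarrow> Suc (Suc (Suc k))"]
  by (simp_all)

lemma TM_Im [simp]: assumes "TM A" "TM (\<lambda>e. F (\<lambda>n. e (Suc n)) (e 0))"
  shows "TM (\<lambda>e. Im (A e) (\<lambda>x. F e x))"
  unfolding Im_def
  by (intro TM_theD TM_const DP_all DP_iff DP_ex DP_conj DP_mem TM_var TM_sh(3)[OF assms(1)] DP_eq TM_bind(2)[OF assms(2)])

definition upair :: "'v \<Rightarrow> 'v \<Rightarrow> 'v" where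
  "upair x y = theD emp (\<lambda>b. \<forall>w. w \<epsilon> b \<longleftrightarrow> w = x \<or> w = y)"
definition Uni :: "'v \<Rightarrow> 'v" where
  "Uni x = theD emp (\<lambda>b. \<forall>w. w \<epsilon> b \<longleftrightarrow> (\<exists>y. y \<epsilon> x \<and> w \<epsilon> y))"
definition Pow :: "'v \<Rightarrow> 'v" where
  "Pow x = theD emp (\<lambda>b. \<forall>w. w \<epsilon> b \<longleftrightarrow> w \<sqsubseteq> x)"

lemma mem_upair [simp]: "w \<epsilon> upair x y \<longleftrightarrow> w = x \<or> w = y"
  unfolding upair_def by (rule theD_set) (rule ax_pair[unfolded is_upair_def])
lemma mem_Uni [simp]: "w \<epsilon> Uni x \<longleftrightarrow> (\<exists>y. y \<epsilon> x \<and> w \<epsilon> y)"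
  unfolding Uni_def by (rule theD_set) (rule ax_union)
lemma mem_Pow [simp]: "w \<epsilon> Pow x \<longleftrightarrow> w \<sqsubseteq> x"
  unfolding Pow_def by (rule theD_set) (rule ax_pow)

lemma TM_upair [simp]: "TM t \<Longrightarrow> TM r \<Longrightarrow> TM (\<lambda>e. upair (t e) (r e))"
  by (rule TM_app2[where F=upair]) (unfold upair_def, simp_all)
lemma TM_Uni [simp]: "TM t \<Longrightarrow> TM (\<lambda>e. Uni (t e))"
  by (rule TM_app1[where F=Uni]) (unfold Uni_def, simp_all)
lemma TM_Pow [simp]: "TM t \<Longrightarrow> TM (\<lambda>e. Pow (t e))"
  by (rule TM_app1[where F=Pow]) (unfold Pow_def, simp_all)

lemma mem_Uni_Im [simp]: "TM (\<lambda>e. F (e 0)) \<Longrightarrow> z \<epsilon> Uni (Im A F) \<longleftrightarrow> (\<exists>x. x \<epsilon> A \<and> z \<epsilon> F x)"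
  by auto

abbreviation sing :: "'v \<Rightarrow> 'v" where "sing x \<equiv> upair x x"
definition pair :: "'v \<Rightarrow> 'v \<Rightarrow> 'v" where "pair x y = upair (sing x) (upair x y)"
definition cup :: "'v \<Rightarrow> 'v \<Rightarrow> 'v" where "cup x y = Uni (upair x y)"
definition succ :: "'v \<Rightarrow> 'v" where "succ x = cup x (sing x)"

lemma mem_cup [simp]: "w \<epsilon> cup x y \<longleftrightarrow> w \<epsilon> x \<or> w \<epsilon> y"
  by (auto simp: cup_def)
lemma mem_succ [simp]: "w \<epsilon> succ x \<longleftrightarrow> w \<epsilon> x \<or> w = x"
  by (auto simp: succ_def)

lemma upair_eq: "upair x y = upair z w \<longleftrightarrow> x = z \<and> y = w \<or> x = w \<and> y = z"
proof
  assume "upair x y = upair z w"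
  then have "\<And>v. v = x \<or> v = y \<longleftrightarrow> v = z \<or> v = w" using mem_upair by metis
  then show "x = z \<and> y = w \<or> x = w \<and> y = z" by metis
qed (auto intro: ext)

lemma pair_eq [simp]: "pair x y = pair z w \<longleftrightarrow> x = z \<and> y = w"
  unfolding pair_def by (auto simp: upair_eq)

lemma TM_pair [simp]: "TM t \<Longrightarrow> TM r \<Longrightarrow> TM (\<lambda>e. pair (t e) (r e))"
  unfolding pair_def by simp
lemma TM_cup [simp]: "TM t \<Longrightarrow> TM r \<Longrightarrow> TM (\<lambda>e. cup (t e) (r e))"
  unfolding cup_def by simp
lemma TM_succ [simp]: "TM t \<Longrightarrow> TM (\<lambda>e. succ (t e))"
  unfolding succ_def by simp

lemma is_upair_iff [simp]: "is_upair mem z x y \<longleftrightarrow> z = upair x y"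
  unfolding is_upair_def by (auto intro: ext)
lemma is_opair_iff [simp]: "is_opair mem p x y \<longleftrightarrow> p = pair x y"
  unfolding is_opair_def by (simp add: pair_def)
lemma is_succ_iff [simp]: "is_succ mem y x \<longleftrightarrow> y = succ x"
  unfolding is_succ_def by (auto intro: ext)
lemma rel_iff [simp]: "rel mem r x y \<longleftrightarrow> pair x y \<epsilon> r"
  unfolding rel_def by auto

text \<open>The default is \<open>p\<close> itself: ordinal levels \<open>V a\<close> are then
  closed under projections of arbitrary elements (\<open>pi_V\<close>), and projections can be
  substituted into bounded formulas (\<open>pi1_subst\<close>).\<close>

definition pi1 :: "'v \<Rightarrow> 'v" where "pi1 p = theD p (\<lambda>x. \<exists>y. p = pair x y)"
definition pi2 :: "'v \<Rightarrow> 'v" where "pi2 p = theD p (\<lambda>y. \<exists>x. p = pair x y)"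

lemma pi_pair [simp]: "pi1 (pair x y) = x" "pi2 (pair x y) = y"
  unfolding pi1_def pi2_def by (auto intro: theD_eq)
lemma TM_pi [simp]: "TM t \<Longrightarrow> TM (\<lambda>e. pi1 (t e))" "TM t \<Longrightarrow> TM (\<lambda>e. pi2 (t e))"
  unfolding pi1_def pi2_def
  by (rule TM_theD, assumption, simp add: TM_sh, rule TM_theD, assumption, simp add: TM_sh)

lemma pi_nonpair: "(\<And>x y. p \<noteq> pair x y) \<Longrightarrow> pi1 p = p" "(\<And>x y. p \<noteq> pair x y) \<Longrightarrow> pi2 p = p"
  unfolding pi1_def pi2_def theD_def by auto

text \<open>The default is the argument, again a term at hand for the bounded substitution
  \<open>app_subst\<close>.\<close>

definition app :: "'v \<Rightarrow> 'v \<Rightarrow> 'v" where "app f x = theD x (\<lambda>y. pair x y \<epsilon> f)"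
definition lam :: "'v \<Rightarrow> ('v \<Rightarrow> 'v) \<Rightarrow> 'v" where "lam A F = Im A (\<lambda>x. pair x (F x))"
definition ran :: "'v \<Rightarrow> 'v" where "ran f = Im f pi2"

lemma TM_app [simp]: "TM t \<Longrightarrow> TM r \<Longrightarrow> TM (\<lambda>e. app (t e) (r e))"
  by (rule TM_app2[where F=app]) (unfold app_def, simp_all)
lemma TM_lam [simp]: assumes "TM A" "TM (\<lambda>e. F (\<lambda>n. e (Suc n)) (e 0))"
  shows "TM (\<lambda>e. lam (A e) (\<lambda>x. F e x))"
  unfolding lam_def by (intro TM_Im TM_pair assms TM_var)
lemma TM_ran [simp]: "TM t \<Longrightarrow> TM (\<lambda>e. ran (t e))"
  by (rule TM_app1[where F=ran]) (unfold ran_def, simp_all)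

lemma function_on_alt: "function_on mem f a \<longleftrightarrow> (\<forall>p. p \<epsilon> f \<longrightarrow> (\<exists>x y. x \<epsilon> a \<and> p = pair x y)) \<and>
    (\<forall>x. x \<epsilon> a \<longrightarrow> (\<exists>!y. pair x y \<epsilon> f))"
  unfolding function_on_def is_opair_iff rel_iff ..

lemma DP_function_on [simp]: "TM t \<Longrightarrow> TM r \<Longrightarrow> DP (\<lambda>e. function_on mem (t e) (r e))"
  by (rule DP_app2[where P="function_on mem"]) (unfold function_on_alt, simp_all)
lemma DP_function_to [simp]: "TM t \<Longrightarrow> TM r \<Longrightarrow> TM q \<Longrightarrow> DP (\<lambda>e. function_to mem (t e) (r e) (q e))"
  by (rule DP_app3[where P="function_to mem"]) (unfold function_to_def rel_iff, simp_all)

lemma mem_lam [simp]: "TM (\<lambda>e. F (e 0)) \<Longrightarrow> p \<epsilon> lam A F \<longleftrightarrow> (\<exists>x. x \<epsilon> A \<and> p = pair x (F x))"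
  by (simp add: lam_def)

lemma fn_lam [simp]: "TM (\<lambda>e. F (e 0)) \<Longrightarrow> function_on mem (lam A F) A"
  by (auto simp: function_on_alt)

lemma app_lam [simp]: "TM (\<lambda>e. F (e 0)) \<Longrightarrow> x \<epsilon> A \<Longrightarrow> app (lam A F) x = F x"
  unfolding app_def by (rule theD_eq) auto

lemma fn_pair: "function_on mem f A \<Longrightarrow> pair x y \<epsilon> f \<longleftrightarrow> x \<epsilon> A \<and> y = app f x"
proof
  assume f: "function_on mem f A" and p: "pair x y \<epsilon> f"
  then have x: "x \<epsilon> A" unfolding function_on_alt by auto
  then have "\<exists>!y. pair x y \<epsilon> f" using f unfolding function_on_alt by auto
  then have "app f x = y" using p unfolding app_def by (intro theD_eq) blast+
  then show "x \<epsilon> A \<and> y = app f x" using x by simp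
next
  assume f: "function_on mem f A" and p: "x \<epsilon> A \<and> y = app f x"
  then have "\<exists>!y. pair x y \<epsilon> f" unfolding function_on_alt by auto
  then show "pair x y \<epsilon> f" using p unfolding app_def theD_def by (auto intro: theI')
qed

lemma fn_mem: assumes "function_on mem f A" shows "p \<epsilon> f \<longleftrightarrow> (\<exists>x. x \<epsilon> A \<and> p = pair x (app f x))"
proof
  assume "p \<epsilon> f"
  then obtain x y where "p = pair x y" using assms unfolding function_on_alt by auto
  then show "\<exists>x. x \<epsilon> A \<and> p = pair x (app f x)" using \<open>p \<epsilon> f\<close> fn_pair[OF assms] by auto
qed (use fn_pair[OF assms] in auto)

lemma fn_ext: "function_on mem f A \<Longrightarrow> function_on mem g A \<Longrightarrow> (\<And>x. x \<epsilon> A \<Longrightarrow> app f x = app g x) \<Longrightarrow> f = g"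
  by (rule ext) (auto simp: fn_mem)

lemma fn_to: "function_to mem f A B \<longleftrightarrow> function_on mem f A \<and> (\<forall>x. x \<epsilon> A \<longrightarrow> app f x \<epsilon> B)"
  by (auto simp: function_to_def fn_pair)

lemma fn_to_lam [simp]: "TM (\<lambda>e. F (e 0)) \<Longrightarrow> function_to mem (lam A F) A B \<longleftrightarrow> (\<forall>x. x \<epsilon> A \<longrightarrow> F x \<epsilon> B)"
  by (auto simp: fn_to)

lemma lam_cong: "TM (\<lambda>e. F (e 0)) \<Longrightarrow> TM (\<lambda>e. G (e 0)) \<Longrightarrow> (\<And>x. x \<epsilon> A \<Longrightarrow> F x = G x) \<Longrightarrow> lam A F = lam A G"
  by (rule fn_ext[where A=A]) auto

lemma mem_ran [simp]: "function_on mem f A \<Longrightarrow> y \<epsilon> ran f \<longleftrightarrow> (\<exists>x. x \<epsilon> A \<and> y = app f x)"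
  unfolding ran_def by (auto simp: fn_mem)

lemma mem_ran_lam [simp]: "TM (\<lambda>e. F (e 0)) \<Longrightarrow> y \<epsilon> ran (lam A F) \<longleftrightarrow> (\<exists>x. x \<epsilon> A \<and> y = F x)"
  by (subst mem_ran[OF fn_lam]) auto

lemma foundation: "x \<noteq> emp \<Longrightarrow> \<exists>m. m \<epsilon> x \<and> (\<forall>w. w \<epsilon> m \<longrightarrow> \<not> w \<epsilon> x)"
  using ax_found[of x] by auto

lemma mem_irrefl [simp]: "\<not> x \<epsilon> x"
  using foundation[of "sing x"] by (metis emp mem_upair)

lemma mem_asym: "x \<epsilon> y \<Longrightarrow> \<not> y \<epsilon> x"
  using foundation[of "upair x y"] by (metis emp mem_upair)

lemma upair_nonemp [simp]: "upair x y \<noteq> emp" "emp \<noteq> upair x y"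
  by (metis emp mem_upair)+
lemma succ_nonemp [simp]: "succ x \<noteq> emp" "emp \<noteq> succ x"
  by (metis emp mem_succ)+
lemma succ_inj [simp]: "succ x = succ y \<longleftrightarrow> x = y"
  by (metis mem_asym mem_succ)

subsection \<open>The natural numbers\<close>

definition om :: 'v where
  "om = (THE w. (emp \<epsilon> w \<and> (\<forall>x. x \<epsilon> w \<longrightarrow> succ x \<epsilon> w)) \<and>
     (\<forall>i. emp \<epsilon> i \<and> (\<forall>x. x \<epsilon> i \<longrightarrow> succ x \<epsilon> i) \<longrightarrow> w \<sqsubseteq> i))"

lemma om: "emp \<epsilon> om" "x \<epsilon> om \<Longrightarrow> succ x \<epsilon> om"
  "emp \<epsilon> i \<Longrightarrow> (\<And>x. x \<epsilon> i \<Longrightarrow> succ x \<epsilon> i) \<Longrightarrow> om \<sqsubseteq> i"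
proof -
  let ?ind = "\<lambda>i. emp \<epsilon> i \<and> (\<forall>x. x \<epsilon> i \<longrightarrow> succ x \<epsilon> i)"
  obtain i where i: "?ind i" using ax_inf by auto
  have "\<exists>w. ?ind w \<and> (\<forall>i. ?ind i \<longrightarrow> w \<sqsubseteq> i)"
    by (rule exI[of _ "Sep i (\<lambda>x. \<forall>i. ?ind i \<longrightarrow> x \<epsilon> i)"]) (use i in \<open>auto simp: subset_of_def\<close>)
  then obtain w where w: "?ind w \<and> (\<forall>i. ?ind i \<longrightarrow> w \<sqsubseteq> i)" by blast
  have "\<exists>!w. ?ind w \<and> (\<forall>i. ?ind i \<longrightarrow> w \<sqsubseteq> i)"
  proof (rule ex1I[of _ w])
    show "v = w" if "?ind v \<and> (\<forall>i. ?ind i \<longrightarrow> v \<sqsubseteq> i)" for v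
      by (rule sub_antisym) (use that w in blast)+
  qed (rule w)
  then have "?ind om \<and> (\<forall>i. ?ind i \<longrightarrow> om \<sqsubseteq> i)" unfolding om_def by (rule theI')
  then show "emp \<epsilon> om" "x \<epsilon> om \<Longrightarrow> succ x \<epsilon> om"
    "emp \<epsilon> i \<Longrightarrow> (\<And>x. x \<epsilon> i \<Longrightarrow> succ x \<epsilon> i) \<Longrightarrow> om \<sqsubseteq> i" for i by blast+
qed

lemma om_induct [consumes 1, case_names dp emp succ]:
  assumes "n \<epsilon> om" "DP (\<lambda>e. P (e 0))" "P emp" "\<And>n. n \<epsilon> om \<Longrightarrow> P n \<Longrightarrow> P (succ n)"
  shows "P n"
proof -
  have "om \<sqsubseteq> Sep om P" by (rule om(3)) (use assms om in auto)
  then show ?thesis using assms(1,2) by (auto dest: subD)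
qed

lemma om_trans: "n \<epsilon> om \<Longrightarrow> m \<epsilon> n \<Longrightarrow> m \<epsilon> om"
proof -
  assume "n \<epsilon> om"
  then have "\<forall>m. m \<epsilon> n \<longrightarrow> m \<epsilon> om" by (induction rule: om_induct) auto
  then show "m \<epsilon> n \<Longrightarrow> m \<epsilon> om" by blast
qed

lemma om_cases: "n \<epsilon> om \<Longrightarrow> n = emp \<or> (\<exists>m. m \<epsilon> om \<and> n = succ m)"
  by (induction rule: om_induct) auto

lemma om_tr: "n \<epsilon> om \<Longrightarrow> m \<epsilon> n \<Longrightarrow> m \<sqsubseteq> n"
proof -
  assume "n \<epsilon> om"
  then have "\<forall>m. m \<epsilon> n \<longrightarrow> m \<sqsubseteq> n" by (induction rule: om_induct) (auto simp: subset_of_def)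
  then show "m \<epsilon> n \<Longrightarrow> m \<sqsubseteq> n" by blast
qed

lemma Uni_succ: "n \<epsilon> om \<Longrightarrow> Uni (succ n) = n"
  by (rule ext) (auto dest: om_tr subD)

end

subsection \<open>Well-founded recursion\<close>

definition (in zfc) attempt :: "('v \<Rightarrow> 'v) \<Rightarrow> ('v \<Rightarrow> 'v \<Rightarrow> 'v) \<Rightarrow> 'v \<Rightarrow> 'v \<Rightarrow> bool" where
  "attempt Ext G f d \<longleftrightarrow> function_on mem f d \<and> (\<forall>y. y \<epsilon> d \<longrightarrow> Ext y \<sqsubseteq> d) \<and>
    (\<forall>y. y \<epsilon> d \<longrightarrow> app f y = G y (lam (Ext y) (\<lambda>z. app f z)))"

definition (in zfc) wfrec :: "('v \<Rightarrow> 'v) \<Rightarrow> ('v \<Rightarrow> 'v \<Rightarrow> 'v) \<Rightarrow> 'v \<Rightarrow> 'v" where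
  "wfrec Ext G x = theD x (\<lambda>v. \<exists>f d. attempt Ext G f d \<and> x \<epsilon> d \<and> v = app f x)"

text \<open>\<open>Ext x\<close> is the set of predecessors of \<open>x\<close>, so the relation is
  set-like. \<open>closed\<close> puts \<open>x\<close> into a set closed under predecessors, and
  \<open>wf\<close> speaks about sets only; together they give induction for definable predicates.
  The instances are the natural numbers, membership and the collapse of an ultrapower.\<close>

locale wfr = zfc mem for mem :: "'v \<Rightarrow> 'v \<Rightarrow> bool" (infix "\<epsilon>" 50) +
  fixes Ext :: "'v \<Rightarrow> 'v" and G :: "'v \<Rightarrow> 'v \<Rightarrow> 'v"
  assumes TE: "TM (\<lambda>e. Ext (e 0))" and TG: "TM (\<lambda>e. G (e 0) (e 1))"
    and closed: "\<exists>d. x \<epsilon> d \<and> (\<forall>y. y \<epsilon> d \<longrightarrow> Ext y \<sqsubseteq> d)"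
    and wf: "d \<noteq> emp \<Longrightarrow> \<exists>m. m \<epsilon> d \<and> (\<forall>y. y \<epsilon> d \<longrightarrow> \<not> y \<epsilon> Ext m)"
begin

lemma TE' [simp]: "TM t \<Longrightarrow> TM (\<lambda>e. Ext (t e))"
  by (rule TM_app1[OF TE])
lemma TG' [simp]: "TM t \<Longrightarrow> TM r \<Longrightarrow> TM (\<lambda>e. G (t e) (r e))"
  by (rule TM_app2[OF TG])

lemma DP_attempt [simp]: "TM t \<Longrightarrow> TM r \<Longrightarrow> DP (\<lambda>e. attempt Ext G (t e) (r e))"
  by (rule DP_app2[where P="attempt Ext G"]) (unfold attempt_def, simp_all)

lemma TM_wfrec: "TM t \<Longrightarrow> TM (\<lambda>e. wfrec Ext G (t e))"
  by (rule TM_app1[where F="wfrec Ext G"]) (unfold wfrec_def, simp_all)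

lemma wf_induct: assumes "DP (\<lambda>e. P (e 0))" "\<And>x. (\<And>y. y \<epsilon> Ext x \<Longrightarrow> P y) \<Longrightarrow> P x"
  shows "P x"
proof (rule ccontr)
  assume n: "\<not> P x"
  obtain d where d: "x \<epsilon> d" "\<forall>y. y \<epsilon> d \<longrightarrow> Ext y \<sqsubseteq> d" using closed by blast
  let ?S = "Sep d (\<lambda>x. \<not> P x)"
  have S: "y \<epsilon> ?S \<longleftrightarrow> y \<epsilon> d \<and> \<not> P y" for y using assms(1) by simp
  then have "?S \<noteq> emp" using n d(1) by (metis emp)
  then obtain m where m: "m \<epsilon> ?S" "\<forall>y. y \<epsilon> ?S \<longrightarrow> \<not> y \<epsilon> Ext m" using wf by blast
  then have "P m" using assms(2) S d(2) by (meson subD)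
  then show False using m(1) S by blast
qed

lemma attempt_unique: "attempt Ext G f d \<Longrightarrow> attempt Ext G g d' \<Longrightarrow> x \<epsilon> d \<Longrightarrow> x \<epsilon> d' \<Longrightarrow> app f x = app g x"
proof -
  have "\<forall>f d g d'. attempt Ext G f d \<and> attempt Ext G g d' \<and> x \<epsilon> d \<and> x \<epsilon> d' \<longrightarrow> app f x = app g x"
  proof (rule wf_induct[of _ x])
    fix x assume IH: "\<And>y. y \<epsilon> Ext x \<Longrightarrow>
      \<forall>f d g d'. attempt Ext G f d \<and> attempt Ext G g d' \<and> y \<epsilon> d \<and> y \<epsilon> d' \<longrightarrow> app f y = app g y"
    show "\<forall>f d g d'. attempt Ext G f d \<and> attempt Ext G g d' \<and> x \<epsilon> d \<and> x \<epsilon> d' \<longrightarrow> app f x = app g x"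
    proof (intro allI impI, elim conjE)
      fix f d g d' assume a: "attempt Ext G f d" "attempt Ext G g d'" "x \<epsilon> d" "x \<epsilon> d'"
      then have "lam (Ext x) (\<lambda>z. app f z) = lam (Ext x) (\<lambda>z. app g z)"
      proof (intro lam_cong)
        fix z assume z: "z \<epsilon> Ext x"
        then have "z \<epsilon> d" "z \<epsilon> d'" using a unfolding attempt_def by (meson subD)+
        then show "app f z = app g z" using IH[OF z] a by blast
      qed simp_all
      with a show "app f x = app g x" unfolding attempt_def by metis
    qed
  qed simp
  then show "attempt Ext G f d \<Longrightarrow> attempt Ext G g d' \<Longrightarrow> x \<epsilon> d \<Longrightarrow> x \<epsilon> d' \<Longrightarrow> app f x = app g x" by blast
qed

lemma wfrec_attempt: "attempt Ext G f d \<Longrightarrow> x \<epsilon> d \<Longrightarrow> wfrec Ext G x = app f x"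
  unfolding wfrec_def by (rule theD_eq) (use attempt_unique in blast)+

lemma wfrec_attempt_eq: assumes "attempt Ext G f d" "x \<epsilon> d"
  shows "wfrec Ext G x = G x (lam (Ext x) (wfrec Ext G))"
proof -
  have "lam (Ext x) (\<lambda>z. app f z) = lam (Ext x) (wfrec Ext G)"
  proof (rule lam_cong)
    fix z assume "z \<epsilon> Ext x"
    then have "z \<epsilon> d" using assms unfolding attempt_def by (meson subD)
    then show "app f z = wfrec Ext G z" using wfrec_attempt[OF assms(1)] by simp
  qed (simp_all add: TM_wfrec)
  then show ?thesis using assms wfrec_attempt[OF assms] unfolding attempt_def by metis
qed

lemma attempt_ex: "\<exists>f d. attempt Ext G f d \<and> x \<epsilon> d"
proof (rule wf_induct[of _ x])
  fix x assume IH: "\<And>y. y \<epsilon> Ext x \<Longrightarrow> \<exists>f d. attempt Ext G f d \<and> y \<epsilon> d"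
  obtain d0 where d0: "x \<epsilon> d0" "\<forall>y. y \<epsilon> d0 \<longrightarrow> Ext y \<sqsubseteq> d0" using closed by blast
  define d where "d = Sep d0 (\<lambda>z. \<exists>f d. attempt Ext G f d \<and> z \<epsilon> d)"
  have d: "z \<epsilon> d \<longleftrightarrow> z \<epsilon> d0 \<and> (\<exists>f d. attempt Ext G f d \<and> z \<epsilon> d)" for z by (simp add: d_def)
  \<comment> \<open>On \<open>d\<close> the recursion is solved by earlier approximations; at the
    new point \<open>x\<close> the recursion equation prescribes the value.\<close>
  let ?F = "\<lambda>z. if z \<epsilon> d then wfrec Ext G z else G z (lam (Ext z) (wfrec Ext G))"
  let ?d = "cup d (sing x)"
  have T: "TM (\<lambda>e. ?F (e 0))" by (simp add: TM_wfrec)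
  have F: "?F z = G z (lam (Ext z) (wfrec Ext G))" for z using d wfrec_attempt_eq by auto
  have cl: "Ext z \<sqsubseteq> d" if "z \<epsilon> ?d" for z
  proof (cases "z \<epsilon> d")
    case True
    then obtain f d' where "attempt Ext G f d'" "z \<epsilon> d'" "z \<epsilon> d0" using d by blast
    then show ?thesis using d d0(2) unfolding attempt_def by (meson subI subD)
  next
    case False
    then have "z = x" using that by simp
    then show ?thesis using IH d d0 by (meson subI subD)
  qed
  have "attempt Ext G (lam ?d ?F) ?d"
    unfolding attempt_def
  proof (intro conjI allI impI)
    fix y assume y: "y \<epsilon> ?d"
    show "Ext y \<sqsubseteq> ?d" using cl[OF y] by (simp add: subset_of_def)
    have "lam (Ext y) (\<lambda>z. app (lam ?d ?F) z) = lam (Ext y) (wfrec Ext G)"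
      by (rule lam_cong) (use T cl[OF y] in \<open>auto simp: TM_wfrec dest: subD\<close>)
    then show "app (lam ?d ?F) y = G y (lam (Ext y) (\<lambda>z. app (lam ?d ?F) z))"
      using app_lam[OF T y] F by simp
  qed (simp add: TM_wfrec)
  then show "\<exists>f d. attempt Ext G f d \<and> x \<epsilon> d" by (rule_tac exI)+ auto
qed simp

lemma wfrec: "wfrec Ext G x = G x (lam (Ext x) (wfrec Ext G))"
  using attempt_ex wfrec_attempt_eq by blast

end

context zfc
begin

text \<open>\<open>Uni n\<close> is the predecessor of a successor \<open>n\<close>. Points outside
  \<open>om\<close> get no predecessors, so that \<open>cup om (sing x)\<close> is closed for every
  \<open>x\<close>.\<close>

definition iter :: "('v \<Rightarrow> 'v) \<Rightarrow> 'v \<Rightarrow> 'v \<Rightarrow> 'v" where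
  "iter F a = wfrec (\<lambda>n. if n \<epsilon> om then n else emp) (\<lambda>n g. if n = emp then a else F (app g (Uni n)))"

lemma iter:
  assumes "TM (\<lambda>e. F (e 0))"
  shows "TM t \<Longrightarrow> TM (\<lambda>e. iter F a (t e))" "iter F a emp = a" "n \<epsilon> om \<Longrightarrow> iter F a (succ n) = F (iter F a n)"
proof -
  note [simp] = TM_app1[OF assms]
  interpret wfr mem "\<lambda>n. if n \<epsilon> om then n else emp" "\<lambda>n g. if n = emp then a else F (app g (Uni n))"
  proof
    show "\<exists>d. x \<epsilon> d \<and> (\<forall>y. y \<epsilon> d \<longrightarrow> (if y \<epsilon> om then y else emp) \<sqsubseteq> d)" for x
      by (rule exI[of _ "cup om (sing x)"]) (auto simp: subset_of_def dest: om_trans)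
    show "\<exists>m. m \<epsilon> d \<and> (\<forall>y. y \<epsilon> d \<longrightarrow> \<not> y \<epsilon> (if m \<epsilon> om then m else emp))" if "d \<noteq> emp" for d
      using foundation[OF that] by auto
  qed simp_all
  show T: "TM t \<Longrightarrow> TM (\<lambda>e. iter F a (t e))" for t unfolding iter_def by (rule TM_wfrec)
  show "iter F a emp = a" unfolding iter_def by (subst wfrec) simp
  assume n: "n \<epsilon> om"
  show "iter F a (succ n) = F (iter F a n)"
    unfolding iter_def
    by (subst wfrec) (use n om T[unfolded iter_def] in \<open>simp add: Uni_succ\<close>)
qed

section \<open>Transitive closure, induction and recursion along membership\<close>

definition TC :: "'v \<Rightarrow> 'v" where "TC x = Uni (Im om (iter Uni x))"

lemma TC: "x \<sqsubseteq> TC x" "y \<epsilon> TC x \<Longrightarrow> y \<sqsubseteq> TC x"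
proof -
  have T: "TM (\<lambda>e. Uni (e 0))" by simp
  have m: "z \<epsilon> TC x \<longleftrightarrow> (\<exists>n. n \<epsilon> om \<and> z \<epsilon> iter Uni x n)" for z
    unfolding TC_def using iter(1)[OF T] by auto
  show "x \<sqsubseteq> TC x" using m om(1) iter(2)[OF T] by (metis subI)
  assume "y \<epsilon> TC x"
  then obtain n where "n \<epsilon> om" "y \<epsilon> iter Uni x n" using m by blast
  then have "z \<epsilon> y \<Longrightarrow> z \<epsilon> iter Uni x (succ n)" for z using iter(3)[OF T] by auto
  then show "y \<sqsubseteq> TC x" using m om(2) \<open>n \<epsilon> om\<close> by (metis subI)
qed

lemma mem_wfr: assumes "TM (\<lambda>e. G (e 0) (e 1))" shows "wfr mem (\<lambda>x. x) G"
proof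
  show "\<exists>d. x \<epsilon> d \<and> (\<forall>y. y \<epsilon> d \<longrightarrow> y \<sqsubseteq> d)" for x
    by (rule exI[of _ "TC (sing x)"]) (use TC TC(1)[of "sing x"] in \<open>auto simp: subset_of_def\<close>)
  show "\<exists>m. m \<epsilon> d \<and> (\<forall>y. y \<epsilon> d \<longrightarrow> \<not> y \<epsilon> m)" if "d \<noteq> emp" for d
    using foundation[OF that] by auto
qed (use assms in simp_all)

lemma mem_induct [case_names dp step]: assumes "DP (\<lambda>e. P (e 0))" "\<And>x. (\<And>y. y \<epsilon> x \<Longrightarrow> P y) \<Longrightarrow> P x"
  shows "P x"
proof -
  interpret wfr mem "\<lambda>x. x" "\<lambda>x g. g" by (rule mem_wfr) simp
  show ?thesis using wf_induct[of P x] assms by blast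
qed

definition memrec :: "('v \<Rightarrow> 'v \<Rightarrow> 'v) \<Rightarrow> 'v \<Rightarrow> 'v" where "memrec G = wfrec (\<lambda>x. x) G"

lemma memrec: assumes "TM (\<lambda>e. G (e 0) (e 1))"
  shows "TM t \<Longrightarrow> TM (\<lambda>e. memrec G (t e))" "memrec G x = G x (lam x (memrec G))"
proof -
  interpret wfr mem "\<lambda>x. x" G by (rule mem_wfr) fact
  show "TM t \<Longrightarrow> TM (\<lambda>e. memrec G (t e))" unfolding memrec_def by (rule TM_wfrec)
  show "memrec G x = G x (lam x (memrec G))" unfolding memrec_def by (rule wfrec)
qed

section \<open>Ordinals, ranks and choice\<close>

lemma mem_asym3: "x \<epsilon> y \<Longrightarrow> y \<epsilon> z \<Longrightarrow> \<not> z \<epsilon> x"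
proof
  assume a: "x \<epsilon> y" "y \<epsilon> z" "z \<epsilon> x"
  let ?A = "cup (upair x y) (sing z)"
  have "x \<epsilon> ?A" by simp
  then have "?A \<noteq> emp" by (metis emp)
  then obtain m where "m \<epsilon> ?A" "\<forall>w. w \<epsilon> m \<longrightarrow> \<not> w \<epsilon> ?A" using foundation by blast
  then show False using a by auto
qed

abbreviation Ord :: "'v \<Rightarrow> bool" where "Ord \<equiv> ordinal mem"

text \<open>Foundation excludes membership cycles of length at most three and supplies minimal
  elements, so transitivity and linearity imply the rest. The simpler condition is bounded, which
  \<open>Ord_bd\<close> exploits.\<close>

lemma Ord_iff: "Ord a \<longleftrightarrow> (\<forall>x. x \<epsilon> a \<longrightarrow> x \<sqsubseteq> a) \<and>
    (\<forall>x y. x \<epsilon> a \<and> y \<epsilon> a \<longrightarrow> x \<epsilon> y \<or> x = y \<or> y \<epsilon> x)" (is "_ \<longleftrightarrow> ?R")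
proof
  assume "Ord a" then show ?R unfolding ordinal_def by blast
next
  assume R: ?R
  have t: "x \<epsilon> a \<Longrightarrow> y \<epsilon> a \<Longrightarrow> z \<epsilon> a \<Longrightarrow> x \<epsilon> y \<Longrightarrow> y \<epsilon> z \<Longrightarrow> x \<epsilon> z" for x y z
    using R mem_asym mem_asym3 by metis
  have m: "b \<sqsubseteq> a \<Longrightarrow> b \<noteq> emp \<Longrightarrow> \<exists>m. m \<epsilon> b \<and> (\<forall>x. x \<epsilon> b \<longrightarrow> m = x \<or> m \<epsilon> x)" for b
  proof -
    assume b: "b \<sqsubseteq> a" "b \<noteq> emp"
    then obtain m where m: "m \<epsilon> b" "\<forall>w. w \<epsilon> m \<longrightarrow> \<not> w \<epsilon> b" using foundation by blast
    then show ?thesis using R b(1) by (intro exI[of _ m]) (meson subD)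
  qed
  show "Ord a" unfolding ordinal_def using R t m by (auto simp: is_empty_iff)
qed

lemma DP_Ord [simp]: "TM t \<Longrightarrow> DP (\<lambda>e. Ord (t e))"
  by (rule DP_app1[where P=Ord]) (unfold Ord_iff, simp_all)

lemma Ord_sub: "Ord a \<Longrightarrow> x \<epsilon> a \<Longrightarrow> x \<sqsubseteq> a" by (simp add: Ord_iff)
lemma Ord_trans: "Ord a \<Longrightarrow> x \<epsilon> y \<Longrightarrow> y \<epsilon> a \<Longrightarrow> x \<epsilon> a" using Ord_sub subD by blast

lemma Ord_in: assumes "Ord a" "x \<epsilon> a" shows "Ord x"
  unfolding Ord_iff
proof (intro conjI allI impI)
  fix y assume y: "y \<epsilon> x"
  show "y \<sqsubseteq> x"
  proof (rule subI)
    fix z assume z: "z \<epsilon> y"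
    have "y \<epsilon> a" "z \<epsilon> a" using Ord_trans assms y z by blast+
    then show "z \<epsilon> x" using assms y z mem_asym mem_asym3 unfolding Ord_iff by metis
  qed
next
  fix y z assume "y \<epsilon> x \<and> z \<epsilon> x"
  then have "y \<epsilon> a" "z \<epsilon> a" using Ord_trans assms by blast+
  then show "y \<epsilon> z \<or> y = z \<or> z \<epsilon> y" using assms unfolding Ord_iff by blast
qed

text \<open>A minimal element of \<open>b\<close> outside \<open>a\<close> is equal to
  \<open>a\<close>.\<close>

lemma Ord_psub: assumes "Ord a" "Ord b" "a \<sqsubseteq> b" "a \<noteq> b" shows "a \<epsilon> b"
proof -
  let ?d = "Sep b (\<lambda>x. \<not> x \<epsilon> a)"
  have "?d \<noteq> emp"
  proof
    assume "?d = emp"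
    then have "\<not> x \<epsilon> ?d" for x by simp
    then have "b \<sqsubseteq> a" by (auto simp: subset_of_def)
    then show False using assms sub_antisym by blast
  qed
  then obtain m where m: "m \<epsilon> ?d" "\<forall>w. w \<epsilon> m \<longrightarrow> \<not> w \<epsilon> ?d" using foundation by blast
  then have mb: "m \<epsilon> b" "\<not> m \<epsilon> a" by auto
  have "m = a"
  proof (rule sub_antisym; rule subI)
    fix w assume "w \<epsilon> m" then show "w \<epsilon> a" using m mb Ord_trans[OF assms(2)] by auto
  next
    fix w assume w: "w \<epsilon> a"
    then have "w \<epsilon> b" using assms(3) subD by blast
    then have "w \<epsilon> m \<or> w = m \<or> m \<epsilon> w" using assms(2) mb unfolding Ord_iff by blast
    then show "w \<epsilon> m" using w mb Ord_trans[OF assms(1)] by blast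
  qed
  then show ?thesis using mb by simp
qed

lemma Ord_linear: assumes "Ord a" "Ord b" shows "a \<epsilon> b \<or> a = b \<or> b \<epsilon> a"
proof -
  let ?c = "Sep a (\<lambda>x. x \<epsilon> b)"
  have m: "x \<epsilon> ?c \<longleftrightarrow> x \<epsilon> a \<and> x \<epsilon> b" for x by simp
  have "Ord ?c" unfolding Ord_iff
  proof (intro conjI allI impI)
    show "x \<sqsubseteq> ?c" if "x \<epsilon> ?c" for x
      by (rule subI) (use that m Ord_trans assms in blast)
  qed (use assms(1) m Ord_iff in metis)
  moreover have "?c \<sqsubseteq> a" "?c \<sqsubseteq> b" using m by (auto simp: subset_of_def)
  ultimately have "?c = a \<or> ?c \<epsilon> a" "?c = b \<or> ?c \<epsilon> b" using Ord_psub assms by blast+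
  then show ?thesis using m by (metis mem_irrefl)
qed

lemma Ord_le: "Ord a \<Longrightarrow> Ord b \<Longrightarrow> a \<sqsubseteq> b \<longleftrightarrow> a \<epsilon> b \<or> a = b"
  using Ord_psub Ord_sub by auto

lemma Ord_not_le: "Ord a \<Longrightarrow> Ord b \<Longrightarrow> \<not> a \<sqsubseteq> b \<longleftrightarrow> b \<epsilon> a"
  using Ord_linear[of a b] Ord_le[of a b] mem_asym by auto

lemma Ord_emp [simp]: "Ord emp" by (simp add: Ord_iff)

lemma Ord_succ: "Ord a \<Longrightarrow> Ord (succ a)"
  unfolding Ord_iff by (auto simp: subset_of_def)

lemma Ord_Uni: assumes "\<And>x. x \<epsilon> A \<Longrightarrow> Ord x" shows "Ord (Uni A)"
  unfolding Ord_iff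
proof (intro conjI allI impI)
  show "x \<sqsubseteq> Uni A" if "x \<epsilon> Uni A" for x
    by (rule subI) (use that assms Ord_trans in auto)
  fix x y assume "x \<epsilon> Uni A \<and> y \<epsilon> Uni A"
  then have "Ord x" "Ord y" using assms Ord_in by auto
  then show "x \<epsilon> y \<or> x = y \<or> y \<epsilon> x" by (rule Ord_linear)
qed

lemma Ord_om_in: "n \<epsilon> om \<Longrightarrow> Ord n"
  by (induction rule: om_induct) (auto intro: Ord_succ)

lemma Ord_om: "Ord om"
  unfolding Ord_iff using om_trans Ord_om_in Ord_linear by (auto intro: subI)

lemma succ_le: "Ord a \<Longrightarrow> x \<epsilon> a \<Longrightarrow> succ x \<epsilon> a \<or> succ x = a"
proof -
  assume a: "Ord a" "x \<epsilon> a"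
  then have "succ x \<sqsubseteq> a" using Ord_sub by (auto simp: subset_of_def)
  then show ?thesis using Ord_le Ord_succ Ord_in a by blast
qed

lemma Ord_least: assumes "DP (\<lambda>e. P (e 0))" "Ord a" "P a"
  obtains b where "Ord b" "P b" "\<And>c. c \<epsilon> b \<Longrightarrow> \<not> P c" "b \<epsilon> succ a"
proof -
  have "\<forall>a. Ord a \<and> P a \<longrightarrow> (\<exists>b. Ord b \<and> P b \<and> (\<forall>c. c \<epsilon> b \<longrightarrow> \<not> P c) \<and> b \<epsilon> succ a)"
  proof
    fix a show "Ord a \<and> P a \<longrightarrow> (\<exists>b. Ord b \<and> P b \<and> (\<forall>c. c \<epsilon> b \<longrightarrow> \<not> P c) \<and> b \<epsilon> succ a)"
    proof (induction a rule: mem_induct)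
      have [simp]: "TM t \<Longrightarrow> DP (\<lambda>e. P (t e))" for t by (rule DP_app1[OF assms(1)])
      case dp
      show "DP (\<lambda>e. Ord (e 0) \<and> P (e 0) \<longrightarrow> (\<exists>b. Ord b \<and> P b \<and> (\<forall>c. c \<epsilon> b \<longrightarrow> \<not> P c) \<and> b \<epsilon> succ (e 0)))"
        by simp
    next
      case (step x)
      then show ?case using Ord_in Ord_trans by (metis mem_succ)
    qed
  qed
  then show thesis using that assms by blast
qed

text \<open>Burali-Forti: otherwise the ordinals would form an ordinal that belongs to
  itself.\<close>

lemma no_Ord_set: "\<not> (\<forall>x. Ord x \<longrightarrow> x \<epsilon> A)"
proof
  assume a: "\<forall>x. Ord x \<longrightarrow> x \<epsilon> A"
  let ?B = "Sep A Ord"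
  have B: "x \<epsilon> ?B \<longleftrightarrow> Ord x" for x using a by auto
  have "Ord ?B"
    by (subst Ord_iff) (use B Ord_in Ord_linear in \<open>blast intro: subI\<close>)
  then show False using B mem_irrefl by blast
qed

definition Lim :: "'v \<Rightarrow> bool" where
  "Lim l \<longleftrightarrow> Ord l \<and> emp \<epsilon> l \<and> (\<forall>x. x \<epsilon> l \<longrightarrow> succ x \<epsilon> l)"

lemma DP_Lim [simp]: "TM t \<Longrightarrow> DP (\<lambda>e. Lim (t e))"
  by (rule DP_app1[where P=Lim]) (unfold Lim_def, simp_all)

lemma Lim_Ord: "Lim l \<Longrightarrow> Ord l" and Lim_emp: "Lim l \<Longrightarrow> emp \<epsilon> l"
  and Lim_succ: "Lim l \<Longrightarrow> x \<epsilon> l \<Longrightarrow> succ x \<epsilon> l"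
  by (simp_all add: Lim_def)

lemma Lim_om: "Lim om"
  by (simp add: Lim_def Ord_om om)

text \<open>Closing off \<open>a\<close> under \<open>F\<close> in omega steps. This is the source
  of limit ordinals and, in \<open>DD_ex\<close>, of closure points of cofinality omega.\<close>

lemma iter_sup:
  assumes T: "TM (\<lambda>e. F (e 0))" and F: "\<forall>x. Ord x \<longrightarrow> Ord (F x) \<and> x \<epsilon> F x" and a: "Ord a"
  defines "l \<equiv> Uni (Im om (iter F a))"
  shows "Lim l" "a \<epsilon> l" "n \<epsilon> om \<Longrightarrow> iter F a n \<epsilon> l" "x \<epsilon> l \<longleftrightarrow> (\<exists>n. n \<epsilon> om \<and> x \<epsilon> iter F a n)"
    "n \<epsilon> om \<Longrightarrow> Ord (iter F a n)"
proof -
  note it = iter[OF T]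
  have m: "x \<epsilon> l \<longleftrightarrow> (\<exists>n. n \<epsilon> om \<and> x \<epsilon> iter F a n)" for x
    unfolding l_def using it(1) by auto
  then show "x \<epsilon> l \<longleftrightarrow> (\<exists>n. n \<epsilon> om \<and> x \<epsilon> iter F a n)" .
  have O: "n \<epsilon> om \<Longrightarrow> Ord (iter F a n)" for n
    by (induction rule: om_induct) (use it F a in auto)
  then show "n \<epsilon> om \<Longrightarrow> Ord (iter F a n)" .
  have s: "n \<epsilon> om \<Longrightarrow> iter F a n \<epsilon> l" for n
    using m O F it(3) om(2) by metis
  then show "n \<epsilon> om \<Longrightarrow> iter F a n \<epsilon> l" .
  show al: "a \<epsilon> l" using s[OF om(1)] it(2) by simp
  have Ol: "Ord l" unfolding l_def by (rule Ord_Uni) (use O it(1) in auto)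
  show "Lim l" unfolding Lim_def
  proof (intro conjI allI impI)
    show "Ord l" by fact
    then show "emp \<epsilon> l" using al Ord_le[OF Ord_emp \<open>Ord l\<close>] by auto
    fix x assume "x \<epsilon> l"
    then obtain n where n: "n \<epsilon> om" "x \<epsilon> iter F a n" using m by blast
    then have "succ x \<epsilon> iter F a n \<or> succ x = iter F a n" using succ_le O by blast
    then show "succ x \<epsilon> l" using s[OF n(1)] n(1) m[of "succ x"] by metis
  qed
qed

lemma Lim_ex: "Ord a \<Longrightarrow> \<exists>l. Lim l \<and> a \<epsilon> l"
  using iter_sup(1,2)[of succ a] Ord_succ by (metis TM_succ TM_var mem_succ)

subsection \<open>The cumulative hierarchy\<close>

text \<open>The recursion runs over all sets; at an ordinal it gives the usual level of the
  hierarchy, by \<open>is_V_iff\<close>.\<close>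

definition V :: "'v \<Rightarrow> 'v" where "V = memrec (\<lambda>x g. Uni (Im (ran g) Pow))"
definition rk :: "'v \<Rightarrow> 'v" where "rk = memrec (\<lambda>x g. Uni (Im (ran g) succ))"

lemma TM_V [simp]: "TM t \<Longrightarrow> TM (\<lambda>e. V (t e))" and TM_rk [simp]: "TM t \<Longrightarrow> TM (\<lambda>e. rk (t e))"
  unfolding V_def rk_def by (rule memrec, simp_all)+

lemma mem_V: "z \<epsilon> V x \<longleftrightarrow> (\<exists>y. y \<epsilon> x \<and> z \<sqsubseteq> V y)"
proof -
  have "V x = Uni (Im (ran (lam x V)) Pow)"
    unfolding V_def by (rule memrec(2)) simp
  then show ?thesis by (auto simp del: mem_Uni)
qed

lemma V_I: "y \<epsilon> x \<Longrightarrow> z \<sqsubseteq> V y \<Longrightarrow> z \<epsilon> V x"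
  using mem_V by metis

lemma mem_rk: "z \<epsilon> rk x \<longleftrightarrow> (\<exists>y. y \<epsilon> x \<and> z \<epsilon> succ (rk y))"
proof -
  have "rk x = Uni (Im (ran (lam x rk)) succ)"
    unfolding rk_def by (rule memrec(2)) simp
  then show ?thesis by (auto simp del: mem_succ)
qed

lemma V_sub: "z \<epsilon> V x \<Longrightarrow> w \<sqsubseteq> z \<Longrightarrow> w \<epsilon> V x"
  using mem_V sub_trans by blast

lemma V_mono: "x \<sqsubseteq> y \<Longrightarrow> V x \<sqsubseteq> V y"
  by (rule subI) (meson mem_V subD)

lemma V_in: "y \<epsilon> x \<Longrightarrow> V y \<epsilon> V x"
  using mem_V by auto

lemma V_tr: assumes "Ord a" "z \<epsilon> V a" shows "z \<sqsubseteq> V a"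
proof -
  obtain y where "y \<epsilon> a" "z \<sqsubseteq> V y" using assms mem_V by blast
  then show ?thesis using V_mono[of y a] Ord_sub assms(1) sub_trans by blast
qed

lemma V_trD: "Ord a \<Longrightarrow> z \<epsilon> V a \<Longrightarrow> w \<epsilon> z \<Longrightarrow> w \<epsilon> V a"
  using V_tr subD by blast

lemma V_up: "Ord b \<Longrightarrow> a \<epsilon> b \<Longrightarrow> x \<epsilon> V a \<Longrightarrow> x \<epsilon> V b"
  using V_mono Ord_sub subD by blast

lemma V_succ: assumes "Ord a" shows "V (succ a) = Pow (V a)"
proof (rule ext)
  fix z show "z \<epsilon> V (succ a) \<longleftrightarrow> z \<epsilon> Pow (V a)"
    using mem_V[of z "succ a"] V_mono Ord_sub[OF assms] sub_trans[of z] by auto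
qed

lemma sub_V_rk: "x \<sqsubseteq> V (rk x)"
proof (induction x rule: mem_induct)
  case (step x)
  show ?case
  proof (rule subI)
    fix y assume y: "y \<epsilon> x"
    then have "rk y \<epsilon> rk x" using mem_rk[of "rk y" x] by auto
    then show "y \<epsilon> V (rk x)" using step[OF y] by (rule V_I)
  qed
qed simp

lemma Ord_rk: "Ord (rk x)"
proof (induction x rule: mem_induct)
  case (step x)
  have "rk x = Uni (Im x (\<lambda>y. succ (rk y)))" by (rule ext, subst mem_rk) auto
  moreover have "Ord (Uni (Im x (\<lambda>y. succ (rk y))))"
    by (rule Ord_Uni) (use step Ord_succ in auto)
  ultimately show ?case by simp
qed simp

lemma in_V_rk: "x \<epsilon> V (succ (rk x))"
  using sub_V_rk V_succ[OF Ord_rk] by simp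

lemma in_V_ex: "\<exists>a. Ord a \<and> x \<epsilon> V a"
  using in_V_rk Ord_rk Ord_succ by blast

lemma Ord_sub_V: "Ord a \<Longrightarrow> a \<sqsubseteq> V a"
proof (induction a rule: mem_induct)
  case (step x)
  show ?case
  proof (rule subI)
    fix y assume "y \<epsilon> x"
    then have "y \<sqsubseteq> V y" using step Ord_in by blast
    then show "y \<epsilon> V x" using \<open>y \<epsilon> x\<close> by (rule V_I[rotated])
  qed
qed simp

lemma Ord_in_V: assumes "Ord a" "Ord b" shows "a \<epsilon> V b \<longleftrightarrow> a \<epsilon> b"
proof
  show "a \<epsilon> b \<Longrightarrow> a \<epsilon> V b" using Ord_sub_V assms subD by blast
  have "\<forall>b. Ord b \<longrightarrow> (\<forall>a. Ord a \<and> a \<epsilon> V b \<longrightarrow> a \<epsilon> b)"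
  proof
    fix b show "Ord b \<longrightarrow> (\<forall>a. Ord a \<and> a \<epsilon> V b \<longrightarrow> a \<epsilon> b)"
    proof (induction b rule: mem_induct)
      case (step b)
      show ?case
      proof (intro impI allI)
        fix a assume b: "Ord b" and a: "Ord a \<and> a \<epsilon> V b"
        then obtain c where c: "c \<epsilon> b" "a \<sqsubseteq> V c" using mem_V by blast
        have "Ord c" using b c Ord_in by blast
        have "a \<sqsubseteq> c"
          by (rule subI) (use step[OF c(1)] c a Ord_in \<open>Ord c\<close> subD in blast)
        then show "a \<epsilon> b" using Ord_le a \<open>Ord c\<close> c(1) b Ord_trans by blast
      qed
    qed simp
  qed
  then show "a \<epsilon> V b \<Longrightarrow> a \<epsilon> b" using assms by blast
qed

lemma is_V_iff [simp]: "is_V mem v a \<longleftrightarrow> Ord a \<and> v = V a"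
proof
  assume "is_V mem v a"
  then obtain f where a: "Ord a" and f: "function_on mem f (succ a)"
    "\<And>b u. pair b u \<epsilon> f \<Longrightarrow> \<forall>x. x \<epsilon> u \<longleftrightarrow> (\<exists>c w. c \<epsilon> b \<and> pair c w \<epsilon> f \<and> x \<sqsubseteq> w)" "pair a v \<epsilon> f"
    unfolding is_V_def by auto
  have "b \<epsilon> succ a \<longrightarrow> app f b = V b" for b
  proof (induction b rule: mem_induct)
    case (step b)
    show ?case
    proof
      assume b: "b \<epsilon> succ a"
      show "app f b = V b"
      proof (rule ext)
        fix x
        have sb: "c \<epsilon> succ a \<and> app f c = V c" if "c \<epsilon> b" for c
          using step[OF that] Ord_trans[OF Ord_succ[OF a] that b] by auto
        have "x \<epsilon> app f b \<longleftrightarrow> (\<exists>c. c \<epsilon> b \<and> c \<epsilon> succ a \<and> x \<sqsubseteq> app f c)"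
          using f(2)[of b "app f b"] b fn_pair[OF f(1)] by auto
        also have "\<dots> \<longleftrightarrow> (\<exists>c. c \<epsilon> b \<and> x \<sqsubseteq> V c)"
          using sb by metis
        finally show "x \<epsilon> app f b \<longleftrightarrow> x \<epsilon> V b" using mem_V by simp
      qed
    qed
  qed simp
  then show "Ord a \<and> v = V a" using a f(3) fn_pair[OF f(1)] by auto
next
  assume v: "Ord a \<and> v = V a"
  show "is_V mem v a" unfolding is_V_def
  proof (intro conjI, use v in simp, rule exI[of _ "lam (succ a) V"], rule exI[of _ "succ a"], intro conjI allI impI)
    fix b u x assume "rel mem (lam (succ a) V) b u"
    then have b: "b \<epsilon> succ a" "u = V b" by auto
    then have "\<And>c. c \<epsilon> b \<Longrightarrow> c \<epsilon> succ a" using v Ord_trans[OF Ord_succ] by blast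
    then show "x \<epsilon> u \<longleftrightarrow> (\<exists>c w. c \<epsilon> b \<and> rel mem (lam (succ a) V) c w \<and> x \<sqsubseteq> w)"
      using b mem_V[of x b] by auto
  qed (use v in auto)
qed

lemma V_limE: assumes "Lim l" "x \<epsilon> V l" obtains a where "a \<epsilon> l" "Ord a" "x \<epsilon> V a" "x \<sqsubseteq> V a"
proof -
  obtain y where y: "y \<epsilon> l" "x \<sqsubseteq> V y" using assms mem_V by blast
  then have o: "Ord y" "Ord (succ y)" using assms Lim_Ord Ord_in Ord_succ by blast+
  have "x \<epsilon> V (succ y)" using V_succ[OF o(1)] y by simp
  then show thesis using that[of "succ y"] y Lim_succ assms o V_tr by blast
qed

lemma V_limE2: assumes "Lim l" "x \<epsilon> V l" "y \<epsilon> V l" obtains a where "a \<epsilon> l" "Ord a" "x \<epsilon> V a" "y \<epsilon> V a"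
proof -
  obtain a where a: "a \<epsilon> l" "Ord a" "x \<epsilon> V a" by (rule V_limE[OF assms(1,2)])
  obtain b where b: "b \<epsilon> l" "Ord b" "y \<epsilon> V b" by (rule V_limE[OF assms(1,3)])
  consider "a \<epsilon> b" | "a = b" | "b \<epsilon> a" using Ord_linear a b by blast
  then show thesis by cases (use a b that V_up in blast)+
qed

lemma V_lim_upair: assumes "Lim l" "x \<epsilon> V l" "y \<epsilon> V l" shows "upair x y \<epsilon> V l"
proof -
  obtain a where "a \<epsilon> l" "Ord a" "x \<epsilon> V a" "y \<epsilon> V a" by (rule V_limE2[OF assms])
  then have "a \<epsilon> l" "upair x y \<sqsubseteq> V a" by (auto simp: subset_of_def)
  then show ?thesis using mem_V by blast
qed

lemma V_lim_pair [intro]: "Lim l \<Longrightarrow> x \<epsilon> V l \<Longrightarrow> y \<epsilon> V l \<Longrightarrow> pair x y \<epsilon> V l"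
  unfolding pair_def by (intro V_lim_upair)

lemma V_lim_Pow: assumes "Lim l" "x \<epsilon> V l" shows "Pow x \<epsilon> V l"
proof -
  obtain a where a: "a \<epsilon> l" "Ord a" "x \<epsilon> V a" by (rule V_limE[OF assms])
  then have "Pow x \<sqsubseteq> V a" using V_sub by (auto simp: subset_of_def)
  then show ?thesis using a mem_V by blast
qed

lemma pair_parts: "pair x y \<epsilon> V a \<Longrightarrow> Ord a \<Longrightarrow> x \<epsilon> V a \<and> y \<epsilon> V a"
  by (metis V_trD mem_upair pair_def)

lemma pi_V [intro]: "Ord a \<Longrightarrow> x \<epsilon> V a \<Longrightarrow> pi1 x \<epsilon> V a" "Ord a \<Longrightarrow> x \<epsilon> V a \<Longrightarrow> pi2 x \<epsilon> V a"
  by (metis pair_parts pi_nonpair(1) pi_pair(1), metis pair_parts pi_nonpair(2) pi_pair(2))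

section \<open>Cartesian products and function sets\<close>

definition Prod :: "'v \<Rightarrow> 'v \<Rightarrow> 'v" where "Prod A B = Uni (Im A (\<lambda>x. Im B (\<lambda>y. pair x y)))"

lemma mem_Prod [simp]: "p \<epsilon> Prod A B \<longleftrightarrow> (\<exists>x y. x \<epsilon> A \<and> y \<epsilon> B \<and> p = pair x y)"
  unfolding Prod_def by auto

lemma TM_Prod [simp]: "TM t \<Longrightarrow> TM r \<Longrightarrow> TM (\<lambda>e. Prod (t e) (r e))"
  by (rule TM_app2[where F=Prod]) (unfold Prod_def, simp_all)

definition Funs :: "'v \<Rightarrow> 'v \<Rightarrow> 'v" where "Funs A B = Sep (Pow (Prod A B)) (\<lambda>f. function_to mem f A B)"

lemma mem_Funs [simp]: "f \<epsilon> Funs A B \<longleftrightarrow> function_to mem f A B"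
  unfolding Funs_def by (auto simp: subset_of_def fn_to fn_mem)

lemma TM_Funs [simp]: "TM t \<Longrightarrow> TM r \<Longrightarrow> TM (\<lambda>e. Funs (t e) (r e))"
  by (rule TM_app2[where F=Funs]) (unfold Funs_def, simp_all)

lemma V_lim_Funs: assumes "Lim l" "function_to mem f A B" "A \<epsilon> V l" "B \<epsilon> V l" shows "f \<epsilon> V l"
proof -
  obtain a where a: "a \<epsilon> l" "Ord a" "A \<epsilon> V a" "B \<epsilon> V a" by (rule V_limE2[OF assms(1,3,4)])
  have o: "Ord (succ (succ a))" using a Ord_succ by blast
  have "f \<sqsubseteq> V (succ (succ a))"
  proof (rule subI)
    fix p assume "p \<epsilon> f"
    then obtain x where "x \<epsilon> A" "p = pair x (app f x)" "app f x \<epsilon> B" using assms(2) by (auto simp: fn_to fn_mem)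
    then show "p \<epsilon> V (succ (succ a))" using a V_trD
      by (auto simp: V_succ Ord_succ pair_def subset_of_def)
  qed
  then show ?thesis using a Lim_succ assms(1) mem_V by blast
qed

subsection \<open>Choice and collection\<close>

lemma choice_fn: assumes "\<And>x. x \<epsilon> A \<Longrightarrow> x \<noteq> emp"
  obtains f where "function_on mem f A" "\<And>x. x \<epsilon> A \<Longrightarrow> app f x \<epsilon> x"
proof -
  \<comment> \<open>Tagging the elements of \<open>x\<close> with \<open>x\<close> makes the family
    disjoint, as the selector form of Choice requires.\<close>
  let ?B = "Im A (\<lambda>x. Im x (\<lambda>y. pair x y))"
  have "\<exists>c. \<forall>x. x \<epsilon> ?B \<longrightarrow> (\<exists>!w. w \<epsilon> x \<and> w \<epsilon> c)"
  proof (rule ax_choice, intro conjI allI impI)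
    fix x assume "x \<epsilon> ?B"
    then obtain a where "a \<epsilon> A" "x = Im a (\<lambda>y. pair a y)" by auto
    moreover obtain y where "y \<epsilon> a" using assms nonempty \<open>a \<epsilon> A\<close> by blast
    ultimately have "pair a y \<epsilon> x" by simp
    then show "\<not> is_empty mem x" by auto
  qed auto
  then obtain c where c: "\<forall>x. x \<epsilon> ?B \<longrightarrow> (\<exists>!w. w \<epsilon> x \<and> w \<epsilon> c)" by blast
  let ?F = "\<lambda>x. theD emp (\<lambda>y. y \<epsilon> x \<and> pair x y \<epsilon> c)"
  have "?F x \<epsilon> x" if "x \<epsilon> A" for x
  proof -
    have "Im x (\<lambda>y. pair x y) \<epsilon> ?B" using that by auto
    then have "\<exists>!w. w \<epsilon> Im x (\<lambda>y. pair x y) \<and> w \<epsilon> c" using c by blast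
    then obtain w where w: "w \<epsilon> Im x (\<lambda>y. pair x y)" "w \<epsilon> c"
      "\<And>v. v \<epsilon> Im x (\<lambda>y. pair x y) \<Longrightarrow> v \<epsilon> c \<Longrightarrow> v = w" by (elim ex1E conjE) blast
    obtain y where y: "w = pair x y" "y \<epsilon> x" using w(1) by auto
    have "?F x = y"
    proof (rule theD_eq)
      fix z assume "z \<epsilon> x \<and> pair x z \<epsilon> c"
      then have "pair x z = w" by (intro w(3)) auto
      then show "z = y" using y by simp
    qed (use w y in auto)
    then show ?thesis using y by simp
  qed
  then show thesis using that[of "lam A ?F"] by simp
qed

text \<open>Scott's trick: the least \<open>a\<close> such that \<open>V a\<close> contains a
  witness is unique, so Replacement applies to the levels although it does not apply to the
  witnesses.\<close>

lemma collection:
  assumes "DP (\<lambda>e. P (e 0) (e 1))" "\<And>x. x \<epsilon> A \<Longrightarrow> \<exists>y. P x y"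
  obtains B where "\<And>x. x \<epsilon> A \<Longrightarrow> \<exists>y. y \<epsilon> B \<and> P x y"
proof -
  have [simp]: "TM t \<Longrightarrow> TM r \<Longrightarrow> DP (\<lambda>e. P (t e) (r e))" for t r by (rule DP_app2[OF assms(1)])
  define Q where "Q x a \<longleftrightarrow> Ord a \<and> (\<exists>y. y \<epsilon> V a \<and> P x y) \<and> (\<forall>b. b \<epsilon> a \<longrightarrow> \<not> (\<exists>y. y \<epsilon> V b \<and> P x y))" for x a
  have [simp]: "TM t \<Longrightarrow> TM r \<Longrightarrow> DP (\<lambda>e. Q (t e) (r e))" for t r unfolding Q_def
    by (rule DP_app2[where P="\<lambda>x a. Ord a \<and> (\<exists>y. y \<epsilon> V a \<and> P x y) \<and> (\<forall>b. b \<epsilon> a \<longrightarrow> \<not> (\<exists>y. y \<epsilon> V b \<and> P x y))"]) simp_all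
  let ?B = "Uni (Im A (\<lambda>x. V (theD emp (Q x))))"
  have "\<exists>y. y \<epsilon> ?B \<and> P x y" if x: "x \<epsilon> A" for x
  proof -
    obtain y where "P x y" using assms(2) x by blast
    then obtain a0 where "Ord a0" "\<exists>y. y \<epsilon> V a0 \<and> P x y" using in_V_ex by blast
    then obtain a where a: "Ord a" "\<exists>y. y \<epsilon> V a \<and> P x y" "\<And>b. b \<epsilon> a \<Longrightarrow> \<not> (\<exists>y. y \<epsilon> V b \<and> P x y)"
      by (rule Ord_least[of "\<lambda>a. \<exists>y. y \<epsilon> V a \<and> P x y", rotated]) simp_all
    have "theD emp (Q x) = a"
    proof (rule theD_eq)
      show "Q x a" unfolding Q_def using a by blast
      show "z = a" if "Q x z" for z using Ord_linear[of z a] that a unfolding Q_def by blast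
    qed
    then show ?thesis using a(2) x by auto
  qed
  then show thesis using that by blast
qed

lemma choice:
  assumes "DP (\<lambda>e. P (e 0) (e 1))" "\<And>x. x \<epsilon> A \<Longrightarrow> \<exists>y. P x y"
  obtains f where "function_on mem f A" "\<And>x. x \<epsilon> A \<Longrightarrow> P x (app f x)"
proof -
  have [simp]: "TM t \<Longrightarrow> TM r \<Longrightarrow> DP (\<lambda>e. P (t e) (r e))" for t r by (rule DP_app2[OF assms(1)])
  obtain B where B: "\<And>x. x \<epsilon> A \<Longrightarrow> \<exists>y. y \<epsilon> B \<and> P x y" using collection[OF assms] by blast
  let ?S = "\<lambda>x. Sep B (P x)"
  obtain g where g: "function_on mem g (Im A ?S)" "\<And>s. s \<epsilon> Im A ?S \<Longrightarrow> app g s \<epsilon> s"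
  proof (rule choice_fn[of "Im A ?S"])
    fix s assume "s \<epsilon> Im A ?S"
    then obtain x where x: "x \<epsilon> A" "s = ?S x" by auto
    then obtain y where "y \<epsilon> s" using B by auto
    then show "s \<noteq> emp" by auto
  qed blast
  have "P x (app (lam A (\<lambda>x. app g (?S x))) x)" if "x \<epsilon> A" for x
  proof -
    have "app g (?S x) \<epsilon> ?S x" by (rule g(2)) (use that in auto)
    then show ?thesis using that by simp
  qed
  then show thesis using that[of "lam A (\<lambda>x. app g (?S x))"] by simp
qed

subsection \<open>Cardinals\<close>

definition injf :: "'v \<Rightarrow> 'v \<Rightarrow> 'v \<Rightarrow> bool" where
  "injf f A B \<longleftrightarrow> function_to mem f A B \<and> (\<forall>x y. x \<epsilon> A \<and> y \<epsilon> A \<and> app f x = app f y \<longrightarrow> x = y)"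

lemma DP_injf [simp]: "TM t \<Longrightarrow> TM r \<Longrightarrow> TM q \<Longrightarrow> DP (\<lambda>e. injf (t e) (r e) (q e))"
  by (rule DP_app3[where P=injf]) (unfold injf_def, simp_all)

text \<open>The order of \<open>c\<close> copied along \<open>f\<close>. It is taken reflexive so
  that the diagonal records the range of \<open>f\<close>, also when \<open>c\<close> has one
  element.\<close>

definition ordrel :: "'v \<Rightarrow> 'v \<Rightarrow> 'v" where
  "ordrel f c = Im (Sep (Prod c c) (\<lambda>p. pi1 p \<epsilon> pi2 p \<or> pi1 p = pi2 p)) (\<lambda>p. pair (app f (pi1 p)) (app f (pi2 p)))"

lemma mem_ordrel: "q \<epsilon> ordrel f c \<longleftrightarrow> (\<exists>x y. x \<epsilon> c \<and> y \<epsilon> c \<and> (x \<epsilon> y \<or> x = y) \<and> q = pair (app f x) (app f y))"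
  unfolding ordrel_def by fastforce

lemma TM_ordrel [simp]: "TM t \<Longrightarrow> TM r \<Longrightarrow> TM (\<lambda>e. ordrel (t e) (r e))"
  by (rule TM_app2[where F=ordrel]) (unfold ordrel_def, simp_all)

text \<open>If \<open>c\<close> were below \<open>d\<close>, both injections would list the same
  order and agree on \<open>c\<close> by induction. Then the value of \<open>g\<close> at
  \<open>c\<close>, being a value of \<open>f\<close>, would repeat an earlier value of
  \<open>g\<close>.\<close>

lemma ordrel_less:
  assumes c: "Ord c" "injf f c A" and d: "Ord d" "injf g d A" and e: "ordrel f c = ordrel g d"
  shows "\<not> c \<epsilon> d"
proof
  assume cd: "c \<epsilon> d"
  have rng: "\<exists>y. y \<epsilon> d \<and> app f x = app g y" if "x \<epsilon> c" for x
  proof -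
    have "pair (app f x) (app f x) \<epsilon> ordrel f c" using that mem_ordrel by blast
    then show ?thesis unfolding e mem_ordrel by auto
  qed
  have rng': "\<exists>y. y \<epsilon> c \<and> app g x = app f y" if "x \<epsilon> d" for x
  proof -
    have "pair (app g x) (app g x) \<epsilon> ordrel f c" unfolding e mem_ordrel using that by blast
    then show ?thesis unfolding mem_ordrel by auto
  qed
  have fi: "x \<epsilon> c \<Longrightarrow> y \<epsilon> c \<Longrightarrow> app f x = app f y \<Longrightarrow> x = y" for x y using c(2) unfolding injf_def by blast
  have gi: "x \<epsilon> d \<Longrightarrow> y \<epsilon> d \<Longrightarrow> app g x = app g y \<Longrightarrow> x = y" for x y using d(2) unfolding injf_def by blast
  have eq: "x \<epsilon> c \<longrightarrow> app f x = app g x" for x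
  proof (induction x rule: mem_induct)
    case (step x)
    show ?case
    proof
      assume x: "x \<epsilon> c"
      then have xd: "x \<epsilon> d" using cd Ord_trans d(1) by blast
      obtain z where z: "z \<epsilon> d" "app f x = app g z" using rng[OF x] by blast
      have "\<not> z \<epsilon> x"
      proof
        assume zx: "z \<epsilon> x"
        then have zc: "z \<epsilon> c" using x Ord_trans c(1) by blast
        then have "app f z = app f x" using step[OF zx] z by simp
        then have "z = x" using fi zc x by blast
        then show False using zx by simp
      qed
      moreover have "\<not> x \<epsilon> z"
      proof
        assume xz: "x \<epsilon> z"
        then have "pair (app g x) (app f x) \<epsilon> ordrel f c" unfolding e mem_ordrel using xd z by auto
        then obtain u v where u: "u \<epsilon> c" "v \<epsilon> c" "u \<epsilon> v \<or> u = v" "app g x = app f u" "app f x = app f v"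
          unfolding mem_ordrel by auto
        have "v = x" using fi u x by metis
        show False
        proof (cases "u = v")
          case True
          then have "app g x = app g z" using u z by simp
          then show False using gi xd z xz by (metis mem_irrefl)
        next
          case False
          then have ux: "u \<epsilon> x" using u \<open>v = x\<close> by blast
          then have "app g u = app g x" using step[OF ux] u by simp
          then have "u = x" using gi xd u(1) cd Ord_trans d(1) by blast
          then show False using ux by simp
        qed
      qed
      ultimately have "z = x" using Ord_linear[of z x] Ord_in d(1) z xd by blast
      then show "app f x = app g x" using z by simp
    qed
  qed simp
  obtain y where "y \<epsilon> c" "app g c = app f y" using rng'[OF cd] by blast
  then have "app g c = app g y" "y \<epsilon> d" using eq cd Ord_trans d(1) by auto
  then show False using gi cd \<open>y \<epsilon> c\<close> by (metis mem_irrefl)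
qed

text \<open>Hartogs: the ordinals that inject into \<open>a\<close> form a set \<open>H\<close>,
  since each of them is determined by a copied order in \<open>Pow (Prod a a)\<close>. A bijection
  onto \<open>H\<close> from a smaller ordinal would make \<open>H\<close> inject into
  \<open>a\<close> and hence belong to itself.\<close>

lemma cardinal_ex: assumes a: "Ord a" shows "\<exists>k. cardinal mem k \<and> a \<epsilon> k"
proof -
  let ?Q = "\<lambda>r c. Ord c \<and> (\<exists>f. injf f c a \<and> r = ordrel f c)"
  let ?T = "\<lambda>r. theD emp (?Q r)"
  define H where "H = Sep (Im (Pow (Prod a a)) ?T) (\<lambda>c. Ord c \<and> (\<exists>f. injf f c a))"
  have H: "c \<epsilon> H \<longleftrightarrow> Ord c \<and> (\<exists>f. injf f c a)" for c
  proof
    assume "Ord c \<and> (\<exists>f. injf f c a)"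
    then obtain f where f: "Ord c" "injf f c a" by blast
    have "?T (ordrel f c) = c"
    proof (rule theD_eq)
      fix z assume "?Q (ordrel f c) z"
      then obtain g where g: "Ord z" "injf g z a" "ordrel f c = ordrel g z" by blast
      show "z = c" using Ord_linear[OF f(1) g(1)] ordrel_less[OF f g] ordrel_less[OF g(1,2) f g(3)[symmetric]] by blast
    qed (use f in blast)
    moreover have "ordrel f c \<sqsubseteq> Prod a a"
      by (rule subI) (use f in \<open>auto simp: mem_ordrel injf_def fn_to\<close>)
    ultimately show "c \<epsilon> H" unfolding H_def using f by auto
  qed (simp add: H_def)
  have OH: "Ord H" unfolding Ord_iff
  proof (intro conjI allI impI)
    fix x assume "x \<epsilon> H"
    then obtain f where f: "Ord x" "injf f x a" using H by blast
    show "x \<sqsubseteq> H"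
    proof (rule subI)
      fix y assume y: "y \<epsilon> x"
      then have "y \<sqsubseteq> x" using f Ord_sub by blast
      then have "injf (lam y (app f)) y a" using f(2) subD[of y x] unfolding injf_def fn_to by auto
      then show "y \<epsilon> H" using H Ord_in f y by blast
    qed
  qed (use H Ord_linear in blast)
  have "injf (lam a (\<lambda>x. x)) a a" unfolding injf_def by auto
  then have "a \<epsilon> H" using H a by blast
  moreover have "cardinal mem H" unfolding cardinal_def
  proof (intro conjI notI)
    assume "\<exists>b f. b \<epsilon> H \<and> bijection mem f b H"
    then obtain b f where b: "b \<epsilon> H" "bijection mem f b H" by blast
    then obtain g where g: "injf g b a" using H by blast
    let ?i = "\<lambda>y. theD emp (\<lambda>x. pair x y \<epsilon> f)"
    have fb: "function_on mem f b" using b(2) unfolding bijection_def function_to_def by blast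
    have i: "?i y \<epsilon> b \<and> app f (?i y) = y" if y: "y \<epsilon> H" for y
    proof -
      have "\<exists>!x. rel mem f x y" using b(2) y unfolding bijection_def by blast
      then obtain x where x: "pair x y \<epsilon> f" "\<And>z. pair z y \<epsilon> f \<Longrightarrow> z = x" unfolding rel_iff by blast
      then have "?i y = x" by (rule theD_eq)
      then show ?thesis using x(1) fn_pair[OF fb] by auto
    qed
    have "injf (lam H (\<lambda>y. app g (?i y))) H a"
      unfolding injf_def
    proof (intro conjI allI impI)
      show "function_to mem (lam H (\<lambda>y. app g (?i y))) H a" using i g by (auto simp: injf_def fn_to)
      fix x y assume "x \<epsilon> H \<and> y \<epsilon> H \<and> app (lam H (\<lambda>y. app g (?i y))) x = app (lam H (\<lambda>y. app g (?i y))) y"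
      then have "x \<epsilon> H" "y \<epsilon> H" "app g (?i x) = app g (?i y)" by auto
      then show "x = y" using i g unfolding injf_def by metis
    qed
    then have "H \<epsilon> H" using H OH by blast
    then show False by simp
  qed (rule OH)
  ultimately show ?thesis by blast
qed

section \<open>Bounded formulas\<close>

abbreviation D0 where "D0 \<equiv> df delta0_fm"

text \<open>Bounded terms are defined by their purpose: substituting them keeps predicates bounded.
  A bounded graph is too weak for that, because eliminating the term needs a quantifier over its
  value, which must have a bound. The renaming \<open>r\<close> is built in to obtain
  \<open>T0_ren\<close>.\<close>

definition T0 :: "(nat \<Rightarrow> 'v) \<Rightarrow> ((nat \<Rightarrow> 'v) \<Rightarrow> 'v) \<Rightarrow> bool" where
  "T0 K t \<longleftrightarrow> (\<forall>Q r. D0 K Q \<longrightarrow> D0 K (\<lambda>e. Q (case_nat (t (\<lambda>n. e (r n))) e)))"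

lemma D0_ren: "D0 K P \<Longrightarrow> D0 K (\<lambda>e. P (\<lambda>n. e (r n)))"
  by (rule df_ren) simp_all

lemma D0_eqI: "D0 K P \<Longrightarrow> (\<And>e. P e \<longleftrightarrow> Q e) \<Longrightarrow> D0 K Q"
  by (subgoal_tac "P = Q") auto

lemma T0_var: "T0 K (\<lambda>e. e i)"
  unfolding T0_def
proof (intro allI impI)
  fix Q and r :: "nat \<Rightarrow> nat" assume "D0 K Q"
  from D0_ren[OF this, of "case_nat (r i) (\<lambda>n. n)"]
  show "D0 K (\<lambda>e. Q (case_nat (e (r i)) e))"
    by (rule D0_eqI) (auto intro!: arg_cong[where f=Q] split: nat.splits)
qed

lemma T0_const: "c \<in> range K \<Longrightarrow> T0 K (\<lambda>e. c)"
  unfolding T0_def using df_const[OF rcl(1)] by blast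

lemma T0_ren: "T0 K t \<Longrightarrow> T0 K (\<lambda>e. t (\<lambda>n. e (r n)))"
  unfolding T0_def
proof (intro allI impI)
  fix Q and q :: "nat \<Rightarrow> nat"
  assume "\<forall>Q r. D0 K Q \<longrightarrow> D0 K (\<lambda>e. Q (case_nat (t (\<lambda>n. e (r n))) e))" "D0 K Q"
  then show "D0 K (\<lambda>e. Q (case_nat (t (\<lambda>n. e (q (r n)))) e))" by (drule_tac spec[of _ Q], drule_tac spec[of _ "\<lambda>n. q (r n)"]) simp
qed

lemma T0_app: "T0 K t \<Longrightarrow> D0 K Q \<Longrightarrow> D0 K (\<lambda>e. Q (case_nat (t e) e))"
  unfolding T0_def by (drule spec[of _ Q], drule spec[of _ "\<lambda>n. n"]) simp

lemma D0_app1: "D0 K (\<lambda>e. P (e 0)) \<Longrightarrow> T0 K t \<Longrightarrow> D0 K (\<lambda>e. P (t e))"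
  using T0_app[of K t "\<lambda>e. P (e 0)"] by simp

lemma D0_app2: assumes "D0 K (\<lambda>e. P (e 0) (e 1))" "T0 K t" "T0 K r" shows "D0 K (\<lambda>e. P (t e) (r e))"
proof -
  have "D0 K (\<lambda>e. P (e 1) (e 0))" using D0_ren[OF assms(1), of "\<lambda>n. if n = 0 then 1 else 0"] by simp
  from T0_app[OF T0_ren[OF assms(3), of Suc] this] have "D0 K (\<lambda>e. P (e 0) (r (\<lambda>n. e (Suc n))))" by simp
  from T0_app[OF assms(2) this] show ?thesis by simp
qed

lemma D0_app3: assumes "D0 K (\<lambda>e. P (e 0) (e 1) (e 2))" "T0 K t" "T0 K r" "T0 K q"
  shows "D0 K (\<lambda>e. P (t e) (r e) (q e))"
proof -
  have "D0 K (\<lambda>e. P (e 1) (e 2) (e 0))"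
    using D0_ren[OF assms(1), of "\<lambda>n. if n = 0 then 1 else if n = 1 then 2 else 0"] by simp
  from T0_app[OF T0_ren[OF assms(4), of "\<lambda>n. Suc (Suc n)"] this]
  have "D0 K (\<lambda>e. P (e 0) (e 1) (q (\<lambda>n. e (Suc (Suc n)))))" by (simp add: numeral_2_eq_2)
  then have "D0 K (\<lambda>e. (\<lambda>x y. P x (e 0) (q y)) (e 1) (\<lambda>n. e (Suc (Suc n))))"
    using D0_ren[of K "\<lambda>e. P (e 0) (e 1) (q (\<lambda>n. e (Suc (Suc n))))" "\<lambda>n. if n = 0 then 1 else if n = 1 then 0 else n"]
    by simp
  from T0_app[OF T0_ren[OF assms(3), of Suc] this]
  have "D0 K (\<lambda>e. P (e 0) (r (\<lambda>n. e (Suc n))) (q (\<lambda>n. e (Suc n))))" by simp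
  from T0_app[OF assms(2) this] show ?thesis by simp
qed

lemma D0_app4: assumes "D0 K (\<lambda>e. P (e 0) (e 1) (e 2) (e 3))" "T0 K t" "T0 K r" "T0 K q" "T0 K p"
  shows "D0 K (\<lambda>e. P (t e) (r e) (q e) (p e))"
proof -
  have a: "D0 K (\<lambda>e. (\<lambda>v. P (e 1) (e 2) (e 3) v) (e 0))"
    using D0_ren[OF assms(1), of "\<lambda>n. if n = 0 then 1 else if n = 1 then 2 else if n = 2 then 3 else 0"] by simp
  from T0_app[OF T0_ren[OF assms(5), of "\<lambda>n. Suc (Suc (Suc n))"] a]
  have "D0 K (\<lambda>e. P (e 0) (e 1) (e 2) (p (\<lambda>n. e (Suc (Suc (Suc n))))))"
    by (simp add: numeral_2_eq_2 numeral_3_eq_3)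
  from D0_ren[OF this, of "\<lambda>n. if n = 0 then 1 else if n = 1 then 2 else if n = 2 then 0 else n"]
  have "D0 K (\<lambda>e. P (e 1) (e 2) (e 0) (p (\<lambda>n. e (Suc (Suc (Suc n))))))" by simp
  from T0_app[OF T0_ren[OF assms(4), of "\<lambda>n. Suc (Suc n)"] this]
  have "D0 K (\<lambda>e. P (e 0) (e 1) (q (\<lambda>n. e (Suc (Suc n)))) (p (\<lambda>n. e (Suc (Suc n)))))"
    by (simp add: numeral_2_eq_2)
  from D0_ren[OF this, of "\<lambda>n. if n = 0 then 1 else if n = 1 then 0 else n"]
  have "D0 K (\<lambda>e. P (e 1) (e 0) (q (\<lambda>n. e (Suc (Suc n)))) (p (\<lambda>n. e (Suc (Suc n)))))" by simp
  from T0_app[OF T0_ren[OF assms(3), of Suc] this]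
  have "D0 K (\<lambda>e. P (e 0) (r (\<lambda>n. e (Suc n))) (q (\<lambda>n. e (Suc n))) (p (\<lambda>n. e (Suc n))))" by simp
  from T0_app[OF assms(2) this] show ?thesis by simp
qed

lemma D0_not: "D0 K P \<Longrightarrow> D0 K (\<lambda>e. \<not> P e)"
  by (rule df_not) (auto intro: delta0_fm.intros)

lemma D0_conj: "D0 K P \<Longrightarrow> D0 K Q \<Longrightarrow> D0 K (\<lambda>e. P e \<and> Q e)"
  by (rule df_conj) (auto intro: delta0_fm.intros)

lemma D0_disj: "D0 K P \<Longrightarrow> D0 K Q \<Longrightarrow> D0 K (\<lambda>e. P e \<or> Q e)"
  using D0_not[OF D0_conj[OF D0_not D0_not]] by simp

lemma D0_imp: "D0 K P \<Longrightarrow> D0 K Q \<Longrightarrow> D0 K (\<lambda>e. P e \<longrightarrow> Q e)"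
  using D0_disj[OF D0_not] by (rule D0_eqI) auto

lemma D0_iff: "D0 K P \<Longrightarrow> D0 K Q \<Longrightarrow> D0 K (\<lambda>e. P e \<longleftrightarrow> Q e)"
  using D0_conj[OF D0_imp D0_imp, of K P Q Q P] by (rule D0_eqI) auto

lemma D0_bconst: "D0 K (\<lambda>e. b)"
proof (cases b)
  case True
  show ?thesis by (rule D0_eqI[OF df_eq_var[of K 0 0]]) (use True in simp)
next
  case False
  show ?thesis by (rule D0_eqI[OF D0_not[OF df_eq_var[of K 0 0]]]) (use False in simp)
qed

lemma D0_if: "D0 K P \<Longrightarrow> D0 K Q \<Longrightarrow> D0 K (\<lambda>e. if b then P e else Q e)"
  by (cases b) auto

lemma D0_bex: assumes "T0 K t" "D0 K (\<lambda>e. P (\<lambda>n. e (Suc n)) (e 0))"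
  shows "D0 K (\<lambda>e. \<exists>y. y \<epsilon> t e \<and> P e y)"
proof -
  define R where "R e \<longleftrightarrow> P (\<lambda>n. e (Suc (Suc n))) (e 0)" for e
  have R: "D0 K R" unfolding R_def
    using D0_ren[OF assms(2), of "\<lambda>n. case n of 0 \<Rightarrow> 0 | Suc k \<Rightarrow> Suc (Suc k)"] by simp
  obtain p where p: "delta0_fm p" "okf p" "\<And>e u y. R (case_nat y e) \<longleftrightarrow> sat UNIV mem p ((mix e K u)(2 := y))"
    by (rule df_bind[OF rcl(1) R]) blast
  have "D0 K (\<lambda>e. \<exists>y. y \<epsilon> e 0 \<and> P (\<lambda>n. e (Suc n)) y)"
    unfolding df_def
  proof (intro exI[of _ "Exists 2 (Conj (Mem 2 0) p)"] conjI allI)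
    fix e u
    have "P (\<lambda>n. e (Suc n)) y \<longleftrightarrow> sat UNIV mem p ((mix e K u)(2 := y))" for y
      using p(3)[of y e u] unfolding R_def by simp
    then show "(\<exists>y. y \<epsilon> e 0 \<and> P (\<lambda>n. e (Suc n)) y) \<longleftrightarrow> sat UNIV mem (Exists 2 (Conj (Mem 2 0) p)) (mix e K u)"
      by simp
  qed (use p in \<open>auto simp: okf_def intro: delta0_fm.intros\<close>)
  from T0_app[OF assms(1) this] show ?thesis by simp
qed

lemma D0_ball: assumes "T0 K t" "D0 K (\<lambda>e. P (\<lambda>n. e (Suc n)) (e 0))"
  shows "D0 K (\<lambda>e. \<forall>y. y \<epsilon> t e \<longrightarrow> P e y)"
  using D0_not[OF D0_bex[OF assms(1) D0_not[OF assms(2)]]] by (rule D0_eqI) auto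

lemma D0_mem: "T0 K t \<Longrightarrow> T0 K r \<Longrightarrow> D0 K (\<lambda>e. t e \<epsilon> r e)"
  by (rule D0_app2[where P="\<lambda>x y. x \<epsilon> y"]) (rule df_mem_var)
lemma D0_eq: "T0 K t \<Longrightarrow> T0 K r \<Longrightarrow> D0 K (\<lambda>e. t e = r e)"
  by (rule D0_app2[where P="\<lambda>x y. x = y"]) (rule df_eq_var)

lemma D0_allfin: "(\<And>i. i < (n::nat) \<Longrightarrow> D0 K (\<lambda>e. P i e)) \<Longrightarrow> D0 K (\<lambda>e. \<forall>i<n. P i e)"
proof (induction n)
  case (Suc n)
  have "D0 K (\<lambda>e. (\<forall>i<n. P i e) \<and> P n e)" using Suc by (intro D0_conj) auto
  then show ?case by (rule D0_eqI) (auto simp: less_Suc_eq)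
qed (simp add: D0_bconst)

lemma D0_exfin: "(\<And>i. i < (n::nat) \<Longrightarrow> D0 K (\<lambda>e. P i e)) \<Longrightarrow> D0 K (\<lambda>e. \<exists>i<n. P i e)"
proof (induction n)
  case (Suc n)
  have "D0 K (\<lambda>e. (\<exists>i<n. P i e) \<or> P n e)" using Suc by (intro D0_disj) auto
  then show ?case by (rule D0_eqI) (auto simp: less_Suc_eq)
qed (simp add: D0_bconst)

lemmas d0a = T0_var D0_bex D0_ball D0_not D0_conj D0_disj D0_imp D0_iff

lemma D0_sub: "T0 K t \<Longrightarrow> T0 K r \<Longrightarrow> D0 K (\<lambda>e. t e \<sqsubseteq> r e)"
  by (rule D0_app2[where P="\<lambda>x y. x \<sqsubseteq> y"]) (unfold subset_of_def, (rule d0a D0_mem)+)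

lemma eq_emp_iff: "x = emp \<longleftrightarrow> (\<forall>y. y \<epsilon> x \<longrightarrow> False)"
  using nonempty by auto

lemma D0_emp: "T0 K t \<Longrightarrow> D0 K (\<lambda>e. t e = emp)"
  by (rule D0_app1[where P="\<lambda>x. x = emp"]) (unfold eq_emp_iff, (rule d0a D0_bconst)+)

lemma eq_upair_iff: "u = upair y z \<longleftrightarrow> y \<epsilon> u \<and> z \<epsilon> u \<and> (\<forall>w. w \<epsilon> u \<longrightarrow> w = y \<or> w = z)"
  by (auto intro: ext)

lemma D0_upair: "T0 K t \<Longrightarrow> T0 K r \<Longrightarrow> T0 K q \<Longrightarrow> D0 K (\<lambda>e. t e = upair (r e) (q e))"
  by (rule D0_app3[where P="\<lambda>u y z. u = upair y z"]) (unfold eq_upair_iff, (rule d0a D0_mem D0_eq)+)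

lemma eq_pair_iff: "p = pair y z \<longleftrightarrow> (\<exists>u. u \<epsilon> p \<and> u = upair y y) \<and> (\<exists>u. u \<epsilon> p \<and> u = upair y z) \<and>
    (\<forall>u. u \<epsilon> p \<longrightarrow> u = upair y y \<or> u = upair y z)"
  by (auto simp: pair_def intro: ext)

lemma D0_pair: "T0 K t \<Longrightarrow> T0 K r \<Longrightarrow> T0 K q \<Longrightarrow> D0 K (\<lambda>e. t e = pair (r e) (q e))"
  by (rule D0_app3[where P="\<lambda>u y z. u = pair y z"]) (unfold eq_pair_iff, (rule d0a D0_upair)+)

lemma eq_succ_iff: "u = succ y \<longleftrightarrow> y \<epsilon> u \<and> (\<forall>w. w \<epsilon> u \<longrightarrow> w \<epsilon> y \<or> w = y) \<and> (\<forall>w. w \<epsilon> y \<longrightarrow> w \<epsilon> u)"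
  using ext[of u "succ y"] by auto

lemma D0_succ: "T0 K t \<Longrightarrow> T0 K r \<Longrightarrow> D0 K (\<lambda>e. t e = succ (r e))"
  by (rule D0_app2[where P="\<lambda>u y. u = succ y"]) (unfold eq_succ_iff, (rule d0a D0_mem D0_eq)+)

lemma succ_mem_iff: "succ y \<epsilon> u \<longleftrightarrow> (\<exists>w. w \<epsilon> u \<and> w = succ y)" by auto

lemma D0_succ_mem: "T0 K t \<Longrightarrow> T0 K r \<Longrightarrow> D0 K (\<lambda>e. succ (r e) \<epsilon> t e)"
  by (rule D0_app2[where P="\<lambda>u y. succ y \<epsilon> u"]) (unfold succ_mem_iff, (rule d0a D0_succ)+)

lemma pair_mem_iff: "pair y z \<epsilon> u \<longleftrightarrow> (\<exists>w. w \<epsilon> u \<and> w = pair y z)" by auto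

lemma D0_pair_mem: "T0 K t \<Longrightarrow> T0 K r \<Longrightarrow> T0 K q \<Longrightarrow> D0 K (\<lambda>e. pair (r e) (q e) \<epsilon> t e)"
  by (rule D0_app3[where P="\<lambda>u y z. pair y z \<epsilon> u"]) (unfold pair_mem_iff, (rule d0a D0_pair)+)

lemma T0I:
  assumes "\<And>Q. D0 K Q \<Longrightarrow> D0 K (\<lambda>e. Q (case_nat (F (e 0)) (\<lambda>n. e (Suc n))))" "T0 K t"
  shows "T0 K (\<lambda>e. F (t e))"
  unfolding T0_def
proof (intro allI impI)
  fix Q and r :: "nat \<Rightarrow> nat" assume "D0 K Q"
  from T0_app[OF T0_ren[OF assms(2), of r] assms(1)[OF this]]
  show "D0 K (\<lambda>e. Q (case_nat (F (t (\<lambda>n. e (r n)))) e))" by simp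
qed

lemma pair_ex1: "(\<exists>y. x = pair y z) \<longleftrightarrow> (\<exists>u. u \<epsilon> x \<and> (\<exists>y. y \<epsilon> u \<and> x = pair y z))"
proof
  assume "\<exists>y. x = pair y z"
  then obtain y where "x = pair y z" by blast
  then show "\<exists>u. u \<epsilon> x \<and> (\<exists>y. y \<epsilon> u \<and> x = pair y z)"
    by (intro exI[of _ "sing y"] conjI exI[of _ y]) (auto simp: pair_def)
qed blast

lemma pair_ex2: "(\<exists>z. x = pair y z) \<longleftrightarrow> (\<exists>u. u \<epsilon> x \<and> (\<exists>z. z \<epsilon> u \<and> x = pair y z))"
proof
  assume "\<exists>z. x = pair y z"
  then obtain z where "x = pair y z" by blast
  then show "\<exists>u. u \<epsilon> x \<and> (\<exists>z. z \<epsilon> u \<and> x = pair y z)"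
    by (intro exI[of _ "upair y z"] conjI exI[of _ z]) (auto simp: pair_def)
qed blast

lemma D0_ren_bind: "D0 K Q \<Longrightarrow> D0 K (\<lambda>e. Q (case_nat (e i) (\<lambda>n. e (r n))))"
  using D0_ren[of K Q "case_nat i r"]
  by (rule D0_eqI) (auto intro!: arg_cong[where f=Q] split: nat.splits)

text \<open>The components of a pair are elements of its elements, so bounded quantifiers reach
  them. The second disjunct is the default case of \<open>pi1\<close>.\<close>

lemma pi1_subst: "Q (pi1 x) \<longleftrightarrow>
    (\<exists>u. u \<epsilon> x \<and> (\<exists>y. y \<epsilon> u \<and> (\<exists>v. v \<epsilon> x \<and> (\<exists>z. z \<epsilon> v \<and> x = pair y z)) \<and> Q y)) \<or>
    \<not> (\<exists>u. u \<epsilon> x \<and> (\<exists>y. y \<epsilon> u \<and> (\<exists>v. v \<epsilon> x \<and> (\<exists>z. z \<epsilon> v \<and> x = pair y z)))) \<and> Q x"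
  unfolding pair_ex2[symmetric]
proof (cases "\<exists>y z. x = pair y z")
  case True
  then obtain y z where x: "x = pair y z" by blast
  have "sing y \<epsilon> x" "y \<epsilon> sing y" using x by (auto simp: pair_def)
  then show "Q (pi1 x) \<longleftrightarrow> (\<exists>u. u \<epsilon> x \<and> (\<exists>y. y \<epsilon> u \<and> (\<exists>z. x = pair y z) \<and> Q y)) \<or>
    \<not> (\<exists>u. u \<epsilon> x \<and> (\<exists>y. y \<epsilon> u \<and> (\<exists>z. x = pair y z))) \<and> Q x" using x by (metis pair_eq pi_pair(1))
next
  case False
  then show "Q (pi1 x) \<longleftrightarrow> (\<exists>u. u \<epsilon> x \<and> (\<exists>y. y \<epsilon> u \<and> (\<exists>z. x = pair y z) \<and> Q y)) \<or>
    \<not> (\<exists>u. u \<epsilon> x \<and> (\<exists>y. y \<epsilon> u \<and> (\<exists>z. x = pair y z))) \<and> Q x" by (metis pi_nonpair(1))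
qed

lemma pi2_subst: "Q (pi2 x) \<longleftrightarrow>
    (\<exists>u. u \<epsilon> x \<and> (\<exists>z. z \<epsilon> u \<and> (\<exists>v. v \<epsilon> x \<and> (\<exists>y. y \<epsilon> v \<and> x = pair y z)) \<and> Q z)) \<or>
    \<not> (\<exists>u. u \<epsilon> x \<and> (\<exists>z. z \<epsilon> u \<and> (\<exists>v. v \<epsilon> x \<and> (\<exists>y. y \<epsilon> v \<and> x = pair y z)))) \<and> Q x"
  unfolding pair_ex1[symmetric]
proof (cases "\<exists>y z. x = pair y z")
  case True
  then obtain y z where x: "x = pair y z" by blast
  have "upair y z \<epsilon> x" "z \<epsilon> upair y z" using x by (auto simp: pair_def)
  then show "Q (pi2 x) \<longleftrightarrow> (\<exists>u. u \<epsilon> x \<and> (\<exists>z. z \<epsilon> u \<and> (\<exists>y. x = pair y z) \<and> Q z)) \<or>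
    \<not> (\<exists>u. u \<epsilon> x \<and> (\<exists>z. z \<epsilon> u \<and> (\<exists>y. x = pair y z))) \<and> Q x" using x by (metis pair_eq pi_pair(2))
next
  case False
  then show "Q (pi2 x) \<longleftrightarrow> (\<exists>u. u \<epsilon> x \<and> (\<exists>z. z \<epsilon> u \<and> (\<exists>y. x = pair y z) \<and> Q z)) \<or>
    \<not> (\<exists>u. u \<epsilon> x \<and> (\<exists>z. z \<epsilon> u \<and> (\<exists>y. x = pair y z))) \<and> Q x" by (metis pi_nonpair(2))
qed

lemma T0_pi1: "T0 K t \<Longrightarrow> T0 K (\<lambda>e. pi1 (t e))"
proof (rule T0I[where F=pi1])
  fix Q assume Q: "D0 K Q"
  show "D0 K (\<lambda>e. Q (case_nat (pi1 (e 0)) (\<lambda>n. e (Suc n))))"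
    by (subst pi1_subst) (rule d0a D0_pair D0_ren_bind[OF Q])+
qed

lemma T0_pi2: "T0 K t \<Longrightarrow> T0 K (\<lambda>e. pi2 (t e))"
proof (rule T0I[where F=pi2])
  fix Q assume Q: "D0 K Q"
  show "D0 K (\<lambda>e. Q (case_nat (pi2 (e 0)) (\<lambda>n. e (Suc n))))"
    by (subst pi2_subst) (rule d0a D0_pair D0_ren_bind[OF Q])+
qed

text \<open>The value of \<open>f\<close> at \<open>x\<close> is \<open>y\<close> and not a default.
  Uniqueness is expressed through the elements \<open>p\<close> of \<open>f\<close> and their
  projections, which keeps it bounded.\<close>

definition appr :: "'v \<Rightarrow> 'v \<Rightarrow> 'v \<Rightarrow> bool" where
  "appr f x y \<longleftrightarrow> pair x y \<epsilon> f \<and> (\<forall>p. p \<epsilon> f \<longrightarrow> pi1 p = x \<longrightarrow> p = pair (pi1 p) (pi2 p) \<longrightarrow> pi2 p = y)"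

lemma D0_appr: "T0 K t \<Longrightarrow> T0 K r \<Longrightarrow> T0 K q \<Longrightarrow> D0 K (\<lambda>e. appr (t e) (r e) (q e))"
  by (rule D0_app3[where P=appr]) (unfold appr_def, (rule d0a D0_pair_mem T0_pi1 T0_pi2 D0_pair D0_eq)+)

lemma appr_iff: "appr f x y \<longleftrightarrow> pair x y \<epsilon> f \<and> (\<forall>z. pair x z \<epsilon> f \<longrightarrow> z = y)"
  unfolding appr_def by (metis pi_pair)

lemma app_subst: "Q (app f x) \<longleftrightarrow> (\<exists>p. p \<epsilon> f \<and> appr f x (pi2 p) \<and> Q (pi2 p)) \<or>
    \<not> (\<exists>p. p \<epsilon> f \<and> appr f x (pi2 p)) \<and> Q x"
proof (cases "\<exists>!y. pair x y \<epsilon> f")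
  case True
  then obtain y where y: "pair x y \<epsilon> f" "\<And>z. pair x z \<epsilon> f \<Longrightarrow> z = y" by (elim ex1E) blast
  then have "app f x = y" unfolding app_def by (rule theD_eq)
  moreover have "appr f x z \<longleftrightarrow> z = y" for z using y unfolding appr_iff by metis
  ultimately show ?thesis using y(1) by (metis pi_pair(2))
next
  case False
  then have "app f x = x" unfolding app_def theD_def by simp
  moreover have "\<not> appr f x z" for z using False unfolding appr_iff by blast
  ultimately show ?thesis by simp
qed

lemma T0_appf: assumes "T0 K t" "T0 K r" shows "T0 K (\<lambda>e. app (t e) (r e))"
  unfolding T0_def
proof (intro allI impI)
  fix Q and q :: "nat \<Rightarrow> nat" assume Q: "D0 K Q"
  have 1: "T0 K (\<lambda>e. t (\<lambda>n. e (q n)))" "T0 K (\<lambda>e. r (\<lambda>n. e (q n)))"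
    "T0 K (\<lambda>e. t (\<lambda>n. e (Suc (q n))))" "T0 K (\<lambda>e. r (\<lambda>n. e (Suc (q n))))" using T0_ren[OF assms(1), of q] T0_ren[OF assms(2), of q]
      T0_ren[OF assms(1), of "\<lambda>n. Suc (q n)"] T0_ren[OF assms(2), of "\<lambda>n. Suc (q n)"] by simp_all
  have 2: "D0 K (\<lambda>e. Q (case_nat (pi2 (e 0)) (\<lambda>n. e (Suc n))))"
    using T0_app[OF T0_pi2[OF T0_var[of K 0]] D0_ren_bind[OF Q, of 0 "\<lambda>n. Suc (Suc n)"]] by simp
  have 3: "D0 K (\<lambda>e. Q (case_nat (r (\<lambda>n. e (q n))) e))" using T0_app[OF 1(2) Q] .
  show "D0 K (\<lambda>e. Q (case_nat (app (t (\<lambda>n. e (q n))) (r (\<lambda>n. e (q n)))) e))"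
    by (subst app_subst) (rule D0_bex D0_conj D0_disj D0_not D0_appr T0_pi2 1 2 3 T0_var)+
qed

lemmas t0 = T0_var T0_pi1 T0_pi2 T0_appf
lemmas d0 = t0 D0_bex D0_ball D0_not D0_conj D0_disj D0_imp D0_iff D0_emp D0_upair D0_pair D0_succ D0_succ_mem D0_pair_mem
  D0_sub D0_mem D0_eq

lemma function_on_bd: "function_on mem f a \<longleftrightarrow>
   (\<forall>p. p \<epsilon> f \<longrightarrow> pi1 p \<epsilon> a \<and> p = pair (pi1 p) (pi2 p)) \<and> (\<forall>x. x \<epsilon> a \<longrightarrow> (\<exists>p. p \<epsilon> f \<and> appr f x (pi2 p)))"
proof
  assume f: "function_on mem f a"
  show "(\<forall>p. p \<epsilon> f \<longrightarrow> pi1 p \<epsilon> a \<and> p = pair (pi1 p) (pi2 p)) \<and> (\<forall>x. x \<epsilon> a \<longrightarrow> (\<exists>p. p \<epsilon> f \<and> appr f x (pi2 p)))"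
  proof (intro conjI allI impI)
    fix x assume "x \<epsilon> a"
    then show "\<exists>p. p \<epsilon> f \<and> appr f x (pi2 p)"
      by (intro exI[of _ "pair x (app f x)"]) (auto simp: fn_pair[OF f] appr_iff)
  qed (auto simp: fn_mem[OF f])
next
  assume r: "(\<forall>p. p \<epsilon> f \<longrightarrow> pi1 p \<epsilon> a \<and> p = pair (pi1 p) (pi2 p)) \<and> (\<forall>x. x \<epsilon> a \<longrightarrow> (\<exists>p. p \<epsilon> f \<and> appr f x (pi2 p)))"
  show "function_on mem f a" unfolding function_on_alt
  proof (intro conjI allI impI)
    show "p \<epsilon> f \<Longrightarrow> \<exists>x y. x \<epsilon> a \<and> p = pair x y" for p using r by blast
    show "x \<epsilon> a \<Longrightarrow> \<exists>!y. pair x y \<epsilon> f" for x using r unfolding appr_iff by blast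
  qed
qed

lemma D0_function_on: "T0 K t \<Longrightarrow> T0 K r \<Longrightarrow> D0 K (\<lambda>e. function_on mem (t e) (r e))"
  by (rule D0_app2[where P="function_on mem"]) (unfold function_on_bd, (rule d0 D0_appr)+)

lemma D0_function_to: "T0 K t \<Longrightarrow> T0 K r \<Longrightarrow> T0 K q \<Longrightarrow> D0 K (\<lambda>e. function_to mem (t e) (r e) (q e))"
  by (rule D0_app3[where P="function_to mem"]) (unfold fn_to, (rule d0 D0_function_on)+)

lemma injf_bd: "injf f A B \<longleftrightarrow> function_to mem f A B \<and> (\<forall>x. x \<epsilon> A \<longrightarrow> (\<forall>y. y \<epsilon> A \<longrightarrow> app f x = app f y \<longrightarrow> x = y))"
  unfolding injf_def by blast

lemma D0_injf: "T0 K t \<Longrightarrow> T0 K r \<Longrightarrow> T0 K q \<Longrightarrow> D0 K (\<lambda>e. injf (t e) (r e) (q e))"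
  by (rule D0_app3[where P=injf]) (unfold injf_bd, (rule d0 D0_function_to)+)

lemma Ord_bd: "Ord a \<longleftrightarrow> (\<forall>x. x \<epsilon> a \<longrightarrow> x \<sqsubseteq> a \<and> (\<forall>y. y \<epsilon> a \<longrightarrow> x \<epsilon> y \<or> x = y \<or> y \<epsilon> x))"
  unfolding Ord_iff by blast

lemma D0_Ord: "T0 K t \<Longrightarrow> D0 K (\<lambda>e. Ord (t e))"
  by (rule D0_app1[where P=Ord]) (unfold Ord_bd, (rule d0)+)

lemma Lim_bd: "Lim l \<longleftrightarrow> Ord l \<and> (\<exists>x. x \<epsilon> l \<and> x = emp) \<and> (\<forall>x. x \<epsilon> l \<longrightarrow> succ x \<epsilon> l)"
  unfolding Lim_def by auto

lemma D0_Lim: "T0 K t \<Longrightarrow> D0 K (\<lambda>e. Lim (t e))"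
  by (rule D0_app1[where P=Lim]) (unfold Lim_bd, (rule d0 D0_Ord)+)

text \<open>Minimality among inductive sets is not bounded; having only zero and successors below
  is, and it forces every element of the limit \<open>w\<close> into \<open>om\<close> by
  induction.\<close>

lemma eq_om_iff: "w = om \<longleftrightarrow> Lim w \<and> (\<forall>x. x \<epsilon> w \<longrightarrow> x = emp \<or> (\<exists>y. y \<epsilon> w \<and> x = succ y))"
proof
  assume w: "Lim w \<and> (\<forall>x. x \<epsilon> w \<longrightarrow> x = emp \<or> (\<exists>y. y \<epsilon> w \<and> x = succ y))"
  have "x \<epsilon> w \<longrightarrow> x \<epsilon> om" for x
  proof (induction x rule: mem_induct)
    case (step x)
    show ?case
    proof
      assume "x \<epsilon> w"
      then consider "x = emp" | y where "y \<epsilon> w" "x = succ y" using w by blast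
      then show "x \<epsilon> om" by cases (use om step in auto)
    qed
  qed simp
  moreover have "om \<sqsubseteq> w" by (rule om(3)) (use w in \<open>auto simp: Lim_def\<close>)
  ultimately show "w = om" by (intro sub_antisym) (auto simp: subset_of_def)
qed (use Lim_om om_cases in auto)

lemma D0_om: "T0 K t \<Longrightarrow> D0 K (\<lambda>e. t e = om)"
  by (rule D0_app1[where P="\<lambda>x. x = om"]) (unfold eq_om_iff, (rule d0 D0_Lim)+)

subsection \<open>An omega-Jonsson-like function\<close>

definition eqv :: "'v \<Rightarrow> 'v \<Rightarrow> bool" where
  "eqv s t \<longleftrightarrow> (\<exists>m. m \<epsilon> om \<and> (\<forall>n. n \<epsilon> om \<longrightarrow> m \<epsilon> n \<longrightarrow> app s n = app t n))"

lemma DP_eqv [simp]: "TM t \<Longrightarrow> TM r \<Longrightarrow> DP (\<lambda>e. eqv (t e) (r e))"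
  by (rule DP_app2[where P=eqv]) (unfold eqv_def, simp_all)

lemma eqv_refl: "eqv s s" unfolding eqv_def using om(1) by blast
lemma eqv_sym: "eqv s t \<Longrightarrow> eqv t s" unfolding eqv_def by metis
lemma eqv_trans: assumes "eqv s t" "eqv t u" shows "eqv s u"
proof -
  obtain m where m: "m \<epsilon> om" "\<And>n. n \<epsilon> om \<Longrightarrow> m \<epsilon> n \<Longrightarrow> app s n = app t n" using assms(1) unfolding eqv_def by blast
  obtain k where k: "k \<epsilon> om" "\<And>n. n \<epsilon> om \<Longrightarrow> k \<epsilon> n \<Longrightarrow> app t n = app u n" using assms(2) unfolding eqv_def by blast
  consider "m \<epsilon> k" | "m = k" | "k \<epsilon> m" using Ord_linear Ord_om_in m(1) k(1) by blast
  then have "\<exists>l. l \<epsilon> om \<and> (\<forall>n. n \<epsilon> om \<longrightarrow> l \<epsilon> n \<longrightarrow> m \<epsilon> n \<and> k \<epsilon> n)"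
    by cases (use m(1) k(1) Ord_trans Ord_om_in in blast)+
  then show ?thesis unfolding eqv_def using m(2) k(2) by metis
qed

text \<open>The function maps a sequence to the value of its representative modulo eventual equality
  at the last place where the two differ.\<close>

lemma jonsson:
  assumes L: "A0 \<epsilon> L" "\<And>B. B \<epsilon> L \<Longrightarrow> B \<sqsubseteq> U \<and> (\<exists>x y. x \<epsilon> B \<and> y \<epsilon> B \<and> x \<noteq> y)"
  obtains F A where "function_on mem F (Funs om U)" "A \<epsilon> L"
    "\<And>B a. B \<epsilon> L \<Longrightarrow> B \<sqsubseteq> A \<Longrightarrow> a \<epsilon> A \<Longrightarrow> \<exists>s. function_to mem s om B \<and> app F s = a"
proof -
  let ?W = "Funs om U"
  let ?cl = "\<lambda>s. Sep ?W (\<lambda>t. eqv s t)"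
  have cl: "t \<epsilon> ?cl s \<longleftrightarrow> t \<epsilon> ?W \<and> eqv s t" for s t by simp
  obtain g where g: "function_on mem g (Im ?W ?cl)" "\<And>s. s \<epsilon> Im ?W ?cl \<Longrightarrow> app g s \<epsilon> s"
  proof (rule choice_fn[of "Im ?W ?cl"])
    fix c assume "c \<epsilon> Im ?W ?cl"
    then obtain s where s: "s \<epsilon> ?W" "c = ?cl s" by auto
    then have "s \<epsilon> c" using cl eqv_refl by blast
    then show "c \<noteq> emp" by auto
  qed blast
  define r where "r s = app g (?cl s)" for s
  have [simp]: "TM t \<Longrightarrow> TM (\<lambda>e. r (t e))" for t unfolding r_def
    by (rule TM_app1[where F="\<lambda>s. app g (?cl s)"]) simp_all
  have r: "r s \<epsilon> ?W \<and> eqv s (r s)" if "s \<epsilon> ?W" for s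
  proof -
    have "?cl s \<epsilon> Im ?W ?cl" using that by auto
    then show ?thesis using g(2) cl unfolding r_def by blast
  qed
  have req: "r s = r t" if "eqv s t" for s t
  proof -
    have "?cl s = ?cl t" by (rule ext) (use cl that eqv_trans eqv_sym in blast)
    then show ?thesis unfolding r_def by simp
  qed
  define last where "last s m \<longleftrightarrow> m \<epsilon> om \<and> app s m \<noteq> app (r s) m \<and> (\<forall>n. n \<epsilon> om \<longrightarrow> m \<epsilon> n \<longrightarrow> app s n = app (r s) n)" for s m
  have [simp]: "TM t \<Longrightarrow> TM q \<Longrightarrow> DP (\<lambda>e. last (t e) (q e))" for t q unfolding last_def
    by (rule DP_app2[where P="\<lambda>s m. m \<epsilon> om \<and> app s m \<noteq> app (r s) m \<and> (\<forall>n. n \<epsilon> om \<longrightarrow> m \<epsilon> n \<longrightarrow> app s n = app (r s) n)"]) simp_all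
  define G where "G s = app (r s) (theD emp (last s))" for s
  have TG [simp]: "TM t \<Longrightarrow> TM (\<lambda>e. G (t e))" for t unfolding G_def
    by (rule TM_app1[where F="\<lambda>s. app (r s) (theD emp (last s))"]) simp_all
  have G: "G s = app (r s) m" if m: "last s m" for s m
  proof -
    have "theD emp (last s) = m"
    proof (rule theD_eq)
      fix k assume k: "last s k"
      then show "k = m" using m Ord_linear[of k m] Ord_om_in unfolding last_def by blast
    qed (rule m)
    then show ?thesis unfolding G_def by simp
  qed
  have "\<exists>A. A \<epsilon> L \<and> (\<forall>B a. B \<epsilon> L \<longrightarrow> B \<sqsubseteq> A \<longrightarrow> a \<epsilon> A \<longrightarrow> (\<exists>s. function_to mem s om B \<and> G s = a))"
  proof (rule ccontr)
    \<comment> \<open>Then each \<open>A\<close> in \<open>L\<close> has a bad pair: some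
      \<open>B\<close> below it and some \<open>a\<close> in \<open>A\<close> that \<open>G\<close>
      misses on sequences in \<open>B\<close>. Iterating a choice of bad pairs gives a decreasing
      sequence \<open>S n\<close> with missed values \<open>al n\<close>.\<close>
    assume n: "\<not> ?thesis"
    define P where "P A p \<longleftrightarrow> pi1 p \<epsilon> L \<and> pi1 p \<sqsubseteq> A \<and> pi2 p \<epsilon> A \<and> \<not> (\<exists>s. function_to mem s om (pi1 p) \<and> G s = pi2 p)" for A p
    have DPP: "DP (\<lambda>e. P (e 0) (e 1))" unfolding P_def by simp
    have "\<exists>p. P A p" if "A \<epsilon> L" for A
    proof -
      have "\<not> (\<forall>B a. B \<epsilon> L \<longrightarrow> B \<sqsubseteq> A \<longrightarrow> a \<epsilon> A \<longrightarrow> (\<exists>s. function_to mem s om B \<and> G s = a))"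
        using n that by blast
      then obtain B a where "B \<epsilon> L" "B \<sqsubseteq> A" "a \<epsilon> A" "\<not> (\<exists>s. function_to mem s om B \<and> G s = a)" by metis
      then have "P A (pair B a)" unfolding P_def by simp
      then show ?thesis by blast
    qed
    then obtain c where c: "\<And>A. A \<epsilon> L \<Longrightarrow> P A (app c A)" using choice[OF DPP, of L] by blast
    define S where "S = iter (\<lambda>X. pi1 (app c X)) A0"
    have T: "TM (\<lambda>e. pi1 (app c (e 0)))" by simp
    have TS [simp]: "TM t \<Longrightarrow> TM (\<lambda>e. S (t e))" for t unfolding S_def by (rule iter(1)[OF T])
    have S0: "S emp = A0" and S1: "n \<epsilon> om \<Longrightarrow> S (succ n) = pi1 (app c (S n))" for n
      unfolding S_def using iter(2,3)[OF T] by blast+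
    have SL: "n \<epsilon> om \<Longrightarrow> S n \<epsilon> L" for n
      by (induction n rule: om_induct) (use S0 S1 L(1) c in \<open>auto simp: P_def\<close>)
    define al where "al n = pi2 (app c (S n))" for n
    have [simp]: "TM t \<Longrightarrow> TM (\<lambda>e. al (t e))" for t unfolding al_def by simp
    have Sm: "S (succ n) \<sqsubseteq> S n" "al n \<epsilon> S n" "\<not> (\<exists>s. function_to mem s om (S (succ n)) \<and> G s = al n)" if "n \<epsilon> om" for n
      using c[OF SL[OF that]] unfolding P_def al_def S1[OF that] by auto
    have dec: "m \<epsilon> om \<Longrightarrow> n \<epsilon> om \<Longrightarrow> m \<epsilon> n \<longrightarrow> S n \<sqsubseteq> S (succ m)" for m n
    proof (rotate_tac, induction n rule: om_induct)
      case (succ n) then show ?case using Sm(1) sub_trans by auto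
    qed simp_all
    let ?s = "lam om al"
    have "al n \<epsilon> U" if "n \<epsilon> om" for n using Sm(2)[OF that] L(2)[OF SL[OF that]] subD by blast
    then have sW: "?s \<epsilon> ?W" by simp
    obtain m0 where m0: "m0 \<epsilon> om" "\<And>n. n \<epsilon> om \<Longrightarrow> m0 \<epsilon> n \<Longrightarrow> app ?s n = app (r ?s) n"
      using r[OF sW] unfolding eqv_def by blast
    define m where "m = succ m0"
    have m: "m \<epsilon> om" "m0 \<epsilon> m" unfolding m_def using m0 om by auto
    then have alm: "al m = app (r ?s) m" using m0 by auto
    have mm: "m0 \<epsilon> n" if "n \<epsilon> om" "m \<epsilon> n" for n using that m Ord_trans Ord_om_in by blast
    obtain x where x: "x \<epsilon> S (succ m)" "x \<noteq> al m"
      using L(2)[OF SL[OF om(2)[OF m(1)]]] by metis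
    \<comment> \<open>Overwriting the sequence of missed values up to \<open>m\<close> by
      \<open>x\<close> moves it into \<open>S (succ m)\<close> without changing its representative.
      The last difference from the representative is now at \<open>m\<close>, so \<open>G\<close>
      takes the missed value \<open>al m\<close>.\<close>
    let ?t = "lam om (\<lambda>n. if m \<epsilon> n then al n else x)"
    have tB: "function_to mem ?t om (S (succ m))"
    proof -
      have "al n \<epsilon> S (succ m)" if "n \<epsilon> om" "m \<epsilon> n" for n
        using subD[OF dec[OF m(1) that(1), rule_format, OF that(2)] Sm(2)[OF that(1)]] .
      then show ?thesis using x by simp
    qed
    have "eqv ?s ?t" unfolding eqv_def using m(1) by (intro exI[of _ m]) auto
    then have rt: "r ?t = r ?s" using req by simp
    have "last ?t m" unfolding last_def rt
      using m(1) x(2) alm m0(2) mm by auto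
    then have "G ?t = al m" using G rt alm by simp
    then show False using Sm(3)[OF m(1)] tB by blast
  qed
  then obtain A where A: "A \<epsilon> L" "\<And>B a. B \<epsilon> L \<Longrightarrow> B \<sqsubseteq> A \<Longrightarrow> a \<epsilon> A \<Longrightarrow> \<exists>s. function_to mem s om B \<and> G s = a" by blast
  show thesis
  proof (rule that[of "lam ?W G" A])
    fix B a assume B: "B \<epsilon> L" "B \<sqsubseteq> A" "a \<epsilon> A"
    then obtain s where s: "function_to mem s om B" "G s = a" using A(2) by blast
    then have "s \<epsilon> ?W" using L(2)[OF B(1)] subD by (auto simp: fn_to)
    then show "\<exists>s. function_to mem s om B \<and> app (lam ?W G) s = a" using s by (intro exI[of _ s]) simp
  qed (use A in simp_all)
qed

end

section \<open>Elementary embeddings\<close>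

lemma (in zfc) delta0_abs_tr: "delta0_fm p \<Longrightarrow> transitive_class mem M \<Longrightarrow> (\<And>i. s i \<in> M) \<Longrightarrow> sat M mem p s \<longleftrightarrow> sat UNIV mem p s"
proof (induction arbitrary: s rule: delta0_fm.induct)
  case (7 \<phi> x y)
  have "sat M mem \<phi> (s(x := a)) \<longleftrightarrow> sat UNIV mem \<phi> (s(x := a))" if "a \<in> M" for a
    by (rule "7.IH") (use "7.prems" that in auto)
  moreover have "a \<in> M" if "a \<epsilon> s y" for a using "7.prems" that unfolding transitive_class_def by blast
  ultimately show ?case using "7.hyps" by (auto simp del: fun_upd_apply) (use "7.hyps" in auto)
next
  case (8 \<phi> x y)
  have "sat M mem \<phi> (s(x := a)) \<longleftrightarrow> sat UNIV mem \<phi> (s(x := a))" if "a \<in> M" for a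
    by (rule "8.IH") (use "8.prems" that in auto)
  moreover have "a \<in> M" if "a \<epsilon> s y" for a using "8.prems" that unfolding transitive_class_def by blast
  ultimately show ?case using "8.hyps" by (auto simp del: fun_upd_apply) (use "8.hyps" in auto)
qed auto

text \<open>\<open>TM_j0\<close> and \<open>DP_M0\<close> say that \<open>j\<close> and
  \<open>M\<close> are classes in the sense of ZFC, so that Separation and induction may mention
  them.\<close>

locale elem = zfc mem for mem :: "'v \<Rightarrow> 'v \<Rightarrow> bool" (infix "\<epsilon>" 50) +
  fixes j :: "'v \<Rightarrow> 'v" and M :: "'v set"
  assumes TM_j0: "TM (\<lambda>e. j (e 0))" and trM: "transitive_class mem M" and el: "elementary_embedding mem j M"
    and DP_M0: "DP (\<lambda>e. e 0 \<in> M)"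
begin

lemma DP_M [simp]: "TM t \<Longrightarrow> DP (\<lambda>e. t e \<in> M)"
  by (rule DP_app1[OF DP_M0])

lemma TM_j [simp]: "TM t \<Longrightarrow> TM (\<lambda>e. j (t e))"
  by (rule TM_app1[OF TM_j0])

lemma jM [simp]: "j x \<in> M"
  using el unfolding elementary_embedding_def by auto

lemma M_tr: "x \<in> M \<Longrightarrow> y \<epsilon> x \<Longrightarrow> y \<in> M"
  using trM unfolding transitive_class_def by blast

section \<open>Transfer of bounded predicates along an embedding\<close>

lemma sat_j: "sat UNIV mem p s \<longleftrightarrow> sat M mem p (\<lambda>i. j (s i))"
  using el unfolding elementary_embedding_def by (auto simp: comp_def)

lemma delta0_abs: "delta0_fm p \<Longrightarrow> (\<And>i. s i \<in> M) \<Longrightarrow> sat M mem p s \<longleftrightarrow> sat UNIV mem p s"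
  by (rule delta0_abs_tr[OF _ trM])

lemma j_emp [simp]: "j emp = emp"
proof (rule ccontr)
  assume "j emp \<noteq> emp"
  then obtain y where y: "y \<epsilon> j emp" using nonempty by blast
  have "sat M mem (Exists 1 (Mem 1 0)) (\<lambda>i. j emp)" using y M_tr[OF jM y] by auto
  then have "sat UNIV mem (Exists 1 (Mem 1 0)) (\<lambda>i. emp)" using sat_j by blast
  then show False by simp
qed

abbreviation K0 :: "nat \<Rightarrow> 'v" where "K0 \<equiv> \<lambda>_. emp"

lemma j_mix: "(\<lambda>i. j (mix e K u i)) = mix (\<lambda>i. j (e i)) (\<lambda>i. j (K i)) (\<lambda>i. j (u i))"
  unfolding mix_def by auto

text \<open>Elementarity leads from the universe to \<open>M\<close>, absoluteness of bounded
  formulas leads back. The parameters are all \<open>emp\<close>, which \<open>j\<close>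
  fixes.\<close>

lemma jD: assumes "D0 K0 P" shows "P (\<lambda>i. j (e i)) \<longleftrightarrow> P e"
proof -
  obtain p where p: "delta0_fm p" "\<And>e u. P e \<longleftrightarrow> sat UNIV mem p (mix e K0 u)" using assms unfolding df_def by blast
  have "P e \<longleftrightarrow> sat M mem p (\<lambda>i. j (mix e K0 K0 i))" using p(2) sat_j by blast
  also have "\<dots> \<longleftrightarrow> sat UNIV mem p (\<lambda>i. j (mix e K0 K0 i))" by (rule delta0_abs) (use p in auto)
  also have "\<dots> \<longleftrightarrow> P (\<lambda>i. j (e i))" unfolding j_mix p(2)[of _ "\<lambda>i. j emp"] by simp
  finally show ?thesis by simp
qed

text \<open>An unbounded universal quantifier in front of a bounded matrix survives the transfer
  when restricted to \<open>M\<close>. In this way closure properties of a set become closure of its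
  image under elements of \<open>M\<close>.\<close>

lemma j_all: assumes "D0 K0 P" "\<And>y. P (case_nat y e)" "x \<in> M" shows "P (case_nat x (\<lambda>i. j (e i)))"
proof -
  obtain p where p: "delta0_fm p" "okf p" "\<And>e u y. P (case_nat y e) \<longleftrightarrow> sat UNIV mem p ((mix e K0 u)(2 := y))"
    by (rule df_bind[OF rcl(1) assms(1)]) blast
  have "sat UNIV mem (Forall 2 p) (mix e K0 K0)" using assms(2) p(3) by simp
  then have "sat M mem (Forall 2 p) (\<lambda>i. j (mix e K0 K0 i))" using sat_j by blast
  then have "sat M mem p ((\<lambda>i. j (mix e K0 K0 i))(2 := x))" using assms(3) by simp
  then have "sat UNIV mem p ((\<lambda>i. j (mix e K0 K0 i))(2 := x))"
    by (subst (asm) delta0_abs[OF p(1)]) (use assms(3) in auto)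
  then show ?thesis unfolding j_mix using p(3)[of x "\<lambda>i. j (e i)" "\<lambda>i. j emp"] by simp
qed

definition ls :: "'v list \<Rightarrow> nat \<Rightarrow> 'v" where "ls xs i = (if i < length xs then xs ! i else emp)"

lemma ls_simps [simp]: "ls (x # xs) 0 = x" "ls (x # xs) (Suc i) = ls xs i" "ls [] i = emp"
  by (auto simp: ls_def)
lemma ls_num [simp]: "ls (x # xs) 1 = ls xs 0" "ls (x # xs) (numeral k) = ls xs (pred_numeral k)"
  by (simp_all add: ls_def numeral_eq_Suc)

lemma j_ls: "(\<lambda>i. j (ls xs i)) = ls (map j xs)"
  by (auto simp: ls_def fun_eq_iff)

lemma jL: "D0 K0 P \<Longrightarrow> P (ls (map j xs)) \<longleftrightarrow> P (ls xs)"
  using jD[of P "ls xs"] by (simp add: j_ls)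

lemma jL_all: assumes "D0 K0 P" "\<And>y. P (ls (y # xs))" "x \<in> M" shows "P (ls (x # map j xs))"
proof -
  have c: "case_nat y (ls ys) = ls (y # ys)" for y ys by (auto simp: fun_eq_iff split: nat.splits)
  show ?thesis using j_all[of P "ls xs" x] assms by (simp add: c j_ls)
qed

lemma j_eq [simp]: "j x = j y \<longleftrightarrow> x = y"
  using jL[OF df_eq_var[of K0 0 1], of "[x, y]"] by simp
lemma j_mem [simp]: "j x \<epsilon> j y \<longleftrightarrow> x \<epsilon> y"
  using jL[OF df_mem_var[of K0 0 1], of "[x, y]"] by simp

lemma j_upair: "j (upair x y) = upair (j x) (j y)"
  using jL[OF D0_upair[OF T0_var T0_var T0_var], of "[upair x y, x, y]" 0 1 2] by simp
lemma j_succ: "j (succ x) = succ (j x)"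
  using jL[OF D0_succ[OF T0_var T0_var], of "[succ x, x]" 0 1] by simp
lemma j_Ord [simp]: "Ord (j x) \<longleftrightarrow> Ord x"
  using jL[OF D0_Ord[OF T0_var], of "[x]" 0] by simp
lemma j_sub [simp]: "j x \<sqsubseteq> j y \<longleftrightarrow> x \<sqsubseteq> y"
  using jL[OF D0_sub[OF T0_var T0_var], of "[x, y]" 0 1] by simp
lemma j_om [simp]: "j om = om"
  using jL[OF D0_om[OF T0_var], of "[om]" 0] by simp
lemma j_fn_on [simp]: "function_on mem (j f) (j A) \<longleftrightarrow> function_on mem f A"
  using jL[OF D0_function_on[OF T0_var T0_var], of "[f, A]" 0 1] by simp
lemma j_injf [simp]: "injf (j f) (j A) (j B) \<longleftrightarrow> injf f A B"
  using jL[OF D0_injf[OF T0_var T0_var T0_var], of "[f, A, B]" 0 1 2] by simp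
lemma j_app: "j (app f x) = app (j f) (j x)"
  using jL[OF D0_eq[OF T0_var T0_appf[OF T0_var T0_var]], of "[app f x, f, x]" 0 1 2] by simp
lemma j_n: "n \<epsilon> om \<Longrightarrow> j n = n"
  by (induction n rule: om_induct) (auto simp: j_succ)

lemma j_ge: "Ord a \<Longrightarrow> \<not> j a \<epsilon> a"
proof
  assume a: "Ord a" "j a \<epsilon> a"
  have "DP (\<lambda>e. j (e 0) \<epsilon> e 0)" by simp
  then obtain b where b: "Ord b" "j b \<epsilon> b" "\<And>c. c \<epsilon> b \<Longrightarrow> \<not> j c \<epsilon> c"
    using Ord_least[of "\<lambda>a. j a \<epsilon> a", OF _ a] by blast
  then show False using b(3)[OF b(2)] by simp
qed

lemma j_ge': "Ord a \<Longrightarrow> a \<epsilon> j a \<or> a = j a"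
  using j_ge Ord_linear[of a "j a"] by auto

lemma crit_range: assumes "Ord k" "j k \<noteq> k" "\<And>a. a \<epsilon> k \<Longrightarrow> j a = a" shows "j x \<noteq> k"
proof
  assume x: "j x = k"
  then have "Ord x" using assms(1) j_Ord by blast
  then consider "x \<epsilon> k" | "x = k" | "k \<epsilon> x" using Ord_linear assms(1) by blast
  then show False
  proof cases
    case 1 then show ?thesis using assms(3)[OF 1] x by auto
  next
    case 3
    then have "j k \<epsilon> k" using x j_mem[of k x] by simp
    then show ?thesis using j_ge assms(1) by blast
  qed (use assms x in auto)
qed

text \<open>The function \<open>V\<close> on \<open>succ a\<close> is sent to one that obeys the
  same recursion inside \<open>M\<close>. One inclusion of the recursion equation is bounded
  (\<open>P\<close>), the other is bounded after a quantifier over its element (\<open>Q\<close>);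
  an induction then identifies the values with \<open>V b\<close> cut down to
  \<open>M\<close>.\<close>

lemma j_V: assumes a: "Ord a" shows "x \<epsilon> j (V a) \<longleftrightarrow> x \<in> M \<and> x \<epsilon> V (j a)"
proof -
  let ?f = "lam (succ a) V"
  have f: "function_on mem ?f (succ a)" by simp
  have app: "b \<epsilon> succ a \<Longrightarrow> app ?f b = V b" for b by simp
  have tr: "\<And>b c. b \<epsilon> succ a \<Longrightarrow> c \<epsilon> b \<Longrightarrow> c \<epsilon> succ a" using a Ord_trans[OF Ord_succ] by blast
  define P where "P e \<longleftrightarrow> (\<forall>b. b \<epsilon> e 1 \<longrightarrow> (\<forall>x. x \<epsilon> app (e 0) b \<longrightarrow> (\<exists>c. c \<epsilon> b \<and> x \<sqsubseteq> app (e 0) c)))" for e :: "nat \<Rightarrow> 'v"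
  have DP: "D0 K0 P" unfolding P_def by (rule d0)+
  have "\<exists>c. c \<epsilon> b \<and> x \<sqsubseteq> app ?f c" if b: "b \<epsilon> succ a" and x: "x \<epsilon> app ?f b" for b x
  proof -
    obtain c where "c \<epsilon> b" "x \<sqsubseteq> V c" using x app[OF b] mem_V by auto
    then show ?thesis using app tr b by metis
  qed
  then have "P (ls [?f, succ a])" unfolding P_def by simp
  then have 1: "P (ls [j ?f, succ (j a)])" using jL[OF DP, of "[?f, succ a]"] by (simp add: j_succ)
  define Q where "Q e \<longleftrightarrow> (\<forall>b. b \<epsilon> e 2 \<longrightarrow> (\<forall>c. c \<epsilon> b \<longrightarrow> e 0 \<sqsubseteq> app (e 1) c \<longrightarrow> e 0 \<epsilon> app (e 1) b))" for e :: "nat \<Rightarrow> 'v"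
  have DQ: "D0 K0 Q" unfolding Q_def by (rule d0)+
  have "x \<epsilon> app ?f b" if b: "b \<epsilon> succ a" and c: "c \<epsilon> b" "x \<sqsubseteq> app ?f c" for x b c
    using app[OF b] app[OF tr[OF b c(1)]] c V_I by metis
  then have "Q (ls [y, ?f, succ a])" for y unfolding Q_def by simp
  then have 2: "y \<in> M \<Longrightarrow> Q (ls [y, j ?f, succ (j a)])" for y
    using jL_all[OF DQ, of "[?f, succ a]" y] by (simp add: j_succ)
  have fj: "function_on mem (j ?f) (succ (j a))" using f by (metis j_fn_on j_succ)
  have oj: "Ord (succ (j a))" using a Ord_succ by simp
  have "b \<epsilon> succ (j a) \<longrightarrow> (\<forall>x. x \<epsilon> app (j ?f) b \<longleftrightarrow> x \<in> M \<and> x \<epsilon> V b)" for b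
  proof (induction b rule: mem_induct)
    case (step b)
    show ?case
    proof (intro impI allI iffI)
      fix x assume b: "b \<epsilon> succ (j a)" and x: "x \<epsilon> app (j ?f) b"
      have "pair b (app (j ?f) b) \<epsilon> j ?f" using fn_pair[OF fj] b by simp
      then have "pair b (app (j ?f) b) \<in> M" using M_tr jM by blast
      moreover have "upair b (app (j ?f) b) \<epsilon> pair b (app (j ?f) b)" "app (j ?f) b \<epsilon> upair b (app (j ?f) b)"
        by (auto simp: pair_def)
      ultimately have "x \<in> M" using M_tr x by blast
      moreover obtain c where c: "c \<epsilon> b" "x \<sqsubseteq> app (j ?f) c" using 1[unfolded P_def, rule_format, of b x] b x by auto
      have "c \<epsilon> succ (j a)" using Ord_trans[OF oj c(1) b] .
      then have "x \<sqsubseteq> V c" using step[OF c(1)] c(2) by (auto simp: subset_of_def)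
      ultimately show "x \<in> M \<and> x \<epsilon> V b" using V_I[OF c(1)] by blast
    next
      fix x assume b: "b \<epsilon> succ (j a)" and x: "x \<in> M \<and> x \<epsilon> V b"
      then obtain c where c: "c \<epsilon> b" "x \<sqsubseteq> V c" using mem_V[of x b] by blast
      have "c \<epsilon> succ (j a)" using Ord_trans[OF oj c(1) b] .
      then have "x \<sqsubseteq> app (j ?f) c" using step[OF c(1)] c(2) x M_tr by (auto simp: subset_of_def)
      then show "x \<epsilon> app (j ?f) b" using 2[of x] x b c(1) unfolding Q_def by (auto simp: numeral_2_eq_2)
    qed
  qed simp
  moreover have "app (j ?f) (j a) = j (V a)" using app[of a] j_app[of ?f a] by simp
  ultimately show ?thesis by auto
qed

text \<open>For \<open>x\<close> contained in an earlier level \<open>V b\<close>, the fixed ordinal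
  \<open>b\<close> keeps \<open>j x\<close> inside \<open>V b\<close>, where \<open>j\<close> is the
  identity by induction; so \<open>x\<close> and \<open>j x\<close> have the same elements.\<close>

lemma j_V_fix: assumes d: "Ord d" and fx: "\<And>a. a \<epsilon> d \<Longrightarrow> j a = a" and x: "x \<epsilon> V d" shows "j x = x"
proof -
  have "a \<sqsubseteq> d \<and> Ord a \<longrightarrow> (\<forall>x. x \<epsilon> V a \<longrightarrow> j x = x)" for a
  proof (induction a rule: mem_induct)
    case (step a)
    show ?case
    proof (intro impI allI)
      fix x assume a: "a \<sqsubseteq> d \<and> Ord a" and x: "x \<epsilon> V a"
      obtain b where b: "b \<epsilon> a" "x \<sqsubseteq> V b" using x mem_V[of x a] by blast
      have bd: "b \<epsilon> d" "Ord b" using a b(1) subD Ord_in by blast+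
      then have IH: "y \<epsilon> V b \<Longrightarrow> j y = y" for y using step[OF b(1)] Ord_sub[OF d] by blast
      show "j x = x"
      proof (rule ext)
        fix y
        have "j x \<sqsubseteq> j (V b)" using b(2) by simp
        then have "y \<epsilon> j x \<Longrightarrow> y \<epsilon> V b" using j_V[OF bd(2), of y] fx[OF bd(1)] subD by metis
        then have "y \<epsilon> j x \<Longrightarrow> j y = y" using IH by blast
        moreover have "y \<epsilon> x \<Longrightarrow> j y = y" using IH b(2) subD by blast
        ultimately show "y \<epsilon> j x \<longleftrightarrow> y \<epsilon> x" using j_mem[of y x] by metis
      qed
    qed
  qed simp
  then show ?thesis using d x by (meson sub_refl)
qed

text \<open>Kunen's inconsistency. For \<open>F\<close> and \<open>A\<close> as in the lemma \<open>jonsson\<close>, the pointwise image of \<open>A\<close>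
  is an admissible \<open>B\<close> for \<open>j F\<close> and \<open>j A\<close>. Sequences into it have the form \<open>j s\<close>, so \<open>j A\<close> consists
  of values of \<open>j\<close>; as \<open>A\<close> is the range of an injection on \<open>r\<close>, so does \<open>r\<close>.\<close>

lemma kunen:
  assumes r: "Ord r" "j r = r" and k: "k \<epsilon> r" "\<And>x. j x \<noteq> k"
    and cl: "\<And>f. function_to mem f r r \<Longrightarrow> f \<in> M"
  shows False
proof -
  \<comment> \<open>\<open>emp\<close> and \<open>k\<close> are two points of \<open>r\<close>, so
    every range in \<open>L\<close> has two elements, as \<open>jonsson\<close> demands.\<close>
  have kne: "k \<noteq> emp" using k(2)[of emp] by auto
  have emp_r: "emp \<epsilon> r" using Ord_le[OF Ord_emp r(1)] k(1) by auto
  define I where "I = Sep (Funs r r) (\<lambda>i. injf i r r)"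
  have I: "i \<epsilon> I \<longleftrightarrow> injf i r r" for i unfolding I_def by (auto simp: injf_def)
  define L where "L = Im I ran"
  have L: "B \<epsilon> L \<longleftrightarrow> (\<exists>i. injf i r r \<and> B = ran i)" for B unfolding L_def using I by auto
  have inj_ran: "y \<epsilon> ran i \<longleftrightarrow> (\<exists>x. x \<epsilon> r \<and> y = app i x)" if "injf i r r" for i y
    using mem_ran[of i r] that unfolding injf_def fn_to by blast
  have "injf (lam r (\<lambda>x. x)) r r" unfolding injf_def by auto
  then have "ran (lam r (\<lambda>x. x)) \<epsilon> L" using L by blast
  moreover have "B \<sqsubseteq> r \<and> (\<exists>x y. x \<epsilon> B \<and> y \<epsilon> B \<and> x \<noteq> y)" if BL: "B \<epsilon> L" for B
  proof -
    obtain i where i: "injf i r r" "B = ran i" using BL L[of B] by blast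
    have "B \<sqsubseteq> r" unfolding i(2)
      by (rule subI, subst (asm) inj_ran[OF i(1)]) (use i(1) in \<open>auto simp: injf_def fn_to\<close>)
    moreover have "app i emp \<epsilon> B" "app i k \<epsilon> B" using inj_ran[OF i(1)] i(2) emp_r k(1) by auto
    moreover have "app i emp \<noteq> app i k" using i(1) emp_r k(1) kne unfolding injf_def by metis
    ultimately show ?thesis by blast
  qed
  ultimately obtain F A where FA: "function_on mem F (Funs om r)" "A \<epsilon> L"
    "\<And>B a. B \<epsilon> L \<Longrightarrow> B \<sqsubseteq> A \<Longrightarrow> a \<epsilon> A \<Longrightarrow> \<exists>s. function_to mem s om B \<and> app F s = a"
    using jonsson[of _ L r] by metis
  obtain i0 where i0: "injf i0 r r" "A = ran i0" using FA(2) L by blast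
  let ?W = "Funs om r"
  have Ar: "x \<epsilon> A \<Longrightarrow> x \<epsilon> r" for x
    unfolding i0(2) by (subst (asm) inj_ran[OF i0(1)]) (use i0(1) in \<open>auto simp: injf_def fn_to\<close>)
  define P where "P e \<longleftrightarrow> (\<forall>B. B \<epsilon> e 0 \<longrightarrow> B \<sqsubseteq> e 1 \<longrightarrow> (\<forall>a. a \<epsilon> e 1 \<longrightarrow>
      (\<exists>s. s \<epsilon> e 2 \<and> function_to mem s (e 3) B \<and> app (e 4) s = a)))" for e :: "nat \<Rightarrow> 'v"
  have DP: "D0 K0 P" unfolding P_def by (rule d0 D0_function_to)+
  have "P (ls [L, A, ?W, om, F])" unfolding P_def
  proof (simp add: numeral_2_eq_2 numeral_3_eq_3, intro allI impI)
    fix B a assume B: "B \<epsilon> L" "B \<sqsubseteq> A" "a \<epsilon> A"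
    obtain s where s: "function_to mem s om B" "app F s = a" using FA(3)[OF B] by blast
    have "function_to mem s om r" using s(1) B(2) Ar subD unfolding fn_to by blast
    then show "\<exists>s. function_to mem s om r \<and> function_to mem s om B \<and> app F s = a" using s by blast
  qed
  then have P: "P (ls [j L, j A, j ?W, om, j F])" using jL[OF DP, of "[L, A, ?W, om, F]"] by simp
  \<comment> \<open>Transferred for all \<open>i\<close> at once: every injection of
    \<open>r\<close> into \<open>r\<close> that lies in \<open>M\<close> has its range in
    \<open>j L\<close>.\<close>
  define Q where "Q e \<longleftrightarrow> injf (e 0) (e 1) (e 1) \<longrightarrow> (\<exists>B. B \<epsilon> e 2 \<and>
      (\<forall>y. y \<epsilon> B \<longrightarrow> (\<exists>x. x \<epsilon> e 1 \<and> y = app (e 0) x)) \<and> (\<forall>x. x \<epsilon> e 1 \<longrightarrow> app (e 0) x \<epsilon> B))" for e :: "nat \<Rightarrow> 'v"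
  have DQ: "D0 K0 Q" unfolding Q_def by (rule d0 D0_injf)+
  have "Q (ls [i, r, L])" for i unfolding Q_def
  proof (simp add: numeral_2_eq_2, intro impI)
    assume i: "injf i r r"
    show "\<exists>B. B \<epsilon> L \<and> (\<forall>y. y \<epsilon> B \<longrightarrow> (\<exists>x. x \<epsilon> r \<and> y = app i x)) \<and> (\<forall>x. x \<epsilon> r \<longrightarrow> app i x \<epsilon> B)"
      by (intro exI[of _ "ran i"]) (use i L inj_ran[OF i] in auto)
  qed
  then have Q: "i \<in> M \<Longrightarrow> Q (ls [i, r, j L])" for i using jL_all[OF DQ, of "[r, L]" i] r(2) by simp
  let ?i = "lam r (\<lambda>x. j (app i0 x))"
  have jr: "x \<epsilon> r \<Longrightarrow> j x \<epsilon> r" for x using j_mem[of x r] r(2) by simp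
  have ii: "injf ?i r r" using i0(1) jr unfolding injf_def fn_to by auto
  then have "?i \<in> M" using cl unfolding injf_def by blast
  then obtain B where B: "B \<epsilon> j L" "\<And>y. y \<epsilon> B \<longleftrightarrow> (\<exists>x. x \<epsilon> r \<and> y = app ?i x)"
  proof -
    have "\<exists>B. B \<epsilon> j L \<and> (\<forall>y. y \<epsilon> B \<longrightarrow> (\<exists>x. x \<epsilon> r \<and> y = app ?i x)) \<and> (\<forall>x. x \<epsilon> r \<longrightarrow> app ?i x \<epsilon> B)"
      using Q[OF \<open>?i \<in> M\<close>] ii unfolding Q_def by (simp add: numeral_2_eq_2)
    then show ?thesis using that by blast
  qed
  have BA: "y \<epsilon> B \<longleftrightarrow> (\<exists>x. x \<epsilon> A \<and> y = j x)" for y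
    using B(2) i0(2) inj_ran[OF i0(1)] by auto
  have "B \<sqsubseteq> j A" using BA by (auto simp: subset_of_def)
  then have fin: "\<exists>s. s \<epsilon> j ?W \<and> function_to mem s om B \<and> app (j F) s = a" if "a \<epsilon> j A" for a
    using P B(1) that unfolding P_def by (auto simp: numeral_2_eq_2 numeral_3_eq_3 numeral_eq_Suc)
  have img: "\<exists>b. b \<epsilon> A \<and> a = j b" if a: "a \<epsilon> j A" for a
  proof -
    obtain s where s: "function_to mem s om B" "app (j F) s = a" using fin[OF a] by blast
    \<comment> \<open>The pullback of \<open>s\<close> along \<open>j\<close>. Since
      \<open>j\<close> fixes the natural numbers, \<open>j ?t\<close> and \<open>s\<close> agree at
      each of them.\<close>
    let ?t = "lam om (\<lambda>n. theD emp (\<lambda>y. y \<epsilon> A \<and> j y = app s n))"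
    have t: "app ?t n \<epsilon> A \<and> j (app ?t n) = app s n" if n: "n \<epsilon> om" for n
    proof -
      obtain y where y: "y \<epsilon> A" "app s n = j y" using s(1) n BA unfolding fn_to by auto
      then have "theD emp (\<lambda>y. y \<epsilon> A \<and> j y = app s n) = y" by (intro theD_eq) auto
      then show ?thesis using y n by simp
    qed
    have "j ?t = s"
    proof (rule fn_ext)
      show "function_on mem (j ?t) om" using j_fn_on[of ?t om] by simp
      show "function_on mem s om" using s(1) unfolding fn_to by blast
      fix n assume n: "n \<epsilon> om"
      show "app (j ?t) n = app s n" using t[OF n] j_app[of ?t n] j_n[OF n] by simp
    qed
    then have "a = j (app F ?t)" using s(2) j_app by metis
    then show ?thesis using a by auto
  qed
  have "app (j i0) k \<epsilon> j A"
  proof -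
    have D: "D0 K0 (\<lambda>e. \<forall>x. x \<epsilon> e 0 \<longrightarrow> app (e 1) x \<epsilon> e 2)" by (rule d0)+
    have "\<forall>x. x \<epsilon> r \<longrightarrow> app i0 x \<epsilon> A" using inj_ran[OF i0(1)] i0(2) by auto
    then have "\<forall>x. x \<epsilon> j r \<longrightarrow> app (j i0) x \<epsilon> j A"
      using jL[OF D, of "[r, i0, A]"] by (simp add: numeral_2_eq_2)
    then show ?thesis using r(2) k(1) by simp
  qed
  then obtain b where b: "b \<epsilon> A" "app (j i0) k = j b" using img by blast
  then obtain h where h: "h \<epsilon> r" "b = app i0 h" using i0(2) inj_ran[OF i0(1), of b] by blast
  then have "app (j i0) k = app (j i0) (j h)" using b j_app by simp
  moreover have "injf (j i0) r r" using i0(1) j_injf[of i0 r r] r(2) by simp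
  ultimately have "k = j h" using k(1) jr[OF h(1)] unfolding injf_def by blast
  then show False using k(2) by metis
qed

end

lemma (in zfc) strong_for_elem:
  assumes "strong_for mem mu k"
  obtains j M where "elem mem j M" "critical_point mem j k" "\<And>x. x \<epsilon> V mu \<Longrightarrow> x \<in> M"
proof -
  obtain j M where j: "definable mem (\<lambda>_. True) {p. \<exists>x. is_opair mem p x (j x)}" "definable mem (\<lambda>_. True) M"
    "transitive_class mem M" "elementary_embedding mem j M" "critical_point mem j k"
    "\<forall>v x. is_V mem v mu \<and> x \<epsilon> v \<longrightarrow> x \<in> M" and mu: "cardinal mem mu"
    using assms unfolding strong_for_def by blast
  have "DP (\<lambda>e. e 0 \<in> {p. \<exists>x. is_opair mem p x (j x)})" by (rule DP_definable[OF j(1)])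
  then have "DP (\<lambda>e. pair (e 1) (e 0) \<in> {p. \<exists>x. is_opair mem p x (j x)})" by (rule DP_app1) simp
  then have "TM (\<lambda>e. j (e 0))" unfolding TM_def by (rule DP_eqI) auto
  then have "elem mem j M" by unfold_locales (use j DP_definable in auto)
  moreover have "Ord mu" using mu unfolding cardinal_def by blast
  ultimately show thesis using that j by auto
qed

section \<open>Ultrapowers\<close>

context zfc
begin

abbreviation one :: 'v where "one \<equiv> sing emp"

text \<open>Unary operations on sets, each given by its condition for \<open>x\<close>. The negated conjunction \<open>0\<close> acts on
  a pair of sets coded as one set, whose components are \<open>1\<close> and \<open>2\<close>. Together with substitutions (\<open>3\<close> to
  \<open>7\<close>), bounded quantification (\<open>8\<close>), membership (\<open>9\<close>) and the singleton of \<open>g\<close> (\<open>10\<close>) they suffice for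
  the theorem of Los.\<close>

definition opT :: "'v \<Rightarrow> nat \<Rightarrow> 'v \<Rightarrow> 'v \<Rightarrow> bool" where
  "opT g i x Z \<longleftrightarrow>
    (if i = 0 then \<not> (pair x emp \<epsilon> Z \<and> pair x one \<epsilon> Z)
     else if i = 1 then pair x emp \<epsilon> Z
     else if i = 2 then pair x one \<epsilon> Z
     else if i = 3 then pair x x \<epsilon> Z
     else if i = 4 then pair (pi1 (pi1 x)) (pi2 x) \<epsilon> Z
     else if i = 5 then pair (pi2 (pi1 x)) (pi2 x) \<epsilon> Z
     else if i = 6 then pair (pi2 x) (pi1 x) \<epsilon> Z
     else if i = 7 then pi1 x \<epsilon> Z
     else if i = 8 then (\<exists>w. w \<epsilon> pi2 x \<and> pair (pi1 x) w \<epsilon> Z)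
     else if i = 9 then pi1 x \<epsilon> pi2 x
     else if i = 10 then x = g
     else x \<epsilon> Z)"

lemma DP_opT [simp]: "TM g \<Longrightarrow> TM x \<Longrightarrow> TM Z \<Longrightarrow> DP (\<lambda>e. opT (g e) i (x e) (Z e))"
  by (rule DP_app3[where P="\<lambda>g x Z. opT g i x Z"]) (unfold opT_def, simp_all)

text \<open>Minimal elements are demanded for sets in \<open>PU\<close> only: with the power set as
  an argument the condition is bounded, and embeddings transfer it.\<close>

definition wfd :: "'v \<Rightarrow> 'v \<Rightarrow> bool" where
  "wfd PU X \<longleftrightarrow> (\<forall>A. A \<epsilon> PU \<longrightarrow> A \<noteq> emp \<longrightarrow> (\<exists>m. m \<epsilon> A \<and> (\<forall>y. y \<epsilon> A \<longrightarrow> \<not> pair y m \<epsilon> X)))"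

lemma DP_wfd [simp]: "TM p \<Longrightarrow> TM x \<Longrightarrow> DP (\<lambda>e. wfd (p e) (x e))"
  by (rule DP_app2[where P=wfd]) (unfold wfd_def, simp_all)

text \<open>\<open>h\<close> plays the role of \<open>X \<mapsto> j(X) \<inter> V\<^sub>b'\<close>.\<close>

definition goodh :: "'v \<Rightarrow> 'v \<Rightarrow> 'v \<Rightarrow> 'v \<Rightarrow> 'v \<Rightarrow> 'v \<Rightarrow> bool" where
  "goodh g U PU U' PU' h \<longleftrightarrow> function_to mem h PU PU' \<and>
    (\<forall>i<11. \<forall>Z. Z \<epsilon> PU \<longrightarrow> (\<forall>Y. Y \<epsilon> PU \<longrightarrow> (\<forall>x. x \<epsilon> U \<longrightarrow> (x \<epsilon> Y \<longleftrightarrow> opT g i x Z)) \<longrightarrow>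
       (\<forall>x. x \<epsilon> U' \<longrightarrow> (x \<epsilon> app h Y \<longleftrightarrow> opT g i x (app h Z))))) \<and>
    (\<forall>X. X \<epsilon> PU \<longrightarrow> wfd PU X \<longrightarrow> wfd PU' (app h X))"

text \<open>A limit level is closed under pairs; \<open>om\<close> and \<open>g\<close> below
  \<open>b\<close> put the natural numbers and \<open>g\<close> into \<open>V b\<close>.\<close>

definition LimO :: "'v \<Rightarrow> 'v \<Rightarrow> bool" where "LimO g b \<longleftrightarrow> Lim b \<and> om \<epsilon> b \<and> g \<epsilon> b"

lemma DP_LimO [simp]: "TM g \<Longrightarrow> TM b \<Longrightarrow> DP (\<lambda>e. LimO (g e) (b e))"
  by (rule DP_app2[where P=LimO]) (unfold LimO_def, simp_all)

definition good :: "'v \<Rightarrow> 'v \<Rightarrow> 'v \<Rightarrow> 'v \<Rightarrow> bool" where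
  "good g b b' h \<longleftrightarrow> goodh g (V b) (Pow (V b)) (V b') (Pow (V b')) h"

lemma DP_good [simp]: "TM b \<Longrightarrow> TM h \<Longrightarrow> DP (\<lambda>e. good g (b e) (b e) (h e))"
  by (rule DP_app2[where P="\<lambda>b h. good g b b h"]) (unfold good_def goodh_def, simp_all)

end

text \<open>Iterated projections act as coordinates on nested pairs, which serve as common
  generators of several classes of the ultrapower.\<close>

inductive prj :: "('v \<Rightarrow> 'v) \<Rightarrow> ('v \<Rightarrow> 'v) \<Rightarrow> ('v \<Rightarrow> 'v) \<Rightarrow> bool" for p1 p2 where
  "prj p1 p2 (\<lambda>x. x)"
| "prj p1 p2 p \<Longrightarrow> prj p1 p2 (\<lambda>x. p1 (p x))"
| "prj p1 p2 p \<Longrightarrow> prj p1 p2 (\<lambda>x. p2 (p x))"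

locale ultra = zfc mem for mem :: "'v \<Rightarrow> 'v \<Rightarrow> bool" (infix "\<epsilon>" 50) +
  fixes g b b' h :: 'v
  assumes Lb: "LimO g b" and Lb': "LimO g b'" and gh: "good g b b' h"
begin

abbreviation U where "U \<equiv> V b"
abbreviation U' where "U' \<equiv> V b'"

lemma lim: "Lim b" "Lim b'" "Ord b" "Ord b'"
  using Lb Lb' Lim_Ord unfolding LimO_def by auto

lemma U_cl [intro]: "x \<epsilon> U \<Longrightarrow> y \<epsilon> U \<Longrightarrow> pair x y \<epsilon> U" "x \<epsilon> U \<Longrightarrow> pi1 x \<epsilon> U" "x \<epsilon> U \<Longrightarrow> pi2 x \<epsilon> U"
  "x \<epsilon> U' \<Longrightarrow> y \<epsilon> U' \<Longrightarrow> pair x y \<epsilon> U'" "x \<epsilon> U' \<Longrightarrow> pi1 x \<epsilon> U'" "x \<epsilon> U' \<Longrightarrow> pi2 x \<epsilon> U'"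
  using V_lim_pair lim pi_V by blast+

lemma V_lim_emp: "Lim l \<Longrightarrow> emp \<epsilon> V l"
  using Ord_sub_V Lim_Ord Lim_emp subD by blast

lemma U_emp [intro, simp]: "emp \<epsilon> U" "emp \<epsilon> U'" "one \<epsilon> U" "one \<epsilon> U'"
  using V_lim_emp V_lim_upair lim by blast+

lemma om_U: "n \<epsilon> om \<Longrightarrow> n \<epsilon> U" "n \<epsilon> om \<Longrightarrow> n \<epsilon> U'"
  using Lb Lb' unfolding LimO_def by (meson Ord_sub_V Ord_trans subD lim)+

lemma h_to: "function_to mem h (Pow U) (Pow U')"
  using gh unfolding good_def goodh_def by blast

lemma h_sub: "X \<sqsubseteq> U \<Longrightarrow> app h X \<sqsubseteq> U'"
  using h_to unfolding fn_to by simp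

lemma h_op: assumes "i < 11" "Z \<sqsubseteq> U" "Y \<sqsubseteq> U" "\<And>x. x \<epsilon> U \<Longrightarrow> x \<epsilon> Y \<longleftrightarrow> opT g i x Z" "a \<epsilon> U'"
  shows "a \<epsilon> app h Y \<longleftrightarrow> opT g i a (app h Z)"
  using gh assms unfolding good_def goodh_def by simp

text \<open>Read: the set defined by \<open>P\<close> belongs to the ultrafilter at
  \<open>a\<close>, which consists of the \<open>X\<close> with \<open>a\<close> in
  \<open>app h X\<close>. As for an extender, all generators \<open>a\<close> in \<open>U'\<close>
  are used together.\<close>

definition fo :: "'v \<Rightarrow> ('v \<Rightarrow> bool) \<Rightarrow> bool" where "fo a P \<longleftrightarrow> a \<epsilon> app h (Sep U P)"

lemma DP_fo [simp]: "TM a \<Longrightarrow> DP (\<lambda>e. P (\<lambda>n. e (Suc n)) (e 0)) \<Longrightarrow> DP (\<lambda>e. fo (a e) (\<lambda>x. P e x))"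
  unfolding fo_def by simp

lemma Sep_sub: "DP (\<lambda>e. P (e 0)) \<Longrightarrow> Sep A P \<sqsubseteq> A"
  by (simp add: subset_of_def)

lemma Sep_cong': "DP (\<lambda>e. P (e 0)) \<Longrightarrow> DP (\<lambda>e. Q (e 0)) \<Longrightarrow> (\<And>x. x \<epsilon> A \<Longrightarrow> P x \<longleftrightarrow> Q x) \<Longrightarrow> Sep A P = Sep A Q"
  by (rule ext) auto

lemma fo_cong: "DP (\<lambda>e. P (e 0)) \<Longrightarrow> DP (\<lambda>e. Q (e 0)) \<Longrightarrow> (\<And>x. x \<epsilon> U \<Longrightarrow> P x \<longleftrightarrow> Q x) \<Longrightarrow> fo a P \<longleftrightarrow> fo a Q"
  unfolding fo_def using Sep_cong'[of P Q U] by simp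

lemma fo_op: assumes "i < 11" "Z \<sqsubseteq> U" "DP (\<lambda>e. P (e 0))" "\<And>x. x \<epsilon> U \<Longrightarrow> P x \<longleftrightarrow> opT g i x Z" "a \<epsilon> U'"
  shows "fo a P \<longleftrightarrow> opT g i a (app h Z)"
  unfolding fo_def by (rule h_op) (use assms in \<open>auto simp: Sep_sub\<close>)

text \<open>Operations are unary, so the two sets are coded as one by the tags \<open>emp\<close>
  and \<open>one\<close>; closure of \<open>U\<close> under pairs keeps the code inside
  \<open>U\<close>. The other Boolean rules follow from this one.\<close>

lemma fo_nand: assumes [simp]: "DP (\<lambda>e. P (e 0))" "DP (\<lambda>e. Q (e 0))" and a: "a \<epsilon> U'"
  shows "fo a (\<lambda>x. \<not> (P x \<and> Q x)) \<longleftrightarrow> \<not> (fo a P \<and> fo a Q)"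
proof -
  let ?Z = "cup (Im (Sep U P) (\<lambda>x. pair x emp)) (Im (Sep U Q) (\<lambda>x. pair x one))"
  have Z: "?Z \<sqsubseteq> U" by (rule subI) auto
  have m: "pair x emp \<epsilon> ?Z \<longleftrightarrow> x \<epsilon> U \<and> P x" "pair x one \<epsilon> ?Z \<longleftrightarrow> x \<epsilon> U \<and> Q x" for x by auto
  have "fo a P \<longleftrightarrow> opT g 1 a (app h ?Z)" by (rule fo_op) (use Z m a in \<open>auto simp: opT_def\<close>)
  moreover have "fo a Q \<longleftrightarrow> opT g 2 a (app h ?Z)" by (rule fo_op) (use Z m a in \<open>auto simp: opT_def\<close>)
  moreover have "fo a (\<lambda>x. \<not> (P x \<and> Q x)) \<longleftrightarrow> opT g 0 a (app h ?Z)"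
    by (rule fo_op) (use Z m a in \<open>auto simp: opT_def\<close>)
  ultimately show ?thesis by (simp add: opT_def)
qed

lemma fo_not: assumes "DP (\<lambda>e. P (e 0))" "a \<epsilon> U'" shows "fo a (\<lambda>x. \<not> P x) \<longleftrightarrow> \<not> fo a P"
  using fo_nand[OF assms(1,1,2)] by simp

lemma fo_conj: assumes "DP (\<lambda>e. P (e 0))" "DP (\<lambda>e. Q (e 0))" "a \<epsilon> U'"
  shows "fo a (\<lambda>x. P x \<and> Q x) \<longleftrightarrow> fo a P \<and> fo a Q"
  using fo_nand[OF assms] fo_not[OF DP_conj[OF assms(1,2)] assms(3)] by blast

lemma fo_mono: assumes "fo a P" "DP (\<lambda>e. P (e 0))" "DP (\<lambda>e. Q (e 0))" "a \<epsilon> U'" "\<And>x. x \<epsilon> U \<Longrightarrow> P x \<Longrightarrow> Q x"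
  shows "fo a Q"
proof -
  have "fo a (\<lambda>x. P x \<and> Q x) \<longleftrightarrow> fo a P" by (rule fo_cong) (use assms in auto)
  then show ?thesis using fo_conj assms by blast
qed

lemma fo_disj: assumes "DP (\<lambda>e. P (e 0))" "DP (\<lambda>e. Q (e 0))" "a \<epsilon> U'"
  shows "fo a (\<lambda>x. P x \<or> Q x) \<longleftrightarrow> fo a P \<or> fo a Q"
  using fo_nand[of "\<lambda>x. \<not> P x" "\<lambda>x. \<not> Q x" a] fo_not[of P a] fo_not[of Q a] assms by simp

lemma fo_true: "a \<epsilon> U' \<Longrightarrow> fo a (\<lambda>x. True)"
  using fo_nand[of "\<lambda>_. True" "\<lambda>_. False" a] fo_not[of "\<lambda>_. True" a] by auto

lemma fo_const [simp]: "a \<epsilon> U' \<Longrightarrow> fo a (\<lambda>x. c) \<longleftrightarrow> c"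
  using fo_true fo_not[of "\<lambda>_. True" a] by (cases c) auto

lemma fo_all: "a \<epsilon> U' \<Longrightarrow> DP (\<lambda>e. P (e 0)) \<Longrightarrow> (\<And>x. x \<epsilon> U \<Longrightarrow> P x) \<Longrightarrow> fo a P"
  by (rule fo_mono[OF fo_true]) auto

text \<open>Besides closure conditions: taking preimages under \<open>k\<close> commutes with
  \<open>h\<close>, so the ultrafilter at \<open>k a\<close> is the projection along
  \<open>k\<close> of the one at \<open>a\<close>.\<close>

definition pre :: "('v \<Rightarrow> 'v) \<Rightarrow> bool" where
  "pre k \<longleftrightarrow> TM (\<lambda>e. k (e 0)) \<and> (\<forall>x. x \<epsilon> U \<longrightarrow> k x \<epsilon> U) \<and> (\<forall>x. x \<epsilon> U' \<longrightarrow> k x \<epsilon> U') \<and>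
    (\<forall>P a. DP (\<lambda>e. P (e 0)) \<longrightarrow> a \<epsilon> U' \<longrightarrow> (fo a (\<lambda>x. P (k x)) \<longleftrightarrow> fo (k a) P))"

lemma preD: "pre k \<Longrightarrow> DP (\<lambda>e. P (e 0)) \<Longrightarrow> a \<epsilon> U' \<Longrightarrow> fo a (\<lambda>x. P (k x)) \<longleftrightarrow> fo (k a) P"
  unfolding pre_def by blast

lemma pre_TM: "pre k \<Longrightarrow> TM t \<Longrightarrow> TM (\<lambda>e. k (t e))"
  unfolding pre_def using TM_app1 by blast

lemma pre_cl: "pre k \<Longrightarrow> x \<epsilon> U \<Longrightarrow> k x \<epsilon> U" "pre k \<Longrightarrow> x \<epsilon> U' \<Longrightarrow> k x \<epsilon> U'"
  unfolding pre_def by blast+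

lemma pre_id: "pre (\<lambda>x. x)" unfolding pre_def by simp

lemma pre_comp: assumes k: "pre k" and l: "pre l" shows "pre (\<lambda>x. k (l x))"
  unfolding pre_def
proof (intro conjI allI impI)
  show "TM (\<lambda>e. k (l (e 0)))" by (intro pre_TM[OF k] pre_TM[OF l] TM_var)
  fix P :: "'v \<Rightarrow> bool" and a assume P: "DP (\<lambda>e. P (e 0))" and a: "a \<epsilon> U'"
  have "DP (\<lambda>e. P (k (e 0)))" by (rule DP_app1[OF P]) (rule pre_TM[OF k TM_var])
  then have "fo a (\<lambda>x. P (k (l x))) \<longleftrightarrow> fo (l a) (\<lambda>x. P (k x))" by (rule preD[OF l _ a])
  also have "\<dots> \<longleftrightarrow> fo (k (l a)) P" by (rule preD[OF k P]) (rule pre_cl(2)[OF l a])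
  finally show "fo a (\<lambda>x. P (k (l x))) \<longleftrightarrow> fo (k (l a)) P" .
qed (use k l pre_cl in blast)+

lemma pre_op:
  assumes i: "i < 11" "\<And>x Z. opT g i x Z \<longleftrightarrow> k x \<epsilon> Z" and T: "TM (\<lambda>e. k (e 0))"
    and cl: "\<And>x. x \<epsilon> U \<Longrightarrow> k x \<epsilon> U" "\<And>x. x \<epsilon> U' \<Longrightarrow> k x \<epsilon> U'"
  shows "pre k"
  unfolding pre_def
proof (intro conjI allI impI)
  fix P :: "'v \<Rightarrow> bool" and a assume P: "DP (\<lambda>e. P (e 0))" and a: "a \<epsilon> U'"
  have DPk: "DP (\<lambda>e. P (k (e 0)))" by (rule DP_app1[OF P T])
  have "fo a (\<lambda>x. P (k x)) \<longleftrightarrow> opT g i a (app h (Sep U P))"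
    by (rule fo_op) (use i P DPk a cl Sep_sub in auto)
  then show "fo a (\<lambda>x. P (k x)) \<longleftrightarrow> fo (k a) P" unfolding fo_def i(2) .
qed (use assms in auto)

lemma pre_basic: "pre (\<lambda>x. pair x x)" "pre (\<lambda>x. pair (pi1 (pi1 x)) (pi2 x))" "pre (\<lambda>x. pair (pi2 (pi1 x)) (pi2 x))"
  "pre (\<lambda>x. pair (pi2 x) (pi1 x))" "pre pi1"
  by (rule pre_op[where i=3], auto simp: opT_def)
    (rule pre_op[where i=4], auto simp: opT_def,
     rule pre_op[where i=5], auto simp: opT_def,
     rule pre_op[where i=6], auto simp: opT_def,
     rule pre_op[where i=7], auto simp: opT_def)

lemma pre_pi2: "pre pi2"
  using pre_comp[OF pre_basic(5,4)] by simp

abbreviation PR where "PR \<equiv> prj pi1 pi2"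

lemma PR_basic: "PR (\<lambda>x. x)" "PR pi1" "PR pi2" "PR (\<lambda>x. pi1 (pi1 x))" "PR (\<lambda>x. pi2 (pi1 x))"
  "PR (\<lambda>x. pi1 (pi2 x))" "PR (\<lambda>x. pi2 (pi2 x))"
  using prj.intros(1)[of pi1 pi2] prj.intros(2)[OF prj.intros(1), of pi1 pi2] prj.intros(3)[OF prj.intros(1), of pi1 pi2]
    prj.intros(2)[OF prj.intros(2)[OF prj.intros(1)], of pi1 pi2] prj.intros(3)[OF prj.intros(2)[OF prj.intros(1)], of pi1 pi2]
    prj.intros(2)[OF prj.intros(3)[OF prj.intros(1)], of pi1 pi2] prj.intros(3)[OF prj.intros(3)[OF prj.intros(1)], of pi1 pi2]
  by simp_all

lemma pre_PR: "PR p \<Longrightarrow> pre p"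
  by (induction rule: prj.induct) (use pre_id pre_comp[OF pre_basic(5)] pre_comp[OF pre_pi2] in auto)

lemma pre_PR1: "PR p \<Longrightarrow> pre (\<lambda>x. pair (p (pi1 x)) (pi2 x))"
proof (induction rule: prj.induct)
  case 1 show ?case using pre_comp[OF pre_basic(4,4)] by simp
next
  case (2 p) then show ?case using pre_comp[OF pre_basic(2) 2(2)] by simp
next
  case (3 p) then show ?case using pre_comp[OF pre_basic(3) 3(2)] by simp
qed

text \<open>The basic maps change one coordinate at a time: double the argument, apply
  \<open>q\<close> to the first copy, swap, apply \<open>p\<close> to the other copy.\<close>

lemma pre_pair: assumes p: "PR p" and q: "PR q" shows "pre (\<lambda>x. pair (p x) (q x))"
proof -
  have "pre (\<lambda>x. pair (q x) x)" using pre_comp[OF pre_PR1[OF q] pre_basic(1)] by simp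
  from pre_comp[OF pre_basic(4) this] have "pre (\<lambda>x. pair x (q x))" by simp
  from pre_comp[OF pre_PR1[OF p] this] show ?thesis by simp
qed

lemma fo_pair: assumes "PR p" "PR q" "DP (\<lambda>e. P (e 0))" "d \<epsilon> U'"
  shows "fo (pair (p d) (q d)) P \<longleftrightarrow> fo d (\<lambda>x. P (pair (p x) (q x)))"
  using preD[OF pre_pair[OF assms(1,2)] assms(3,4)] by simp

subsection \<open>The ultrapower relation\<close>

text \<open>The classes of \<open>(a, f)\<close> and \<open>(c, k)\<close> have different generators
  and are compared over the common generator \<open>pair a c\<close>.\<close>

definition memS :: "'v \<Rightarrow> 'v \<Rightarrow> 'v \<Rightarrow> 'v \<Rightarrow> bool" where
  "memS a f c k \<longleftrightarrow> fo (pair a c) (\<lambda>z. app f (pi1 z) \<epsilon> app k (pi2 z))"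
definition eqS :: "'v \<Rightarrow> 'v \<Rightarrow> 'v \<Rightarrow> 'v \<Rightarrow> bool" where
  "eqS a f c k \<longleftrightarrow> fo (pair a c) (\<lambda>z. app f (pi1 z) = app k (pi2 z))"

lemma DP_memS [simp]: "TM a \<Longrightarrow> TM f \<Longrightarrow> TM c \<Longrightarrow> TM k \<Longrightarrow> DP (\<lambda>e. memS (a e) (f e) (c e) (k e))"
  and DP_eqS [simp]: "TM a \<Longrightarrow> TM f \<Longrightarrow> TM c \<Longrightarrow> TM k \<Longrightarrow> DP (\<lambda>e. eqS (a e) (f e) (c e) (k e))"
  unfolding memS_def eqS_def by (simp_all add: TM_sh)

lemma memS_at: assumes "d \<epsilon> U'" "PR p" "PR q"
  shows "memS (p d) f (q d) k \<longleftrightarrow> fo d (\<lambda>x. app f (p x) \<epsilon> app k (q x))"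
  unfolding memS_def using fo_pair[OF assms(2,3) _ assms(1), of "\<lambda>z. app f (pi1 z) \<epsilon> app k (pi2 z)"] by simp
lemma eqS_at: assumes "d \<epsilon> U'" "PR p" "PR q"
  shows "eqS (p d) f (q d) k \<longleftrightarrow> fo d (\<lambda>x. app f (p x) = app k (q x))"
  unfolding eqS_def using fo_pair[OF assms(2,3) _ assms(1), of "\<lambda>z. app f (pi1 z) = app k (pi2 z)"] by simp

lemma eqS_sym: assumes "a \<epsilon> U'" "c \<epsilon> U'" "eqS a f c k" shows "eqS c k a f"
proof -
  have d: "pair a c \<epsilon> U'" using assms by blast
  have "fo (pair a c) (\<lambda>x. app f (pi1 x) = app k (pi2 x))" using assms(3) unfolding eqS_def .
  then have "fo (pair a c) (\<lambda>x. app k (pi2 x) = app f (pi1 x))" by (simp add: eq_commute)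
  then show ?thesis using eqS_at[OF d PR_basic(3,2), of k f] by simp
qed

text \<open>Three classes are compared over one generator that projects to all of theirs;
  \<open>eqS_at\<close> changes the generator.\<close>

lemma eqS_trans: assumes U: "a \<epsilon> U'" "c \<epsilon> U'" "d \<epsilon> U'" and e: "eqS a f c k" "eqS c k d m" shows "eqS a f d m"
proof -
  let ?d = "pair (pair a c) d"
  have d: "?d \<epsilon> U'" using U by blast
  have "fo ?d (\<lambda>x. app f (pi1 (pi1 x)) = app k (pi2 (pi1 x)))" "fo ?d (\<lambda>x. app k (pi2 (pi1 x)) = app m (pi2 x))"
    using eqS_at[OF d PR_basic(4,5), of f k] eqS_at[OF d PR_basic(5,3), of k m] e by simp_all
  then have "fo ?d (\<lambda>x. app f (pi1 (pi1 x)) = app k (pi2 (pi1 x)) \<and> app k (pi2 (pi1 x)) = app m (pi2 x))"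
    by (subst fo_conj) (use d in auto)
  then have "fo ?d (\<lambda>x. app f (pi1 (pi1 x)) = app m (pi2 x))" by (rule fo_mono) (use d in auto)
  then show ?thesis using eqS_at[OF d PR_basic(4,3), of f m] by simp
qed

lemma memS_cong: assumes U: "a \<epsilon> U'" "a' \<epsilon> U'" "c \<epsilon> U'" "c' \<epsilon> U'" and e: "eqS a f a' f'" "eqS c k c' k'" "memS a f c k"
  shows "memS a' f' c' k'"
proof -
  let ?d = "pair (pair a a') (pair c c')"
  have d: "?d \<epsilon> U'" using U by blast
  have "fo ?d (\<lambda>x. app f (pi1 (pi1 x)) = app f' (pi2 (pi1 x)))" "fo ?d (\<lambda>x. app k (pi1 (pi2 x)) = app k' (pi2 (pi2 x)))"
    "fo ?d (\<lambda>x. app f (pi1 (pi1 x)) \<epsilon> app k (pi1 (pi2 x)))"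
    using eqS_at[OF d PR_basic(4,5), of f f'] eqS_at[OF d PR_basic(6,7), of k k']
      memS_at[OF d PR_basic(4,6), of f k] e by simp_all
  then have "fo ?d (\<lambda>x. app f (pi1 (pi1 x)) = app f' (pi2 (pi1 x)) \<and> app k (pi1 (pi2 x)) = app k' (pi2 (pi2 x)) \<and>
    app f (pi1 (pi1 x)) \<epsilon> app k (pi1 (pi2 x)))"
    by (subst fo_conj, simp_all add: d, subst fo_conj, simp_all add: d)
  then have "fo ?d (\<lambda>x. app f' (pi2 (pi1 x)) \<epsilon> app k' (pi2 (pi2 x)))" by (rule fo_mono) (use d in auto)
  then show ?thesis using memS_at[OF d PR_basic(5,7), of f' k'] by simp
qed

lemma eqS_refl: "a \<epsilon> U' \<Longrightarrow> eqS a f a f"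
  using eqS_at[of a "\<lambda>x. x" "\<lambda>x. x" f f] PR_basic(1) by simp

lemma eqS_pi1: "a \<epsilon> U' \<Longrightarrow> c \<epsilon> U' \<Longrightarrow> eqS a f (pair a c) (lam U (\<lambda>z. app f (pi1 z)))"
proof -
  assume U: "a \<epsilon> U'" "c \<epsilon> U'"
  then have d: "pair a c \<epsilon> U'" by blast
  have "fo (pair a c) (\<lambda>x. app f (pi1 x) = app (lam U (\<lambda>z. app f (pi1 z))) x)"
    by (rule fo_all) (use d in auto)
  then show ?thesis using eqS_at[OF d PR_basic(2,1), of f "lam U (\<lambda>z. app f (pi1 z))"] by simp
qed

lemma eqS_pi2: "a \<epsilon> U' \<Longrightarrow> c \<epsilon> U' \<Longrightarrow> eqS c f (pair a c) (lam U (\<lambda>z. app f (pi2 z)))"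
proof -
  assume U: "a \<epsilon> U'" "c \<epsilon> U'"
  then have d: "pair a c \<epsilon> U'" by blast
  have "fo (pair a c) (\<lambda>x. app f (pi2 x) = app (lam U (\<lambda>z. app f (pi2 z))) x)"
    by (rule fo_all) (use d in auto)
  then show ?thesis using eqS_at[OF d PR_basic(3,1), of f "lam U (\<lambda>z. app f (pi2 z))"] by simp
qed

lemma fo_choice: assumes P: "DP (\<lambda>e. P (e 0) (e 1))" and a: "a \<epsilon> U'" "fo a (\<lambda>x. \<exists>y. P x y)"
  obtains m where "function_on mem m U" "fo a (\<lambda>x. P x (app m x))"
proof -
  have [simp]: "TM t \<Longrightarrow> TM r \<Longrightarrow> DP (\<lambda>e. P (t e) (r e))" for t r by (rule DP_app2[OF P])
  have D: "DP (\<lambda>e. (\<exists>y. P (e 0) y) \<longrightarrow> P (e 0) (e 1))" by simp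
  have "\<exists>y. (\<exists>y. P x y) \<longrightarrow> P x y" for x by blast
  then obtain m where m: "function_on mem m U" "\<And>x. x \<epsilon> U \<Longrightarrow> (\<exists>y. P x y) \<longrightarrow> P x (app m x)"
    using choice[OF D, of U] by metis
  have "fo a (\<lambda>x. P x (app m x))" by (rule fo_mono[OF a(2)]) (use m a in auto)
  then show thesis using that m(1) by blast
qed

lemma neq_ext: "x \<noteq> y \<Longrightarrow> (\<exists>w. w \<epsilon> x \<and> \<not> w \<epsilon> y) \<or> (\<exists>w. w \<epsilon> y \<and> \<not> w \<epsilon> x)"
  using ext by blast

text \<open>Extensionality of the ultrapower. Where two values differ, choice picks an element of
  one of them outside the other, and the picked elements represent the distinguishing class.\<close>

lemma extS: assumes U: "a \<epsilon> U'" "c \<epsilon> U'" and ne: "\<not> eqS a f c k"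
  obtains d m where "d \<epsilon> U'" "function_on mem m U" "memS d m a f \<longleftrightarrow> \<not> memS d m c k"
proof -
  let ?d = "pair a c"
  have d: "?d \<epsilon> U'" using U by blast
  have "\<not> fo ?d (\<lambda>x. app f (pi1 x) = app k (pi2 x))" using ne unfolding eqS_def .
  then have "fo ?d (\<lambda>x. \<not> app f (pi1 x) = app k (pi2 x))" by (subst fo_not) (use d in auto)
  then have "fo ?d (\<lambda>x. (\<exists>y. y \<epsilon> app f (pi1 x) \<and> \<not> y \<epsilon> app k (pi2 x)) \<or> (\<exists>y. y \<epsilon> app k (pi2 x) \<and> \<not> y \<epsilon> app f (pi1 x)))"
    by (rule fo_mono) (use d neq_ext in auto)
  then consider "fo ?d (\<lambda>x. \<exists>y. y \<epsilon> app f (pi1 x) \<and> \<not> y \<epsilon> app k (pi2 x))"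
    | "fo ?d (\<lambda>x. \<exists>y. y \<epsilon> app k (pi2 x) \<and> \<not> y \<epsilon> app f (pi1 x))"
    by (subst (asm) fo_disj) (use d in auto)
  then show thesis
  proof cases
    case 1
    obtain m where m: "function_on mem m U" "fo ?d (\<lambda>x. app m x \<epsilon> app f (pi1 x) \<and> \<not> app m x \<epsilon> app k (pi2 x))"
      by (rule fo_choice[OF _ d 1]) simp_all
    then have "memS ?d m a f" "\<not> memS ?d m c k"
      using memS_at[OF d PR_basic(1,2), of m f] memS_at[OF d PR_basic(1,3), of m k] d
      by (simp_all add: fo_conj fo_not)
    then show ?thesis using that d m(1) by blast
  next
    case 2
    obtain m where m: "function_on mem m U" "fo ?d (\<lambda>x. app m x \<epsilon> app k (pi2 x) \<and> \<not> app m x \<epsilon> app f (pi1 x))"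
      by (rule fo_choice[OF _ d 2]) simp_all
    then have "memS ?d m c k" "\<not> memS ?d m a f"
      using memS_at[OF d PR_basic(1,2), of m f] memS_at[OF d PR_basic(1,3), of m k] d
      by (simp_all add: fo_conj fo_not)
    then show ?thesis using that d m(1) by blast
  qed
qed

definition idU :: 'v where "idU = lam U (\<lambda>x. x)"

lemma idU [simp]: "x \<epsilon> U \<Longrightarrow> app idU x = x" "function_on mem idU U"
  unfolding idU_def by simp_all

lemma idU_pi [simp]: "x \<epsilon> U \<Longrightarrow> app idU (pi1 x) = pi1 x" "x \<epsilon> U \<Longrightarrow> app idU (pi2 x) = pi2 x"
  by (intro idU(1) U_cl; assumption)+

lemma memS_id: assumes "a \<epsilon> U'" "c \<epsilon> U'" shows "memS a idU c idU \<longleftrightarrow> a \<epsilon> c"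
proof -
  have d: "pair a c \<epsilon> U'" using assms by blast
  have "memS a idU c idU \<longleftrightarrow> fo (pair a c) (\<lambda>z. pi1 z \<epsilon> pi2 z)" unfolding memS_def by (rule fo_cong) auto
  also have "\<dots> \<longleftrightarrow> opT g 9 (pair a c) (app h emp)" by (rule fo_op) (use d in \<open>auto simp: opT_def\<close>)
  finally show ?thesis by (simp add: opT_def)
qed

text \<open>Operation 8 expresses membership of the value in the second coordinate as a search
  through that coordinate; \<open>h\<close> turns the search into an actual element \<open>w\<close>
  of \<open>c\<close>. It follows in \<open>cc_id\<close> that the identity classes collapse to
  their generators.\<close>

lemma memS_normal: assumes U: "a \<epsilon> U'" "c \<epsilon> U'" and m: "memS a f c idU"
  obtains w where "w \<epsilon> c" "eqS a f w idU"
proof -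
  have d: "pair a c \<epsilon> U'" using U by blast
  let ?Z = "Sep U (\<lambda>z. app f (pi1 z) = pi2 z)"
  have "fo (pair a c) (\<lambda>z. app f (pi1 z) \<epsilon> pi2 z)"
    using m unfolding memS_def by (subst fo_cong[where Q="\<lambda>z. app f (pi1 z) \<epsilon> app idU (pi2 z)"]) auto
  moreover have "fo (pair a c) (\<lambda>z. app f (pi1 z) \<epsilon> pi2 z) \<longleftrightarrow> opT g 8 (pair a c) (app h ?Z)"
  proof (rule fo_op)
    fix x assume x: "x \<epsilon> U"
    have "pair (pi1 x) w \<epsilon> U" if "w \<epsilon> pi2 x" for w
      using V_trD[OF lim(3) U_cl(3)[OF x] that] x by blast
    then show "app f (pi1 x) \<epsilon> pi2 x \<longleftrightarrow> opT g 8 x ?Z" by (auto simp: opT_def)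
  qed (use d in \<open>auto simp: subset_of_def\<close>)
  ultimately obtain w where w: "w \<epsilon> c" "pair a w \<epsilon> app h ?Z" by (auto simp: opT_def)
  have wU: "w \<epsilon> U'" using w U V_trD lim by blast
  have "fo (pair a w) (\<lambda>z. app f (pi1 z) = pi2 z)" using w(2) unfolding fo_def .
  then have "eqS a f w idU" unfolding eqS_def by (subst fo_cong[where Q="\<lambda>z. app f (pi1 z) = pi2 z"]) auto
  then show thesis using that w by blast
qed

section \<open>Natural numbers are represented by themselves\<close>

lemma fo_finite: "n \<epsilon> om \<Longrightarrow> \<forall>c f. c \<epsilon> U' \<longrightarrow> fo c (\<lambda>x. app f x \<epsilon> n) \<longrightarrow> (\<exists>m. m \<epsilon> n \<and> fo c (\<lambda>x. app f x = m))"
proof (induction n rule: om_induct)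
  case (succ n)
  show ?case
  proof (intro allI impI)
    fix c f assume c: "c \<epsilon> U'" "fo c (\<lambda>x. app f x \<epsilon> succ n)"
    then have "fo c (\<lambda>x. app f x \<epsilon> n) \<or> fo c (\<lambda>x. app f x = n)" by (simp add: fo_disj)
    then show "\<exists>m. m \<epsilon> succ n \<and> fo c (\<lambda>x. app f x = m)" using succ c by auto
  qed
qed auto

text \<open>Otherwise almost every \<open>x\<close> for the ultrafilter at \<open>n\<close> has an
  element outside \<open>n\<close> or lacks an element of \<open>n\<close>. By normality in the
  first case and by \<open>fo_finite\<close> in the second, that element is represented by some
  member of \<open>n\<close>, where the hypothesis \<open>IH\<close> gives a contradiction.\<close>

lemma fo_om_step: assumes n: "n \<epsilon> om" and IH: "\<And>m. m \<epsilon> n \<Longrightarrow> fo m (\<lambda>x. x = m)" shows "fo n (\<lambda>x. x = n)"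
proof (rule ccontr)
  have nU: "n \<epsilon> U'" using n om_U by blast
  assume "\<not> fo n (\<lambda>x. x = n)"
  then have "fo n (\<lambda>x. \<not> x = n)" using nU by (simp add: fo_not)
  then have "fo n (\<lambda>x. (\<exists>y. y \<epsilon> x \<and> \<not> y \<epsilon> n) \<or> (\<exists>m. m \<epsilon> n \<and> \<not> m \<epsilon> x))"
    by (rule fo_mono) (use nU neq_ext in auto)
  then consider "fo n (\<lambda>x. \<exists>y. y \<epsilon> x \<and> \<not> y \<epsilon> n)" | "fo n (\<lambda>x. \<exists>m. m \<epsilon> n \<and> \<not> m \<epsilon> x)"
    using nU by (auto simp: fo_disj)
  then show False
  proof cases
    case 1
    obtain f where f: "function_on mem f U" "fo n (\<lambda>x. app f x \<epsilon> x \<and> \<not> app f x \<epsilon> n)"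
      by (rule fo_choice[OF _ nU 1]) simp_all
    then have f2: "fo n (\<lambda>x. app f x \<epsilon> x)" "fo n (\<lambda>x. \<not> app f x \<epsilon> n)" using nU by (simp_all add: fo_conj)
    have "fo n (\<lambda>x. app f x \<epsilon> app idU x)" by (rule fo_mono[OF f2(1)]) (use nU in auto)
    then have "memS n f n idU" using memS_at[OF nU PR_basic(1,1), of f idU] by simp
    then obtain w where w: "w \<epsilon> n" "eqS n f w idU" using memS_normal[OF nU nU] by blast
    have wU: "w \<epsilon> U'" using w(1) n om_trans om_U by blast
    then have d: "pair n w \<epsilon> U'" using nU by blast
    have a: "fo (pair n w) (\<lambda>z. app f (pi1 z) = app idU (pi2 z))" using w(2) unfolding eqS_def .
    have b: "fo (pair n w) (\<lambda>z. \<not> app f (pi1 z) \<epsilon> n)"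
      using preD[OF pre_PR[OF PR_basic(2)] _ d, of "\<lambda>x. \<not> app f x \<epsilon> n"] f2(2) by simp
    have c: "fo (pair n w) (\<lambda>z. pi2 z = w)"
      using preD[OF pre_PR[OF PR_basic(3)] _ d, of "\<lambda>x. x = w"] IH[OF w(1)] by simp
    have "fo (pair n w) (\<lambda>z. app f (pi1 z) = app idU (pi2 z) \<and> \<not> app f (pi1 z) \<epsilon> n \<and> pi2 z = w)"
      using a b c d by (simp add: fo_conj)
    then have "fo (pair n w) (\<lambda>z. False)" by (rule fo_mono) (use d w(1) in auto)
    then show False using d by simp
  next
    case 2
    obtain f where f: "function_on mem f U" "fo n (\<lambda>x. app f x \<epsilon> n \<and> \<not> app f x \<epsilon> x)"
      by (rule fo_choice[OF _ nU 2]) simp_all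
    then have f2: "fo n (\<lambda>x. app f x \<epsilon> n)" "fo n (\<lambda>x. \<not> app f x \<epsilon> x)" using nU by (simp_all add: fo_conj)
    then obtain m where m: "m \<epsilon> n" "fo n (\<lambda>x. app f x = m)" using fo_finite[OF n] nU by blast
    have mU: "m \<epsilon> U'" using m(1) n om_trans om_U by blast
    then have d: "pair m n \<epsilon> U'" using nU by blast
    have "fo n (\<lambda>x. \<not> app f x \<epsilon> x \<and> app f x = m)" using f2(2) m(2) nU by (simp add: fo_conj)
    then have "fo n (\<lambda>x. \<not> m \<epsilon> x)" by (rule fo_mono) (use nU in auto)
    then have a: "fo (pair m n) (\<lambda>z. \<not> m \<epsilon> pi2 z)"
      using preD[OF pre_PR[OF PR_basic(3)] _ d, of "\<lambda>x. \<not> m \<epsilon> x"] by simp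
    have b: "fo (pair m n) (\<lambda>z. pi1 z = m)"
      using preD[OF pre_PR[OF PR_basic(2)] _ d, of "\<lambda>x. x = m"] IH[OF m(1)] by simp
    have c: "fo (pair m n) (\<lambda>z. app idU (pi1 z) \<epsilon> app idU (pi2 z))"
      using memS_id[OF mU nU] m(1) unfolding memS_def by simp
    have "fo (pair m n) (\<lambda>z. \<not> m \<epsilon> pi2 z \<and> pi1 z = m \<and> app idU (pi1 z) \<epsilon> app idU (pi2 z))"
      using a b c d by (simp add: fo_conj)
    then have "fo (pair m n) (\<lambda>z. False)" by (rule fo_mono) (use d in auto)
    then show False using d by simp
  qed
qed

lemma fo_om: assumes "n \<epsilon> om" shows "fo n (\<lambda>x. x = n)"
proof -
  have "\<forall>m. m \<epsilon> n \<longrightarrow> fo m (\<lambda>x. x = m)"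
    using assms
  proof (induction n rule: om_induct)
    case (succ n)
    then show ?case using fo_om_step[of n] by auto
  qed simp_all
  then show ?thesis using fo_om_step assms by blast
qed

section \<open>Classes of the ultrapower and well-foundedness\<close>

definition el :: "'v \<Rightarrow> bool" where "el x \<longleftrightarrow> (\<exists>a f. a \<epsilon> U' \<and> function_on mem f U \<and> x = pair a f)"

lemma DP_el [simp]: "TM x \<Longrightarrow> DP (\<lambda>e. el (x e))"
  by (rule DP_app1[where P=el]) (unfold el_def, simp_all)

abbreviation mS where "mS x y \<equiv> memS (pi1 x) (pi2 x) (pi1 y) (pi2 y)"
abbreviation eS where "eS x y \<equiv> eqS (pi1 x) (pi2 x) (pi1 y) (pi2 y)"

lemma el_D: "el x \<Longrightarrow> pi1 x \<epsilon> U'" "el x \<Longrightarrow> function_on mem (pi2 x) U" "el x \<Longrightarrow> x = pair (pi1 x) (pi2 x)"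
  unfolding el_def by auto

lemma el_pair [simp]: "el (pair a f) \<longleftrightarrow> a \<epsilon> U' \<and> function_on mem f U"
  unfolding el_def by auto

text \<open>A descending sequence of classes with generators a_n and functions f_n defines on
  \<open>U\<close> the relation of (n+1, u) to (n, v) given by membership of f_{n+1}(u) in f_n(v).
  It is well-founded, hence so is its image under \<open>h\<close>, although the points (n, a_n)
  descend along that image. The tags n let one set cover all steps, and \<open>fo_om\<close> carries
  them over to \<open>U'\<close>.\<close>

lemma mS_wf: assumes K: "K \<noteq> emp" "\<And>x. x \<epsilon> K \<Longrightarrow> el x"
  shows "\<exists>m. m \<epsilon> K \<and> (\<forall>y. y \<epsilon> K \<longrightarrow> \<not> mS y m)"
proof (rule ccontr)
  assume n: "\<not> ?thesis"
  have DK: "DP (\<lambda>e. e 1 \<epsilon> K \<and> mS (e 1) (e 0))" by simp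
  have "\<exists>y. y \<epsilon> K \<and> mS y x" if "x \<epsilon> K" for x using n that by blast
  then obtain c where c: "\<And>x. x \<epsilon> K \<Longrightarrow> app c x \<epsilon> K \<and> mS (app c x) x"
    using choice[OF DK, of K] by blast
  obtain x0 where x0: "x0 \<epsilon> K" using K nonempty by blast
  define s where "s = iter (\<lambda>x. app c x) x0"
  have T: "TM (\<lambda>e. app c (e 0))" by simp
  have Ts [simp]: "TM t \<Longrightarrow> TM (\<lambda>e. s (t e))" for t unfolding s_def by (rule iter(1)[OF T])
  have s0: "s emp = x0" and s1: "n \<epsilon> om \<Longrightarrow> s (succ n) = app c (s n)" for n
    unfolding s_def using iter(2,3)[OF T] by blast+
  have sK: "n \<epsilon> om \<Longrightarrow> s n \<epsilon> K" for n
    by (induction n rule: om_induct) (use s0 s1 x0 c in auto)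
  have sm: "n \<epsilon> om \<Longrightarrow> mS (s (succ n)) (s n)" for n using c[OF sK] s1 by auto
  have aU: "n \<epsilon> om \<Longrightarrow> pi1 (s n) \<epsilon> U'" for n using sK K(2) el_D(1) by blast
  define Q where "Q n q \<longleftrightarrow> pi1 (pi1 q) = succ n \<and> pi1 (pi2 q) = n \<and>
    app (pi2 (s (succ n))) (pi2 (pi1 q)) \<epsilon> app (pi2 (s n)) (pi2 (pi2 q))" for n q
  have DQ [simp]: "TM t \<Longrightarrow> TM r \<Longrightarrow> DP (\<lambda>e. Q (t e) (r e))" for t r
    by (rule DP_app2[where P=Q]) (unfold Q_def, simp_all)
  let ?X = "Sep U (\<lambda>q. \<exists>n. n \<epsilon> om \<and> Q n q)"
  have "wfd (Pow U) ?X" unfolding wfd_def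
  proof (intro allI impI)
    fix A assume A: "A \<noteq> emp"
    \<comment> \<open>Pairs in \<open>?X\<close> are mapped to pairs in the membership relation, so
      Foundation for the image of \<open>A\<close> supplies a minimal element.\<close>
    let ?v = "\<lambda>m. app (pi2 (s (pi1 m))) (pi2 m)"
    obtain m0 where "m0 \<epsilon> A" using A nonempty by blast
    then have "?v m0 \<epsilon> Im A ?v" by auto
    then have "Im A ?v \<noteq> emp" by (metis emp)
    then obtain v where v: "v \<epsilon> Im A ?v" "\<forall>w. w \<epsilon> v \<longrightarrow> \<not> w \<epsilon> Im A ?v" using foundation by blast
    then obtain m where m: "m \<epsilon> A" "v = ?v m" by auto
    have "\<not> pair y m \<epsilon> ?X" if y: "y \<epsilon> A" for y
    proof
      assume "pair y m \<epsilon> ?X"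
      then have "?v y \<epsilon> ?v m" by (auto simp: Q_def)
      moreover have "?v y \<epsilon> Im A ?v" using y by auto
      ultimately show False using v(2) m(2) by blast
    qed
    then show "\<exists>m. m \<epsilon> A \<and> (\<forall>y. y \<epsilon> A \<longrightarrow> \<not> pair y m \<epsilon> ?X)" using m by blast
  qed
  then have w: "wfd (Pow U') (app h ?X)"
    using gh Sep_sub unfolding good_def goodh_def by simp
  let ?A = "Im om (\<lambda>n. pair n (pi1 (s n)))"
  have "?A \<sqsubseteq> U'" using aU om_U by (auto simp: subset_of_def)
  moreover have "pair emp (pi1 (s emp)) \<epsilon> ?A" using om(1) by auto
  then have "?A \<noteq> emp" by (metis emp)
  ultimately obtain m where m: "m \<epsilon> ?A" "\<And>y. y \<epsilon> ?A \<Longrightarrow> \<not> pair y m \<epsilon> app h ?X" using w unfolding wfd_def by auto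
  then obtain n where n: "n \<epsilon> om" "m = pair n (pi1 (s n))" by auto
  let ?y = "pair (succ n) (pi1 (s (succ n)))"
  have sn: "succ n \<epsilon> om" using n om by blast
  have "?y \<epsilon> ?A" using sn by auto
  then have no: "\<not> pair ?y m \<epsilon> app h ?X" using m(2) by blast
  let ?q = "pair ?y m"
  have q: "?q \<epsilon> U'" using n sn aU om_U by blast
  have "fo ?q (\<lambda>x. pi1 (pi1 x) = succ n)"
    using preD[OF pre_PR[OF PR_basic(4)] _ q, of "\<lambda>x. x = succ n"] fo_om[OF sn] by simp
  moreover have "fo ?q (\<lambda>x. pi1 (pi2 x) = n)"
    using preD[OF pre_PR[OF PR_basic(6)] _ q, of "\<lambda>x. x = n"] fo_om[OF n(1)] n(2) by simp
  moreover have "fo ?q (\<lambda>x. app (pi2 (s (succ n))) (pi2 (pi1 x)) \<epsilon> app (pi2 (s n)) (pi2 (pi2 x)))"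
    using memS_at[OF q PR_basic(5,7), of "pi2 (s (succ n))" "pi2 (s n)"] sm[OF n(1)] n(2) by simp
  ultimately have "fo ?q (\<lambda>x. pi1 (pi1 x) = succ n \<and> pi1 (pi2 x) = n \<and> app (pi2 (s (succ n))) (pi2 (pi1 x)) \<epsilon> app (pi2 (s n)) (pi2 (pi2 x)))"
    using q by (simp add: fo_conj)
  then have "fo ?q (\<lambda>q. \<exists>n. n \<epsilon> om \<and> Q n q)" by (rule fo_mono) (use q n(1) in \<open>auto simp: Q_def\<close>)
  then show False using no unfolding fo_def by simp
qed

end

context ultra
begin

subsection \<open>Collapse and Los theorem\<close>

text \<open>The pairs below \<open>x\<close> need not form a set. Restricting the functions to
  elements of values of the function of \<open>x\<close>, with \<open>emp\<close> as a default
  value, leaves a set that still meets every class below \<open>x\<close>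
  (\<open>trunc\<close>).\<close>

definition Ext :: "'v \<Rightarrow> 'v" where
  "Ext x = (if el x then Sep (Prod U' (Funs U (cup (Uni (ran (pi2 x))) one))) (\<lambda>y. mS y x) else emp)"

lemma mem_Ext: "y \<epsilon> Ext x \<longleftrightarrow> el x \<and> el y \<and> (\<forall>z. z \<epsilon> U \<longrightarrow> app (pi2 y) z \<epsilon> cup (Uni (ran (pi2 x))) one) \<and> mS y x"
proof (cases "el x")
  case True
  have "(\<exists>u v. u \<epsilon> U' \<and> function_to mem v U W \<and> y = pair u v) \<longleftrightarrow> el y \<and> (\<forall>z. z \<epsilon> U \<longrightarrow> app (pi2 y) z \<epsilon> W)" for W
    unfolding el_def fn_to by auto
  then show ?thesis unfolding Ext_def using True by simp
qed (simp add: Ext_def)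

lemma TM_Ext: "TM (\<lambda>e. Ext (e 0))"
  unfolding Ext_def by simp

lemma Ext_closed: "\<exists>d. x \<epsilon> d \<and> (\<forall>y. y \<epsilon> d \<longrightarrow> Ext y \<sqsubseteq> d)"
proof -
  obtain a where a: "Ord a" "ran (pi2 x) \<epsilon> V a" using in_V_ex by blast
  define D where "D = Sep (Prod U' (Funs U (V a))) (\<lambda>y. ran (pi2 y) \<sqsubseteq> V a)"
  have D: "y \<epsilon> D \<longleftrightarrow> el y \<and> (\<forall>z. z \<epsilon> U \<longrightarrow> app (pi2 y) z \<epsilon> V a)" for y
  proof
    assume "y \<epsilon> D"
    then show "el y \<and> (\<forall>z. z \<epsilon> U \<longrightarrow> app (pi2 y) z \<epsilon> V a)" unfolding D_def el_def by (auto simp: fn_to)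
  next
    assume y: "el y \<and> (\<forall>z. z \<epsilon> U \<longrightarrow> app (pi2 y) z \<epsilon> V a)"
    then have "ran (pi2 y) \<sqsubseteq> V a" using mem_ran[OF el_D(2)] by (auto simp: subset_of_def)
    moreover have "y \<epsilon> Prod U' (Funs U (V a))" using y el_D[of y] by (auto simp: fn_to)
    ultimately show "y \<epsilon> D" unfolding D_def by simp
  qed
  have aemp: "emp \<epsilon> V a" using a(2) V_sub emp_sub by blast
  have sub: "Ext y \<sqsubseteq> D" if y: "el y" "ran (pi2 y) \<sqsubseteq> V a" for y
  proof (rule subI)
    fix z assume z: "z \<epsilon> Ext y"
    have "app (pi2 z) u \<epsilon> V a" if u: "u \<epsilon> U" for u
    proof -
      have "app (pi2 z) u \<epsilon> Uni (ran (pi2 y)) \<or> app (pi2 z) u = emp" using z u unfolding mem_Ext by auto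
      then show ?thesis using aemp V_trD[OF a(1)] subD[OF y(2)] by auto
    qed
    then show "z \<epsilon> D" using D z unfolding mem_Ext by blast
  qed
  show ?thesis
  proof (intro exI[of _ "cup (sing x) D"] conjI allI impI)
    fix y assume "y \<epsilon> cup (sing x) D"
    then have "el y \<Longrightarrow> ran (pi2 y) \<sqsubseteq> V a" using V_tr[OF a] unfolding D_def by auto
    then have "Ext y \<sqsubseteq> D" using sub by (cases "el y") (auto simp: Ext_def)
    then show "Ext y \<sqsubseteq> cup (sing x) D" by (auto simp: subset_of_def)
  qed simp
qed

lemma Ext_wf: "d \<noteq> emp \<Longrightarrow> \<exists>m. m \<epsilon> d \<and> (\<forall>y. y \<epsilon> d \<longrightarrow> \<not> y \<epsilon> Ext m)"
  using mS_wf[of d] mem_Ext by blast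

sublocale wfr mem Ext "\<lambda>x g. ran g"
  by unfold_locales (use TM_Ext Ext_closed Ext_wf in simp_all)

definition cc :: "'v \<Rightarrow> 'v" where "cc = wfrec Ext (\<lambda>x g. ran g)"

lemma TM_cc [simp]: "TM t \<Longrightarrow> TM (\<lambda>e. cc (t e))"
  unfolding cc_def by (rule TM_wfrec)

lemma mem_cc: "z \<epsilon> cc x \<longleftrightarrow> (\<exists>y. y \<epsilon> Ext x \<and> z = cc y)"
proof -
  have "cc x = ran (lam (Ext x) cc)" unfolding cc_def by (rule wfrec)
  then show ?thesis by simp
qed

lemma eS_sym: "el x \<Longrightarrow> el y \<Longrightarrow> eS x y \<Longrightarrow> eS y x" using eqS_sym el_D by blast
lemma eS_trans: "el x \<Longrightarrow> el y \<Longrightarrow> el z \<Longrightarrow> eS x y \<Longrightarrow> eS y z \<Longrightarrow> eS x z" using eqS_trans el_D by meson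
lemma eS_refl: "el x \<Longrightarrow> eS x x" using eqS_refl el_D by blast
lemma mS_cong: "el x \<Longrightarrow> el x' \<Longrightarrow> el y \<Longrightarrow> el y' \<Longrightarrow> eS x x' \<Longrightarrow> eS y y' \<Longrightarrow> mS x y \<Longrightarrow> mS x' y'"
  using memS_cong el_D by meson

lemma trunc: assumes x: "el x" and y: "el y" and m: "mS y x"
  obtains y' where "y' \<epsilon> Ext x" "eS y y'" "el y'"
proof -
  let ?W = "cup (Uni (ran (pi2 x))) one"
  let ?k = "lam U (\<lambda>z. if app (pi2 y) z \<epsilon> ?W then app (pi2 y) z else emp)"
  let ?y = "pair (pi1 y) ?k"
  have d: "pair (pi1 y) (pi1 x) \<epsilon> U'" using x y el_D by blast
  have yU: "pi1 y \<epsilon> U'" using y el_D by blast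
  have "fo (pair (pi1 y) (pi1 x)) (\<lambda>z. app (pi2 y) (pi1 z) \<epsilon> ?W)"
    by (rule fo_mono[OF m[unfolded memS_def]]) (use d mem_ran[OF el_D(2)[OF x]] in auto)
  then have "fo (pi1 y) (\<lambda>z. app (pi2 y) z \<epsilon> ?W)"
    using preD[OF pre_PR[OF PR_basic(2)] _ d, of "\<lambda>z. app (pi2 y) z \<epsilon> ?W"] by (simp del: mem_cup)
  then have "fo (pi1 y) (\<lambda>z. app (pi2 y) z = app ?k z)" by (rule fo_mono) (use yU in auto)
  then have e: "eS y ?y" using eqS_at[OF yU PR_basic(1,1), of "pi2 y" ?k] by simp
  have el: "el ?y" using yU by simp
  have "mS ?y x" by (rule mS_cong[OF y el x x e eS_refl[OF x] m])
  then have "?y \<epsilon> Ext x" using el x unfolding mem_Ext by simp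
  then show thesis using that e el by blast
qed

lemma cc_eq1: "\<forall>y. el x \<and> el y \<and> eS x y \<longrightarrow> cc x = cc y"
proof (rule wf_induct[of _ x])
  fix x assume IH: "\<And>z. z \<epsilon> Ext x \<Longrightarrow> \<forall>y. el z \<and> el y \<and> eS z y \<longrightarrow> cc z = cc y"
  show "\<forall>y. el x \<and> el y \<and> eS x y \<longrightarrow> cc x = cc y"
  proof (intro allI impI, elim conjE)
    fix y assume x: "el x" and y: "el y" and e: "eS x y"
    show "cc x = cc y"
    proof (rule ext)
      fix v
      show "v \<epsilon> cc x \<longleftrightarrow> v \<epsilon> cc y"
      proof
        assume "v \<epsilon> cc x"
        then obtain z where z: "z \<epsilon> Ext x" "v = cc z" unfolding mem_cc by blast
        then have zz: "el z" "mS z x" unfolding mem_Ext by auto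
        then have "mS z y" using mS_cong[OF zz(1) zz(1) x y eS_refl[OF zz(1)] e] by blast
        then obtain z' where z': "z' \<epsilon> Ext y" "eS z z'" "el z'" using trunc[OF y zz(1)] by blast
        then have "cc z = cc z'" using IH[OF z(1)] zz by blast
        then show "v \<epsilon> cc y" using z' z unfolding mem_cc by blast
      next
        assume "v \<epsilon> cc y"
        then obtain z where z: "z \<epsilon> Ext y" "v = cc z" unfolding mem_cc by blast
        then have zz: "el z" "mS z y" unfolding mem_Ext by auto
        then have "mS z x" using mS_cong[OF zz(1) zz(1) y x eS_refl[OF zz(1)] eS_sym[OF x y e]] by blast
        then obtain z' where z': "z' \<epsilon> Ext x" "eS z z'" "el z'" using trunc[OF x zz(1)] by blast
        then have "cc z' = cc z" using IH[OF z'(1)] zz eS_sym by blast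
        then show "v \<epsilon> cc x" using z' z unfolding mem_cc by metis
      qed
    qed
  qed
qed simp

text \<open>Injectivity of the collapse: by the induction hypothesis pairs with the same collapse
  have the same members, and \<open>extS\<close> separates classes that differ.\<close>

lemma cc_eq2: "\<forall>y. el x \<and> el y \<and> cc x = cc y \<longrightarrow> eS x y"
proof (rule wf_induct[of _ x])
  fix x assume IH: "\<And>z. z \<epsilon> Ext x \<Longrightarrow> \<forall>y. el z \<and> el y \<and> cc z = cc y \<longrightarrow> eS z y"
  show "\<forall>y. el x \<and> el y \<and> cc x = cc y \<longrightarrow> eS x y"
  proof (intro allI impI, elim conjE)
    fix y assume x: "el x" and y: "el y" and e: "cc x = cc y"
    have 1: "mS z y" if z: "el z" "mS z x" for z
    proof -
      obtain z' where z': "z' \<epsilon> Ext x" "eS z z'" "el z'" using trunc[OF x z] by blast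
      then have "cc z' \<epsilon> cc y" using e mem_cc by metis
      then obtain w where w: "w \<epsilon> Ext y" "cc z' = cc w" unfolding mem_cc by blast
      then have ww: "el w" "mS w y" unfolding mem_Ext by auto
      then have "eS z' w" using IH[OF z'(1)] z'(3) w by blast
      then have "eS w z" using eS_trans eS_sym z z' ww by meson
      then show ?thesis using mS_cong[OF ww(1) z(1) y y _ eS_refl[OF y] ww(2)] by blast
    qed
    have 2: "mS z x" if z: "el z" "mS z y" for z
    proof -
      obtain z' where z': "z' \<epsilon> Ext y" "eS z z'" "el z'" using trunc[OF y z] by blast
      then have "cc z' \<epsilon> cc x" using e mem_cc by metis
      then obtain w where w: "w \<epsilon> Ext x" "cc z' = cc w" unfolding mem_cc by blast
      then have ww: "el w" "mS w x" unfolding mem_Ext by auto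
      then have "eS w z'" using IH[OF w(1)] z'(3) w by metis
      then have "eS w z" using eS_trans eS_sym z z' ww by meson
      then show ?thesis using mS_cong[OF ww(1) z(1) x x _ eS_refl[OF x] ww(2)] by blast
    qed
    show "eS x y"
    proof (rule ccontr)
      assume "\<not> eS x y"
      then obtain d m where d: "d \<epsilon> U'" "function_on mem m U"
        "memS d m (pi1 x) (pi2 x) \<longleftrightarrow> \<not> memS d m (pi1 y) (pi2 y)"
        using extS[of "pi1 x" "pi1 y" "pi2 x" "pi2 y"] el_D x y by metis
      then show False using 1[of "pair d m"] 2[of "pair d m"] by auto
    qed
  qed
qed simp

lemma cc_eq: "el x \<Longrightarrow> el y \<Longrightarrow> cc x = cc y \<longleftrightarrow> eS x y"
  using cc_eq1 cc_eq2 by blast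

lemma cc_mem: assumes "el x" "el y" shows "cc y \<epsilon> cc x \<longleftrightarrow> mS y x"
proof
  assume "mS y x"
  then obtain y' where "y' \<epsilon> Ext x" "eS y y'" "el y'" using trunc assms by blast
  then show "cc y \<epsilon> cc x" using mem_cc cc_eq assms by metis
next
  assume "cc y \<epsilon> cc x"
  then obtain z where z: "z \<epsilon> Ext x" "cc y = cc z" unfolding mem_cc by blast
  then have zz: "el z" "mS z x" unfolding mem_Ext by auto
  then have "eS z y" using z(2) cc_eq assms by metis
  then show "mS y x" using mS_cong[OF zz(1) assms(2,1,1) _ eS_refl[OF assms(1)] zz(2)] by blast
qed

definition MM :: "'v set" where "MM = {z. \<exists>x. el x \<and> z = cc x}"

lemma MM_tr: "transitive_class mem MM"
  unfolding transitive_class_def MM_def using mem_cc mem_Ext by blast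

lemma cc_MM: "el x \<Longrightarrow> cc x \<in> MM" unfolding MM_def by blast

lemma DP_sat_app: "DP (\<lambda>e. sat UNIV mem p (\<lambda>i. app (F i) (e 0)))"
  by (rule DP_sat) simp

lemma DP_sat_upd: "DP (\<lambda>e. sat UNIV mem p ((\<lambda>i. app (F i) (e 0))(v := e 1)))"
proof -
  have "TM (\<lambda>e. ((\<lambda>i. app (F i) (e 0))(v := e 1)) i)" for i by (cases "i = v") auto
  from DP_sat[where t="\<lambda>i e. ((\<lambda>i. app (F i) (e 0))(v := e 1)) i", OF this] show ?thesis .
qed

text \<open>A witness brings its own generator \<open>c\<close>; it is moved together with the
  assignment to the generator \<open>pair d c\<close>, over which \<open>IH\<close> applies.
  Conversely a witness function over \<open>d\<close> comes from choice.\<close>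

lemma los_ex:
  assumes IH: "\<And>d F. d \<epsilon> U' \<Longrightarrow> (\<And>i. function_on mem (F i) U) \<Longrightarrow>
      sat MM mem p (\<lambda>i. cc (pair d (F i))) \<longleftrightarrow> fo d (\<lambda>x. sat UNIV mem p (\<lambda>i. app (F i) x))"
    and d: "d \<epsilon> U'" and F: "\<And>i. function_on mem (F i) U"
  shows "(\<exists>a\<in>MM. sat MM mem p ((\<lambda>i. cc (pair d (F i)))(v := a))) \<longleftrightarrow>
    fo d (\<lambda>x. \<exists>y. sat UNIV mem p ((\<lambda>i. app (F i) x)(v := y)))"
proof
  let ?P = "\<lambda>x y. sat UNIV mem p ((\<lambda>i. app (F i) x)(v := y))"
  have P [simp]: "TM t \<Longrightarrow> TM r \<Longrightarrow> DP (\<lambda>e. ?P (t e) (r e))" for t r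
    by (rule DP_app2[where P="?P"]) (rule DP_sat_upd)
  assume "\<exists>a\<in>MM. sat MM mem p ((\<lambda>i. cc (pair d (F i)))(v := a))"
  then obtain c k where k: "c \<epsilon> U'" "function_on mem k U" "sat MM mem p ((\<lambda>i. cc (pair d (F i)))(v := cc (pair c k)))"
    unfolding MM_def el_def by auto
  let ?d = "pair d c"
  let ?F = "\<lambda>i. if i = v then lam U (\<lambda>z. app k (pi2 z)) else lam U (\<lambda>z. app (F i) (pi1 z))"
  have dU: "?d \<epsilon> U'" using d k by blast
  have "cc (pair d (F i)) = cc (pair ?d (lam U (\<lambda>z. app (F i) (pi1 z))))" for i
    using eqS_pi1[OF d k(1), of "F i"] d F dU by (subst cc_eq) auto
  moreover have "cc (pair c k) = cc (pair ?d (lam U (\<lambda>z. app k (pi2 z))))"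
    using eqS_pi2[OF d k(1), of k] k dU by (subst cc_eq) auto
  ultimately have "(\<lambda>i. cc (pair d (F i)))(v := cc (pair c k)) = (\<lambda>i. cc (pair ?d (?F i)))" by auto
  then have "sat MM mem p (\<lambda>i. cc (pair ?d (?F i)))" using k(3) by simp
  then have f: "fo ?d (\<lambda>x. sat UNIV mem p (\<lambda>i. app (?F i) x))" by (subst (asm) IH) (use dU in auto)
  have "fo ?d (\<lambda>x. \<exists>y. ?P (pi1 x) y)"
  proof (rule fo_mono[OF f])
    fix x assume x: "x \<epsilon> U" "sat UNIV mem p (\<lambda>i. app (?F i) x)"
    have "(\<lambda>i. app (?F i) x) = (\<lambda>i. app (F i) (pi1 x))(v := app k (pi2 x))" using x(1) by auto
    then show "\<exists>y. ?P (pi1 x) y" using x(2) by auto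
  qed (use dU DP_sat_app in simp_all)
  then show "fo d (\<lambda>x. \<exists>y. ?P x y)"
    using preD[OF pre_PR[OF PR_basic(2)] _ dU, of "\<lambda>x. \<exists>y. ?P x y"] by simp
next
  let ?P = "\<lambda>x y. sat UNIV mem p ((\<lambda>i. app (F i) x)(v := y))"
  assume a: "fo d (\<lambda>x. \<exists>y. ?P x y)"
  obtain m where m: "function_on mem m U" "fo d (\<lambda>x. ?P x (app m x))"
    using fo_choice[of ?P, OF DP_sat_upd d a] by blast
  let ?F = "F(v := m)"
  have "(\<lambda>i. app (F i) x)(v := app m x) = (\<lambda>i. app (?F i) x)" for x by auto
  then have "fo d (\<lambda>x. sat UNIV mem p (\<lambda>i. app (?F i) x))" using m(2) by simp
  then have "sat MM mem p (\<lambda>i. cc (pair d (?F i)))" by (subst IH) (use d m F in auto)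
  moreover have "(\<lambda>i. cc (pair d (?F i))) = (\<lambda>i. cc (pair d (F i)))(v := cc (pair d m))" by auto
  ultimately show "\<exists>a\<in>MM. sat MM mem p ((\<lambda>i. cc (pair d (F i)))(v := a))"
    using cc_MM[of "pair d m"] d m(1) by auto
qed

lemma los:
  "d \<epsilon> U' \<Longrightarrow> (\<And>i. function_on mem (F i) U) \<Longrightarrow>
    sat MM mem p (\<lambda>i. cc (pair d (F i))) \<longleftrightarrow> fo d (\<lambda>x. sat UNIV mem p (\<lambda>i. app (F i) x))"
proof (induction p arbitrary: d F)
  case (Mem x y)
  have "cc (pair d (F x)) \<epsilon> cc (pair d (F y)) \<longleftrightarrow> memS d (F x) d (F y)"
    using cc_mem[of "pair d (F y)" "pair d (F x)"] Mem by simp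
  also have "\<dots> \<longleftrightarrow> fo d (\<lambda>z. app (F x) z \<epsilon> app (F y) z)"
    using memS_at[OF Mem(1) PR_basic(1,1)] by simp
  finally show ?case by simp
next
  case (Eq x y)
  have "cc (pair d (F x)) = cc (pair d (F y)) \<longleftrightarrow> eqS d (F x) d (F y)"
    using cc_eq[of "pair d (F x)" "pair d (F y)"] Eq by simp
  also have "\<dots> \<longleftrightarrow> fo d (\<lambda>z. app (F x) z = app (F y) z)"
    using eqS_at[OF Eq(1) PR_basic(1,1)] by simp
  finally show ?case by simp
next
  case (Neg p)
  then show ?case using fo_not[OF DP_sat_app Neg(2)] by simp
next
  case (Conj p q)
  then show ?case using fo_conj[OF DP_sat_app DP_sat_app Conj(3)] by simp
next
  case (Disj p q)
  then show ?case using fo_disj[OF DP_sat_app DP_sat_app Disj(3)] by simp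
next
  case (Imp p q)
  have "fo d (\<lambda>x. \<not> sat UNIV mem p (\<lambda>i. app (F i) x) \<or> sat UNIV mem q (\<lambda>i. app (F i) x)) \<longleftrightarrow>
    \<not> fo d (\<lambda>x. sat UNIV mem p (\<lambda>i. app (F i) x)) \<or> fo d (\<lambda>x. sat UNIV mem q (\<lambda>i. app (F i) x))"
    by (subst fo_disj[OF DP_not[OF DP_sat_app] DP_sat_app Imp(3)], subst fo_not[OF DP_sat_app Imp(3)]) (rule refl)
  moreover have "(\<lambda>x. sat UNIV mem (fm.Imp p q) (\<lambda>i. app (F i) x)) =
    (\<lambda>x. \<not> sat UNIV mem p (\<lambda>i. app (F i) x) \<or> sat UNIV mem q (\<lambda>i. app (F i) x))" by auto
  ultimately show ?case using Imp by simp
next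
  case (Exists v p)
  show ?case using los_ex[OF Exists(1) Exists(2,3), where v=v] by simp
next
  case (Forall v p)
  \<comment> \<open>The universal quantifier is treated as the existential one for the negated
    matrix.\<close>
  have "sat MM mem (Neg p) (\<lambda>i. cc (pair d (F i))) \<longleftrightarrow> fo d (\<lambda>x. sat UNIV mem (Neg p) (\<lambda>i. app (F i) x))"
    if "d \<epsilon> U'" "\<And>i. function_on mem (F i) U" for d F
    using Forall(1)[OF that] fo_not[OF DP_sat_app that(1)] by simp
  from los_ex[of "Neg p", OF this Forall(2,3), where v=v]
  have A: "(\<exists>a\<in>MM. \<not> sat MM mem p ((\<lambda>i. cc (pair d (F i)))(v := a))) \<longleftrightarrow>
    fo d (\<lambda>x. \<not> (\<forall>y. sat UNIV mem p ((\<lambda>i. app (F i) x)(v := y))))" by simp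
  have D: "DP (\<lambda>e. \<forall>y. sat UNIV mem p ((\<lambda>i. app (F i) (e 0))(v := y)))"
    by (rule DP_all, rule DP_app2[where P="\<lambda>x y. sat UNIV mem p ((\<lambda>i. app (F i) x)(v := y))"], rule DP_sat_upd) simp_all
  show ?case using A[unfolded fo_not[OF D Forall(2)]] by (simp only: sat.simps ball_UNIV) blast
qed

definition jj :: "'v \<Rightarrow> 'v" where "jj x = cc (pair emp (lam U (\<lambda>_. x)))"

lemma jj_elem: "elem mem jj MM"
proof
  show "TM (\<lambda>e. jj (e 0))" unfolding jj_def by simp
  show "transitive_class mem MM" by (rule MM_tr)
  show "DP (\<lambda>e. e 0 \<in> MM)" unfolding MM_def by simp
  show "elementary_embedding mem jj MM" unfolding elementary_embedding_def
  proof (intro conjI allI)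
    show "range jj \<subseteq> MM" unfolding jj_def using cc_MM by auto
    fix p s
    have "sat MM mem p (jj \<circ> s) \<longleftrightarrow> fo emp (\<lambda>x. sat UNIV mem p (\<lambda>i. app (lam U (\<lambda>_. s i)) x))"
      unfolding comp_def jj_def by (rule los) simp_all
    also have "\<dots> \<longleftrightarrow> fo emp (\<lambda>x. sat UNIV mem p s)"
      by (rule fo_cong) (use DP_sat_app in simp_all)
    finally show "sat UNIV mem p s \<longleftrightarrow> sat MM mem p (jj \<circ> s)" by simp
  qed
qed

lemma cc_id: "a \<epsilon> U' \<longrightarrow> cc (pair a idU) = a"
proof (induction a rule: mem_induct)
  case (step a)
  show ?case
  proof
    assume a: "a \<epsilon> U'"
    have e: "el (pair a idU)" using a by simp
    show "cc (pair a idU) = a"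
    proof (rule ext)
      fix v
      show "v \<epsilon> cc (pair a idU) \<longleftrightarrow> v \<epsilon> a"
      proof
        assume "v \<epsilon> cc (pair a idU)"
        then obtain y where y: "el y" "mS y (pair a idU)" "v = cc y" unfolding mem_cc mem_Ext by blast
        then obtain w where w: "w \<epsilon> a" "eqS (pi1 y) (pi2 y) w idU"
          using memS_normal[OF el_D(1)[OF y(1)] a] by auto
        have wU: "w \<epsilon> U'" using w(1) a V_trD lim by blast
        have "cc y = cc (pair w idU)" using cc_eq[of y "pair w idU"] w(2) wU y(1) by simp
        then show "v \<epsilon> a" using step[OF w(1)] wU w(1) y(3) by simp
      next
        assume v: "v \<epsilon> a"
        then have vU: "v \<epsilon> U'" using a V_trD lim by blast
        then have "cc (pair v idU) \<epsilon> cc (pair a idU)" using cc_mem[of "pair a idU" "pair v idU"] memS_id[OF vU a] v a by simp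
        then show "v \<epsilon> cc (pair a idU)" using step[OF v] vU by simp
      qed
    qed
  qed
qed simp

lemma U'_MM: "a \<epsilon> U' \<Longrightarrow> a \<in> MM"
  using cc_id[of a] cc_MM[of "pair a idU"] by auto

text \<open>By \<open>cc_id\<close> the element \<open>a\<close> is the class of the identity at the
  generator \<open>a\<close>; membership of this class in a constant class is decided by
  \<open>h\<close>.\<close>

lemma jj_h: assumes X: "X \<sqsubseteq> U" and a: "a \<epsilon> U'" shows "a \<epsilon> jj X \<longleftrightarrow> a \<epsilon> app h X"
proof -
  have d: "pair a emp \<epsilon> U'" using a by blast
  have "a \<epsilon> jj X \<longleftrightarrow> cc (pair a idU) \<epsilon> cc (pair emp (lam U (\<lambda>_. X)))" using cc_id a unfolding jj_def by simp
  also have "\<dots> \<longleftrightarrow> memS a idU emp (lam U (\<lambda>_. X))" by (subst cc_mem) (use a in auto)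
  also have "\<dots> \<longleftrightarrow> fo (pair a emp) (\<lambda>z. pi1 z \<epsilon> X)" unfolding memS_def by (rule fo_cong) (simp_all add: U_cl)
  also have "\<dots> \<longleftrightarrow> fo a (\<lambda>z. z \<epsilon> X)" using preD[OF pre_PR[OF PR_basic(2)] _ d, of "\<lambda>z. z \<epsilon> X"] by simp
  also have "Sep U (\<lambda>z. z \<epsilon> X) = X" by (rule ext) (use X subD in auto)
  then have "fo a (\<lambda>z. z \<epsilon> X) \<longleftrightarrow> a \<epsilon> app h X" unfolding fo_def by simp
  finally show ?thesis .
qed

lemma jj_g: "jj g = g"
proof -
  interpret elem mem jj MM by (rule jj_elem)
  have gU: "g \<epsilon> U" "g \<epsilon> U'" using Lb Lb' lim Ord_sub_V subD unfolding LimO_def by blast+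
  have "fo g (\<lambda>x. x = g) \<longleftrightarrow> opT g 10 g (app h emp)" by (rule fo_op) (use gU in \<open>auto simp: opT_def\<close>)
  then have "fo g (\<lambda>x. x = g)" by (simp add: opT_def)
  moreover have "Sep U (\<lambda>x. x = g) = sing g" by (rule ext) (use gU in auto)
  ultimately have "g \<epsilon> app h (sing g)" unfolding fo_def by simp
  then have "g \<epsilon> jj (sing g)" using jj_h[of "sing g" g] gU by (auto simp: subset_of_def)
  then show ?thesis by (simp add: j_upair)
qed

end

section \<open>Strong cardinals and good maps\<close>

context zfc
begin

lemma card_Ord: "cardinal mem k \<Longrightarrow> Ord k"
  by (simp add: cardinal_def)

text \<open>All points at which \<open>Z\<close> is consulted are built from \<open>x\<close>, its
  projections and, for operation 8, elements of a projection. They stay in a limit level, so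
  \<open>Z\<close> may be cut down to that level.\<close>

lemma opT_local: assumes l: "Lim l" "x \<epsilon> V l" and Z: "\<And>z. z \<epsilon> V l \<Longrightarrow> z \<epsilon> Z \<longleftrightarrow> z \<epsilon> Z'"
  shows "opT g i x Z \<longleftrightarrow> opT g i x Z'"
proof -
  have o: "Ord l" using l Lim_Ord by blast
  note cl = V_lim_pair[OF l(1)] pi_V[OF o]
  have e: "emp \<epsilon> V l" using Ord_sub_V o l Lim_emp subD by blast
  then have 1: "one \<epsilon> V l" using V_lim_upair l by blast
  have w: "w \<epsilon> pi2 x \<Longrightarrow> pair (pi1 x) w \<epsilon> Z \<longleftrightarrow> pair (pi1 x) w \<epsilon> Z'" for w
    using Z cl l(2) V_trD[OF o] by meson
  show ?thesis unfolding opT_def using w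
    by (simp add: Z cl l(2) e 1 cong: conj_cong)
qed

lemma eq_one_iff: "y = one \<longleftrightarrow> (\<exists>z. z \<epsilon> y \<and> z = emp) \<and> (\<forall>z. z \<epsilon> y \<longrightarrow> z = emp)"
  using ext[of y one] by auto

lemma D0_one: "T0 K t \<Longrightarrow> D0 K (\<lambda>e. t e = one)"
  by (rule D0_app1[where P="\<lambda>x. x = one"]) (unfold eq_one_iff, (rule d0)+)

lemma pair_emp_mem: "pair x emp \<epsilon> Z \<longleftrightarrow> (\<exists>q. q \<epsilon> Z \<and> q = pair x (pi2 q) \<and> pi2 q = emp)"
  "pair x one \<epsilon> Z \<longleftrightarrow> (\<exists>q. q \<epsilon> Z \<and> q = pair x (pi2 q) \<and> pi2 q = one)"
  by (metis pi_pair(2))+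

lemma D0_opT: "T0 K g \<Longrightarrow> T0 K x \<Longrightarrow> T0 K Z \<Longrightarrow> D0 K (\<lambda>e. opT (g e) i (x e) (Z e))"
  by (rule D0_app3[where P="\<lambda>g x Z. opT g i x Z"])
    (unfold opT_def pair_emp_mem, (rule D0_if d0 D0_one)+)

lemma D0_wfd: "T0 K p \<Longrightarrow> T0 K x \<Longrightarrow> D0 K (\<lambda>e. wfd (p e) (x e))"
  by (rule D0_app2[where P=wfd]) (unfold wfd_def, (rule d0)+)

lemma D0_LimO: "T0 K g \<Longrightarrow> T0 K b \<Longrightarrow> D0 K (\<lambda>e. LimO (g e) (b e))"
proof (rule D0_app2[where P=LimO])
  have "LimO g b \<longleftrightarrow> Lim b \<and> (\<exists>w. w \<epsilon> b \<and> w = om) \<and> g \<epsilon> b" for g b unfolding LimO_def by blast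
  then show "D0 K (\<lambda>e. LimO (e 0) (e 1))" by (simp only:) (rule d0 D0_om D0_Lim)+
qed

lemma Lim_mem_V: "Lim l \<Longrightarrow> a \<epsilon> l \<Longrightarrow> a \<epsilon> V l"
  using Ord_sub_V Lim_Ord subD by blast

lemma Ord_max: "Ord a \<Longrightarrow> Ord b \<Longrightarrow> \<exists>c. Ord c \<and> a \<epsilon> c \<and> b \<epsilon> c"
  using Ord_linear[of a b] Ord_succ[of a] Ord_succ[of b] mem_succ by metis

lemma LimO_ex: assumes "Ord g" "Ord a" shows "\<exists>l. LimO g l \<and> a \<epsilon> l"
proof -
  obtain c where c: "Ord c" "g \<epsilon> c" "a \<epsilon> c" using Ord_max assms by blast
  obtain d where d: "Ord d" "c \<epsilon> d" "om \<epsilon> d" using Ord_max c Ord_om by blast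
  obtain l where l: "Lim l" "d \<epsilon> l" using Lim_ex d by blast
  then show ?thesis unfolding LimO_def using Ord_trans[OF Lim_Ord] c d by (metis Lim_Ord Ord_trans)
qed

lemma LimO_D: "LimO g b \<Longrightarrow> Lim b" "LimO g b \<Longrightarrow> Ord b" "LimO g b \<Longrightarrow> g \<epsilon> b" "LimO g b \<Longrightarrow> om \<epsilon> b"
  unfolding LimO_def using Lim_Ord by auto

end

context elem
begin

lemma V_sub_jV: assumes "Ord a" "\<And>x. x \<epsilon> V a \<Longrightarrow> x \<in> M" shows "V a \<sqsubseteq> j (V a)"
proof (rule subI)
  fix x assume x: "x \<epsilon> V a"
  have "a \<sqsubseteq> j a" using j_ge' assms(1) Ord_le j_Ord by blast
  then show "x \<epsilon> j (V a)" using j_V[OF assms(1)] V_mono subD x assms(2) by blast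
qed

text \<open>The operations and well-foundedness are bounded conditions on \<open>V l\<close> and its
  power set, so they hold for \<open>j (V l)\<close>. As \<open>M\<close> has all subsets of
  \<open>V l\<close>, this set includes \<open>V l\<close>, and cutting down to \<open>V l\<close>
  preserves both conditions.\<close>

lemma good_of_j:
  assumes l: "LimO g l" and M: "\<And>X. X \<sqsubseteq> V l \<Longrightarrow> X \<in> M" and g: "j g = g"
  defines "h \<equiv> lam (Pow (V l)) (\<lambda>X. Sep (V l) (\<lambda>x. x \<epsilon> j X))"
  shows "good g l l h" "k \<epsilon> V l \<Longrightarrow> k \<epsilon> app h (sing k) \<longleftrightarrow> j k = k"
proof -
  let ?W = "V l"
  note ll = LimO_D[OF l]
  have h: "app h X = Sep ?W (\<lambda>x. x \<epsilon> j X)" if "X \<sqsubseteq> ?W" for X unfolding h_def using that by simp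
  have sub: "x \<epsilon> ?W \<Longrightarrow> x \<epsilon> j ?W" for x
    using V_sub_jV[OF ll(2)] M V_tr[OF ll(2)] subD by blast
  show "k \<epsilon> V l \<Longrightarrow> k \<epsilon> app h (sing k) \<longleftrightarrow> j k = k"
    by (subst h) (auto simp: subset_of_def j_upair)
  have op: "x \<epsilon> app h Y \<longleftrightarrow> opT g i x (app h Z)"
    if Z: "Z \<sqsubseteq> ?W" and Y: "Y \<sqsubseteq> ?W" and e: "\<forall>x. x \<epsilon> ?W \<longrightarrow> (x \<epsilon> Y \<longleftrightarrow> opT g i x Z)" and x: "x \<epsilon> ?W" for i Z Y x
  proof -
    have D: "D0 K0 (\<lambda>e. \<forall>x. x \<epsilon> e 0 \<longrightarrow> (x \<epsilon> e 1 \<longleftrightarrow> opT (e 2) i x (e 3)))" by (rule d0 D0_opT)+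
    have "\<forall>x. x \<epsilon> j ?W \<longrightarrow> (x \<epsilon> j Y \<longleftrightarrow> opT (j g) i x (j Z))"
      using jL[OF D, of "[?W, Y, g, Z]"] e by (simp add: numeral_2_eq_2 numeral_3_eq_3)
    then have "x \<epsilon> j Y \<longleftrightarrow> opT g i x (j Z)" using sub[OF x] g by simp
    also have "\<dots> \<longleftrightarrow> opT g i x (app h Z)" by (rule opT_local[OF ll(1) x]) (simp add: h[OF Z])
    finally show ?thesis using h[OF Y] x by simp
  qed
  have wf: "wfd (Pow ?W) (app h X)" if X: "X \<sqsubseteq> ?W" and w: "wfd (Pow ?W) X" for X
  proof -
    have D: "D0 K0 (\<lambda>e. wfd (e 0) (e 1))" by (rule d0 D0_wfd)+
    have jw: "wfd (j (Pow ?W)) (j X)" using jL[OF D, of "[Pow ?W, X]"] w by simp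
    have D2: "D0 K0 (\<lambda>e. e 0 \<sqsubseteq> e 1 \<longrightarrow> e 0 \<epsilon> e 2)" by (rule d0)+
    have "A \<in> M \<Longrightarrow> A \<sqsubseteq> j ?W \<longrightarrow> A \<epsilon> j (Pow ?W)" for A
      using jL_all[OF D2, of "[?W, Pow ?W]" A] by (simp add: numeral_2_eq_2)
    moreover have "?W \<sqsubseteq> j ?W" using sub by (rule subI)
    ultimately have P: "A \<sqsubseteq> ?W \<Longrightarrow> A \<epsilon> j (Pow ?W)" for A using M sub_trans by blast
    show ?thesis unfolding wfd_def
    proof (intro allI impI)
      fix A assume A: "A \<epsilon> Pow ?W" "A \<noteq> emp"
      then obtain m where "m \<epsilon> A" "\<forall>y. y \<epsilon> A \<longrightarrow> \<not> pair y m \<epsilon> j X" using jw P unfolding wfd_def by (meson mem_Pow)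
      then show "\<exists>m. m \<epsilon> A \<and> (\<forall>y. y \<epsilon> A \<longrightarrow> \<not> pair y m \<epsilon> app h X)" using h[OF X] by auto
    qed
  qed
  show "good g l l h" unfolding good_def goodh_def
  proof (intro conjI allI impI)
    show "function_to mem h (Pow ?W) (Pow ?W)" unfolding h_def by (auto simp: subset_of_def)
  qed (use op wf in auto)
qed

text \<open>A function from some \<open>a\<close> below \<open>k\<close> onto \<open>k\<close> is
  sent to one from \<open>a\<close> onto \<open>j k\<close>, but on \<open>a\<close> the new
  function has the old values, so it misses \<open>k\<close>.\<close>

lemma crit_cardinal: assumes k: "Ord k" "j k \<noteq> k" "\<And>a. a \<epsilon> k \<Longrightarrow> j a = a" shows "cardinal mem k"
  unfolding cardinal_def
proof (intro conjI notI)
  assume "\<exists>a f. a \<epsilon> k \<and> bijection mem f a k"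
  then obtain a f where a: "a \<epsilon> k" and f: "function_to mem f a k" "\<forall>y. y \<epsilon> k \<longrightarrow> (\<exists>!x. rel mem f x y)"
    unfolding bijection_def by blast
  have fo: "function_on mem f a" using f(1) unfolding fn_to by blast
  have onto: "\<forall>y. y \<epsilon> k \<longrightarrow> (\<exists>x. x \<epsilon> a \<and> app f x = y)"
  proof (intro allI impI)
    fix y assume "y \<epsilon> k"
    then obtain x where "rel mem f x y" using f(2) by blast
    then show "\<exists>x. x \<epsilon> a \<and> app f x = y" using fn_pair[OF fo] by auto
  qed
  have D: "D0 K0 (\<lambda>e. \<forall>y. y \<epsilon> e 0 \<longrightarrow> (\<exists>x. x \<epsilon> e 1 \<and> app (e 2) x = y))" by (rule d0)+
  have jo: "\<forall>y. y \<epsilon> j k \<longrightarrow> (\<exists>x. x \<epsilon> j a \<and> app (j f) x = y)"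
    using jL[OF D, of "[k, a, f]"] onto by (simp add: numeral_2_eq_2)
  have "k \<epsilon> j k" using j_ge' k by metis
  then obtain x where x: "x \<epsilon> j a" "app (j f) x = k" using jo by blast
  have xa: "x \<epsilon> a" using x(1) k(3)[OF a] by simp
  then have "x \<epsilon> k" using a Ord_trans k(1) by blast
  then have "app (j f) x = j (app f x)" using k(3) j_app by metis
  moreover have "app f x \<epsilon> k" using f(1) xa unfolding fn_to by blast
  ultimately have "k \<epsilon> k" using k(3) x(2) by metis
  then show False by simp
qed (rule k(1))

end

context zfc
begin

section \<open>Good maps as first-order substitutes for embeddings\<close>

lemma good_ultra: "LimO g b \<Longrightarrow> LimO g b' \<Longrightarrow> good g b b' h \<Longrightarrow> ultra mem g b b' h"
  by unfold_locales

lemma good_elem: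
  assumes "LimO g b" "LimO g b'" "good g b b' h"
  obtains j M where "elem mem j M" "\<And>x. x \<epsilon> V b' \<Longrightarrow> x \<in> M" "j g = g"
    "\<And>X a. X \<sqsubseteq> V b \<Longrightarrow> a \<epsilon> V b' \<Longrightarrow> a \<epsilon> j X \<longleftrightarrow> a \<epsilon> app h X"
    "\<And>k. k \<epsilon> V b \<Longrightarrow> k \<epsilon> V b' \<Longrightarrow> k \<epsilon> app h (sing k) \<longleftrightarrow> j k = k"
proof -
  interpret ultra mem g b b' h by (rule good_ultra) fact+
  interpret e: elem mem jj MM by (rule jj_elem)
  have "k \<epsilon> app h (sing k) \<longleftrightarrow> jj k = k" if "k \<epsilon> U" "k \<epsilon> U'" for k
    using jj_h[of "sing k" k] that e.j_upair[of k k] by (auto simp: subset_of_def)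
  then show thesis using that[OF jj_elem U'_MM jj_g jj_h] by blast
qed

text \<open>For the embedding of the ultrapower, \<open>a \<epsilon> app h (sing a)\<close> means
  that \<open>a\<close> is fixed; so \<open>k\<close> is its critical point.\<close>

definition crith :: "'v \<Rightarrow> 'v \<Rightarrow> bool" where
  "crith h k \<longleftrightarrow> \<not> k \<epsilon> app h (sing k) \<and> (\<forall>a. a \<epsilon> k \<longrightarrow> a \<epsilon> app h (sing a))"

lemma DP_crith [simp]: "TM h \<Longrightarrow> TM k \<Longrightarrow> DP (\<lambda>e. crith (h e) (k e))"
  by (rule DP_app2[where P=crith]) (unfold crith_def, simp_all)

lemma crith_cardinal: assumes "LimO g l" "good g l l h" "k \<epsilon> l" "crith h k" shows "cardinal mem k"
proof -
  obtain j M where e: "elem mem j M" "\<And>k. k \<epsilon> V l \<Longrightarrow> k \<epsilon> V l \<Longrightarrow> k \<epsilon> app h (sing k) \<longleftrightarrow> j k = k"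
    using good_elem[OF assms(1,1,2)] by metis
  interpret elem mem j M by (rule e(1))
  have V: "x \<epsilon> l \<Longrightarrow> x \<epsilon> V l" for x using LimO_D assms(1) Lim_mem_V by blast
  have "Ord k" using assms(1,3) LimO_D(2) Ord_in by blast
  moreover have "a \<epsilon> k \<Longrightarrow> a \<epsilon> l" for a using assms(1,3) LimO_D(2) Ord_trans by blast
  ultimately show ?thesis by (intro crit_cardinal) (use e(2) V assms(3,4) in \<open>auto simp: crith_def\<close>)
qed

lemma strong_forI:
  assumes l: "LimO g l" and h: "good g l l h" "crith h k" and mu: "cardinal mem mu" "k \<epsilon> mu" "mu \<epsilon> l"
  shows "strong_for mem mu k"
proof -
  have o: "Ord l" "Ord mu" using l LimO_D mu unfolding cardinal_def by blast+
  have kl: "k \<epsilon> l" using mu Ord_trans o by blast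
  obtain j M where e: "elem mem j M" "\<And>x. x \<epsilon> V l \<Longrightarrow> x \<in> M"
    "\<And>k. k \<epsilon> V l \<Longrightarrow> k \<epsilon> V l \<Longrightarrow> k \<epsilon> app h (sing k) \<longleftrightarrow> j k = k"
    using good_elem[OF l l h(1)] by metis
  interpret elem mem j M by (rule e(1))
  have V: "x \<epsilon> l \<Longrightarrow> x \<epsilon> V l" for x using LimO_D l Lim_mem_V by blast
  have fx: "a \<epsilon> k \<Longrightarrow> j a = a" for a
    using h(2) e(3)[of a] V[of a] Ord_trans[OF o(1) _ kl] unfolding crith_def by blast
  have "\<not> j k = k" using h(2) e(3) V kl unfolding crith_def by blast
  moreover have "Ord k" using kl o Ord_in by blast
  ultimately have c: "critical_point mem j k" unfolding critical_point_def using fx by blast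
  have "definable mem (\<lambda>_. True) {p. \<exists>x. is_opair mem p x (j x)}"
    unfolding is_opair_iff by (rule definable_DP) simp
  moreover have "definable mem (\<lambda>_. True) M" using definable_DP[of "\<lambda>x. x \<in> M"] by simp
  moreover have "\<forall>v x. is_V mem v mu \<and> x \<epsilon> v \<longrightarrow> x \<in> M"
    using e(2) V_up[OF o(1) mu(3)] by auto
  ultimately show ?thesis unfolding strong_for_def
    using c trM el mu crith_cardinal[OF l h(1) kl h(2)] by blast
qed

text \<open>Embeddings are classes, good maps are sets: this makes strongness definable, as
  \<open>DP_strong\<close> requires. A cardinal above \<open>succ l\<close> is taken so that the
  target contains all subsets of \<open>V l\<close>. The constant is \<open>emp\<close> because
  every embedding fixes it.\<close>

lemma strong_iff: "strong mem k \<longleftrightarrow> cardinal mem k \<and>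
   (\<forall>l. LimO emp l \<and> k \<epsilon> l \<longrightarrow> (\<exists>h. good emp l l h \<and> crith h k))"
proof
  assume s: "strong mem k"
  then have c: "cardinal mem k" and ok: "Ord k" unfolding strong_def cardinal_def by blast+
  show "cardinal mem k \<and> (\<forall>l. LimO emp l \<and> k \<epsilon> l \<longrightarrow> (\<exists>h. good emp l l h \<and> crith h k))"
  proof (intro conjI allI impI c, elim conjE)
    fix l assume l: "LimO emp l" and kl: "k \<epsilon> l"
    have ol: "Ord l" using LimO_D l by blast
    obtain mu where mu: "cardinal mem mu" "succ l \<epsilon> mu" using cardinal_ex Ord_succ ol by blast
    have om: "Ord mu" using mu card_Ord by blast
    have "l \<epsilon> mu" using Ord_trans[OF om _ mu(2), of l] by simp
    then have "k \<epsilon> mu" using kl Ord_trans om by blast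
    then have "strong_for mem mu k" using s mu unfolding strong_def by blast
    then obtain j M where e: "elem mem j M" "critical_point mem j k" "\<And>x. x \<epsilon> V mu \<Longrightarrow> x \<in> M"
      using strong_for_elem by blast
    interpret elem mem j M by (rule e(1))
    have M: "X \<sqsubseteq> V l \<Longrightarrow> X \<in> M" for X using e(3) V_up[OF om mu(2)] V_succ[OF ol] by simp
    note gj = good_of_j[OF l M j_emp]
    have V: "x \<epsilon> l \<Longrightarrow> x \<epsilon> V l" for x using LimO_D l Lim_mem_V by blast
    have "crith (lam (Pow (V l)) (\<lambda>X. Sep (V l) (\<lambda>x. x \<epsilon> j X))) k"
      unfolding crith_def
      using gj(2) V kl Ord_trans[OF ol] e(2) unfolding critical_point_def by metis
    then show "\<exists>h. good emp l l h \<and> crith h k" using gj(1) by blast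
  qed
next
  assume r: "cardinal mem k \<and> (\<forall>l. LimO emp l \<and> k \<epsilon> l \<longrightarrow> (\<exists>h. good emp l l h \<and> crith h k))"
  show "strong mem k" unfolding strong_def
  proof (intro conjI allI impI)
    show "cardinal mem k" using r by blast
    fix mu assume mu: "cardinal mem mu \<and> k \<epsilon> mu"
    then have om: "Ord mu" using card_Ord by blast
    obtain l where l: "LimO emp l" "mu \<epsilon> l" using LimO_ex[OF Ord_emp om] by blast
    then have "k \<epsilon> l" using mu Ord_trans LimO_D by blast
    then obtain h where "good emp l l h" "crith h k" using r l by blast
    then show "strong_for mem mu k" using strong_forI l mu by blast
  qed
qed

lemma DP_cardinal: "DP (\<lambda>e. cardinal mem (e 0))"
proof -
  have "cardinal mem k \<longleftrightarrow> Ord k \<and> \<not> (\<exists>a f. a \<epsilon> k \<and> function_to mem f a k \<and> (\<forall>y. y \<epsilon> k \<longrightarrow> (\<exists>!x. pair x y \<epsilon> f)))" for k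
    unfolding cardinal_def bijection_def rel_iff ..
  then show ?thesis by simp
qed

lemma DP_strong: "DP (\<lambda>e. strong mem (e 0))"
  unfolding strong_iff using DP_cardinal by simp

lemma strong_unbounded: assumes "proper_class mem {k. strong mem k}" "Ord a"
  shows "\<exists>k. strong mem k \<and> a \<epsilon> k"
proof (rule ccontr)
  assume n: "\<not> ?thesis"
  have "k \<epsilon> succ a" if k: "strong mem k" for k
  proof -
    have "Ord k" using k card_Ord unfolding strong_def by blast
    then show ?thesis using n k Ord_linear[of k a] assms(2) by auto
  qed
  then have "x \<epsilon> Sep (succ a) (strong mem) \<longleftrightarrow> strong mem x" for x using DP_strong by auto
  then show False using assms(1) unfolding proper_class_def by auto
qed

end

locale nostrong = zfc mem for mem :: "'v \<Rightarrow> 'v \<Rightarrow> bool" (infix "\<epsilon>" 50) +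
  fixes g :: 'v
  assumes Og: "Ord g" and bd: "\<And>k. strong mem k \<Longrightarrow> k \<epsilon> g"
begin

text \<open>By \<open>good_of_j\<close>, every embedding that fixes \<open>g\<close> and has all
  subsets of \<open>V l\<close> in its target then fixes \<open>k\<close>.\<close>

definition NB :: "'v \<Rightarrow> 'v \<Rightarrow> bool" where
  "NB l k \<longleftrightarrow> LimO g l \<and> k \<epsilon> l \<and> (\<forall>h. good g l l h \<longrightarrow> k \<epsilon> app h (sing k))"

lemma DP_NB [simp]: "TM l \<Longrightarrow> TM k \<Longrightarrow> DP (\<lambda>e. NB (l e) (k e))"
  by (rule DP_app2[where P=NB]) (unfold NB_def, simp_all)

text \<open>Otherwise good maps move \<open>k\<close> at all large levels. Kunen's theorem at
  \<open>g\<close> puts their critical points above \<open>g\<close>, and they are at most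
  \<open>k\<close>. These candidates form a set, so one of them is critical at unboundedly many
  levels; it is strong, against \<open>bd\<close>.\<close>

lemma NB_ex: assumes k: "Ord k" shows "\<exists>l. NB l k"
proof (rule ccontr)
  assume n: "\<not> (\<exists>l. NB l k)"
  have A: "\<exists>k'. k' \<epsilon> succ k \<and> g \<epsilon> k' \<and> (\<exists>h. good g l l h \<and> crith h k')" if l: "LimO g l" "k \<epsilon> l" for l
  proof -
    obtain h where h: "good g l l h" "\<not> k \<epsilon> app h (sing k)" using n l unfolding NB_def by blast
    obtain j M where e: "elem mem j M" "\<And>x. x \<epsilon> V l \<Longrightarrow> x \<in> M" "j g = g"
      "\<And>k. k \<epsilon> V l \<Longrightarrow> k \<epsilon> V l \<Longrightarrow> k \<epsilon> app h (sing k) \<longleftrightarrow> j k = k"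
      using good_elem[OF l(1,1) h(1)] by metis
    interpret elem mem j M by (rule e(1))
    note ll = LimO_D[OF l(1)]
    have V: "x \<epsilon> l \<Longrightarrow> x \<epsilon> V l" for x using ll Lim_mem_V by blast
    have "j k \<noteq> k" using h(2) e(4) V l(2) by blast
    then obtain k' where k': "Ord k'" "j k' \<noteq> k'" "\<And>a. a \<epsilon> k' \<Longrightarrow> \<not> j a \<noteq> a" "k' \<epsilon> succ k"
      using Ord_least[of "\<lambda>a. j a \<noteq> a" k] k by auto
    have k'l: "k' \<epsilon> l" using k'(4) l(2) Ord_trans ll(2) by auto
    have "\<not> k' \<epsilon> g"
    proof
      assume "k' \<epsilon> g"
      moreover have "f \<in> M" if "function_to mem f g g" for f
        using e(2) V_lim_Funs[OF ll(1) that] V ll(3) by blast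
      moreover have "j x \<noteq> k'" for x using crit_range k' by blast
      ultimately show False using kunen Og e(3) by blast
    qed
    moreover have "k' \<noteq> g" using k'(2) e(3) by blast
    ultimately have "g \<epsilon> k'" using Ord_linear Og k'(1) by blast
    moreover have "crith h k'" unfolding crith_def using e(4) V k' k'l Ord_trans[OF ll(2) _ k'l] by blast
    ultimately show ?thesis using k'(4) h(1) by blast
  qed
  define R where "R k' d \<longleftrightarrow> Ord d \<and> (\<forall>l. LimO g l \<and> d \<epsilon> l \<longrightarrow> \<not> (\<exists>h. good g l l h \<and> crith h k'))" for k' d
  have DR: "DP (\<lambda>e. R (e 0) (e 1))" unfolding R_def by simp
  have "\<exists>k'. k' \<epsilon> succ k \<and> g \<epsilon> k' \<and> \<not> (\<exists>d. R k' d)"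
  proof (rule ccontr)
    assume c: "\<not> ?thesis"
    let ?A = "Sep (succ k) (\<lambda>k'. g \<epsilon> k')"
    have "\<exists>d. R x d" if "x \<epsilon> ?A" for x using c that by auto
    then obtain B where B: "\<And>x. x \<epsilon> ?A \<Longrightarrow> \<exists>y. y \<epsilon> B \<and> R x y" using collection[OF DR, of ?A] by blast
    \<comment> \<open>A common bound for the levels at which the candidates can be critical; any
      larger level contradicts it.\<close>
    let ?d = "Uni (Sep B Ord)"
    have Od: "Ord ?d" by (rule Ord_Uni) simp
    obtain c0 where c0: "Ord c0" "k \<epsilon> c0" "succ ?d \<epsilon> c0" using Ord_max[OF k Ord_succ[OF Od]] by blast
    obtain l where l: "LimO g l" "c0 \<epsilon> l" using LimO_ex[OF Og c0(1)] by blast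
    have ol: "Ord l" using l LimO_D by blast
    have sd: "succ ?d \<epsilon> l" "k \<epsilon> l" using Ord_trans[OF ol] c0 l by blast+
    obtain k' h where k': "k' \<epsilon> succ k" "g \<epsilon> k'" "good g l l h" "crith h k'" using A[OF l(1) sd(2)] by blast
    obtain y where y: "y \<epsilon> B" "R k' y" using B[of k'] k' by auto
    have "Ord y" using y R_def by blast
    then have "y \<sqsubseteq> ?d" using y(1) by (auto simp: subset_of_def)
    then have "y \<epsilon> succ ?d" using Ord_le[OF \<open>Ord y\<close> Od] by auto
    then have "y \<epsilon> l" using Ord_trans[OF ol _ sd(1)] by blast
    then show False using y(2) l(1) k' unfolding R_def by blast
  qed
  then obtain k' where k': "k' \<epsilon> succ k" "g \<epsilon> k'" "\<And>d. \<not> R k' d" by blast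
  have ok': "Ord k'" using k' k Ord_in Ord_succ by blast
  have un: "\<exists>l h. LimO g l \<and> d \<epsilon> l \<and> good g l l h \<and> crith h k'" if "Ord d" for d
    using k'(3)[of d] that unfolding R_def by blast
  have "strong mem k'" unfolding strong_def
  proof (intro conjI allI impI)
    obtain l h where "LimO g l" "k' \<epsilon> l" "good g l l h" "crith h k'" using un[OF ok'] by blast
    then show "cardinal mem k'" using crith_cardinal by blast
    fix mu assume mu: "cardinal mem mu \<and> k' \<epsilon> mu"
    then obtain l h where "LimO g l" "mu \<epsilon> l" "good g l l h" "crith h k'" using un[of mu] card_Ord by blast
    then show "strong_for mem mu k'" using strong_forI mu by blast
  qed
  then have "k' \<epsilon> g" by (rule bd)
  then show False using k'(2) mem_asym by blast
qed

text \<open>The last clause makes embeddings fix the ordinals below \<open>b\<close>. The function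
  \<open>f\<close> controls \<open>b\<close> itself: an embedding that fixes the values of
  \<open>f\<close> cannot move \<open>b\<close> up, since \<open>f\<close> stays cofinal.\<close>

definition DD :: "'v \<Rightarrow> bool" where
  "DD b \<longleftrightarrow> LimO g b \<and> (\<exists>f. function_to mem f om b \<and> (\<forall>x. x \<epsilon> b \<longrightarrow> (\<exists>n. n \<epsilon> om \<and> x \<epsilon> app f n))) \<and>
    (\<forall>k. k \<epsilon> b \<longrightarrow> (\<exists>l. l \<epsilon> b \<and> NB l k))"

lemma DP_DD [simp]: "TM b \<Longrightarrow> DP (\<lambda>e. DD (b e))"
  by (rule DP_app1[where P=DD]) (unfold DD_def, simp_all)

lemma DD_ex: assumes "Ord a" shows "\<exists>b. DD b \<and> a \<epsilon> b"
proof -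
  define th where "th k = theD emp (\<lambda>l. Ord l \<and> NB l k \<and> (\<forall>m. m \<epsilon> l \<longrightarrow> \<not> NB m k))" for k
  have T [simp]: "TM t \<Longrightarrow> TM (\<lambda>e. th (t e))" for t
    by (rule TM_app1[where F=th]) (unfold th_def, simp_all)
  have th: "Ord (th k) \<and> NB (th k) k" if k: "Ord k" for k
  proof -
    obtain l0 where l0: "NB l0 k" using NB_ex k by blast
    then have o0: "Ord l0" using LimO_D(2) unfolding NB_def by blast
    have D: "DP (\<lambda>e. NB (e 0) k)" by simp
    obtain l where l: "Ord l" "NB l k" "\<And>m. m \<epsilon> l \<Longrightarrow> \<not> NB m k"
      using Ord_least[where P="\<lambda>l. NB l k", OF D o0 l0] by blast
    have "th k = l" unfolding th_def
    proof (rule theD_eq)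
      fix z assume "Ord z \<and> NB z k \<and> (\<forall>m. m \<epsilon> z \<longrightarrow> \<not> NB m k)"
      then show "z = l" using Ord_linear[of z l] l by blast
    qed (use l in blast)
    then show ?thesis using l by simp
  qed
  define S where "S d = succ (Uni (Im (succ d) th))" for d
  have TS: "TM (\<lambda>e. S (e 0))" unfolding S_def by simp
  have S: "Ord (S d) \<and> d \<epsilon> S d" and Sth: "k \<epsilon> succ d \<Longrightarrow> th k \<epsilon> S d" if d: "Ord d" for d k
  proof -
    have o: "Ord k" if "k \<epsilon> succ d" for k using that d Ord_succ Ord_in by blast
    have OU: "Ord (Uni (Im (succ d) th))" by (rule Ord_Uni) (use o th in auto)
    then have "Ord (S d)" unfolding S_def by (rule Ord_succ)
    moreover have "d \<epsilon> th d" using th d NB_def by blast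
    then have "d \<epsilon> Uni (Im (succ d) th)" by auto
    ultimately show "Ord (S d) \<and> d \<epsilon> S d" unfolding S_def by simp
    assume k: "k \<epsilon> succ d"
    then have "th k \<sqsubseteq> Uni (Im (succ d) th)" by (auto simp: subset_of_def simp del: mem_succ)
    then show "th k \<epsilon> S d" unfolding S_def using Ord_le[OF _ OU] th o[OF k] by auto
  qed
  obtain l0 where l0: "LimO g l0" "a \<epsilon> l0" using LimO_ex[OF Og assms] by blast
  have S': "\<forall>d. Ord d \<longrightarrow> Ord (S d) \<and> d \<epsilon> S d" using S by blast
  note it = iter_sup[where F=S and a=l0, OF TS S' LimO_D(2)[OF l0(1)]]
  let ?l = "Uni (Im om (iter S l0))"
  have ol: "Ord ?l" using it(1) Lim_Ord by blast
  have sub: "x \<epsilon> l0 \<Longrightarrow> x \<epsilon> ?l" for x using Ord_trans[OF ol _ it(2)] by blast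
  have TI: "TM (\<lambda>e. iter S l0 (e 0))" by (rule iter(1)[OF TS]) simp
  have "DD ?l" unfolding DD_def
  proof (intro conjI allI impI)
    show "LimO g ?l" unfolding LimO_def using it(1) sub LimO_D[OF l0(1)] by blast
    show "\<exists>f. function_to mem f om ?l \<and> (\<forall>x. x \<epsilon> ?l \<longrightarrow> (\<exists>n. n \<epsilon> om \<and> x \<epsilon> app f n))"
    proof (rule exI[of _ "lam om (iter S l0)"], intro conjI allI impI)
      show "function_to mem (lam om (iter S l0)) om ?l" using TI it(3) by (simp del: mem_Uni mem_Uni_Im)
      fix x assume "x \<epsilon> ?l"
      then show "\<exists>n. n \<epsilon> om \<and> x \<epsilon> app (lam om (iter S l0)) n" using it(4) TI app_lam by metis
    qed
    fix k assume "k \<epsilon> ?l"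
    then obtain n where n: "n \<epsilon> om" "k \<epsilon> iter S l0 n" using it(4) by blast
    have "th k \<epsilon> S (iter S l0 n)" using Sth[OF it(5)[OF n(1)], of k] n(2) by simp
    moreover have "S (iter S l0 n) \<epsilon> ?l" using it(3)[OF om(2)[OF n(1)]] iter(3)[OF TS n(1)] by simp
    ultimately have "th k \<epsilon> ?l" using Ord_trans ol by blast
    moreover have "Ord k" using n it(5) Ord_in by blast
    ultimately show "\<exists>l. l \<epsilon> ?l \<and> NB l k" using th by blast
  qed
  then show ?thesis using sub l0(2) by blast
qed

text \<open>An ordinal below both \<open>b\<close> and \<open>b'\<close> has an \<open>NB\<close>
  witness below both, and the embedding of \<open>h\<close> induces a good map at that witness; so
  the ordinal is fixed. Hence the embedding is the identity on \<open>V b'\<close> and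
  \<open>h\<close> only cuts down to \<open>V b'\<close>.\<close>

lemma DD_good:
  assumes b: "DD b" and b': "DD b'" and h: "good g b b' h"
  shows "b' \<sqsubseteq> b" "X \<sqsubseteq> V b \<Longrightarrow> x \<epsilon> app h X \<longleftrightarrow> x \<epsilon> V b' \<and> x \<epsilon> X"
proof -
  have l: "LimO g b" "LimO g b'" using b b' DD_def by blast+
  note lb = LimO_D[OF l(1)] and lb' = LimO_D[OF l(2)]
  interpret ultra mem g b b' h using good_ultra l h by blast
  obtain j M where e: "elem mem j M" "\<And>x. x \<epsilon> V b' \<Longrightarrow> x \<in> M" "j g = g"
    "\<And>X a. X \<sqsubseteq> V b \<Longrightarrow> a \<epsilon> V b' \<Longrightarrow> a \<epsilon> j X \<longleftrightarrow> a \<epsilon> app h X"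
    using good_elem[OF l h] by metis
  interpret elem mem j M by (rule e(1))
  have fx: "j k = k" if k: "k \<epsilon> b" "k \<epsilon> b'" for k
  proof (rule ccontr)
    assume jk: "j k \<noteq> k"
    obtain m where m: "m \<epsilon> b" "m \<epsilon> b'" "NB m k"
    proof (cases "b \<sqsubseteq> b'")
      case True
      then obtain m where "m \<epsilon> b" "NB m k" using b k unfolding DD_def by blast
      then show ?thesis using that True subD by blast
    next
      case False
      then have "b' \<epsilon> b" using Ord_not_le lb lb' by blast
      moreover obtain m where "m \<epsilon> b'" "NB m k" using b' k unfolding DD_def by blast
      ultimately show ?thesis using that Ord_trans lb by blast
    qed
    have lm: "LimO g m" "k \<epsilon> m" using m NB_def by blast+
    note lmD = LimO_D[OF lm(1)]
    have "X \<in> M" if "X \<sqsubseteq> V m" for X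
      using e(2) V_I[OF m(2) that] by blast
    note gj = good_of_j[OF lm(1) this e(3)]
    show False using m(3) gj jk Lim_mem_V[OF lmD(1) lm(2)] unfolding NB_def by metis
  qed
  show sub: "b' \<sqsubseteq> b"
  proof (rule ccontr)
    assume "\<not> b' \<sqsubseteq> b"
    then have bb': "b \<epsilon> b'" using Ord_not_le lb lb' by blast
    have fx': "j k = k" if "k \<epsilon> b" for k using fx that bb' Ord_trans lb' by blast
    have bM: "b \<epsilon> V b'" using Lim_mem_V lb' bb' by blast
    \<comment> \<open>As \<open>b\<close> is in \<open>V b'\<close>, this puts \<open>b\<close> into
      \<open>j (V b)\<close> and thereby below \<open>j b\<close>.\<close>
    have "app h (V b) = V b'"
    proof (rule ext)
      fix x
      have T: "Sep (V b) (\<lambda>_. True) = V b" by (rule ext) simp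
      show "x \<epsilon> app h (V b) \<longleftrightarrow> x \<epsilon> V b'"
        using fo_true[of x] h_sub[of "V b"] subD unfolding fo_def T by auto
    qed
    then have "b \<epsilon> j (V b)" using e(4)[of "V b" b] bM by simp
    then have "b \<epsilon> j b" using j_V[OF lb(2)] Ord_in_V[OF lb(2)] lb(2) by simp
    obtain f where f: "function_to mem f om b" "\<forall>x. x \<epsilon> b \<longrightarrow> (\<exists>n. n \<epsilon> om \<and> x \<epsilon> app f n)"
      using b unfolding DD_def by blast
    have D: "D0 K0 (\<lambda>e. \<forall>x. x \<epsilon> e 0 \<longrightarrow> (\<exists>n. n \<epsilon> e 1 \<and> x \<epsilon> app (e 2) n))" by (rule d0)+
    have "\<forall>x. x \<epsilon> j b \<longrightarrow> (\<exists>n. n \<epsilon> om \<and> x \<epsilon> app (j f) n)"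
      using jL[OF D, of "[b, om, f]"] f(2) by (simp add: numeral_2_eq_2)
    then obtain n where n: "n \<epsilon> om" "b \<epsilon> app (j f) n" using \<open>b \<epsilon> j b\<close> by blast
    have fn: "app f n \<epsilon> b" using f(1) n(1) unfolding fn_to by blast
    have "app (j f) n = app f n" using j_app[of f n] j_n[OF n(1)] fx'[OF fn] by simp
    then show False using n(2) fn mem_asym by auto
  qed
  have "j x = x" if "x \<epsilon> V b'" for x
    by (rule j_V_fix[OF lb'(2) _ that]) (use fx sub subD in blast)
  then show "x \<epsilon> app h X \<longleftrightarrow> x \<epsilon> V b' \<and> x \<epsilon> X" if X: "X \<sqsubseteq> V b"
    using e(4)[OF X, of x] h_sub[OF X] subD j_mem[of x X] by metis
qed

end

section \<open>Graphs, products and homomorphisms\<close>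

context zfc
begin

lemma graph_iff: "graph mem A \<longleftrightarrow> A = pair (pi1 A) (pi2 A) \<and> pi1 A \<noteq> emp \<and>
    (\<forall>p. p \<epsilon> pi2 A \<longrightarrow> (\<exists>x y. x \<epsilon> pi1 A \<and> y \<epsilon> pi1 A \<and> p = pair x y))"
  unfolding graph_def by auto

lemma graphE: assumes "graph mem A"
  obtains G R where "A = pair G R" "G \<noteq> emp" "\<And>p. p \<epsilon> R \<Longrightarrow> \<exists>x y. x \<epsilon> G \<and> y \<epsilon> G \<and> p = pair x y"
  using assms that unfolding graph_def by auto

lemma vertex_pair [simp]: "vertex mem (pair G R) x \<longleftrightarrow> x \<epsilon> G"
  unfolding vertex_def by auto
lemma edge_pair [simp]: "edge mem (pair G R) x y \<longleftrightarrow> pair x y \<epsilon> R"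
  unfolding edge_def by auto

lemma hom_pair: "hom mem h (pair G R) (pair H Q) \<longleftrightarrow> function_to mem h G H \<and>
    (\<forall>x y. x \<epsilon> G \<and> y \<epsilon> G \<and> pair x y \<epsilon> R \<longrightarrow> pair (app h x) (app h y) \<epsilon> Q)"
proof -
  have "hom mem h (pair G R) (pair H Q) \<longleftrightarrow> function_to mem h G H \<and>
    (\<forall>x y x' y'. pair x y \<epsilon> R \<and> pair x x' \<epsilon> h \<and> pair y y' \<epsilon> h \<longrightarrow> pair x' y' \<epsilon> Q)"
    unfolding hom_def by auto
  then show ?thesis using fn_pair[of h G] unfolding fn_to by metis
qed

lemma hom_form: "hom mem h A B \<Longrightarrow> A = pair (pi1 A) (pi2 A) \<and> B = pair (pi1 B) (pi2 B)"
  unfolding hom_def by auto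

lemma DP_hom [simp]: "TM h \<Longrightarrow> TM a \<Longrightarrow> TM b \<Longrightarrow> DP (\<lambda>e. hom mem (h e) (a e) (b e))"
  by (rule DP_app3[where P="hom mem"]) (unfold hom_def edge_def is_opair_iff rel_iff, simp)

definition Hom :: "'v \<Rightarrow> 'v \<Rightarrow> bool" where "Hom A B \<longleftrightarrow> (\<exists>h. hom mem h A B)"

lemma DP_Hom [simp]: "TM a \<Longrightarrow> TM b \<Longrightarrow> DP (\<lambda>e. Hom (a e) (b e))"
  by (rule DP_app2[where P=Hom]) (unfold Hom_def, simp_all)

lemma hom_lamI: assumes "TM (\<lambda>e. F (e 0))" "\<And>x. x \<epsilon> G \<Longrightarrow> F x \<epsilon> H"
    "\<And>x y. x \<epsilon> G \<Longrightarrow> y \<epsilon> G \<Longrightarrow> pair x y \<epsilon> R \<Longrightarrow> pair (F x) (F y) \<epsilon> Q"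
  shows "hom mem (lam G F) (pair G R) (pair H Q)"
  unfolding hom_pair using assms by simp

lemma HomI: assumes "TM (\<lambda>e. F (e 0))" "\<And>x. x \<epsilon> G \<Longrightarrow> F x \<epsilon> H"
    "\<And>x y. x \<epsilon> G \<Longrightarrow> y \<epsilon> G \<Longrightarrow> pair x y \<epsilon> R \<Longrightarrow> pair (F x) (F y) \<epsilon> Q"
  shows "Hom (pair G R) (pair H Q)"
  unfolding Hom_def using hom_lamI[OF assms] by blast

lemma Hom_trans: assumes "Hom A B" "Hom B C" shows "Hom A C"
proof -
  obtain h k where h: "hom mem h A B" and k: "hom mem k B C" using assms Hom_def by blast
  obtain G R H Q J S where e: "A = pair G R" "B = pair H Q" "C = pair J S" using hom_form h k by metis
  show ?thesis unfolding e
    by (rule HomI[where F="\<lambda>x. app k (app h x)"]) (use h k in \<open>auto simp: e hom_pair fn_to\<close>)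
qed

lemma is_productD:
  assumes P: "is_product mem P S" and S: "\<And>A. A \<epsilon> S \<Longrightarrow> graph mem A"
  obtains U R where "P = pair U R"
    "\<And>f. f \<epsilon> U \<longleftrightarrow> function_on mem f S \<and> (\<forall>A. A \<epsilon> S \<longrightarrow> app f A \<epsilon> pi1 A)"
    "\<And>f g. pair f g \<epsilon> R \<longleftrightarrow> f \<epsilon> U \<and> g \<epsilon> U \<and> (\<forall>A. A \<epsilon> S \<longrightarrow> pair (app f A) (app g A) \<epsilon> pi2 A)"
proof -
  obtain U R where 0: "P = pair U R" and
    1: "\<forall>f. f \<epsilon> U \<longleftrightarrow> function_on mem f S \<and> (\<forall>\<A> a. \<A> \<epsilon> S \<and> pair \<A> a \<epsilon> f \<longrightarrow> vertex mem \<A> a)" and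
    2: "\<forall>p. p \<epsilon> R \<longleftrightarrow> (\<exists>f g. f \<epsilon> U \<and> g \<epsilon> U \<and> p = pair f g \<and>
        (\<forall>\<A> a b. \<A> \<epsilon> S \<and> pair \<A> a \<epsilon> f \<and> pair \<A> b \<epsilon> g \<longrightarrow> edge mem \<A> a b))"
    using P unfolding is_product_def is_opair_iff rel_iff by auto
  have v: "vertex mem A x \<longleftrightarrow> x \<epsilon> pi1 A" "edge mem A x y \<longleftrightarrow> pair x y \<epsilon> pi2 A" if "A \<epsilon> S" for A x y
    using graphE[OF S[OF that]] by (metis vertex_pair pi_pair(1), metis graphE[OF S[OF that]] edge_pair pi_pair(2))
  have U: "f \<epsilon> U \<longleftrightarrow> function_on mem f S \<and> (\<forall>A. A \<epsilon> S \<longrightarrow> app f A \<epsilon> pi1 A)" for f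
    using 1 v(1) fn_pair[of f S] by metis
  have "pair f g \<epsilon> R \<longleftrightarrow> f \<epsilon> U \<and> g \<epsilon> U \<and> (\<forall>A. A \<epsilon> S \<longrightarrow> pair (app f A) (app g A) \<epsilon> pi2 A)" for f g
  proof -
    have "pair f g \<epsilon> R \<longleftrightarrow> f \<epsilon> U \<and> g \<epsilon> U \<and> (\<forall>\<A> a b. \<A> \<epsilon> S \<and> pair \<A> a \<epsilon> f \<and> pair \<A> b \<epsilon> g \<longrightarrow> edge mem \<A> a b)"
      using 2[rule_format, of "pair f g"] by auto
    then show ?thesis using U fn_pair[of f S] fn_pair[of g S] v(2) by metis
  qed
  then show thesis using that 0 U by blast
qed

lemma product_ex: assumes S: "\<And>A. A \<epsilon> S \<Longrightarrow> graph mem A" shows "\<exists>P. is_product mem P S"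
proof -
  let ?U = "Sep (Funs S (Uni (Im S pi1))) (\<lambda>f. \<forall>A. A \<epsilon> S \<longrightarrow> app f A \<epsilon> pi1 A)"
  let ?R = "Sep (Prod ?U ?U) (\<lambda>p. \<forall>A. A \<epsilon> S \<longrightarrow> pair (app (pi1 p) A) (app (pi2 p) A) \<epsilon> pi2 A)"
  have U: "f \<epsilon> ?U \<longleftrightarrow> function_on mem f S \<and> (\<forall>A. A \<epsilon> S \<longrightarrow> app f A \<epsilon> pi1 A)" for f
    by (auto simp: fn_to)
  have v: "vertex mem A x \<longleftrightarrow> x \<epsilon> pi1 A" "edge mem A x y \<longleftrightarrow> pair x y \<epsilon> pi2 A" if "A \<epsilon> S" for A x y
    using graphE[OF S[OF that]] by (metis vertex_pair pi_pair(1), metis graphE[OF S[OF that]] edge_pair pi_pair(2))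
  have "is_product mem (pair ?U ?R) S" unfolding is_product_def is_opair_iff rel_iff
  proof (rule exI[of _ ?U], rule exI[of _ ?R], intro conjI allI)
    fix f
    show "f \<epsilon> ?U \<longleftrightarrow> function_on mem f S \<and> (\<forall>\<A> a. \<A> \<epsilon> S \<and> pair \<A> a \<epsilon> f \<longrightarrow> vertex mem \<A> a)"
    proof (cases "function_on mem f S")
      case True
      have "(\<forall>A. A \<epsilon> S \<longrightarrow> app f A \<epsilon> pi1 A) \<longleftrightarrow> (\<forall>A a. A \<epsilon> S \<and> pair A a \<epsilon> f \<longrightarrow> vertex mem A a)"
        using v(1) fn_pair[OF True] by auto
      then show ?thesis using U[of f] True by blast
    qed (use U[of f] in blast)
  next
    fix p
    have "(\<forall>\<A> a b. \<A> \<epsilon> S \<and> pair \<A> a \<epsilon> f \<and> pair \<A> b \<epsilon> g \<longrightarrow> edge mem \<A> a b) \<longleftrightarrow>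
      (\<forall>A. A \<epsilon> S \<longrightarrow> pair (app f A) (app g A) \<epsilon> pi2 A)" if "f \<epsilon> ?U" "g \<epsilon> ?U" for f g
    proof -
      have "function_on mem f S" "function_on mem g S" using that U by blast+
      then show ?thesis using fn_pair[of f S] fn_pair[of g S] v(2) by auto
    qed
    then show "p \<epsilon> ?R \<longleftrightarrow> (\<exists>f g. f \<epsilon> ?U \<and> g \<epsilon> ?U \<and> p = pair f g \<and>
        (\<forall>\<A> a b. \<A> \<epsilon> S \<and> pair \<A> a \<epsilon> f \<and> pair \<A> b \<epsilon> g \<longrightarrow> edge mem \<A> a b))"
      by (subst mem_Sep, simp) (auto simp del: mem_Sep)
  qed simp
  then show ?thesis by blast
qed

lemma product_proj: assumes P: "is_product mem P S" and S: "\<And>A. A \<epsilon> S \<Longrightarrow> graph mem A" and A: "A \<epsilon> S" shows "Hom P A"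
proof -
  obtain U R where P': "P = pair U R"
    "\<And>f. f \<epsilon> U \<longleftrightarrow> function_on mem f S \<and> (\<forall>A. A \<epsilon> S \<longrightarrow> app f A \<epsilon> pi1 A)"
    "\<And>f g. pair f g \<epsilon> R \<longleftrightarrow> f \<epsilon> U \<and> g \<epsilon> U \<and> (\<forall>A. A \<epsilon> S \<longrightarrow> pair (app f A) (app g A) \<epsilon> pi2 A)"
    using is_productD[OF P S] by metis
  obtain G Q where g: "A = pair G Q" using graphE[OF S[OF A]] by metis
  have "Hom (pair U R) (pair G Q)"
    by (rule HomI[where F="\<lambda>f. app f A"]) (use P' A g in auto)
  then show ?thesis using P' g by simp
qed

text \<open>Choice selects the homomorphisms into the factors simultaneously; together they are the
  components of one map into the product.\<close>

lemma product_univ: assumes P: "is_product mem P S" and S: "\<And>A. A \<epsilon> S \<Longrightarrow> graph mem A"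
    and X: "X = pair (pi1 X) (pi2 X)" and H: "\<And>A. A \<epsilon> S \<Longrightarrow> Hom X A"
  shows "Hom X P"
proof -
  obtain U R where P': "P = pair U R"
    "\<And>f. f \<epsilon> U \<longleftrightarrow> function_on mem f S \<and> (\<forall>A. A \<epsilon> S \<longrightarrow> app f A \<epsilon> pi1 A)"
    "\<And>f g. pair f g \<epsilon> R \<longleftrightarrow> f \<epsilon> U \<and> g \<epsilon> U \<and> (\<forall>A. A \<epsilon> S \<longrightarrow> pair (app f A) (app g A) \<epsilon> pi2 A)"
    using is_productD[OF P S] by metis
  have D: "DP (\<lambda>e. hom mem (e 1) X (e 0))" by simp
  obtain c where c: "\<And>A. A \<epsilon> S \<Longrightarrow> hom mem (app c A) X A"
    using choice[OF D, of S] H unfolding Hom_def by metis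
  have c1: "x \<epsilon> pi1 X \<Longrightarrow> app (app c A) x \<epsilon> pi1 A"
    and c2: "x \<epsilon> pi1 X \<Longrightarrow> y \<epsilon> pi1 X \<Longrightarrow> pair x y \<epsilon> pi2 X \<Longrightarrow> pair (app (app c A) x) (app (app c A) y) \<epsilon> pi2 A"
    if A: "A \<epsilon> S" for A x y
  proof -
    have "hom mem (app c A) (pair (pi1 X) (pi2 X)) (pair (pi1 A) (pi2 A))" using c[OF A] hom_form[OF c[OF A]] by simp
    then show "x \<epsilon> pi1 X \<Longrightarrow> app (app c A) x \<epsilon> pi1 A"
     "x \<epsilon> pi1 X \<Longrightarrow> y \<epsilon> pi1 X \<Longrightarrow> pair x y \<epsilon> pi2 X \<Longrightarrow> pair (app (app c A) x) (app (app c A) y) \<epsilon> pi2 A"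
      unfolding hom_pair fn_to by auto
  qed
  have "Hom (pair (pi1 X) (pi2 X)) (pair U R)"
    by (rule HomI[where F="\<lambda>x. lam S (\<lambda>A. app (app c A) x)"]) (use P'(2,3) c1 c2 in auto)
  then show ?thesis using X P'(1) by simp
qed

section \<open>From strong cardinals to product reflection\<close>

text \<open>A formula mentions finitely many variables. This permits resetting the other parameters
  to \<open>emp\<close>, so that all parameters lie in one level below a strong cardinal, and it
  provides fresh variables.\<close>

lemma sat_vars: "\<exists>N. \<forall>D s s'. (\<forall>i<N. s i = s' i) \<longrightarrow> (sat D mem p s \<longleftrightarrow> sat D mem p s')"
proof (induction p)
  case (Mem x y)
  show ?case by (rule exI[of _ "Suc (max x y)"]) (simp add: less_Suc_eq_le)
next
  case (Eq x y)
  show ?case by (rule exI[of _ "Suc (max x y)"]) (simp add: less_Suc_eq_le)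
next
  case (Neg p) then show ?case by simp
next
  case (Conj p q)
  then obtain N N' where "\<forall>D s s'. (\<forall>i<N. s i = s' i) \<longrightarrow> (sat D mem p s \<longleftrightarrow> sat D mem p s')"
    "\<forall>D s s'. (\<forall>i<N'. s i = s' i) \<longrightarrow> (sat D mem q s \<longleftrightarrow> sat D mem q s')" by blast
  then have "\<forall>D s s'. (\<forall>i<max N N'. s i = s' i) \<longrightarrow> (sat D mem (Conj p q) s \<longleftrightarrow> sat D mem (Conj p q) s')"
    by (metis less_max_iff_disj sat.simps(4))
  then show ?case by blast
next
  case (Disj p q)
  then obtain N N' where "\<forall>D s s'. (\<forall>i<N. s i = s' i) \<longrightarrow> (sat D mem p s \<longleftrightarrow> sat D mem p s')"
    "\<forall>D s s'. (\<forall>i<N'. s i = s' i) \<longrightarrow> (sat D mem q s \<longleftrightarrow> sat D mem q s')" by blast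
  then have "\<forall>D s s'. (\<forall>i<max N N'. s i = s' i) \<longrightarrow> (sat D mem (Disj p q) s \<longleftrightarrow> sat D mem (Disj p q) s')"
    by (metis less_max_iff_disj sat.simps(5))
  then show ?case by blast
next
  case (Imp p q)
  then obtain N N' where "\<forall>D s s'. (\<forall>i<N. s i = s' i) \<longrightarrow> (sat D mem p s \<longleftrightarrow> sat D mem p s')"
    "\<forall>D s s'. (\<forall>i<N'. s i = s' i) \<longrightarrow> (sat D mem q s \<longleftrightarrow> sat D mem q s')" by blast
  then have "\<forall>D s s'. (\<forall>i<max N N'. s i = s' i) \<longrightarrow> (sat D mem (fm.Imp p q) s \<longleftrightarrow> sat D mem (fm.Imp p q) s')"
    by (metis less_max_iff_disj sat.simps(6))
  then show ?case by blast
next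
  case (Exists x p)
  then obtain N where N: "\<And>D s s'. (\<forall>i<N. s i = s' i) \<Longrightarrow> (sat D mem p s \<longleftrightarrow> sat D mem p s')" by blast
  have "sat D mem p (s(x := a)) \<longleftrightarrow> sat D mem p (s'(x := a))" if "\<forall>i<N. s i = s' i" for D s s' a
    by (rule N) (use that in auto)
  then show ?case by (intro exI[of _ N]) (simp del: fun_upd_apply, blast)
next
  case (Forall x p)
  then obtain N where N: "\<And>D s s'. (\<forall>i<N. s i = s' i) \<Longrightarrow> (sat D mem p s \<longleftrightarrow> sat D mem p s')" by blast
  have "sat D mem p (s(x := a)) \<longleftrightarrow> sat D mem p (s'(x := a))" if "\<forall>i<N. s i = s' i" for D s s' a
    by (rule N) (use that in auto)
  then show ?case by (intro exI[of _ N]) (simp del: fun_upd_apply, blast)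
qed

text \<open>\<open>w\<close> codes values for the leading existential quantifiers by nested pairs. A
  transitive \<open>M\<close> that contains \<open>w\<close> contains these values, and the
  remaining Pi_1 matrix passes down to \<open>M\<close> because its quantifiers range over
  less.\<close>

lemma sigma2_down:
  assumes "sigma_fm 2 p" "sat UNIV mem p s"
  shows "\<exists>w. \<forall>M. transitive_class mem M \<and> w \<in> M \<and> (\<forall>i. s i \<in> M) \<longrightarrow> sat M mem p s"
proof -
  let ?S = "\<lambda>n p. (n = 0 \<longrightarrow> delta0_fm p) \<and> (n = 2 \<longrightarrow> (\<forall>s. sat UNIV mem p s \<longrightarrow>
     (\<exists>w. \<forall>M. transitive_class mem M \<and> w \<in> M \<and> (\<forall>i. s i \<in> M) \<longrightarrow> sat M mem p s)))"
  let ?P = "\<lambda>n p. n = 1 \<longrightarrow> (\<forall>s M. sat UNIV mem p s \<and> transitive_class mem M \<and> (\<forall>i. s i \<in> M) \<longrightarrow> sat M mem p s)"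
  have "(sigma_fm n p \<longrightarrow> ?S n p) \<and> (pi_fm n p \<longrightarrow> ?P n p)" for n p
  proof (induction rule: sigma_fm_pi_fm.induct)
    case (4 n p x)
    show ?case
    proof (intro conjI impI allI)
      fix s assume n: "Suc n = 2" and "sat UNIV mem (Exists x p) s"
      then obtain a where "sat UNIV mem p (s(x := a))" by auto
      then obtain w where w: "\<And>M. transitive_class mem M \<and> w \<in> M \<and> (\<forall>i. (s(x := a)) i \<in> M) \<Longrightarrow> sat M mem p (s(x := a))"
        using 4(2) n by blast
      show "\<exists>w. \<forall>M. transitive_class mem M \<and> w \<in> M \<and> (\<forall>i. s i \<in> M) \<longrightarrow> sat M mem (Exists x p) s"
      proof (intro exI[of _ "pair a w"] allI impI)
        fix M assume M: "transitive_class mem M \<and> pair a w \<in> M \<and> (\<forall>i. s i \<in> M)"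
        have "upair a w \<epsilon> pair a w" "a \<epsilon> upair a w" "w \<epsilon> upair a w" by (auto simp: pair_def)
        then have "a \<in> M" "w \<in> M" using M unfolding transitive_class_def by blast+
        then have "sat M mem p (s(x := a))" using w[of M] M by simp
        then show "sat M mem (Exists x p) s" using \<open>a \<in> M\<close> by (auto simp del: fun_upd_apply)
      qed
    qed simp
  next
    case (5 n p)
    then show ?case using delta0_abs_tr[of p] by auto
  next
    case (6 n p x)
    show ?case
    proof (intro impI allI, elim conjE)
      fix s M assume n: "Suc n = 1" and 1: "sat UNIV mem (Forall x p) s" "transitive_class mem M" "\<forall>i. s i \<in> M"
      have "sat M mem p (s(x := a))" if "a \<in> M" for a
      proof -
        have "sat UNIV mem p (s(x := a))" "\<forall>i. (s(x := a)) i \<in> M" using 1 that by simp_all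
        then show ?thesis using 6(2) n 1(2) by blast
      qed
      then show "sat M mem (Forall x p) s" by (simp del: fun_upd_apply)
    qed
  qed auto
  then show ?thesis using assms by blast
qed

theorem strong_PRP:
  assumes pc: "proper_class mem {k. strong mem k}"
  shows "PRP mem (sigma_fm 2)"
  unfolding PRP_def
proof (intro allI impI, elim conjE)
  fix C assume defC: "definable mem (sigma_fm 2) C" and grC: "\<forall>A\<in>C. graph mem A"
  obtain p s0 where p: "sigma_fm 2 p" and C0: "C = {x. sat UNIV mem p (s0(0 := x))}" using defC definable_def by metis
  obtain N where N: "\<And>D s s'. (\<forall>i<N. s i = s' i) \<Longrightarrow> (sat D mem p s \<longleftrightarrow> sat D mem p s')" using sat_vars by metis
  define s where "s i = (if i < N then s0 i else emp)" for i
  have C: "x \<in> C \<longleftrightarrow> sat UNIV mem p (s(0 := x))" for x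
    unfolding C0 using N[of "s0(0 := x)" "s(0 := x)" UNIV] by (simp add: s_def)
  have [simp]: "TM t \<Longrightarrow> DP (\<lambda>e. t e \<in> C)" for t by (rule DP_app1[OF DP_definable[OF defC]])
  have "\<exists>c. Ord c \<and> (\<forall>i<n. s i \<epsilon> V c)" for n
  proof (induction n)
    case (Suc n)
    then obtain c where c: "Ord c" "\<forall>i<n. s i \<epsilon> V c" by blast
    obtain d where d: "Ord d" "s n \<epsilon> V d" using in_V_ex by blast
    obtain b where "Ord b" "c \<epsilon> b" "d \<epsilon> b" using Ord_max c d by blast
    then show ?case using c d V_up less_Suc_eq by metis
  qed (use Ord_emp in blast)
  then obtain c where c: "Ord c" "\<forall>i<N. s i \<epsilon> V c" by blast
  obtain k where k: "strong mem k" "c \<epsilon> k" using strong_unbounded[OF pc c(1)] by blast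
  have ok: "Ord k" using k card_Ord unfolding strong_def by blast
  have sk: "s i \<epsilon> V k" for i
  proof (cases "i < N")
    case True then show ?thesis using c V_up ok k by blast
  next
    case False
    then show ?thesis using V_I[OF k(2), of emp] by (simp add: s_def)
  qed
  let ?S = "Sep (V k) (\<lambda>x. x \<in> C)"
  have Sgr: "A \<epsilon> ?S \<Longrightarrow> graph mem A" for A using grC by simp
  obtain P where P: "is_product mem P ?S" using product_ex[of ?S] Sgr by blast
  have "Hom P G" if GC: "G \<in> C" for G
  proof (rule ccontr)
    assume nG: "\<not> Hom P G"
    define B where "B r \<longleftrightarrow> (\<exists>G. G \<epsilon> V (succ r) \<and> G \<in> C \<and> \<not> Hom P G)" for r
    have DB: "DP (\<lambda>e. B (e 0))" unfolding B_def by simp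
    have "B (rk G)" unfolding B_def using in_V_rk GC nG by blast
    then obtain r where r: "Ord r" "B r" "\<And>q. q \<epsilon> r \<Longrightarrow> \<not> B q"
      using Ord_least[OF DB Ord_rk] by blast
    then obtain G where G: "G \<epsilon> V (succ r)" "G \<in> C" "\<not> Hom P G" unfolding B_def by blast
    let ?T = "Sep (V r) (\<lambda>x. x \<in> C)"
    have Tgr: "A \<epsilon> ?T \<Longrightarrow> graph mem A" for A using grC by simp
    obtain Q where Q: "is_product mem Q ?T" using product_ex[of ?T] Tgr by blast
    have "Hom P A" if "A \<epsilon> ?T" for A
    proof -
      have A: "A \<epsilon> V r" "A \<in> C" using that by simp_all
      then obtain q where q: "q \<epsilon> r" "A \<sqsubseteq> V q" using mem_V[of A r] by blast
      then have "A \<epsilon> V (succ q)" using V_succ r(1) Ord_in by simp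
      then show ?thesis using r(3)[OF q(1)] A unfolding B_def by blast
    qed
    moreover have "P = pair (pi1 P) (pi2 P)" using is_productD[OF P Sgr] by (metis pi_pair)
    ultimately have PQ: "Hom P Q" using product_univ[OF Q Tgr] by blast
    have "\<not> succ r \<sqsubseteq> k"
    proof
      assume "succ r \<sqsubseteq> k"
      then have "G \<epsilon> ?S" using G V_mono subD by simp blast
      then show False using product_proj[OF P Sgr] G(3) by blast
    qed
    then have kr: "k \<epsilon> r \<or> k = r" using Ord_not_le[OF Ord_succ[OF r(1)] ok] by simp
    obtain w where w: "\<And>M. transitive_class mem M \<and> w \<in> M \<and> (\<forall>i. (s(0 := G)) i \<in> M) \<Longrightarrow> sat M mem p (s(0 := G))"
      using sigma2_down[OF p, of "s(0 := G)"] G(2) C by blast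
    \<comment> \<open>The target level \<open>mu\<close> is chosen above a limit \<open>l\<close>
      beyond the levels of \<open>w\<close>, of \<open>G\<close> and of \<open>r\<close>, so that
      \<open>M\<close> contains both sets and, for Kunen's theorem, all functions from
      \<open>r\<close> to \<open>r\<close>.\<close>
    obtain a where a: "Ord a" "w \<epsilon> V a" using in_V_ex by blast
    obtain b where b: "Ord b" "a \<epsilon> b" "succ r \<epsilon> b" using Ord_max a(1) Ord_succ[OF r(1)] by blast
    obtain d where d: "Ord d" "b \<epsilon> d" "k \<epsilon> d" using Ord_max b(1) ok by blast
    obtain l where l: "Lim l" "d \<epsilon> l" using Lim_ex d(1) by blast
    have ol: "Ord l" using l Lim_Ord by blast
    obtain mu where mu: "cardinal mem mu" "l \<epsilon> mu" using cardinal_ex ol by blast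
    have om: "Ord mu" using mu card_Ord by blast
    have "k \<epsilon> mu" by (rule Ord_trans[OF om Ord_trans[OF ol d(3) l(2)] mu(2)])
    then have "strong_for mem mu k" using k(1) mu(1) unfolding strong_def by blast
    then obtain j M where e: "elem mem j M" "critical_point mem j k" "\<And>x. x \<epsilon> V mu \<Longrightarrow> x \<in> M"
      using strong_for_elem by blast
    interpret elem mem j M by (rule e(1))
    have lM: "x \<epsilon> V l \<Longrightarrow> x \<in> M" for x using e(3) V_up[OF om mu(2)] by blast
    have bl: "b \<epsilon> l" using Ord_trans[OF ol d(2) l(2)] .
    have bM: "x \<epsilon> V b \<Longrightarrow> x \<in> M" for x using lM V_up[OF ol bl] by blast
    have wM: "w \<in> M" using bM V_up[OF b(1,2) a(2)] by blast
    have GM: "G \<in> M" using bM V_up[OF b(1,3) G(1)] by blast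
    have kc: "j k \<noteq> k" "\<And>a. a \<epsilon> k \<Longrightarrow> j a = a" using e(2) unfolding critical_point_def by blast+
    have js: "j (s i) = s i" for i by (rule j_V_fix[OF ok kc(2) sk])
    then have sM: "s i \<in> M" for i using jM[of "s i"] by simp
    have satG: "sat M mem p (s(0 := G))" using w[of M] trM wM GM sM by simp
    consider "r \<epsilon> j r" | "r = j r" using j_ge' r(1) by blast
    then show False
    proof cases
      case 1
      \<comment> \<open>Two variables beyond those of \<open>p\<close> and different from 0. The
        formula says that the members of \<open>C\<close> in \<open>V r\<close> lie in
        \<open>?T\<close>; in \<open>M\<close> it puts \<open>G\<close> into \<open>j ?T\<close>, as
        \<open>M\<close> satisfies \<open>p\<close> at \<open>G\<close>.\<close>
      let ?v = "Suc N" and ?u = "Suc (Suc N)"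
      let ?f = "Forall 0 (fm.Imp (Conj (fm.Mem 0 ?u) p) (fm.Mem 0 ?v))"
      let ?s = "s(?v := ?T, ?u := V r)"
      have "sat UNIV mem p (?s(0 := x)) \<longleftrightarrow> x \<in> C" for x
        unfolding C by (rule N) auto
      then have "sat UNIV mem ?f ?s" by simp
      then have "sat M mem ?f (\<lambda>i. j (?s i))" using sat_j by blast
      then have "G \<epsilon> j (V r) \<longrightarrow> sat M mem p ((\<lambda>i. j (?s i))(0 := G)) \<longrightarrow> G \<epsilon> j ?T" using GM by simp
      moreover have "sat M mem p ((\<lambda>i. j (?s i))(0 := G)) \<longleftrightarrow> sat M mem p (s(0 := G))"
        by (rule N) (auto simp: js)
      moreover have "G \<epsilon> j (V r)"
      proof -
        have "succ r \<sqsubseteq> j r" using succ_le[of "j r" r] 1 r(1) Ord_sub[of "j r"] by auto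
        then have "G \<epsilon> V (j r)" using G(1) V_mono subD by blast
        then show ?thesis using j_V[OF r(1)] GM by blast
      qed
      ultimately have GT: "G \<epsilon> j ?T" using satG by blast
      obtain U R where Q': "Q = pair U R"
        "\<And>f. f \<epsilon> U \<longleftrightarrow> function_on mem f ?T \<and> (\<forall>A. A \<epsilon> ?T \<longrightarrow> app f A \<epsilon> pi1 A)"
        "\<And>f g. pair f g \<epsilon> R \<longleftrightarrow> f \<epsilon> U \<and> g \<epsilon> U \<and> (\<forall>A. A \<epsilon> ?T \<longrightarrow> pair (app f A) (app g A) \<epsilon> pi2 A)"
        by (rule is_productD[OF Q Tgr that])
      have D1: "D0 K0 (\<lambda>e. \<forall>A. A \<epsilon> e 0 \<longrightarrow> app (e 1) A \<epsilon> pi1 A)" by (rule d0)+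
      have D2: "D0 K0 (\<lambda>e. \<forall>A. A \<epsilon> e 0 \<longrightarrow> pair (app (e 1) A) (app (e 2) A) \<epsilon> pi2 A)" by (rule d0)+
      have GG: "G = pair (pi1 G) (pi2 G)" using grC G(2) graph_iff by blast
      have "Hom (pair U R) (pair (pi1 G) (pi2 G))"
      proof (rule HomI[where F="\<lambda>f. app (j f) G"])
        fix f assume "f \<epsilon> U"
        then have "\<forall>A. A \<epsilon> j ?T \<longrightarrow> app (j f) A \<epsilon> pi1 A" using Q'(2) jL[OF D1, of "[?T, f]"] by simp
        then show "app (j f) G \<epsilon> pi1 G" using GT by blast
      next
        fix f g assume "f \<epsilon> U" "g \<epsilon> U" "pair f g \<epsilon> R"
        then have "\<forall>A. A \<epsilon> j ?T \<longrightarrow> pair (app (j f) A) (app (j g) A) \<epsilon> pi2 A"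
          using Q'(3)[of f g] jL[OF D2, of "[?T, f, g]"] by (simp add: numeral_2_eq_2)
        then show "pair (app (j f) G) (app (j g) G) \<epsilon> pi2 G" using GT by blast
      qed simp
      then have "Hom Q G" using Q'(1) GG by simp
      then show False using PQ Hom_trans G(3) by blast
    next
      case 2
      then have "k \<epsilon> r" using kr kc(1) by auto
      moreover have "f \<in> M" if f: "function_to mem f r r" for f
      proof -
        have "r \<epsilon> l" using Ord_trans[OF ol _ bl] Ord_trans[OF b(1) _ b(3), of r] by simp
        then have "r \<epsilon> V l" using Lim_mem_V l by blast
        then show ?thesis using lM V_lim_Funs[OF l(1) f] by blast
      qed
      moreover have "j x \<noteq> k" for x using crit_range ok kc by blast
      ultimately show False using kunen[of r k] r(1) 2 by metis
    qed
  qed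
  then show "\<exists>S. (\<forall>A. A \<epsilon> S \<longrightarrow> A \<in> C) \<and> (\<exists>P. is_product mem P S \<and> (\<forall>B\<in>C. \<exists>h. hom mem h P B))"
    using P unfolding Hom_def by (intro exI[of _ ?S]) auto
qed

section \<open>From product reflection to the semi-weak Vopenka principle\<close>

lemma D0_sat: "delta0_fm p \<Longrightarrow> (\<And>i. T0 K (t i)) \<Longrightarrow> D0 K (\<lambda>e. sat UNIV mem p (\<lambda>i. t i e))"
proof (induction arbitrary: t rule: delta0_fm.induct)
  case (7 p x y)
  have upd: "(\<lambda>i. t i e)(x := a) = (\<lambda>i. if i = x then a else t i e)" for e a by auto
  have "D0 K (\<lambda>e. \<exists>a. a \<epsilon> t y e \<and> sat UNIV mem p (\<lambda>i. if i = x then a else t i e))"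
  proof (rule D0_bex)
    have "T0 K (\<lambda>e. if i = x then e 0 else t i (\<lambda>n. e (Suc n)))" for i
      using T0_var[of K 0] T0_ren[OF 7(4), of i Suc] by (cases "i = x") simp_all
    from 7(3)[of "\<lambda>i e. if i = x then e 0 else t i (\<lambda>n. e (Suc n))", OF this]
    show "D0 K (\<lambda>e. sat UNIV mem p (\<lambda>i. if i = x then e 0 else t i (\<lambda>n. e (Suc n))))" .
  qed (rule 7(4))
  then show ?case by (rule D0_eqI) (use 7(2) in \<open>auto simp: upd\<close>)
next
  case (8 p x y)
  have upd: "(\<lambda>i. t i e)(x := a) = (\<lambda>i. if i = x then a else t i e)" for e a by auto
  have "D0 K (\<lambda>e. \<forall>a. a \<epsilon> t y e \<longrightarrow> sat UNIV mem p (\<lambda>i. if i = x then a else t i e))"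
  proof (rule D0_ball)
    have "T0 K (\<lambda>e. if i = x then e 0 else t i (\<lambda>n. e (Suc n)))" for i
      using T0_var[of K 0] T0_ren[OF 8(4), of i Suc] by (cases "i = x") simp_all
    from 8(3)[of "\<lambda>i e. if i = x then e 0 else t i (\<lambda>n. e (Suc n))", OF this]
    show "D0 K (\<lambda>e. sat UNIV mem p (\<lambda>i. if i = x then e 0 else t i (\<lambda>n. e (Suc n))))" .
  qed (rule 8(4))
  then show ?case by (rule D0_eqI) (use 8(2) in \<open>auto simp: upd\<close>)
qed (simp_all add: d0)

lemma df_weaken: "df \<Gamma> K P \<Longrightarrow> (\<And>p. \<Gamma> p \<Longrightarrow> \<Delta> p) \<Longrightarrow> df \<Delta> K P"
  unfolding df_def by blast

text \<open>A bounded condition passes under the quantifiers of the prefix because the universe is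
  not empty. The shape serves two purposes: a bounded conjunct for Sigma classes, and an additional
  bounded alternative for Pi classes.\<close>

lemma sigma_pi_subst:
  assumes "D0 K Q1" "D0 K Q2" "\<And>i. T0 K (t i)"
  shows "sigma_fm n p \<Longrightarrow> df (sigma_fm n) K (\<lambda>e. Q1 e \<or> Q2 e \<and> sat UNIV mem p (\<lambda>i. t i e))"
    and "pi_fm n p \<Longrightarrow> df (pi_fm n) K (\<lambda>e. Q1 e \<or> Q2 e \<and> sat UNIV mem p (\<lambda>i. t i e))"
proof -
  let ?G = "\<lambda>\<Gamma> p. \<forall>Q1 Q2 t. D0 K Q1 \<longrightarrow> D0 K Q2 \<longrightarrow> (\<forall>i. T0 K (t i)) \<longrightarrow>
     df \<Gamma> K (\<lambda>e. Q1 e \<or> Q2 e \<and> sat UNIV mem p (\<lambda>i. t i e))"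
  have upd: "(\<lambda>i. t i e)(x := a) = (\<lambda>i. if i = x then a else t i e)" for t e a and x :: nat by auto
  have T: "T0 K (\<lambda>e. if i = x then e 0 else t i (\<lambda>n. e (Suc n)))" if "\<forall>i. T0 K (t i)" for i x t
    using T0_var[of K 0] T0_ren[of K "t i" Suc] that by (cases "i = x") simp_all
  have "(sigma_fm n p \<longrightarrow> ?G (sigma_fm n) p) \<and> (pi_fm n p \<longrightarrow> ?G (pi_fm n) p)"
  proof (induction rule: sigma_fm_pi_fm.induct)
    case (1 p)
    show ?case
    proof (intro allI impI)
      fix Q1 Q2 and t :: "nat \<Rightarrow> (nat \<Rightarrow> 'v) \<Rightarrow> 'v" assume a: "D0 K Q1" "D0 K Q2" "\<forall>i. T0 K (t i)"
      show "df (sigma_fm 0) K (\<lambda>e. Q1 e \<or> Q2 e \<and> sat UNIV mem p (\<lambda>i. t i e))"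
        by (rule df_weaken[OF D0_disj[OF a(1) D0_conj[OF a(2) D0_sat[OF 1 a(3)[rule_format]]]]]) (rule sigma_fm_pi_fm.intros)
    qed
  next
    case (2 p)
    show ?case
    proof (intro allI impI)
      fix Q1 Q2 and t :: "nat \<Rightarrow> (nat \<Rightarrow> 'v) \<Rightarrow> 'v" assume a: "D0 K Q1" "D0 K Q2" "\<forall>i. T0 K (t i)"
      show "df (pi_fm 0) K (\<lambda>e. Q1 e \<or> Q2 e \<and> sat UNIV mem p (\<lambda>i. t i e))"
        by (rule df_weaken[OF D0_disj[OF a(1) D0_conj[OF a(2) D0_sat[OF 2 a(3)[rule_format]]]]]) (rule sigma_fm_pi_fm.intros)
    qed
  next
    case (3 n p)
    show ?case
    proof (intro allI impI)
      fix Q1 Q2 and t :: "nat \<Rightarrow> (nat \<Rightarrow> 'v) \<Rightarrow> 'v" assume a: "D0 K Q1" "D0 K Q2" "\<forall>i. T0 K (t i)"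
      have "df (pi_fm n) K (\<lambda>e. Q1 e \<or> Q2 e \<and> sat UNIV mem p (\<lambda>i. t i e))" using 3(2) a by blast
      then show "df (sigma_fm (Suc n)) K (\<lambda>e. Q1 e \<or> Q2 e \<and> sat UNIV mem p (\<lambda>i. t i e))"
        by (rule df_weaken) (rule sigma_fm_pi_fm.intros)
    qed
  next
    case (4 n p x)
    show ?case
    proof (intro allI impI)
      fix Q1 Q2 and t :: "nat \<Rightarrow> (nat \<Rightarrow> 'v) \<Rightarrow> 'v" assume a: "D0 K Q1" "D0 K Q2" "\<forall>i. T0 K (t i)"
      have "df (sigma_fm (Suc n)) K (\<lambda>e. \<exists>a. Q1 e \<or> Q2 e \<and> sat UNIV mem p (\<lambda>i. if i = x then a else t i e))"
      proof (rule df_ex)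
        show "df (sigma_fm (Suc n)) K (\<lambda>e. Q1 (\<lambda>n. e (Suc n)) \<or> Q2 (\<lambda>n. e (Suc n)) \<and>
            sat UNIV mem p (\<lambda>i. if i = x then e 0 else t i (\<lambda>n. e (Suc n))))"
          using 4(2)[rule_format, of "\<lambda>e. Q1 (\<lambda>n. e (Suc n))" "\<lambda>e. Q2 (\<lambda>n. e (Suc n))" "\<lambda>i e. if i = x then e 0 else t i (\<lambda>n. e (Suc n))",
            OF D0_ren[OF a(1)] D0_ren[OF a(2)] T[OF a(3)]] .
      qed (auto intro: sigma_fm_pi_fm.intros)
      moreover have "(\<exists>a. Q1 e \<or> Q2 e \<and> sat UNIV mem p (\<lambda>i. if i = x then a else t i e)) \<longleftrightarrow>
         Q1 e \<or> Q2 e \<and> sat UNIV mem (Exists x p) (\<lambda>i. t i e)" for e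
        by (auto simp: upd)
      ultimately show "df (sigma_fm (Suc n)) K (\<lambda>e. Q1 e \<or> Q2 e \<and> sat UNIV mem (Exists x p) (\<lambda>i. t i e))" by simp
    qed
  next
    case (5 n p)
    show ?case
    proof (intro allI impI)
      fix Q1 Q2 and t :: "nat \<Rightarrow> (nat \<Rightarrow> 'v) \<Rightarrow> 'v" assume a: "D0 K Q1" "D0 K Q2" "\<forall>i. T0 K (t i)"
      have "df (sigma_fm n) K (\<lambda>e. Q1 e \<or> Q2 e \<and> sat UNIV mem p (\<lambda>i. t i e))" using 5(2) a by blast
      then show "df (pi_fm (Suc n)) K (\<lambda>e. Q1 e \<or> Q2 e \<and> sat UNIV mem p (\<lambda>i. t i e))"
        by (rule df_weaken) (rule sigma_fm_pi_fm.intros)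
    qed
  next
    case (6 n p x)
    show ?case
    proof (intro allI impI)
      fix Q1 Q2 and t :: "nat \<Rightarrow> (nat \<Rightarrow> 'v) \<Rightarrow> 'v" assume a: "D0 K Q1" "D0 K Q2" "\<forall>i. T0 K (t i)"
      have "df (pi_fm (Suc n)) K (\<lambda>e. \<forall>a. Q1 e \<or> Q2 e \<and> sat UNIV mem p (\<lambda>i. if i = x then a else t i e))"
      proof (rule df_all)
        show "df (pi_fm (Suc n)) K (\<lambda>e. Q1 (\<lambda>n. e (Suc n)) \<or> Q2 (\<lambda>n. e (Suc n)) \<and>
            sat UNIV mem p (\<lambda>i. if i = x then e 0 else t i (\<lambda>n. e (Suc n))))"
          using 6(2)[rule_format, of "\<lambda>e. Q1 (\<lambda>n. e (Suc n))" "\<lambda>e. Q2 (\<lambda>n. e (Suc n))" "\<lambda>i e. if i = x then e 0 else t i (\<lambda>n. e (Suc n))",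
            OF D0_ren[OF a(1)] D0_ren[OF a(2)] T[OF a(3)]] .
      qed (auto intro: sigma_fm_pi_fm.intros)
      moreover have "(\<forall>a. Q1 e \<or> Q2 e \<and> sat UNIV mem p (\<lambda>i. if i = x then a else t i e)) \<longleftrightarrow>
         Q1 e \<or> Q2 e \<and> sat UNIV mem (Forall x p) (\<lambda>i. t i e)" for e
        by (auto simp: upd)
      ultimately show "df (pi_fm (Suc n)) K (\<lambda>e. Q1 e \<or> Q2 e \<and> sat UNIV mem (Forall x p) (\<lambda>i. t i e))" by simp
    qed
  qed
  then show "sigma_fm n p \<Longrightarrow> df (sigma_fm n) K (\<lambda>e. Q1 e \<or> Q2 e \<and> sat UNIV mem p (\<lambda>i. t i e))"
    "pi_fm n p \<Longrightarrow> df (pi_fm n) K (\<lambda>e. Q1 e \<or> Q2 e \<and> sat UNIV mem p (\<lambda>i. t i e))"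
    using assms by blast+
qed

text \<open>The labels let a bounded quantifier recover the term of the sequence that a copy comes from, so that
  the class of copies is definable by a formula of the same complexity as the sequence.\<close>

definition lgr :: "'v \<Rightarrow> 'v" where
  "lgr p = pair (Im (pi1 (pi2 p)) (\<lambda>x. pair p x))
     (Im (pi2 (pi2 p)) (\<lambda>q. pair (pair p (pi1 q)) (pair p (pi2 q))))"

text \<open>All quantifiers range over components of \<open>X\<close> or of the graph. An edge of
  the copy is found as an element \<open>w\<close> of \<open>pi2 X\<close> and compared by
  projections, which avoids naming a pair of pairs.\<close>

lemma eq_lgr_iff: assumes "graph mem (pi2 p)"
  shows "X = lgr p \<longleftrightarrow> X = pair (pi1 X) (pi2 X) \<and>
    (\<forall>v. v \<epsilon> pi1 X \<longrightarrow> pi2 v \<epsilon> pi1 (pi2 p) \<and> v = pair p (pi2 v)) \<and>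
    (\<forall>x. x \<epsilon> pi1 (pi2 p) \<longrightarrow> pair p x \<epsilon> pi1 X) \<and>
    (\<forall>w. w \<epsilon> pi2 X \<longrightarrow> w = pair (pi1 w) (pi2 w) \<and> pi1 w \<epsilon> pi1 X \<and> pi2 w \<epsilon> pi1 X \<and>
       pair (pi2 (pi1 w)) (pi2 (pi2 w)) \<epsilon> pi2 (pi2 p)) \<and>
    (\<forall>q. q \<epsilon> pi2 (pi2 p) \<longrightarrow> (\<exists>w. w \<epsilon> pi2 X \<and> w = pair (pi1 w) (pi2 w) \<and>
       pi1 w = pair p (pi1 q) \<and> pi2 w = pair p (pi2 q)))" (is "_ \<longleftrightarrow> ?R")
proof
  obtain G R where g: "pi2 p = pair G R" "G \<noteq> emp" "\<And>q. q \<epsilon> R \<Longrightarrow> \<exists>x y. x \<epsilon> G \<and> y \<epsilon> G \<and> q = pair x y"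
    using graphE[OF assms] by metis
  show ?R if "X = lgr p"
    unfolding that lgr_def using g(3) by (auto simp: g(1)) (use g(3) in force)+
  assume r: ?R
  have "pi1 X = pi1 (lgr p)" by (rule ext) (use r in \<open>auto simp: lgr_def\<close>)
  moreover have "w \<epsilon> pi2 X \<longleftrightarrow> w \<epsilon> pi2 (lgr p)" for w
  proof
    assume w: "w \<epsilon> pi2 X"
    let ?q = "pair (pi2 (pi1 w)) (pi2 (pi2 w))"
    have "pi1 w = pair p (pi2 (pi1 w))" "pi2 w = pair p (pi2 (pi2 w))" "w = pair (pi1 w) (pi2 w)"
      "?q \<epsilon> pi2 (pi2 p)" using r w by blast+
    then have 1: "?q \<epsilon> pi2 (pi2 p)" and 2: "w = pair (pair p (pi1 ?q)) (pair p (pi2 ?q))"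
      unfolding pi_pair by metis+
    show "w \<epsilon> pi2 (lgr p)" unfolding lgr_def pi_pair by (subst mem_Im) (simp, rule exI[of _ ?q], rule conjI[OF 1 2])
  next
    assume "w \<epsilon> pi2 (lgr p)"
    then obtain q where q: "q \<epsilon> pi2 (pi2 p)" "w = pair (pair p (pi1 q)) (pair p (pi2 q))"
      by (auto simp: lgr_def)
    then obtain w' where "w' \<epsilon> pi2 X" "w' = pair (pi1 w') (pi2 w')" "pi1 w' = pair p (pi1 q)" "pi2 w' = pair p (pi2 q)"
      using r by blast
    then show "w \<epsilon> pi2 X" using q by metis
  qed
  then have "pi2 X = pi2 (lgr p)" by (rule ext)
  moreover have "X = pair (pi1 X) (pi2 X)" using r by blast
  ultimately show "X = lgr p" by (simp add: lgr_def)
qed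

definition is_lgr :: "'v \<Rightarrow> 'v \<Rightarrow> bool" where
  "is_lgr X p \<longleftrightarrow> graph mem (pi2 p) \<and> X = lgr p"

lemma D0_is_lgr: "T0 K t \<Longrightarrow> T0 K r \<Longrightarrow> D0 K (\<lambda>e. is_lgr (t e) (r e))"
proof (rule D0_app2[where P=is_lgr])
  have gb: "graph mem A \<longleftrightarrow> A = pair (pi1 A) (pi2 A) \<and> pi1 A \<noteq> emp \<and>
    (\<forall>w. w \<epsilon> pi2 A \<longrightarrow> (\<exists>x. x \<epsilon> pi1 A \<and> (\<exists>y. y \<epsilon> pi1 A \<and> w = pair x y)))" for A
    unfolding graph_iff by blast
  show "D0 K (\<lambda>e. is_lgr (e 0) (e 1))"
    unfolding is_lgr_def by (simp only: eq_lgr_iff cong: conj_cong) (unfold gb, (rule d0)+)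
qed

lemma lgr_graph: assumes "graph mem (pi2 p)" shows "graph mem (lgr p)"
proof -
  obtain G R where g: "pi2 p = pair G R" "G \<noteq> emp" "\<And>q. q \<epsilon> R \<Longrightarrow> \<exists>x y. x \<epsilon> G \<and> y \<epsilon> G \<and> q = pair x y"
    using graphE[OF assms] by metis
  obtain x where "x \<epsilon> G" using nonempty g(2) by blast
  then have "pair p x \<epsilon> pi1 (lgr p)" by (simp add: lgr_def g(1))
  then have "pi1 (lgr p) \<noteq> emp" by (metis emp)
  moreover have "\<exists>x y. x \<epsilon> pi1 (lgr p) \<and> y \<epsilon> pi1 (lgr p) \<and> w = pair x y" if w: "w \<epsilon> pi2 (lgr p)" for w
  proof -
    obtain q where q: "q \<epsilon> R" "w = pair (pair p (pi1 q)) (pair p (pi2 q))" using w by (auto simp: lgr_def g(1))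
    obtain x y where "x \<epsilon> G" "y \<epsilon> G" "q = pair x y" using g(3)[OF q(1)] by blast
    then show ?thesis using q(2) by (intro exI[of _ "pair p x"] exI[of _ "pair p y"]) (simp add: lgr_def g(1))
  qed
  ultimately show ?thesis unfolding graph_iff by (simp add: lgr_def)
qed

lemma Hom_lgr: assumes "graph mem A" shows "Hom A (lgr (pair a A))" "Hom (lgr (pair a A)) A"
proof -
  obtain G R where g: "A = pair G R" "G \<noteq> emp" "\<And>q. q \<epsilon> R \<Longrightarrow> \<exists>x y. x \<epsilon> G \<and> y \<epsilon> G \<and> q = pair x y"
    using graphE[OF assms] by metis
  let ?p = "pair a A"
  have l: "lgr ?p = pair (Im G (\<lambda>x. pair ?p x)) (Im R (\<lambda>q. pair (pair ?p (pi1 q)) (pair ?p (pi2 q))))"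
    by (simp add: lgr_def g(1))
  show "Hom A (lgr ?p)" unfolding l
    by (subst g(1), rule HomI[where F="\<lambda>x. pair ?p x"]) (auto intro!: exI[of _ "pair _ _"])
  show "Hom (lgr ?p) A" unfolding l
  proof (subst g(1), rule HomI[where F=pi2])
    fix x y
    assume "pair x y \<epsilon> Im R (\<lambda>q. pair (pair ?p (pi1 q)) (pair ?p (pi2 q)))"
    then obtain q where q: "q \<epsilon> R" "pair x y = pair (pair ?p (pi1 q)) (pair ?p (pi2 q))" by (subst (asm) mem_Im) auto
    obtain x' y' where "q = pair x' y'" using g(3)[OF q(1)] by blast
    then show "pair (pi2 x) (pi2 y) \<epsilon> R" using q by simp
  qed auto
qed

lemma Ord_bound: assumes "\<And>x. x \<epsilon> A \<Longrightarrow> Ord x" shows "\<exists>b. Ord b \<and> (\<forall>x. x \<epsilon> A \<longrightarrow> x \<epsilon> b)"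
proof -
  have o: "Ord (Uni A)" using Ord_Uni assms by blast
  have "x \<epsilon> succ (Uni A)" if "x \<epsilon> A" for x
  proof -
    have "x \<sqsubseteq> Uni A" using that by (auto simp: subset_of_def)
    then show ?thesis using Ord_le[OF assms[OF that] o] by simp
  qed
  then show ?thesis using Ord_succ[OF o] by blast
qed

text \<open>\<open>?o\<close> reads the index off the labels, so the copies form a proper class. If
  \<open>b\<close> bounds the indices of the copies in \<open>S\<close>, then \<open>F b\<close>
  maps to all factors, hence to the product, hence to \<open>F (succ b)\<close>, which a
  counterexample forbids.\<close>

lemma PRP_SWVP_aux:
  assumes P: "PRP mem \<Gamma>"
    and D: "\<And>F. definable mem \<Gamma> (OR_sequence mem F) \<Longrightarrow> (\<And>a. Ord a \<Longrightarrow> graph mem (F a)) \<Longrightarrow>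
       definable mem \<Gamma> {X. \<exists>a. Ord a \<and> X = lgr (pair a (F a))}"
  shows "SWVP mem \<Gamma>"
  unfolding SWVP_def
proof (intro notI, elim exE conjE)
  fix F assume F: "definable mem \<Gamma> (OR_sequence mem F)"
    and gr: "\<forall>a. Ord a \<longrightarrow> graph mem (F a)"
    and H: "\<forall>a b. Ord a \<and> Ord b \<and> (a \<epsilon> b \<or> a = b) \<longrightarrow> (\<exists>h. hom mem h (F b) (F a))"
    and N: "\<forall>a b. Ord a \<and> Ord b \<and> a \<epsilon> b \<longrightarrow> \<not> (\<exists>h. hom mem h (F a) (F b))"
  let ?L = "\<lambda>a. lgr (pair a (F a))"
  let ?C = "{X. \<exists>a. Ord a \<and> X = ?L a}"
  let ?o = "\<lambda>X. Im (pi1 X) (\<lambda>v. pi1 (pi1 v))"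
  have o: "x \<epsilon> ?o (?L a) \<longleftrightarrow> x = a" if oa: "Ord a" for x a
  proof -
    obtain G R where g: "F a = pair G R" "G \<noteq> emp" using graphE[OF gr[rule_format, OF oa]] by metis
    then obtain y where "y \<epsilon> G" using nonempty by blast
    then show ?thesis using g by (auto simp: lgr_def)
  qed
  have Dc: "definable mem \<Gamma> ?C" by (rule D[OF F]) (use gr in blast)
  have "proper_class mem ?C" unfolding proper_class_def
  proof
    assume "\<exists>c. \<forall>x. x \<epsilon> c \<longleftrightarrow> x \<in> ?C"
    then obtain c where c: "\<And>x. x \<epsilon> c \<longleftrightarrow> x \<in> ?C" by blast
    have "a \<epsilon> Uni (Im c ?o)" if "Ord a" for a
    proof -
      have "?L a \<epsilon> c" using c that by blast
      then show ?thesis using o[OF that] by (subst mem_Uni_Im, simp) blast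
    qed
    then show False using no_Ord_set by blast
  qed
  moreover have "graph mem X" if "X \<in> ?C" for X using that lgr_graph gr by auto
  ultimately obtain S P where S: "\<And>A. A \<epsilon> S \<Longrightarrow> A \<in> ?C" and P: "is_product mem P S" "\<And>B. B \<in> ?C \<Longrightarrow> Hom P B"
    using assms(1)[unfolded PRP_def, rule_format, of ?C] Dc unfolding Hom_def by blast
  have Sg: "A \<epsilon> S \<Longrightarrow> graph mem A" for A using S lgr_graph gr by fastforce
  let ?A = "Uni (Im S ?o)"
  have Ao: "x \<epsilon> ?A \<longleftrightarrow> (\<exists>X. X \<epsilon> S \<and> x \<epsilon> ?o X)" for x by (subst mem_Uni_Im) simp_all
  have "Ord x" if xA: "x \<epsilon> ?A" for x
  proof -
    obtain X where X: "X \<epsilon> S" "x \<epsilon> ?o X" using Ao[THEN iffD1, OF xA] by blast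
    then obtain a where "Ord a" "X = ?L a" using S by blast
    then show ?thesis using o[of a x] X(2) by simp
  qed
  then obtain b where b: "Ord b" "\<And>x. x \<epsilon> ?A \<Longrightarrow> x \<epsilon> b" using Ord_bound by blast
  have "Hom (F b) P"
  proof (rule product_univ[OF P(1) Sg])
    show "F b = pair (pi1 (F b)) (pi2 (F b))" using gr b(1) graph_iff by blast
    fix X assume X: "X \<epsilon> S"
    then obtain a where a: "Ord a" "X = ?L a" using S by blast
    then have "a \<epsilon> b" using b(2) Ao o X by blast
    then have "Hom (F b) (F a)" using H a b Hom_def by blast
    moreover have "Hom (F a) (?L a)" using Hom_lgr gr a by blast
    ultimately show "Hom (F b) X" using Hom_trans a by blast
  qed
  moreover have "Hom P (?L (succ b))" using P(2) Ord_succ[OF b(1)] by blast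
  moreover have "Hom (?L (succ b)) (F (succ b))" using Hom_lgr gr Ord_succ[OF b(1)] by blast
  ultimately have "Hom (F b) (F (succ b))" using Hom_trans by blast
  then show False using N b(1) Ord_succ[OF b(1)] unfolding Hom_def by (metis mem_succ)
qed

text \<open>Every vertex of a copy carries the same label, so the label can be introduced by an
  existential or by a universal quantifier over vertices. In the universal form, nonemptiness
  excludes vacuous truth; it stands in both disjuncts to fit \<open>sigma_pi_subst\<close>.\<close>

lemma lgr_class:
  assumes S: "OR_sequence mem F = {x. sat UNIV mem p (s(0 := x))}" and gr: "\<And>a. Ord a \<Longrightarrow> graph mem (F a)"
  shows "{X. \<exists>a. Ord a \<and> X = lgr (pair a (F a))} = {X. \<exists>v. v \<epsilon> pi1 X \<and> is_lgr X (pi1 v) \<and> sat UNIV mem p (s(0 := pi1 v))}"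
    "{X. \<exists>a. Ord a \<and> X = lgr (pair a (F a))} =
      {X. \<forall>v. (pi1 X \<noteq> emp \<and> \<not> v \<epsilon> pi1 X) \<or> (pi1 X \<noteq> emp \<and> is_lgr X (pi1 v)) \<and> sat UNIV mem p (s(0 := pi1 v))}"
proof -
  have sat: "sat UNIV mem p (s(0 := x)) \<longleftrightarrow> (\<exists>a. Ord a \<and> x = pair a (F a))" for x
    using S unfolding OR_sequence_def is_opair_iff by blast
  have v: "v \<epsilon> pi1 (lgr q) \<Longrightarrow> pi1 v = q" for v q by (auto simp: lgr_def)
  have ne: "\<exists>v. v \<epsilon> pi1 (lgr (pair a (F a)))" if "Ord a" for a
    using lgr_graph[of "pair a (F a)"] gr[OF that] unfolding graph_iff[of "lgr _"] by (simp add: nonempty)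
  have isl: "is_lgr X q \<Longrightarrow> X = lgr q" for X q unfolding is_lgr_def by simp
  have L: "is_lgr (lgr (pair a (F a))) (pair a (F a))" if "Ord a" for a using gr[OF that] by (simp add: is_lgr_def)
  show "{X. \<exists>a. Ord a \<and> X = lgr (pair a (F a))} = {X. \<exists>v. v \<epsilon> pi1 X \<and> is_lgr X (pi1 v) \<and> sat UNIV mem p (s(0 := pi1 v))}"
    unfolding sat
  proof (intro set_eqI iffI; clarify)
    fix a assume a: "Ord a"
    then obtain v where "v \<epsilon> pi1 (lgr (pair a (F a)))" using ne by blast
    then show "\<exists>v. v \<epsilon> pi1 (lgr (pair a (F a))) \<and> is_lgr (lgr (pair a (F a))) (pi1 v) \<and> (\<exists>b. Ord b \<and> pi1 v = pair b (F b))"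
      using v L a by metis
  qed (use isl in metis)
  show "{X. \<exists>a. Ord a \<and> X = lgr (pair a (F a))} =
      {X. \<forall>v. (pi1 X \<noteq> emp \<and> \<not> v \<epsilon> pi1 X) \<or> (pi1 X \<noteq> emp \<and> is_lgr X (pi1 v)) \<and> sat UNIV mem p (s(0 := pi1 v))}"
    unfolding sat
  proof (intro set_eqI iffI; clarify)
    fix a v assume a: "Ord a"
    assume "\<not> ((pi1 (lgr (pair a (F a))) \<noteq> emp \<and> is_lgr (lgr (pair a (F a))) (pi1 v)) \<and> (\<exists>aa. Ord aa \<and> pi1 v = pair aa (F aa)))"
    moreover have "pi1 (lgr (pair a (F a))) \<noteq> emp" using ne[OF a] by (metis emp)
    ultimately show "pi1 (lgr (pair a (F a))) \<noteq> emp \<and> \<not> v \<epsilon> pi1 (lgr (pair a (F a)))"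
      using v L[OF a] a by metis
  next
    fix X assume r: "\<forall>v. (pi1 X \<noteq> emp \<and> \<not> v \<epsilon> pi1 X) \<or> (pi1 X \<noteq> emp \<and> is_lgr X (pi1 v)) \<and> (\<exists>a. Ord a \<and> pi1 v = pair a (F a))"
    then have "pi1 X \<noteq> emp" by blast
    then obtain v where "v \<epsilon> pi1 X" using nonempty by blast
    then have "is_lgr X (pi1 v) \<and> (\<exists>a. Ord a \<and> pi1 v = pair a (F a))" using r by blast
    then show "\<exists>a. Ord a \<and> X = lgr (pair a (F a))" using isl by metis
  qed
qed

theorem PRP_SWVP:
  "PRP mem (sigma_fm (Suc n)) \<Longrightarrow> SWVP mem (sigma_fm (Suc n))"
  "PRP mem (pi_fm (Suc n)) \<Longrightarrow> SWVP mem (pi_fm (Suc n))"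
proof -
  have T: "T0 s (\<lambda>e. if i = 0 then pi1 (e 0) else s i)" for s and i :: nat
    by (cases "i = 0") (simp_all add: T0_pi1 T0_var T0_const)
  have upd: "s(0 := pi1 v) = (\<lambda>i. if i = 0 then pi1 v else s i)" for s v by auto
  show "PRP mem (sigma_fm (Suc n)) \<Longrightarrow> SWVP mem (sigma_fm (Suc n))"
  proof (erule PRP_SWVP_aux)
    fix F assume "definable mem (sigma_fm (Suc n)) (OR_sequence mem F)" and gr: "\<And>a. Ord a \<Longrightarrow> graph mem (F a)"
    then obtain p s where p: "sigma_fm (Suc n) p" "OR_sequence mem F = {x. sat UNIV mem p (s(0 := x))}"
      unfolding definable_def by blast
    have "df (sigma_fm (Suc n)) s (\<lambda>e. \<exists>v. False \<or> (v \<epsilon> pi1 (e 0) \<and> is_lgr (e 0) (pi1 v)) \<and> sat UNIV mem p (\<lambda>i. if i = 0 then pi1 v else s i))"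
    proof (rule df_ex)
      have q: "D0 s (\<lambda>e. e 0 \<epsilon> pi1 (e (Suc 0)) \<and> is_lgr (e (Suc 0)) (pi1 (e 0)))" by (rule d0 D0_is_lgr)+
      show "df (sigma_fm (Suc n)) s (\<lambda>e. False \<or> (e 0 \<epsilon> pi1 (e (Suc 0)) \<and> is_lgr (e (Suc 0)) (pi1 (e 0))) \<and>
          sat UNIV mem p (\<lambda>i. if i = 0 then pi1 (e 0) else s i))"
        by (rule sigma_pi_subst(1)[OF D0_bconst q T p(1)])
    qed (auto intro: sigma_fm_pi_fm.intros)
    from definable_df[OF this]
    show "definable mem (sigma_fm (Suc n)) {X. \<exists>a. Ord a \<and> X = lgr (pair a (F a))}"
      by (subst lgr_class(1)[OF p(2) gr]) (assumption, simp add: upd)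
  qed
  show "PRP mem (pi_fm (Suc n)) \<Longrightarrow> SWVP mem (pi_fm (Suc n))"
  proof (erule PRP_SWVP_aux)
    fix F assume "definable mem (pi_fm (Suc n)) (OR_sequence mem F)" and gr: "\<And>a. Ord a \<Longrightarrow> graph mem (F a)"
    then obtain p s where p: "pi_fm (Suc n) p" "OR_sequence mem F = {x. sat UNIV mem p (s(0 := x))}"
      unfolding definable_def by blast
    have "df (pi_fm (Suc n)) s (\<lambda>e. \<forall>v. (pi1 (e 0) \<noteq> emp \<and> \<not> v \<epsilon> pi1 (e 0)) \<or>
        (pi1 (e 0) \<noteq> emp \<and> is_lgr (e 0) (pi1 v)) \<and> sat UNIV mem p (\<lambda>i. if i = 0 then pi1 v else s i))"
    proof (rule df_all)
      have q: "D0 s (\<lambda>e. pi1 (e (Suc 0)) \<noteq> emp \<and> is_lgr (e (Suc 0)) (pi1 (e 0)))" by (rule d0 D0_is_lgr)+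
      have q': "D0 s (\<lambda>e. pi1 (e (Suc 0)) \<noteq> emp \<and> \<not> e 0 \<epsilon> pi1 (e (Suc 0)))" by (rule d0)+
      show "df (pi_fm (Suc n)) s (\<lambda>e. (pi1 (e (Suc 0)) \<noteq> emp \<and> \<not> e 0 \<epsilon> pi1 (e (Suc 0))) \<or>
          (pi1 (e (Suc 0)) \<noteq> emp \<and> is_lgr (e (Suc 0)) (pi1 (e 0))) \<and>
          sat UNIV mem p (\<lambda>i. if i = 0 then pi1 (e 0) else s i))"
        by (rule sigma_pi_subst(2)[OF q' q T p(1)])
    qed (auto intro: sigma_fm_pi_fm.intros)
    from definable_df[OF this]
    show "definable mem (pi_fm (Suc n)) {X. \<exists>a. Ord a \<and> X = lgr (pair a (F a))}"
      by (subst lgr_class(2)[OF p(2) gr]) (assumption, simp add: upd)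
  qed
qed

lemma pi_sigma_Suc: "pi_fm n p \<Longrightarrow> sigma_fm (Suc n) p"
  by (rule sigma_fm_pi_fm.intros)

lemma definable_mono: "definable mem \<Delta> C \<Longrightarrow> (\<And>p. \<Delta> p \<Longrightarrow> \<Gamma> p) \<Longrightarrow> definable mem \<Gamma> C"
  unfolding definable_def by blast

lemma PRP_mono: "PRP mem \<Gamma> \<Longrightarrow> (\<And>p. \<Delta> p \<Longrightarrow> \<Gamma> p) \<Longrightarrow> PRP mem \<Delta>"
  unfolding PRP_def using definable_mono[of \<Delta> _ \<Gamma>] by simp

lemma WVP_mono: assumes "WVP mem \<Gamma>" "\<And>p. \<Delta> p \<Longrightarrow> \<Gamma> p" shows "WVP mem \<Delta>"
  using assms(1) unfolding WVP_def
  by (rule contrapos_nn) (elim exE conjE, intro exI conjI, rule definable_mono[OF _ assms(2)], assumption+)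

lemma SWVP_WVP: assumes "SWVP mem \<Gamma>" shows "WVP mem \<Gamma>"
  unfolding WVP_def
proof (intro notI, elim exE conjE)
  fix F assume a: "definable mem \<Gamma> (OR_sequence mem F)" "\<forall>a. Ord a \<longrightarrow> graph mem (F a)"
    "\<forall>a b. Ord a \<and> Ord b \<and> (a \<epsilon> b \<or> a = b) \<longrightarrow> (\<exists>!h. hom mem h (F b) (F a))"
    "\<forall>a b. Ord a \<and> Ord b \<and> a \<epsilon> b \<longrightarrow> \<not> (\<exists>h. hom mem h (F a) (F b))"
  have b: "\<forall>a b. Ord a \<and> Ord b \<and> (a \<epsilon> b \<or> a = b) \<longrightarrow> (\<exists>h. hom mem h (F b) (F a))"
    using a(3) ex1_implies_ex by fast
  show False using assms[unfolded SWVP_def]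
    by (rule notE) (rule exI[of _ F], rule conjI[OF a(1) conjI[OF a(2) conjI[OF b a(4)]]])
qed

end

section \<open>Rigid graphs from good maps\<close>

text \<open>The tags \<open>0, \<dots>, 10\<close> are for the arguments of the operations \<open>opT\<close>, \<open>11\<close> for well-founded relations,
  and \<open>12\<close> for all subsets; the tag \<open>t + 13\<close> marks the constant adjacent to the vertices with tag \<open>t\<close>.\<close>

definition TE :: "nat \<Rightarrow> nat \<Rightarrow> bool" where
  "TE t s \<longleftrightarrow> 13 \<le> t \<and> t < s \<or> t < 13 \<and> s = t + 13 \<or> s < 13 \<and> t = s + 13 \<or> t \<le> 11 \<and> s = 12 \<or> t = 12 \<and> s \<le> 10"

text \<open>Transitive triangles occur only in the linear order of the tags from 13 on. This is what
  makes the constants recognisable by homomorphisms.\<close>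

lemma TE_tri: "TE a b \<Longrightarrow> TE b c \<Longrightarrow> TE a c \<Longrightarrow> 13 \<le> a \<and> 13 \<le> b \<and> 13 \<le> c"
  unfolding TE_def by (elim disjE; linarith)

text \<open>Each tag from 13 to 25 belongs to a transitive triangle, so its image is at least 13; a
  strictly increasing map of this finite interval to itself is the identity.\<close>

lemma TE_id:
  assumes E: "\<And>i j. 13 \<le> i \<Longrightarrow> i < j \<Longrightarrow> j < 26 \<Longrightarrow> TE (f i) (f j)"
    and B: "\<And>i. 13 \<le> i \<Longrightarrow> i < 26 \<Longrightarrow> f i < 26" and i: "13 \<le> i" "i < 26"
  shows "f i = i"
proof -
  have ge: "13 \<le> f i" if "13 \<le> i" "i < 26" for i
  proof (cases "i \<le> 15")
    case True
    then have "i = 13 \<or> i = 14 \<or> i = 15" using that by auto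
    moreover have "13 \<le> f 13 \<and> 13 \<le> f 14 \<and> 13 \<le> f 15" by (rule TE_tri; rule E) simp_all
    ultimately show ?thesis by auto
  next
    case False
    have "13 \<le> f 13 \<and> 13 \<le> f 14 \<and> 13 \<le> f i" by (rule TE_tri; rule E) (use that False in simp_all)
    then show ?thesis by simp
  qed
  have lt: "f i < f j" if "13 \<le> i" "i < j" "j < 26" for i j
    using E[OF that] ge[of i] ge[of j] that unfolding TE_def by auto
  have step: "i + k < 26 \<Longrightarrow> f i + k \<le> f (i + k)" if "13 \<le> i" for i k
  proof (induction k)
    case (Suc k)
    then show ?case using lt[of "i + k" "i + Suc k"] that by simp
  qed simp
  have "f 13 + (i - 13) \<le> f i" using step[of 13 "i - 13"] i by simp
  moreover have "f i + (25 - i) \<le> f 25" using step[of i "25 - i"] i by simp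
  ultimately show ?thesis using ge[of 13] B[of 25] i by simp
qed

lemma range_case_nat: "range (case_nat a f) = insert a (range f)"
  by (auto simp: image_iff split: nat.splits)

context zfc
begin

primrec num :: "nat \<Rightarrow> 'v" where
  "num 0 = emp"
| "num (Suc n) = succ (num n)"

lemma num_om [simp]: "num n \<epsilon> om"
  by (induction n) (use om in auto)

lemma num_less: "m < n \<Longrightarrow> num m \<epsilon> num n"
proof (induction n)
  case (Suc n)
  then show ?case by (cases "m = n") auto
qed simp

lemma num_inj [simp]: "num m = num n \<longleftrightarrow> m = n"
  by (metis linorder_neq_iff mem_irrefl num_less)

text \<open>Admitting only well-founded relations at tag 11 turns preservation of well-foundedness
  into mere preservation of vertices. The constants carry \<open>r\<close>, a place for the record
  that is used to define the graph.\<close>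

definition vert :: "'v \<Rightarrow> 'v \<Rightarrow> 'v \<Rightarrow> bool" where
  "vert r PU v \<longleftrightarrow> v = pair (pi1 v) (pi2 v) \<and>
     ((\<exists>t<13. pi1 v = num t \<and> pi2 v \<epsilon> PU \<and> (t = 11 \<longrightarrow> wfd PU (pi2 v))) \<or>
      (\<exists>t<26. 13 \<le> t \<and> pi1 v = num t \<and> pi2 v = r))"

text \<open>Edges from tags up to 11 to tag 12 tie each copy of a set to the set itself. Edges from
  tag 12 to a tag \<open>s\<close> up to 10 join a set to the arguments from which operation
  \<open>s\<close> produces it.\<close>

definition edg :: "'v \<Rightarrow> 'v \<Rightarrow> 'v \<Rightarrow> 'v \<Rightarrow> bool" where
  "edg g U v w \<longleftrightarrow> (\<exists>t<26. \<exists>s<26. pi1 v = num t \<and> pi1 w = num s \<and> TE t s \<and>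
     (t \<le> 11 \<and> s = 12 \<longrightarrow> pi2 w = pi2 v) \<and>
     (t = 12 \<and> s \<le> 10 \<longrightarrow> (\<forall>x. x \<epsilon> U \<longrightarrow> (x \<epsilon> pi2 v \<longleftrightarrow> opT g s x (pi2 w)))))"

lemma D0_vert: "range num \<subseteq> range K \<Longrightarrow> T0 K r \<Longrightarrow> T0 K p \<Longrightarrow> T0 K v \<Longrightarrow> D0 K (\<lambda>e. vert (r e) (p e) (v e))"
  by (rule D0_app3[where P=vert])
    (unfold vert_def, (rule d0 D0_bconst D0_exfin D0_wfd T0_const subsetD[of "range num" "range K"] rangeI | assumption)+)

lemma D0_edg: "range num \<subseteq> range K \<Longrightarrow> T0 K g \<Longrightarrow> T0 K u \<Longrightarrow> T0 K v \<Longrightarrow> T0 K w \<Longrightarrow> D0 K (\<lambda>e. edg (g e) (u e) (v e) (w e))"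
  by (rule D0_app4[where P=edg])
    (unfold edg_def, (rule d0 D0_bconst D0_exfin D0_opT T0_const subsetD[of "range num" "range K"] rangeI | assumption)+)

lemma DP_vert [simp]: "TM v \<Longrightarrow> DP (\<lambda>e. vert r p (v e))"
proof (rule DP_app1[where P="vert r p"])
  show "DP (\<lambda>e. vert r p (e 0))"
    by (rule df_imp_DP[where K="case_nat r (case_nat p num)" and \<Gamma>=delta0_fm]) (rule D0_vert[OF _ T0_const T0_const T0_var], auto simp: range_case_nat)
qed

lemma DP_edg [simp]: "TM v \<Longrightarrow> TM w \<Longrightarrow> DP (\<lambda>e. edg g u (v e) (w e))"
proof (rule DP_app2[where P="edg g u"])
  show "DP (\<lambda>e. edg g u (e 0) (e 1))"
    by (rule df_imp_DP[where K="case_nat g (case_nat u num)" and \<Gamma>=delta0_fm]) (rule D0_edg[OF _ T0_const T0_const T0_var T0_var], auto simp: range_case_nat)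
qed

definition gv :: "'v \<Rightarrow> 'v \<Rightarrow> 'v" where
  "gv r b = Sep (Prod om (cup (Pow (V b)) (sing r))) (vert r (Pow (V b)))"
definition ge :: "'v \<Rightarrow> 'v \<Rightarrow> 'v \<Rightarrow> 'v" where
  "ge g r b = Sep (Prod (gv r b) (gv r b)) (\<lambda>q. edg g (V b) (pi1 q) (pi2 q))"
definition gr :: "'v \<Rightarrow> 'v \<Rightarrow> 'v \<Rightarrow> 'v" where
  "gr g r b = pair (gv r b) (ge g r b)"

lemma mem_gv: "v \<epsilon> gv r b \<longleftrightarrow> vert r (Pow (V b)) v"
proof -
  have "v \<epsilon> Prod om (cup (Pow (V b)) (sing r))" if v: "vert r (Pow (V b)) v"
  proof -
    have "v = pair (pi1 v) (pi2 v)" "pi1 v \<epsilon> om" "pi2 v \<epsilon> cup (Pow (V b)) (sing r)" using v unfolding vert_def by auto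
    then show ?thesis by (metis mem_Prod)
  qed
  then show ?thesis unfolding gv_def by auto
qed

lemma mem_ge: "q \<epsilon> ge g r b \<longleftrightarrow> q = pair (pi1 q) (pi2 q) \<and> pi1 q \<epsilon> gv r b \<and> pi2 q \<epsilon> gv r b \<and> edg g (V b) (pi1 q) (pi2 q)"
  unfolding ge_def by (auto simp: mem_Prod)

lemma pair_vert: "vert r (Pow (V b)) (pair (num t) X) \<longleftrightarrow>
    t < 13 \<and> X \<sqsubseteq> V b \<and> (t = 11 \<longrightarrow> wfd (Pow (V b)) X) \<or> 13 \<le> t \<and> t < 26 \<and> X = r"
  unfolding vert_def by auto

lemma gv_cases: assumes "v \<epsilon> gv r b"
  obtains t X where "v = pair (num t) X" "t < 13" "X \<sqsubseteq> V b" "t = 11 \<longrightarrow> wfd (Pow (V b)) X"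
  | t where "v = pair (num t) r" "13 \<le> t" "t < 26"
  using assms unfolding mem_gv vert_def by (metis mem_Pow)

lemma gv_tag: assumes "v \<epsilon> gv r b" obtains t where "t < 26" "pi1 v = num t"
proof (rule gv_cases[OF assms])
  fix t X assume "v = pair (num t) X" "t < 13" then show ?thesis using that[of t] by simp
next
  fix t assume "v = pair (num t) r" "13 \<le> t" "t < 26" then show ?thesis using that[of t] by simp
qed

lemma pair_edg: "edg g U (pair (num t) X) (pair (num s) Y) \<longleftrightarrow> t < 26 \<and> s < 26 \<and> TE t s \<and>
     (t \<le> 11 \<and> s = 12 \<longrightarrow> Y = X) \<and> (t = 12 \<and> s \<le> 10 \<longrightarrow> (\<forall>x. x \<epsilon> U \<longrightarrow> (x \<epsilon> X \<longleftrightarrow> opT g s x Y)))"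
  unfolding edg_def by auto

lemma gr_graph: "graph mem (gr g r b)"
proof -
  have "pair (num 13) r \<epsilon> gv r b" by (simp add: mem_gv pair_vert)
  then have "gv r b \<noteq> emp" by (metis emp)
  then show ?thesis unfolding graph_iff gr_def by (simp add: mem_ge) blast
qed

definition rmap :: "'v \<Rightarrow> 'v \<Rightarrow> 'v \<Rightarrow> 'v" where
  "rmap r' b' v = pair (pi1 v) (if pi1 v \<epsilon> num 13 then Sep (V b') (\<lambda>x. x \<epsilon> pi2 v) else r')"

lemma TM_rmap [simp]: "TM v \<Longrightarrow> TM (\<lambda>e. rmap r' b' (v e))"
  by (rule TM_app1[where F="rmap r' b'"]) (unfold rmap_def, simp)

lemma num_mem [simp]: "num m \<epsilon> num n \<longleftrightarrow> m < n"
  by (metis linorder_less_linear mem_asym mem_irrefl num_less)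

lemma rmap_pair: "rmap r' b' (pair (num t) X) = pair (num t) (if t < 13 then Sep (V b') (\<lambda>x. x \<epsilon> X) else r')"
  unfolding rmap_def by simp

lemma gr_Hom:
  assumes l: "LimO g b" "LimO g b'" and bb: "b' \<sqsubseteq> b"
  shows "Hom (gr g r b) (gr g r' b')"
  unfolding gr_def
proof (rule HomI[where F="rmap r' b'"])
  have sub: "x \<epsilon> V b' \<Longrightarrow> x \<epsilon> V b" for x using V_mono[OF bb] subD by blast
  have wf: "wfd (Pow (V b')) (Sep (V b') (\<lambda>x. x \<epsilon> X))" if "wfd (Pow (V b)) X" for X
    using that V_mono[OF bb] sub_trans unfolding wfd_def by simp blast
  show "rmap r' b' v \<epsilon> gv r' b'" if v: "v \<epsilon> gv r b" for v
    by (rule gv_cases[OF v]) (auto simp: rmap_pair mem_gv pair_vert wf subset_of_def)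
  show "pair (rmap r' b' v) (rmap r' b' w) \<epsilon> ge g r' b'" if v: "v \<epsilon> gv r b" and w: "w \<epsilon> gv r b" and e: "pair v w \<epsilon> ge g r b" for v w
  proof -
    obtain t X where vt: "v = pair (num t) X" using gv_cases[OF v] by metis
    obtain s Y where ws: "w = pair (num s) Y" using gv_cases[OF w] by metis
    have E: "edg g (V b) (pair (num t) X) (pair (num s) Y)" using e by (simp add: mem_ge vt ws)
    have "edg g (V b') (rmap r' b' v) (rmap r' b' w)"
      unfolding vt ws rmap_pair pair_edg
    proof (intro conjI impI allI)
      fix x assume ts: "t = 12 \<and> s \<le> 10" and x: "x \<epsilon> V b'"
      have "x \<epsilon> X \<longleftrightarrow> opT g s x Y" using E sub[OF x] ts unfolding pair_edg by blast
      also have "opT g s x Y \<longleftrightarrow> opT g s x (Sep (V b') (\<lambda>x. x \<epsilon> Y))"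
        by (rule opT_local[OF LimO_D(1)[OF l(2)] x]) simp
      finally show "x \<epsilon> (if t < 13 then Sep (V b') (\<lambda>x. x \<epsilon> X) else r') \<longleftrightarrow>
          opT g s x (if s < 13 then Sep (V b') (\<lambda>x. x \<epsilon> Y) else r')" using ts x by simp
    qed (use E in \<open>auto simp: pair_edg\<close>)
    moreover have "rmap r' b' v \<epsilon> gv r' b'" "rmap r' b' w \<epsilon> gv r' b'"
      using \<open>\<And>v. v \<epsilon> gv r b \<Longrightarrow> rmap r' b' v \<epsilon> gv r' b'\<close> v w by blast+
    ultimately show ?thesis by (simp add: mem_ge)
  qed
qed simp

text \<open>Tags are preserved: those of constants by \<open>TE_id\<close>, the others because their
  vertices are joined in both directions to their constant. The action on tag 12 is
  \<open>k\<close>; edges into tag 12 make the action on the other sets the same, and edges out of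
  it make \<open>k\<close> respect the operations.\<close>

lemma gr_hom_good:
  assumes h: "hom mem h (gr g r b) (gr g r' b')"
  defines "k \<equiv> lam (Pow (V b)) (\<lambda>X. pi2 (app h (pair (num 12) X)))"
  shows "good g b b' k"
    "v \<epsilon> gv r b \<Longrightarrow> app h v = pair (pi1 v) (if pi1 v \<epsilon> num 13 then app k (pi2 v) else r')"
proof -
  have hv: "app h v \<epsilon> gv r' b'" if "v \<epsilon> gv r b" for v
    using h that unfolding gr_def hom_pair fn_to by blast
  have he: "edg g (V b') (app h v) (app h w)" if "v \<epsilon> gv r b" "w \<epsilon> gv r b" "edg g (V b) v w" for v w
  proof -
    have "pair v w \<epsilon> ge g r b" using that by (simp add: mem_ge)
    then have "pair (app h v) (app h w) \<epsilon> ge g r' b'" using h that unfolding gr_def hom_pair by blast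
    then show ?thesis by (simp add: mem_ge)
  qed
  have "\<forall>v. \<exists>t. v \<epsilon> gv r b \<longrightarrow> t < 26 \<and> pi1 (app h v) = num t" using gv_tag[OF hv] by metis
  then obtain tg where tg: "\<And>v. v \<epsilon> gv r b \<Longrightarrow> tg v < 26" "\<And>v. v \<epsilon> gv r b \<Longrightarrow> pi1 (app h v) = num (tg v)" by metis
  have ap: "app h v = pair (num (tg v)) (pi2 (app h v))" if v: "v \<epsilon> gv r b" for v
    using hv[OF v] tg(2)[OF v] unfolding mem_gv vert_def by metis
  have te: "TE (tg v) (tg w)" if "v \<epsilon> gv r b" "w \<epsilon> gv r b" "edg g (V b) v w" for v w
    using he[OF that] ap[OF that(1)] ap[OF that(2)] pair_edg by metis
  let ?c = "\<lambda>i. pair (num i) r"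
  have c: "?c i \<epsilon> gv r b" if "13 \<le> i" "i < 26" for i using that by (simp add: mem_gv pair_vert)
  have tc: "tg (?c i) = i" if "13 \<le> i" "i < 26" for i
  proof (rule TE_id[where f="\<lambda>i. tg (?c i)", OF _ _ that])
    show "TE (tg (?c i)) (tg (?c j))" if "13 \<le> i" "i < j" "j < 26" for i j
      by (rule te) (use that in \<open>auto simp: c pair_edg TE_def\<close>)
  qed (use tg(1) c in blast)
  have td: "tg (pair (num t) X) = t" if v: "pair (num t) X \<epsilon> gv r b" "t < 13" for t X
  proof -
    let ?v = "pair (num t) X"
    have "TE (tg ?v) (tg (?c (t + 13)))" "TE (tg (?c (t + 13))) (tg ?v)"
      by (rule te; use v c in \<open>auto simp: pair_edg TE_def\<close>)+
    then have "TE (tg ?v) (t + 13)" "TE (t + 13) (tg ?v)" using tc[of "t + 13"] v(2) by auto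
    then show ?thesis unfolding TE_def by linarith
  qed
  have b12: "pair (num 12) X \<epsilon> gv r b" if "X \<sqsubseteq> V b" for X using that by (simp add: mem_gv pair_vert)
  have k: "app k X = pi2 (app h (pair (num 12) X))" if "X \<sqsubseteq> V b" for X unfolding k_def using that by simp
  have h12: "app h (pair (num 12) X) = pair (num 12) (app k X)" if X: "X \<sqsubseteq> V b" for X
    using ap[OF b12[OF X]] td[OF b12[OF X]] k[OF X] by simp
  have kV: "app k X \<sqsubseteq> V b'" if X: "X \<sqsubseteq> V b" for X
    using hv[OF b12[OF X]] unfolding h12[OF X] mem_gv pair_vert by simp
  have ht: "app h (pair (num t) X) = pair (num t) (app k X)" if v: "pair (num t) X \<epsilon> gv r b" "t < 13" for t X
  proof (cases "t = 12")
    case True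
    then show ?thesis using h12 v by (simp add: mem_gv pair_vert)
  next
    case False
    then have t: "t \<le> 11" and X: "X \<sqsubseteq> V b" using v by (auto simp: mem_gv pair_vert)
    have "edg g (V b') (app h (pair (num t) X)) (app h (pair (num 12) X))"
      by (rule he[OF v(1) b12[OF X]]) (use t in \<open>simp add: pair_edg TE_def\<close>)
    then have "edg g (V b') (pair (num t) (pi2 (app h (pair (num t) X)))) (pair (num 12) (app k X))"
      unfolding h12[OF X] using ap[OF v(1)] td[OF v] by simp
    then have "app k X = pi2 (app h (pair (num t) X))" using t unfolding pair_edg by blast
    then show ?thesis using ap[OF v(1)] td[OF v] by simp
  qed
  show "app h v = pair (pi1 v) (if pi1 v \<epsilon> num 13 then app k (pi2 v) else r')" if v: "v \<epsilon> gv r b" for v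
  proof (rule gv_cases[OF v])
    fix t X assume "v = pair (num t) X" "t < 13"
    then show ?thesis using ht v by simp
  next
    fix t assume t: "v = ?c t" "13 \<le> t" "t < 26"
    have "app h v = pair (num t) (pi2 (app h v))" using ap[OF v] tc t by simp
    moreover have "vert r' (Pow (V b')) (app h v)" using hv[OF v] mem_gv by blast
    ultimately have "app h v = pair (num t) r'" using pair_vert t by (metis not_less)
    then show ?thesis using t by simp
  qed
  show "good g b b' k" unfolding good_def goodh_def
  proof (intro conjI allI impI)
    show "function_to mem k (Pow (V b)) (Pow (V b'))" unfolding k_def using kV k by simp
    show "wfd (Pow (V b')) (app k X)" if X: "X \<epsilon> Pow (V b)" "wfd (Pow (V b)) X" for X
    proof -
      have 1: "pair (num 11) X \<epsilon> gv r b" using X by (simp add: mem_gv pair_vert)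
      have "app h (pair (num 11) X) = pair (num 11) (app k X)" by (rule ht[OF 1]) simp
      then show ?thesis using hv[OF 1] by (simp add: mem_gv pair_vert)
    qed
    show "x \<epsilon> app k Y \<longleftrightarrow> opT g i x (app k Z)"
      if i: "i < 11" and Z: "Z \<epsilon> Pow (V b)" and Y: "Y \<epsilon> Pow (V b)"
        and e: "\<forall>x. x \<epsilon> V b \<longrightarrow> (x \<epsilon> Y \<longleftrightarrow> opT g i x Z)" and x: "x \<epsilon> V b'" for i Y Z x
    proof -
      have zi: "pair (num i) Z \<epsilon> gv r b" using i Z by (simp add: mem_gv pair_vert)
      have Y': "Y \<sqsubseteq> V b" using Y by simp
      have "edg g (V b') (app h (pair (num 12) Y)) (app h (pair (num i) Z))"
        by (rule he[OF b12[OF Y'] zi]) (use i e in \<open>simp add: pair_edg TE_def\<close>)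
      moreover have "app h (pair (num i) Z) = pair (num i) (app k Z)" by (rule ht[OF zi]) (use i in simp)
      ultimately show ?thesis unfolding h12[OF Y'] using i x by (simp add: pair_edg)
    qed
  qed
qed

end

context nostrong
begin

lemma DD_hom:
  assumes b: "DD b" and b': "DD b'" and h: "hom mem h (gr g r b) (gr g r' b')"
  shows "b' \<sqsubseteq> b" "v \<epsilon> gv r b \<Longrightarrow> app h v = rmap r' b' v"
proof -
  note k = gr_hom_good[OF h]
  show "b' \<sqsubseteq> b" by (rule DD_good(1)[OF b b' k(1)])
  assume v: "v \<epsilon> gv r b"
  show "app h v = rmap r' b' v"
  proof (cases "pi1 v \<epsilon> num 13")
    case True
    then have X: "pi2 v \<sqsubseteq> V b" using gv_cases[OF v] by (metis num_mem not_less pi_pair)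
    have "app (lam (Pow (V b)) (\<lambda>X. pi2 (app h (pair (num 12) X)))) (pi2 v) = Sep (V b') (\<lambda>x. x \<epsilon> pi2 v)"
      by (rule ext) (simp only: DD_good(2)[OF b b' k(1) X], simp)
    then show ?thesis using k(2)[OF v] True unfolding rmap_def by simp
  next
    case False
    then show ?thesis using k(2)[OF v] unfolding rmap_def by simp
  qed
qed

lemma DD_hom_unique:
  assumes b: "DD b" "DD b'" and h: "hom mem h (gr g r b) (gr g r' b')" "hom mem k (gr g r b) (gr g r' b')"
  shows "h = k"
proof (rule fn_ext[of _ "gv r b"])
  show "function_on mem h (gv r b)" "function_on mem k (gv r b)" using h unfolding gr_def hom_pair fn_to by blast+
qed (use DD_hom(2)[OF b] h in metis)

end

section \<open>A boldface Pi1 sequence without strong cardinals\<close>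

context nostrong
begin

lemma Ord_DD: "DD b \<Longrightarrow> Ord b"
  unfolding DD_def using LimO_D by blast

section \<open>Increasing enumeration of the closure points\<close>

definition bpred :: "'v \<Rightarrow> 'v \<Rightarrow> bool" where
  "bpred s b \<longleftrightarrow> DD b \<and> (\<forall>y. y \<epsilon> s \<longrightarrow> y \<epsilon> b)"

lemma DP_bpred [simp]: "TM s \<Longrightarrow> TM b \<Longrightarrow> DP (\<lambda>e. bpred (s e) (b e))"
  by (rule DP_app2[where P=bpred]) (unfold bpred_def, simp_all)

definition enum :: "'v \<Rightarrow> 'v" where
  "enum = memrec (\<lambda>x f. theD emp (\<lambda>b. bpred (ran f) b \<and> (\<forall>c. c \<epsilon> b \<longrightarrow> \<not> bpred (ran f) c)))"

lemma enum_rec: "enum x = theD emp (\<lambda>b. bpred (ran (lam x enum)) b \<and> (\<forall>c. c \<epsilon> b \<longrightarrow> \<not> bpred (ran (lam x enum)) c))"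
  unfolding enum_def by (rule memrec(2)) simp

lemma TM_enum [simp]: "TM t \<Longrightarrow> TM (\<lambda>e. enum (t e))"
  unfolding enum_def by (rule memrec(1)) simp_all

lemma enum_bpred: "bpred (ran (lam x enum)) b \<longleftrightarrow> DD b \<and> (\<forall>y. y \<epsilon> x \<longrightarrow> enum y \<epsilon> b)"
  unfolding bpred_def by auto

lemma enum_ex: assumes "\<And>y. y \<epsilon> x \<Longrightarrow> DD (enum y)"
  shows "bpred (ran (lam x enum)) (enum x) \<and> (\<forall>c. c \<epsilon> enum x \<longrightarrow> \<not> bpred (ran (lam x enum)) c)"
proof -
  have "\<exists>c. Ord c \<and> (\<forall>y. y \<epsilon> Im x enum \<longrightarrow> y \<epsilon> c)" by (rule Ord_bound) (use assms Ord_DD in auto)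
  then obtain c where c: "Ord c" "\<And>y. y \<epsilon> x \<Longrightarrow> enum y \<epsilon> c" by auto
  obtain b where b: "DD b" "c \<epsilon> b" using DD_ex c(1) by blast
  have B: "bpred (ran (lam x enum)) b" unfolding enum_bpred using b c(2) Ord_trans[OF Ord_DD] by blast
  have D: "DP (\<lambda>e. bpred (ran (lam x enum)) (e 0))" by simp
  obtain d where d: "Ord d" "bpred (ran (lam x enum)) d" "\<And>c. c \<epsilon> d \<Longrightarrow> \<not> bpred (ran (lam x enum)) c"
    using Ord_least[OF D Ord_DD[OF b(1)] B] by blast
  have "enum x = d"
  proof (subst enum_rec, rule theD_eq)
    fix z assume "bpred (ran (lam x enum)) z \<and> (\<forall>c. c \<epsilon> z \<longrightarrow> \<not> bpred (ran (lam x enum)) c)"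
    then show "z = d" using Ord_linear[of z d] d Ord_DD bpred_def by blast
  qed (use d in blast)
  then show ?thesis using d by blast
qed

lemma enum_DD: "DD (enum x)"
proof (induction x rule: mem_induct)
  case (step x)
  then show ?case using enum_ex[of x] enum_bpred by blast
qed simp

lemma enum_less: "y \<epsilon> x \<Longrightarrow> enum y \<epsilon> enum x"
  using enum_ex[of x] enum_DD enum_bpred by blast

lemma enum_eqI: assumes "DD b" "\<And>y. y \<epsilon> x \<Longrightarrow> enum y \<epsilon> b" "\<And>c. c \<epsilon> b \<Longrightarrow> DD c \<Longrightarrow> \<exists>y. y \<epsilon> x \<and> \<not> enum y \<epsilon> c"
  shows "b = enum x"
  using Ord_linear[of b "enum x"] Ord_DD assms enum_DD enum_ex[of x] enum_less unfolding enum_bpred by metis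

lemma enum_least: "c \<epsilon> enum x \<Longrightarrow> DD c \<Longrightarrow> \<exists>y. y \<epsilon> x \<and> \<not> enum y \<epsilon> c"
  using enum_ex[of x] enum_DD unfolding enum_bpred by blast

subsection \<open>Bounded definitions\<close>

text \<open>\<open>vs\<close> stands for the function \<open>V\<close> on an initial segment of the
  ordinals, whose values bound the quantifiers of \<open>NB\<close>: for a limit \<open>c\<close>
  above \<open>l\<close>, the good maps at \<open>l\<close> are elements of \<open>V c\<close>. The
  power set of \<open>V l\<close> is the value at \<open>succ l\<close>.\<close>

definition NBb :: "'v \<Rightarrow> 'v \<Rightarrow> 'v \<Rightarrow> 'v \<Rightarrow> bool" where
  "NBb vs c l k \<longleftrightarrow> LimO g l \<and> k \<epsilon> l \<and> (\<exists>m. m \<epsilon> c \<and> m = succ l \<and>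
     (\<forall>h. h \<epsilon> app vs c \<longrightarrow> goodh g (app vs l) (app vs m) (app vs l) (app vs m) h \<longrightarrow>
       (\<exists>s. s \<epsilon> app vs c \<and> s = upair k k \<and> k \<epsilon> app h s)))"

text \<open>\<open>d\<close> has to reach beyond \<open>succ c\<close>: the cofinal function is a
  subset of \<open>V c\<close> and is therefore found in \<open>V (succ c)\<close>.\<close>

definition DDb :: "'v \<Rightarrow> 'v \<Rightarrow> 'v \<Rightarrow> bool" where
  "DDb vs d c \<longleftrightarrow> LimO g c \<and> (\<exists>m. m \<epsilon> d \<and> m = succ c \<and>
     (\<exists>f. f \<epsilon> app vs m \<and> function_to mem f om c \<and> (\<forall>x. x \<epsilon> c \<longrightarrow> (\<exists>n. n \<epsilon> om \<and> x \<epsilon> app f n)))) \<and>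
     (\<forall>k. k \<epsilon> c \<longrightarrow> (\<exists>l. l \<epsilon> c \<and> NBb vs c l k))"

lemma NBb_iff: assumes c: "Lim c" and vs: "\<And>x. x \<epsilon> succ c \<Longrightarrow> app vs x = V x" and l: "l \<epsilon> c"
  shows "NBb vs c l k \<longleftrightarrow> NB l k"
proof (cases "LimO g l \<and> k \<epsilon> l")
  case True
  have oc: "Ord c" using c Lim_Ord by blast
  have ol: "Ord l" using Ord_in oc l by blast
  have sl: "succ l \<epsilon> c" using c l unfolding Lim_def by blast
  have Vl: "V l \<epsilon> V c" using V_in l by blast
  have P: "Pow (V l) \<epsilon> V c" using V_lim_Pow c Vl by blast
  have k: "sing k \<epsilon> V c" using V_lim_upair[OF c] True Lim_mem_V[OF c] Ord_trans[OF oc _ l] by blast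
  have h: "h \<epsilon> V c" if "good g l l h" for h
    using that V_lim_Funs[OF c _ P P] unfolding good_def goodh_def by blast
  have vc: "app vs c = V c" "app vs l = V l" "app vs (succ l) = Pow (V l)" using vs l sl V_succ[OF ol] by auto
  have "NBb vs c l k \<longleftrightarrow> (\<forall>h. h \<epsilon> V c \<longrightarrow> good g l l h \<longrightarrow> k \<epsilon> app h (sing k))"
    unfolding NBb_def good_def using True sl k by (simp add: vc cong: conj_cong)
  also have "\<dots> \<longleftrightarrow> NB l k" unfolding NB_def using True h by blast
  finally show ?thesis .
qed (auto simp: NBb_def NB_def)

lemma DDb_iff: assumes c: "succ c \<epsilon> d" and d: "Ord d" and vs: "\<And>x. x \<epsilon> d \<Longrightarrow> app vs x = V x"
  shows "DDb vs d c \<longleftrightarrow> DD c"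
proof (cases "LimO g c")
  case True
  note lc = LimO_D[OF True]
  have "x \<epsilon> succ c \<Longrightarrow> app vs x = V x" for x using vs Ord_trans[OF d _ c] by blast
  then have N: "l \<epsilon> c \<Longrightarrow> NBb vs c l k \<longleftrightarrow> NB l k" for l k using NBb_iff lc(1) by blast
  have f: "f \<epsilon> app vs (succ c)" if f: "function_to mem f om c" for f
  proof -
    have "p \<epsilon> V c" if p: "p \<epsilon> f" for p
    proof -
      have fo: "function_on mem f om" "\<And>x. x \<epsilon> om \<Longrightarrow> app f x \<epsilon> c" using f unfolding fn_to by blast+
      then obtain n where n: "n \<epsilon> om" "p = pair n (app f n)" using fn_mem[OF fo(1)] p by blast
      then have "n \<epsilon> V c" "app f n \<epsilon> V c" using fo(2) Lim_mem_V[OF lc(1)] Ord_trans[OF lc(2) _ lc(4)] by blast+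
      then show ?thesis using n(2) V_lim_pair[OF lc(1)] by blast
    qed
    then have "f \<sqsubseteq> V c" by (rule subI)
    then show ?thesis using vs[OF c] V_succ[OF lc(2)] by simp
  qed
  have 1: "(\<exists>m. m \<epsilon> d \<and> m = succ c \<and>
     (\<exists>f. f \<epsilon> app vs m \<and> function_to mem f om c \<and> (\<forall>x. x \<epsilon> c \<longrightarrow> (\<exists>n. n \<epsilon> om \<and> x \<epsilon> app f n)))) \<longleftrightarrow>
     (\<exists>f. function_to mem f om c \<and> (\<forall>x. x \<epsilon> c \<longrightarrow> (\<exists>n. n \<epsilon> om \<and> x \<epsilon> app f n)))" using c f by blast
  have 2: "(\<forall>k. k \<epsilon> c \<longrightarrow> (\<exists>l. l \<epsilon> c \<and> NBb vs c l k)) \<longleftrightarrow> (\<forall>k. k \<epsilon> c \<longrightarrow> (\<exists>l. l \<epsilon> c \<and> NB l k))"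
    using N by blast
  show ?thesis unfolding DDb_def DD_def 1 2 ..
qed (simp add: DDb_def DD_def)

section \<open>Records and the definition of the sequence\<close>

abbreviation r1 where "r1 r \<equiv> pi1 r"
abbreviation r2 where "r2 r \<equiv> pi1 (pi2 r)"
abbreviation r3 where "r3 r \<equiv> pi1 (pi2 (pi2 r))"
abbreviation r4 where "r4 r \<equiv> pi1 (pi2 (pi2 (pi2 r)))"
abbreviation r5 where "r5 r \<equiv> pi2 (pi2 (pi2 (pi2 r)))"

text \<open>The two functions \<open>V\<close> and \<open>enum\<close> restricted to initial
  segments, preceded by ordinals that describe their domains. The domain of the first includes
  \<open>succ (enum a)\<close>, where its value is the power set of
  \<open>V (enum a)\<close>.\<close>

definition rcd :: "'v \<Rightarrow> 'v" where
  "rcd a = pair (succ a) (pair (succ (enum a)) (pair (succ (succ (enum a)))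
     (pair (lam (succ (succ (enum a))) V) (lam (succ a) enum))))"

text \<open>About the levels it demands only that they are not too large: each element is a subset
  of an earlier level. That they are large enough is the content of \<open>full\<close>.\<close>

definition REC :: "'v \<Rightarrow> 'v \<Rightarrow> bool" where
  "REC a r \<longleftrightarrow> Ord a \<and> r = pair (pi1 r) (pi2 r) \<and> pi2 r = pair (pi1 (pi2 r)) (pi2 (pi2 r)) \<and>
     pi2 (pi2 r) = pair (pi1 (pi2 (pi2 r))) (pi2 (pi2 (pi2 r))) \<and>
     pi2 (pi2 (pi2 r)) = pair (pi1 (pi2 (pi2 (pi2 r)))) (pi2 (pi2 (pi2 (pi2 r)))) \<and>
     r1 r = succ a \<and> r2 r = succ (app (r5 r) a) \<and> r3 r = succ (r2 r) \<and>
     function_on mem (r4 r) (r3 r) \<and> function_on mem (r5 r) (r1 r) \<and>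
     (\<forall>y. y \<epsilon> r3 r \<longrightarrow> (\<forall>x. x \<epsilon> app (r4 r) y \<longrightarrow> (\<exists>z. z \<epsilon> y \<and> x \<sqsubseteq> app (r4 r) z))) \<and>
     (\<forall>y. y \<epsilon> r1 r \<longrightarrow> DDb (r4 r) (r3 r) (app (r5 r) y) \<and> (\<forall>z. z \<epsilon> y \<longrightarrow> app (r5 r) z \<epsilon> app (r5 r) y) \<and>
       (\<forall>c. c \<epsilon> app (r5 r) y \<longrightarrow> DDb (r4 r) (r3 r) c \<longrightarrow> (\<exists>z. z \<epsilon> y \<and> \<not> app (r5 r) z \<epsilon> c)))"

text \<open>The only condition on \<open>rcd a\<close> that needs an unbounded quantifier.\<close>

definition full :: "'v \<Rightarrow> 'v \<Rightarrow> bool" where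
  "full r x \<longleftrightarrow> (\<forall>y. y \<epsilon> r3 r \<longrightarrow> (\<forall>z. z \<epsilon> y \<longrightarrow> x \<sqsubseteq> app (r4 r) z \<longrightarrow> x \<epsilon> app (r4 r) y))"

lemma rcd_parts: "r1 (rcd a) = succ a" "r2 (rcd a) = succ (enum a)" "r3 (rcd a) = succ (succ (enum a))"
  "r4 (rcd a) = lam (succ (succ (enum a))) V" "r5 (rcd a) = lam (succ a) enum"
  unfolding rcd_def by simp_all

lemma REC_rcd: assumes a: "Ord a" shows "REC a (rcd a)" "full (rcd a) x"
proof -
  let ?b = "enum a" and ?d = "succ (succ (enum a))"
  have ob: "Ord ?b" using Ord_DD enum_DD by blast
  have od: "Ord ?d" using Ord_succ ob by blast
  have v: "x \<epsilon> ?d \<Longrightarrow> app (lam ?d V) x = V x" for x by (rule app_lam) simp_all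
  have e: "x \<epsilon> succ a \<Longrightarrow> app (lam (succ a) enum) x = enum x" for x by (rule app_lam) simp_all
  have tr: "z \<epsilon> y \<Longrightarrow> y \<epsilon> ?d \<Longrightarrow> z \<epsilon> ?d" for z y using Ord_trans[OF od] by blast
  have tra: "z \<epsilon> y \<Longrightarrow> y \<epsilon> succ a \<Longrightarrow> z \<epsilon> succ a" for z y using Ord_trans[OF Ord_succ[OF a]] by blast
  have le: "enum y \<epsilon> succ ?b" if "y \<epsilon> succ a" for y using that enum_less[of y a] by auto
  have D: "DDb (lam ?d V) ?d c \<longleftrightarrow> DD c" if "c \<epsilon> succ ?b" for c
  proof (rule DDb_iff[OF _ od v])
    show "succ c \<epsilon> ?d" using that succ_le[of "succ ?b" c] Ord_succ[OF ob] by auto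
  qed
  have D': "DDb (lam ?d V) ?d c \<longleftrightarrow> DD c" if "y \<epsilon> succ a" "c \<epsilon> enum y" for y c
    by (rule D) (use le that Ord_trans[OF Ord_succ[OF ob]] in blast)
  show "full (rcd a) x" unfolding full_def rcd_parts
  proof (intro allI impI)
    fix y z assume "y \<epsilon> ?d" "z \<epsilon> y" "x \<sqsubseteq> app (lam ?d V) z"
    then show "x \<epsilon> app (lam ?d V) y" using v tr V_I by metis
  qed
  have "\<exists>z. z \<epsilon> y \<and> x \<sqsubseteq> app (lam ?d V) z" if y: "y \<epsilon> ?d" and x: "x \<epsilon> app (lam ?d V) y" for x y
  proof -
    obtain z where "z \<epsilon> y" "x \<sqsubseteq> V z" using x v[OF y] mem_V[of x y] by auto
    then show ?thesis using v tr y by metis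
  qed
  moreover have "DDb (lam ?d V) ?d (app (lam (succ a) enum) y) \<and>
      (\<forall>z. z \<epsilon> y \<longrightarrow> app (lam (succ a) enum) z \<epsilon> app (lam (succ a) enum) y) \<and>
      (\<forall>c. c \<epsilon> app (lam (succ a) enum) y \<longrightarrow> DDb (lam ?d V) ?d c \<longrightarrow> (\<exists>z. z \<epsilon> y \<and> \<not> app (lam (succ a) enum) z \<epsilon> c))"
    if y: "y \<epsilon> succ a" for y
  proof (intro conjI allI impI)
    show "DDb (lam ?d V) ?d (app (lam (succ a) enum) y)" unfolding e[OF y] D[OF le[OF y]] by (rule enum_DD)
    show "app (lam (succ a) enum) z \<epsilon> app (lam (succ a) enum) y" if "z \<epsilon> y" for z
      unfolding e[OF y] e[OF tra[OF that y]] by (rule enum_less[OF that])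
    fix c assume c: "c \<epsilon> app (lam (succ a) enum) y" "DDb (lam ?d V) ?d c"
    then have "c \<epsilon> enum y" "DD c" unfolding e[OF y] using D'[OF y] by blast+
    then obtain z where "z \<epsilon> y" "\<not> enum z \<epsilon> c" using enum_least by blast
    then show "\<exists>z. z \<epsilon> y \<and> \<not> app (lam (succ a) enum) z \<epsilon> c" using e tra y by metis
  qed
  moreover have "app (lam (succ a) enum) a = enum a" by (rule e) simp
  ultimately show "REC a (rcd a)" unfolding REC_def rcd_parts using a
    by (simp add: rcd_def del: mem_succ)
qed

text \<open>Both inclusions of the recursion equation identify \<open>r4 r\<close> with
  \<open>V\<close> by induction. Then \<open>DDb\<close> means \<open>DD\<close>, and the clauses on
  \<open>r5 r\<close> characterise \<open>enum\<close> by \<open>enum_eqI\<close>.\<close>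

lemma REC_unique: assumes R: "REC a r" and F: "\<And>x. full r x" shows "r = rcd a"
proof -
  let ?b = "app (r5 r) a" and ?d = "r3 r"
  have a: "Ord a" and r: "r1 r = succ a" "r2 r = succ ?b" "r3 r = succ (r2 r)"
    "function_on mem (r4 r) ?d" "function_on mem (r5 r) (r1 r)"
    and V1: "\<And>x y. y \<epsilon> ?d \<Longrightarrow> x \<epsilon> app (r4 r) y \<Longrightarrow> \<exists>z. z \<epsilon> y \<and> x \<sqsubseteq> app (r4 r) z"
    and E: "\<And>y. y \<epsilon> r1 r \<Longrightarrow> DDb (r4 r) ?d (app (r5 r) y)" "\<And>y z. y \<epsilon> r1 r \<Longrightarrow> z \<epsilon> y \<Longrightarrow> app (r5 r) z \<epsilon> app (r5 r) y"
     "\<And>y c. y \<epsilon> r1 r \<Longrightarrow> c \<epsilon> app (r5 r) y \<Longrightarrow> DDb (r4 r) ?d c \<Longrightarrow> \<exists>z. z \<epsilon> y \<and> \<not> app (r5 r) z \<epsilon> c"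
    and pr: "r = pair (r1 r) (pair (r2 r) (pair (r3 r) (pair (r4 r) (r5 r))))"
    using R unfolding REC_def by (blast, blast, blast, blast, blast, blast, blast, blast, blast, blast, metis)
  have d: "?d = succ (succ ?b)" using r by simp
  have "LimO g ?b" using E(1)[of a] r(1) unfolding DDb_def by simp
  then have ob: "Ord ?b" using LimO_D by blast
  then have od: "Ord ?d" unfolding d using Ord_succ by blast
  have v: "y \<epsilon> ?d \<longrightarrow> app (r4 r) y = V y" for y
  proof (induction y rule: mem_induct)
    case (step y)
    show ?case
    proof
      assume y: "y \<epsilon> ?d"
      have IH: "z \<epsilon> y \<Longrightarrow> app (r4 r) z = V z" for z using step Ord_trans[OF od _ y] by blast
      show "app (r4 r) y = V y"
      proof (rule ext)
        fix x
        show "x \<epsilon> app (r4 r) y \<longleftrightarrow> x \<epsilon> V y"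
          using V1[OF y, of x] F[of x] y IH mem_V[of x y] unfolding full_def by metis
      qed
    qed
  qed simp
  have tra: "z \<epsilon> y \<Longrightarrow> y \<epsilon> succ a \<Longrightarrow> z \<epsilon> succ a" for z y using Ord_trans[OF Ord_succ[OF a]] by blast
  have D: "DDb (r4 r) ?d c \<longleftrightarrow> DD c" if "c \<epsilon> succ ?b" for c
  proof (rule DDb_iff[OF _ od])
    show "succ c \<epsilon> ?d" unfolding d using that succ_le[of "succ ?b" c] Ord_succ[OF ob] by auto
  qed (use v in blast)
  have le: "app (r5 r) y \<epsilon> succ ?b" if "y \<epsilon> succ a" for y using that E(2)[of a y] r(1) by auto
  have D': "DDb (r4 r) ?d c \<longleftrightarrow> DD c" if "y \<epsilon> succ a" "c \<epsilon> app (r5 r) y" for y c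
    by (rule D) (use le that Ord_trans[OF Ord_succ[OF ob]] in blast)
  have e: "y \<epsilon> succ a \<longrightarrow> app (r5 r) y = enum y" for y
  proof (induction y rule: mem_induct)
    case (step y)
    show ?case
    proof
      assume y: "y \<epsilon> succ a"
      then have y': "y \<epsilon> r1 r" using r(1) by simp
      have IH: "z \<epsilon> y \<Longrightarrow> app (r5 r) z = enum z" for z using step tra y by blast
      show "app (r5 r) y = enum y"
      proof (rule enum_eqI)
        show "DD (app (r5 r) y)" using E(1)[OF y'] D[OF le[OF y]] by blast
        show "enum z \<epsilon> app (r5 r) y" if "z \<epsilon> y" for z using E(2)[OF y' that] IH[OF that] by simp
        show "\<exists>z. z \<epsilon> y \<and> \<not> enum z \<epsilon> c" if "c \<epsilon> app (r5 r) y" "DD c" for c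
          using E(3)[OF y' that(1)] D'[OF y that(1)] that(2) IH by metis
      qed
    qed
  qed simp
  have ea: "?b = enum a" using e by simp
  have "r4 r = lam ?d V" by (rule fn_ext[OF r(4)]) (use v in simp_all)
  moreover have "r5 r = lam (succ a) enum" by (rule fn_ext[OF r(5)[unfolded r(1)]]) (use e in \<open>simp_all del: mem_succ\<close>)
  ultimately show ?thesis unfolding rcd_def using pr r(1,2) d ea by metis
qed

text \<open>For \<open>r = rcd a\<close> the set \<open>app (r4 r) (r2 r)\<close> is the power set
  of \<open>V (enum a)\<close>, so \<open>A\<close> is described without forming power sets.\<close>

definition isgr :: "'v \<Rightarrow> 'v \<Rightarrow> 'v \<Rightarrow> bool" where
  "isgr a A r \<longleftrightarrow> A = pair (pi1 A) (pi2 A) \<and>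
     (\<forall>v. v \<epsilon> pi1 A \<longrightarrow> vert r (app (r4 r) (r2 r)) v) \<and>
     (\<forall>t<13. \<forall>X. X \<epsilon> app (r4 r) (r2 r) \<longrightarrow> (t = 11 \<longrightarrow> wfd (app (r4 r) (r2 r)) X) \<longrightarrow> pair (num t) X \<epsilon> pi1 A) \<and>
     (\<forall>t<26. 13 \<le> t \<longrightarrow> pair (num t) r \<epsilon> pi1 A) \<and>
     (\<forall>q. q \<epsilon> pi2 A \<longrightarrow> q = pair (pi1 q) (pi2 q) \<and> pi1 q \<epsilon> pi1 A \<and> pi2 q \<epsilon> pi1 A \<and>
        edg g (app (r4 r) (app (r5 r) a)) (pi1 q) (pi2 q)) \<and>
     (\<forall>v. v \<epsilon> pi1 A \<longrightarrow> (\<forall>w. w \<epsilon> pi1 A \<longrightarrow> edg g (app (r4 r) (app (r5 r) a)) v w \<longrightarrow> pair v w \<epsilon> pi2 A))"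

lemma isgr_iff: "isgr a A (rcd a) \<longleftrightarrow> A = gr g (rcd a) (enum a)"
proof -
  let ?b = "enum a" and ?r = "rcd a"
  have ob: "Ord ?b" using Ord_DD enum_DD by blast
  have e: "app (r5 ?r) a = ?b" "app (r4 ?r) (r2 ?r) = Pow (V ?b)" "app (r4 ?r) ?b = V ?b"
    unfolding rcd_parts using V_succ[OF ob] by simp_all
  show ?thesis
  proof
    assume i: "isgr a A ?r"
    have "v \<epsilon> pi1 A \<longleftrightarrow> v \<epsilon> gv ?r ?b" for v
    proof
      show "v \<epsilon> pi1 A \<Longrightarrow> v \<epsilon> gv ?r ?b" using i unfolding isgr_def e mem_gv by blast
      assume v: "v \<epsilon> gv ?r ?b"
      show "v \<epsilon> pi1 A"
        by (rule gv_cases[OF v]) (use i in \<open>auto simp: isgr_def e\<close>)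
    qed
    then have 1: "pi1 A = gv ?r ?b" by (rule ext)
    have "pi2 A = ge g ?r ?b"
    proof (rule ext)
      fix q show "q \<epsilon> pi2 A \<longleftrightarrow> q \<epsilon> ge g ?r ?b"
        using i unfolding isgr_def e mem_ge 1 by metis
    qed
    then show "A = gr g ?r ?b" using i 1 unfolding isgr_def gr_def by metis
  next
    assume A: "A = gr g ?r ?b"
    show "isgr a A ?r" unfolding isgr_def e A gr_def pi_pair
      by (auto simp: mem_gv pair_vert mem_ge)
  qed
qed

definition seq :: "'v \<Rightarrow> 'v" where
  "seq a = gr g (rcd a) (enum a)"

text \<open>The constant with the last tag, 25, delivers the record, so that its existence is a
  bounded quantifier; \<open>x\<close> is the variable of the only unbounded one.\<close>

definition seqd :: "'v \<Rightarrow> 'v \<Rightarrow> bool" where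
  "seqd p x \<longleftrightarrow> p = pair (pi1 p) (pi2 p) \<and> (\<exists>v. v \<epsilon> pi1 (pi2 p) \<and> pi1 v = num 25 \<and>
     REC (pi1 p) (pi2 v) \<and> isgr (pi1 p) (pi2 p) (pi2 v) \<and> full (pi2 v) x)"

lemma OR_seq: "OR_sequence mem seq = {p. \<forall>x. seqd p x}"
proof (intro set_eqI iffI)
  fix p assume "p \<in> OR_sequence mem seq"
  then obtain a where a: "Ord a" "p = pair a (seq a)" unfolding OR_sequence_def is_opair_iff by blast
  have v: "pair (num 25) (rcd a) \<epsilon> pi1 (seq a)" unfolding seq_def gr_def by (simp add: mem_gv pair_vert)
  have "seqd p x" for x unfolding seqd_def a(2) pi_pair
    by (intro conjI refl exI[of _ "pair (num 25) (rcd a)"] v) (use REC_rcd[OF a(1)] isgr_iff[of a "seq a"] in \<open>simp_all add: seq_def\<close>)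
  then show "p \<in> {p. \<forall>x. seqd p x}" by blast
next
  fix p assume "p \<in> {p. \<forall>x. seqd p x}"
  then have s: "seqd p x" for x by blast
  let ?a = "pi1 p" and ?A = "pi2 p"
  obtain v where p: "p = pair ?a ?A" and v: "v \<epsilon> pi1 ?A" "pi1 v = num 25" "REC ?a (pi2 v)" "isgr ?a ?A (pi2 v)"
    using s[of emp] unfolding seqd_def by blast
  \<comment> \<open>The vertex found for \<open>x\<close> may depend on \<open>x\<close>, but
    \<open>isgr\<close> for \<open>v\<close> forces all constants to carry the same record.\<close>
  have "full (pi2 v) x" for x
  proof -
    obtain w where w: "w \<epsilon> pi1 ?A" "pi1 w = num 25" "full (pi2 w) x" using s[of x] unfolding seqd_def by blast
    then have "vert (pi2 v) (app (r4 (pi2 v)) (r2 (pi2 v))) w" using v(4) unfolding isgr_def by blast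
    then have "pi2 w = pi2 v" using w(2) unfolding vert_def by auto
    then show ?thesis using w(3) by simp
  qed
  then have "pi2 v = rcd ?a" using REC_unique v(3) by blast
  then have "?A = seq ?a" using v(4) isgr_iff unfolding seq_def by metis
  then have "p = pair ?a (seq ?a)" using p by metis
  moreover have "Ord ?a" using v(3) unfolding REC_def by blast
  ultimately show "p \<in> OR_sequence mem seq"
    unfolding OR_sequence_def is_opair_iff by (intro CollectI exI[of _ ?a] conjI)
qed

text \<open>The parameters are \<open>g\<close>, \<open>om\<close> and the numerals of the tags;
  with their help \<open>seqd\<close> is bounded.\<close>

lemma definable_seq: "definable mem (pi_fm 1) (OR_sequence mem seq)"
proof -
  let ?K = "case_nat g (case_nat om num)"
  have g: "T0 ?K (\<lambda>e. g)" and o: "T0 ?K (\<lambda>e. om)" and n: "T0 ?K (\<lambda>e. num t)" for t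
    by (rule T0_const, simp add: range_case_nat)+
  have r: "range num \<subseteq> range ?K" by (auto simp: range_case_nat)
  have NB: "D0 ?K (\<lambda>e. NBb (e 0) (e 1) (e 2) (e 3))"
    unfolding NBb_def goodh_def by (rule d0 D0_allfin D0_opT D0_wfd D0_LimO D0_function_to g)+
  have DD: "D0 ?K (\<lambda>e. DDb (e 0) (e 1) (e 2))"
    unfolding DDb_def by (rule d0 D0_app4[where P=NBb, OF NB] D0_LimO D0_function_to g o)+
  have R: "D0 ?K (\<lambda>e. REC (e 0) (e 1))"
    unfolding REC_def by (rule d0 D0_app3[where P=DDb, OF DD] D0_Ord D0_function_on)+
  have I: "D0 ?K (\<lambda>e. isgr (e 0) (e 1) (e 2))"
    unfolding isgr_def by (rule d0 D0_bconst D0_allfin D0_wfd D0_vert D0_edg g n r)+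
  have Fu: "D0 ?K (\<lambda>e. full (e 0) (e 1))"
    unfolding full_def by (rule d0)+
  have S: "D0 ?K (\<lambda>e. seqd (e 1) (e 0))"
    unfolding seqd_def by (rule d0 n D0_app2[where P=REC, OF R] D0_app3[where P=isgr, OF I] D0_app2[where P=full, OF Fu])+
  have "df (pi_fm (Suc 0)) ?K (\<lambda>e. \<forall>x. seqd (e 0) x)"
  proof (rule df_all)
    show "df (pi_fm (Suc 0)) ?K (\<lambda>e. seqd (e (Suc 0)) (e 0))"
      by (rule df_weaken[OF S[unfolded One_nat_def]]) (auto intro: sigma_fm_pi_fm.intros)
  qed (auto intro: sigma_fm_pi_fm.intros)
  from definable_df[OF this] show ?thesis unfolding OR_seq by simp
qed

theorem not_WVP: "\<not> WVP mem (pi_fm 1)"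
proof -
  have l: "LimO g (enum a)" for a using enum_DD DD_def by blast
  have "\<exists>!h. hom mem h (seq b) (seq a)" if "Ord a" "Ord b" "a \<epsilon> b \<or> a = b" for a b
  proof -
    have "enum a \<sqsubseteq> enum b" using that enum_less Ord_le[OF Ord_DD[OF enum_DD] Ord_DD[OF enum_DD]] by blast
    then have "Hom (seq b) (seq a)" unfolding seq_def using gr_Hom l by blast
    then show ?thesis unfolding Hom_def seq_def using DD_hom_unique[OF enum_DD enum_DD] by blast
  qed
  moreover have "\<not> (\<exists>h. hom mem h (seq a) (seq b))" if "Ord a" "Ord b" "a \<epsilon> b" for a b
  proof
    assume "\<exists>h. hom mem h (seq a) (seq b)"
    then have "enum b \<sqsubseteq> enum a" unfolding seq_def using DD_hom(1)[OF enum_DD enum_DD] by blast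
    then show False using enum_less[OF that(3)] subD mem_irrefl by blast
  qed
  moreover have "graph mem (seq a)" for a unfolding seq_def by (rule gr_graph)
  ultimately show ?thesis unfolding WVP_def not_not using definable_seq
    by (intro exI[of _ seq] conjI allI impI) blast+
qed

end

theorem (in zfc) WVP_strong: assumes "WVP mem (pi_fm 1)" shows "proper_class mem {k. strong mem k}"
proof (rule ccontr)
  assume "\<not> ?thesis"
  then obtain c where c: "\<And>x. x \<epsilon> c \<longleftrightarrow> strong mem x" unfolding proper_class_def by auto
  have "\<exists>g. Ord g \<and> (\<forall>k. k \<epsilon> c \<longrightarrow> k \<epsilon> g)"
    by (rule Ord_bound) (use c card_Ord in \<open>auto simp: strong_def\<close>)
  then obtain g where g: "Ord g" "\<And>k. strong mem k \<Longrightarrow> k \<epsilon> g" using c by blast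
  interpret nostrong mem g by unfold_locales (use g in auto)
  show False using not_WVP assms by blast
qed

section \<open>The equivalences\<close>

theorem theorem5p12:
  fixes mem :: "'v \<Rightarrow> 'v \<Rightarrow> bool"
  assumes "ZFC mem"
  shows "(proper_class mem {\<kappa>. strong mem \<kappa>} \<longleftrightarrow> PRP mem (sigma_fm 2)) \<and>
         (PRP mem (sigma_fm 2) \<longleftrightarrow> PRP mem (pi_fm 1)) \<and>
         (PRP mem (pi_fm 1) \<longleftrightarrow> SWVP mem (sigma_fm 2)) \<and>
         (SWVP mem (sigma_fm 2) \<longleftrightarrow> SWVP mem (pi_fm 1)) \<and>
         (SWVP mem (pi_fm 1) \<longleftrightarrow> WVP mem (sigma_fm 2)) \<and>
         (WVP mem (sigma_fm 2) \<longleftrightarrow> WVP mem (pi_fm 1))"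
proof -
  interpret zfc mem by unfold_locales fact
  have le: "pi_fm 1 p \<Longrightarrow> sigma_fm 2 p" for p
    using pi_sigma_Suc[of 1 p] by (simp add: numeral_2_eq_2)
  \<comment> \<open>Two chains lead from product reflection for Sigma_2 to the weak principle for
    Pi_1, one through the Pi_1 principles and one through the Sigma_2 principles;
    \<open>WVP_strong\<close> closes both.\<close>
  have "PRP mem (sigma_fm 2)" if "proper_class mem {\<kappa>. strong mem \<kappa>}" using strong_PRP that .
  moreover have "PRP mem (pi_fm 1)" if "PRP mem (sigma_fm 2)" using PRP_mono[OF that le] .
  moreover have "SWVP mem (pi_fm 1)" if "PRP mem (pi_fm 1)" using PRP_SWVP(2)[of 0] that by simp
  moreover have "WVP mem (pi_fm 1)" if "SWVP mem (pi_fm 1)" using SWVP_WVP that .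
  moreover have "proper_class mem {\<kappa>. strong mem \<kappa>}" if "WVP mem (pi_fm 1)" using WVP_strong that .
  moreover have "SWVP mem (sigma_fm 2)" if "PRP mem (sigma_fm 2)"
    using PRP_SWVP(1)[of 1] that by (simp add: numeral_2_eq_2)
  moreover have "WVP mem (sigma_fm 2)" if "SWVP mem (sigma_fm 2)" using SWVP_WVP that .
  moreover have "WVP mem (pi_fm 1)" if "WVP mem (sigma_fm 2)" using WVP_mono[OF that le] .
  ultimately show ?thesis by blast
qed

end
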